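(* Assume (H), $\mu_{\max}:=\sup_{a\in(0,\hat a)}\overline\mu(a)<\infty$, and $$x\mapsto\frac{1}{1-G_{\alpha^{**}}(x)}\notin L^1_{\mathrm{loc}}(\overline\Omega),$$ i.e. there is $x_*\in\overline\Omega$ such that this function is not integrable on $\Omega\cap B(x_*,\delta)$ for any $\delta>0$. Then $s(\mathcal A)$ is the principal eigenvalue of $\mathcal A$ (for either choice $X=C(\overline\Omega)$ or $X=L^1(\Omega)$).
   Context: Standing setting. $N\ge1$, $\Omega\subset\mathbb R^N$ is a bounded domain, $\hat a\in(0,\infty]$ and $D>0$. The kernel $J\in C(\mathbb R^N)$ is nonnegative, supported in some ball $B(0,r)$, $J(0)>0$ and $\int_{\mathbb R^N}J=1$. The rates satisfy $\beta\in C(\mathbb R^N,L^\infty_+(0,\hat a))$, $\mu\in C(\mathbb R^N,L^\infty_{\mathrm{loc},+}[0,\hat a))$; with $\underline\mu(a)=\min_{x\in\overline\Omega}\mu(a,x)$, $\overline\mu(a)=\max_{x\in\overline\Omega}\mu(a,x)$, $\underline\beta(a)=\min_{x\in\overline\Omega}\beta(a,x)$, $\overline\beta(a)=\max_{x\in\overline\Omega}\beta(a,x)$, there is $\tilde\mu>0$ with $\underline\mu(a)\ge\tilde\mu$ a.e., and for every $x\in\mathbb R^N$ and a.e. $a$: $\underline\beta(a)\le\beta(a,x)$, $\mu(a,x)\le\overline\mu(a)$; also $\underline\beta$ is not a.e. zero on $(0,\hat a)$. $X$ is either $C(\overline\Omega)$ or $L^1(\Omega)$ with its usual positive cone $X_+$.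 $\mathcal X=X\times L^1((0,\hat a),X)$, $\mathcal X_0=\{0\}\times L^1((0,\hat a),X)$, positive cone $X_+\times L^1_+((0,\hat a),X)$. $K\in\mathcal L(X)$, $K\varphi=\int_\Omega J(\cdot-y)\varphi(y)dy$. $\pi(\tau,a,x)=\exp(-\int_\tau^a\mu(s,x)ds)$ and $\Pi(\tau,a)$ is multiplication by $\pi(\tau,a,\cdot)$ on $X$. $\mathcal U(\tau,a)$ ($0\le\tau\le a<\hat a$) is the evolution family on $X$ of $\partial_au=D(K-I)u-\mu(a,\cdot)u$. $\mathcal B_1$ is the closed operator in $\mathcal X$ (domain dense in $\mathcal X_0$) with resolvent, for $\lambda>-D-\tilde\mu$, $(\lambda I-\mathcal B_1)^{-1}(\eta,g)=(0,h)$, $h(a)=e^{-(\lambda+D)a}\Pi(0,a)\eta+\int_0^ae^{-(\lambda+D)(a-s)}\Pi(s,a)g(s)ds$ (formally $\mathcal B_1(0,u)=(-u(0),-\partial_au-(D+\mu)u)$); $\mathcal B_2(0,g)=(0,DKg)$; $\mathcal B=\mathcal B_1+\mathcal B_2$, with resolvent for $\lambda>-\tilde\mu$: $(\lambda I-\mathcal B)^{-1}(\eta,g)=(0,h)$, $h(a)=e^{-\lambda a}\mathcal U(0,a)\eta+\int_0^ae^{-\lambda(a-s)}\mathcal U(s,a)g(s)ds$; $\mathcal C(0,h)=(\int_0^{\hat a}\beta(a,\cdot)h(a)da,0)$; $\mathcal A=\mathcal B+\mathcal C$ with $\mathrm{dom}(\mathcal A)=\mathrm{dom}(\mathcal B)$.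 For a closed operator $T$, $s(T)=\sup\{\mathrm{Re}\lambda:\lambda\in\sigma(T)\}$. A real number is the principal eigenvalue of $T$ if it is an eigenvalue of $T$ with a positive eigenvector and it is larger than the real part of every other eigenvalue of $T$. $V=\mathbb R$ if $\hat a<\infty$, $V=(-D-\tilde\mu,\infty)$ if $\hat a=\infty$. Assumption (H): if $\hat a=\infty$, there is $\hat\lambda\in V$ with $\int_0^\infty\underline\beta(a)e^{-(\hat\lambda+D)a}e^{-\int_0^a\overline\mu(s)ds}da>1$. For $\alpha\in V$, $G_\alpha(x)=\int_0^{\hat a}\beta(a,x)e^{-(\alpha+D)a}\pi(0,a,x)da$; $\alpha^{**}\in V$ is the number with $\max_{x\in\overline\Omega}G_{\alpha^{**}}(x)=1$. *)

theory Defs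
  imports "HOL-Analysis.Analysis"
begin

text \<open>Which state space X is used: X = C(closure Omega) or X = L1(Omega).
  All spaces are complexified (spectrum of a real operator = spectrum of its complexification).
  An element of the product space (X x L1((0,ahat),X)) is represented by a pair (eta, g)
  with eta :: point => complex and g :: age => point => complex.\<close>

datatype Xchoice = XC | XL1

type_synonym 'n elt = "((real^'n) \<Rightarrow> complex) \<times> (real \<Rightarrow> (real^'n) \<Rightarrow> complex)"

definition ages :: "ereal \<Rightarrow> real set" where
  "ages ahat = {a. 0 < a \<and> ereal a < ahat}"

definition cnonneg :: "complex \<Rightarrow> bool" where
  "cnonneg z \<longleftrightarrow> Im z = 0 \<and> 0 \<le> Re z"

text \<open>The product measure on (0,ahat) x Omega; L1((0,ahat),L1(Omega)) = L1((0,ahat) x Omega).\<close>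
definition prodM :: "ereal \<Rightarrow> (real^'n) set \<Rightarrow> (real \<times> (real^'n)) measure" where
  "prodM ahat Om = lebesgue_on (ages ahat) \<Otimes>\<^sub>M lebesgue_on Om"

definition inXX :: "Xchoice \<Rightarrow> (real^'n) set \<Rightarrow> ereal \<Rightarrow> 'n elt \<Rightarrow> bool" where
  "inXX ch Om ahat p = (case p of (eta, g) \<Rightarrow> (case ch of
     XC \<Rightarrow> continuous_on (closure Om) eta
         \<and> (AE a in lebesgue_on (ages ahat). continuous_on (closure Om) (g a))
         \<and> (\<forall>x\<in>closure Om. (\<lambda>a. g a x) \<in> borel_measurable (lebesgue_on (ages ahat)))
         \<and> (\<integral>\<^sup>+ a. (SUP x\<in>closure Om. ennreal (cmod (g a x))) \<partial>lebesgue_on (ages ahat)) < \<infinity>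
   | XL1 \<Rightarrow> set_integrable lebesgue Om eta
         \<and> integrable (prodM ahat Om) (\<lambda>q. g (fst q) (snd q))))"

definition eqXX :: "Xchoice \<Rightarrow> (real^'n) set \<Rightarrow> ereal \<Rightarrow> 'n elt \<Rightarrow> 'n elt \<Rightarrow> bool" where
  "eqXX ch Om ahat p p' = (case p of (eta, g) \<Rightarrow> case p' of (eta', g') \<Rightarrow> (case ch of
     XC \<Rightarrow> (\<forall>x\<in>closure Om. eta x = eta' x)
         \<and> (AE a in lebesgue_on (ages ahat). \<forall>x\<in>closure Om. g a x = g' a x)
   | XL1 \<Rightarrow> (AE x in lebesgue_on Om. eta x = eta' x)
         \<and> (AE q in prodM ahat Om. g (fst q) (snd q) = g' (fst q) (snd q))))"

definition normXX :: "Xchoice \<Rightarrow> (real^'n) set \<Rightarrow> ereal \<Rightarrow> 'n elt \<Rightarrow> real" where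
  "normXX ch Om ahat p = (case p of (eta, g) \<Rightarrow> (case ch of
     XC \<Rightarrow> (SUP x\<in>closure Om. cmod (eta x))
         + enn2real (\<integral>\<^sup>+ a. (SUP x\<in>closure Om. ennreal (cmod (g a x))) \<partial>lebesgue_on (ages ahat))
   | XL1 \<Rightarrow> (\<integral>x. cmod (eta x) \<partial>lebesgue_on Om)
         + (\<integral>q. cmod (g (fst q) (snd q)) \<partial>prodM ahat Om)))"

definition posXX :: "Xchoice \<Rightarrow> (real^'n) set \<Rightarrow> ereal \<Rightarrow> 'n elt \<Rightarrow> bool" where
  "posXX ch Om ahat p = (case p of (eta, g) \<Rightarrow> (case ch of
     XC \<Rightarrow> (\<forall>x\<in>closure Om. cnonneg (eta x))
         \<and> (AE a in lebesgue_on (ages ahat). \<forall>x\<in>closure Om. cnonneg (g a x))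
   | XL1 \<Rightarrow> (AE x in lebesgue_on Om. cnonneg (eta x))
         \<and> (AE q in prodM ahat Om. cnonneg (g (fst q) (snd q)))))"

definition zeroXX :: "'n elt" where
  "zeroXX = ((\<lambda>x. 0), (\<lambda>a x. 0))"

definition scaleXX :: "complex \<Rightarrow> 'n elt \<Rightarrow> 'n elt" where
  "scaleXX c p = ((\<lambda>x. c * fst p x), (\<lambda>a x. c * snd p a x))"

definition diffXX :: "'n elt \<Rightarrow> 'n elt \<Rightarrow> 'n elt" where
  "diffXX p q = ((\<lambda>x. fst p x - fst q x), (\<lambda>a x. snd p a x - snd q a x))"

definition pi_surv :: "(real \<Rightarrow> real^'n \<Rightarrow> real) \<Rightarrow> real \<Rightarrow> real \<Rightarrow> real^'n \<Rightarrow> real" where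
  "pi_surv mu tau a x = exp (- integral\<^sup>L (lebesgue_on {tau..a}) (\<lambda>s. mu s x))"

text \<open>Resolvent of B1 at lambda = 0 (note 0 > -D - mu~):
  (0 I - B1)^(-1) (eta, g) = (0, h),
  h(a) = e^(-D a) Pi(0,a) eta + int_0^a e^(-D (a-s)) Pi(s,a) g(s) ds.\<close>
definition R0 :: "(real \<Rightarrow> real^'n \<Rightarrow> real) \<Rightarrow> real \<Rightarrow> 'n elt \<Rightarrow> (real \<Rightarrow> real^'n \<Rightarrow> complex)" where
  "R0 mu D p = (\<lambda>a x. complex_of_real (exp (- D * a) * pi_surv mu 0 a x) * fst p x
      + integral\<^sup>L (lebesgue_on {0..a})
          (\<lambda>s. complex_of_real (exp (- D * (a - s)) * pi_surv mu s a x) * snd p s x))"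

text \<open>The domain of A = B1 + B2 + C is dom(B1) = range of (0 I - B1)^(-1); it is parametrised by
  p = (eta,g) in the product space via domA_elt p = (0, R0 p).  On this element
  B1(0,h) = -(eta,g), B2(0,h) = (0, D K h), C(0,h) = (int beta(a,.) h(a) da, 0).\<close>
definition domA_elt :: "(real \<Rightarrow> real^'n \<Rightarrow> real) \<Rightarrow> real \<Rightarrow> 'n elt \<Rightarrow> 'n elt" where
  "domA_elt mu D p = ((\<lambda>x. 0), R0 mu D p)"

definition opA_img :: "(real^'n) set \<Rightarrow> ereal \<Rightarrow> real \<Rightarrow> (real^'n \<Rightarrow> real)
     \<Rightarrow> (real \<Rightarrow> real^'n \<Rightarrow> real) \<Rightarrow> (real \<Rightarrow> real^'n \<Rightarrow> real) \<Rightarrow> 'n elt \<Rightarrow> 'n elt" where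
  "opA_img Om ahat D J beta mu p =
     (let h = R0 mu D p in
      ((\<lambda>x. - fst p x + integral\<^sup>L (lebesgue_on (ages ahat)) (\<lambda>a. complex_of_real (beta a x) * h a x)),
       (\<lambda>a x. - snd p a x + complex_of_real D *
            integral\<^sup>L (lebesgue_on Om) (\<lambda>y. complex_of_real (J (x - y)) * h a y))))"

definition is_eigenvalue_A :: "Xchoice \<Rightarrow> (real^'n) set \<Rightarrow> ereal \<Rightarrow> real \<Rightarrow> (real^'n \<Rightarrow> real)
     \<Rightarrow> (real \<Rightarrow> real^'n \<Rightarrow> real) \<Rightarrow> (real \<Rightarrow> real^'n \<Rightarrow> real) \<Rightarrow> complex \<Rightarrow> bool" where
  "is_eigenvalue_A ch Om ahat D J beta mu lam \<longleftrightarrow>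
     (\<exists>p. inXX ch Om ahat p \<and> \<not> eqXX ch Om ahat (domA_elt mu D p) zeroXX
        \<and> eqXX ch Om ahat (opA_img Om ahat D J beta mu p) (scaleXX lam (domA_elt mu D p)))"

definition resolvent_A :: "Xchoice \<Rightarrow> (real^'n) set \<Rightarrow> ereal \<Rightarrow> real \<Rightarrow> (real^'n \<Rightarrow> real)
     \<Rightarrow> (real \<Rightarrow> real^'n \<Rightarrow> real) \<Rightarrow> (real \<Rightarrow> real^'n \<Rightarrow> real) \<Rightarrow> complex set" where
  "resolvent_A ch Om ahat D J beta mu = {lam.
     let L = (\<lambda>p. diffXX (scaleXX lam (domA_elt mu D p)) (opA_img Om ahat D J beta mu p)) in
     (\<forall>f. inXX ch Om ahat f \<longrightarrow> (\<exists>p. inXX ch Om ahat p \<and> eqXX ch Om ahat (L p) f))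
     \<and> (\<exists>C. \<forall>p. inXX ch Om ahat p \<longrightarrow>
            normXX ch Om ahat (domA_elt mu D p) \<le> C * normXX ch Om ahat (L p))}"

definition spectrum_A :: "Xchoice \<Rightarrow> (real^'n) set \<Rightarrow> ereal \<Rightarrow> real \<Rightarrow> (real^'n \<Rightarrow> real)
     \<Rightarrow> (real \<Rightarrow> real^'n \<Rightarrow> real) \<Rightarrow> (real \<Rightarrow> real^'n \<Rightarrow> real) \<Rightarrow> complex set" where
  "spectrum_A ch Om ahat D J beta mu = UNIV - resolvent_A ch Om ahat D J beta mu"

definition sbound_A :: "Xchoice \<Rightarrow> (real^'n) set \<Rightarrow> ereal \<Rightarrow> real \<Rightarrow> (real^'n \<Rightarrow> real)
     \<Rightarrow> (real \<Rightarrow> real^'n \<Rightarrow> real) \<Rightarrow> (real \<Rightarrow> real^'n \<Rightarrow> real) \<Rightarrow> ereal" where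
  "sbound_A ch Om ahat D J beta mu = (SUP lam\<in>spectrum_A ch Om ahat D J beta mu. ereal (Re lam))"

definition principal_eigenvalue_A :: "Xchoice \<Rightarrow> (real^'n) set \<Rightarrow> ereal \<Rightarrow> real \<Rightarrow> (real^'n \<Rightarrow> real)
     \<Rightarrow> (real \<Rightarrow> real^'n \<Rightarrow> real) \<Rightarrow> (real \<Rightarrow> real^'n \<Rightarrow> real) \<Rightarrow> real \<Rightarrow> bool" where
  "principal_eigenvalue_A ch Om ahat D J beta mu r \<longleftrightarrow>
     (\<exists>p. inXX ch Om ahat p \<and> \<not> eqXX ch Om ahat (domA_elt mu D p) zeroXX
        \<and> eqXX ch Om ahat (opA_img Om ahat D J beta mu p) (scaleXX (complex_of_real r) (domA_elt mu D p))
        \<and> posXX ch Om ahat (domA_elt mu D p))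
     \<and> (\<forall>lam. is_eigenvalue_A ch Om ahat D J beta mu lam \<and> lam \<noteq> complex_of_real r \<longrightarrow> Re lam < r)"

text \<open>Rational points of Omega: a countable dense subset of closure Omega (Omega open).
  Since x -> beta(.,x), mu(.,x) are continuous into L-infinity, the pointwise inf/sup over
  this set is (a.e.) the min/max over closure Omega, independent of representatives.\<close>
definition ratpts :: "(real^'n) set \<Rightarrow> (real^'n) set" where
  "ratpts Om = {x\<in>Om. \<forall>i. x $ i \<in> \<rat>}"

definition lowenv :: "(real \<Rightarrow> real^'n \<Rightarrow> real) \<Rightarrow> (real^'n) set \<Rightarrow> real \<Rightarrow> real" where
  "lowenv f Om a = (INF x\<in>ratpts Om. f a x)"

definition upenv :: "(real \<Rightarrow> real^'n \<Rightarrow> real) \<Rightarrow> (real^'n) set \<Rightarrow> real \<Rightarrow> real" where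
  "upenv f Om a = (SUP x\<in>ratpts Om. f a x)"

definition Gfun :: "ereal \<Rightarrow> real \<Rightarrow> (real \<Rightarrow> real^'n \<Rightarrow> real) \<Rightarrow> (real \<Rightarrow> real^'n \<Rightarrow> real)
     \<Rightarrow> real \<Rightarrow> real^'n \<Rightarrow> ennreal" where
  "Gfun ahat D beta mu alpha x =
     (\<integral>\<^sup>+ a. ennreal (beta a x * exp (- (alpha + D) * a) * pi_surv mu 0 a x) \<partial>lebesgue_on (ages ahat))"

definition Vset :: "ereal \<Rightarrow> real \<Rightarrow> real \<Rightarrow> real set" where
  "Vset ahat D mut = (if ahat = \<infinity> then {- D - mut<..} else UNIV)"

end

theory Submission
  imports Defs "HOL-Complex_Analysis.Great_Picard" "HOL-Real_Asymp.Real_Asymp"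
begin

text \<open>An eigenvector of the operator at a real \<open>r\<close> is determined by its newborn density \<open>z\<close>. Separating in the
  renewal equation the offspring of individuals that never dispersed, it reads \<open>z = G\<^sub>r z + N\<^sub>r z\<close>, that is
  \<open>z = T\<^sub>r z\<close> with \<open>T\<^sub>r = (1 - G\<^sub>r)\<^sup>-\<^sup>1 N\<^sub>r\<close>, where \<open>N\<^sub>r\<close> is a compact, strictly positive integral operator and
  \<open>r\<close> is so large that \<open>max G\<^sub>r < 1\<close>. A Krein-Rutman argument for the decreasing family \<open>T\<^sub>r\<close> yields \<open>r\<close> and a
  positive \<open>z\<close> once some \<open>l\<^sub>0\<close> has a nonzero subsolution \<open>w \<le> T\<^sub>l w\<close> (\<open>l = l\<^sub>0\<close>). Since \<open>1 / (1 - G)\<close> at the critical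
  exponent is not locally integrable, \<open>T\<^sub>l\<close> blows up as \<open>l\<close> decreases to that exponent, which gives \<open>w\<close>. If the
  maximal age is infinite and the age equation is not yet solvable at that exponent, the Perron eigenfunction
  of the dispersal kernel is a subsolution by (H). Comparison with the positive solution bounds all solutions
  for \<open>Re \<zeta> > r\<close> in \<open>L\<^sup>1\<close>, so the resolvent exists by a Neumann series, and smoothing transfers this to
  continuous functions. On the line \<open>Re \<zeta> = r\<close>, equality in the triangle inequality forces
  \<open>cos (Im \<zeta> * a) = 1\<close> for all ages \<open>a\<close> in a set of positive measure, so \<open>\<zeta> = r\<close>.\<close>

abbreviation (input) "BM == borel_measurable"
abbreviation (input) "NI == nn_integral"
abbreviation (input) "en == ennreal"
abbreviation (input) ind :: "'a set => 'a => 'b::zero_neq_one" where "ind == indicator"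

section \<open>Fixed points of monotone families of positive operators\<close>

definition cone_on :: "'a::topological_space set => ('a => real) set" where
 "cone_on S = {w. continuous_on S w & (ALL x:S. 0 <= w x)}"

lemma cone_onD: "w : cone_on S ==> continuous_on S w" "w : cone_on S ==> x : S ==> 0 <= w x" by (auto simp: cone_on_def)

lemma cone_on_const: "0 <= c ==> (%_. c) : cone_on S" by (auto simp: cone_on_def)

lemma cone_on_add: "v : cone_on S ==> w : cone_on S ==> (%x. v x + w x) : cone_on S" by (auto simp: cone_on_def intro: continuous_intros)

lemma cone_on_scale: "0 <= c ==> w : cone_on S ==> (%x. c * w x) : cone_on S" by (auto simp: cone_on_def intro: continuous_intros)

locale cone_operator =
 fixes S :: "'a::euclidean_space set" and T :: "('a => real) => 'a => real" and d0 :: real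
 assumes S_compact: "compact S" and S_connected: "connected S"
  and d0_pos: "0 < d0"
  and T_in: "!!w. w : cone_on S ==> T w : cone_on S"
  and T_add: "!!v w x. v : cone_on S ==> w : cone_on S ==> x : S ==>
     T (%x. v x + w x) x = T v x + T w x"
  and T_scale: "!!c w x. 0 <= c ==> w : cone_on S ==> x : S ==> T (%x. c * w x) x = c * T w x"
  and T_mono: "!!v w x. v : cone_on S ==> w : cone_on S ==> (!!y. y : S ==> v y <= w y) ==>
     x : S ==> T v x <= T w x"
  and T_loc: "!!w x y. w : cone_on S ==> x : S ==> T w x = 0 ==> y : S ==> dist x y < d0 ==> w y = 0"
  and T_equi: "!!x e. x : S ==> 0 < e ==> EX d>0. ALL w:cone_on S. (ALL y:S. w y <= 1) -->
     (ALL y:S. norm (x - y) < d --> \<bar>T w x - T w y\<bar> < e)"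
begin

lemma T_cong: "v : cone_on S ==> w : cone_on S ==> (!!y. y : S ==> v y = w y) ==> x : S ==> T v x = T w x" by (intro antisym T_mono) auto

lemma iter_in: "w : cone_on S ==> (T ^^ n) w : cone_on S" by (induction n) (auto intro: T_in)

lemma T_le_const:
 assumes "w : cone_on S" "!!y. y : S ==> w y <= c" "0 <= c" "x : S"
 shows "T w x <= c * T (%_. 1) x"
proof -
 have "T w x <= T (%_. c * 1) x" using assms by (intro T_mono) (auto intro: cone_on_const)
 also have "... = c * T (%_. 1) x" using assms by (intro T_scale) (auto intro: cone_on_const)
 finally show ?thesis .
qed

lemma zero_set_trivial:
 assumes "closed Z" "Z <= S" "!!x y. x : Z ==> y : S ==> dist x y < d0 ==> y : Z"
 shows "Z = {} | Z = S"
proof -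
 have "openin (top_of_set S) Z" unfolding openin_euclidean_subtopology_iff using assms d0_pos by (auto simp: dist_commute intro!: exI[of _ d0])
 moreover have "closedin (top_of_set S) Z" using assms by (simp add: closed_subset)
 ultimately show ?thesis using S_connected unfolding connected_clopen by blast
qed

lemma eventually_positive:
 assumes d: "d : cone_on S" and x1: "x1 : S" "d x1 ~= 0"
 shows "EX n. ALL x:S. 0 < (\<Sum>j\<le>n. (T ^^ j) d x)"
proof -
 define Z where "Z n = {x\<in>S. (\<Sum>j\<le>n. (T ^^ j) d x) = 0}" for n
 have it: "(T ^^ j) d : cone_on S" for j by (rule iter_in[OF d])
 have Zall: "Z n = {x\<in>S. ALL j<=n. (T ^^ j) d x = 0}" for n unfolding Z_def using cone_onD(2)[OF it]
  by (intro Collect_cong conj_cong refl, subst sum_nonneg_eq_0_iff) auto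
 have closedZ: "closed (Z n)" for n unfolding Z_def by (intro continuous_closed_preimage_constant continuous_intros compact_imp_closed S_compact
    cone_onD(1)[OF it])
 have "EX n. Z n = {}"
 proof (rule ccontr)
  assume ne: "\<nexists>n. Z n = {}"
  have comp: "compact (Z n)" for n
  proof -
   have "Z n = S \<inter> Z n" by (auto simp: Z_def)
   then show ?thesis using compact_Int_closed[OF S_compact closedZ[of n]] by simp
  qed
  have "\<Inter>(range Z) ~= {}" by (rule compact_nest) (use ne comp in \<open>auto simp: Zall\<close>)
  moreover have "\<Inter>(range Z) = {} | \<Inter>(range Z) = S"
  proof (rule zero_set_trivial)
   show "closed (\<Inter>(range Z))" using closedZ by auto
   show "\<Inter>(range Z) <= S" by (auto simp: Z_def)
   fix x y assume xy: "x : \<Inter>(range Z)" "y : S" "dist x y < d0"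
   have "(T ^^ j) d y = 0" for j
   proof -
    have "x : Z (Suc j)" using xy by auto
    then have "T ((T ^^ j) d) x = 0" "x : S" by (auto simp: Zall)
    then show ?thesis using T_loc[OF it] xy by blast
   qed
   then show "y : \<Inter>(range Z)" using xy by (auto simp: Zall)
  qed
  ultimately have "x1 : Z 0" using x1 by auto
  then show False using x1 by (auto simp: Zall)
 qed
 then obtain n where "Z n = {}" by blast
 then have "ALL x:S. (\<Sum>j\<le>n. (T ^^ j) d x) ~= 0" by (auto simp: Z_def)
 moreover have "ALL x:S. 0 <= (\<Sum>j\<le>n. (T ^^ j) d x)" by (auto intro!: sum_nonneg cone_onD(2)[OF it])
 ultimately show ?thesis by (metis less_eq_real_def)
qed

lemma fixed_point_positive:
 assumes z: "z : cone_on S" "!!x. x : S ==> T z x = z x" and x1: "x1 : S" "z x1 ~= 0" and x: "x : S"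
 shows "0 < z x"
proof -
 define Z where "Z = {x\<in>S. z x = 0}"
 have "Z = {} | Z = S"
 proof (rule zero_set_trivial)
  show "closed Z" unfolding Z_def by (intro continuous_closed_preimage_constant compact_imp_closed S_compact cone_onD(1) z)
  show "Z <= S" by (auto simp: Z_def)
  show "y : Z" if "x : Z" "y : S" "dist x y < d0" for x y using that T_loc[OF z(1), of x y] z(2)[of x] by (simp add: Z_def)
 qed
 then have "Z = {}" using x1 by (auto simp: Z_def)
 then show ?thesis using x cone_onD(2)[OF z(1) x] by (force simp: Z_def less_eq_real_def)
qed

text \<open>If a subsolution is not a solution, summing iterates makes the defect strictly positive.\<close>

lemma strict_subsolution:
 assumes z: "z : cone_on S" "!!x. x : S ==> z x <= T z x"
  and x1: "x1 : S" "T z x1 ~= z x1"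
 obtains w ep where "w : cone_on S" "0 < ep" "EX x:S. w x ~= 0" "!!x. x : S ==> w x + ep <= T w x"
proof -
 define d where "d = (%x. T z x - z x)"
 have d: "d : cone_on S" unfolding d_def cone_on_def using z(2) cone_onD(1)[OF z(1)] cone_onD(1)[OF T_in[OF z(1)]] by (auto intro: continuous_intros)
 obtain n where n: "ALL x:S. 0 < (\<Sum>j\<le>n. (T ^^ j) d x)" using eventually_positive[OF d x1(1)] x1 by (auto simp: d_def)
 define w where "w = (%x. \<Sum>j\<le>n. (T ^^ j) z x)"
 have sumin: "(%x. \<Sum>j\<le>m. (T ^^ j) z x) : cone_on S" for m by (induction m) (auto simp: z intro!: cone_on_add iter_in[OF z(1)] T_in)
 have w: "w : cone_on S" unfolding w_def by (rule sumin)
 have iter_d: "x : S ==> (T ^^ j) d x + (T ^^ j) z x = T ((T ^^ j) z) x" for j x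
 proof (induction j arbitrary: x)
  case 0 then show ?case by (simp add: d_def)
 next
  case (Suc j)
  have "(T ^^ Suc j) d x + (T ^^ Suc j) z x = T (%x. (T ^^ j) d x + (T ^^ j) z x) x" using Suc.prems by (simp add: T_add iter_in d z)
  also have "... = T (T ((T ^^ j) z)) x" by (intro T_cong cone_on_add iter_in d z T_in Suc)
  finally show ?case by simp
 qed
 have Tsum: "x : S ==> T (%x. \<Sum>j\<le>m. (T ^^ j) z x) x = (\<Sum>j\<le>m. T ((T ^^ j) z) x)" for m x
 proof (induction m)
  case (Suc m)
  then show ?case using T_add[OF sumin[of m] iter_in[OF z(1)], of x "Suc m"] by simp
 qed simp
 have defect: "T w x = (\<Sum>j\<le>n. (T ^^ j) d x) + w x" if "x : S" for x
  unfolding w_def Tsum[OF that] sum.distrib[symmetric] using iter_d[OF that] by simp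
 have cont: "continuous_on S (%x. \<Sum>j\<le>n. (T ^^ j) d x)" by (intro continuous_intros cone_onD(1) iter_in d)
 obtain x0 where x0: "x0 : S" "!!x. x : S ==> (\<Sum>j\<le>n. (T ^^ j) d x0) <= (\<Sum>j\<le>n. (T ^^ j) d x)"
  using continuous_attains_inf[OF S_compact _ cont] x1 by blast
 have ne: "EX x:S. w x ~= 0"
 proof (rule ccontr)
  assume "~ ?thesis"
  then have w0: "!!x. x : S ==> w x = 0" by auto
  have "T w x0 = T (%x. 0 * w x) x0" using x0 w0 by (intro T_cong w cone_on_scale) auto
  also have "... = 0" using T_scale[OF _ w x0(1), of 0] by simp
  finally show False using defect[OF x0(1)] n x0(1) w0[OF x0(1)] by auto
 qed
 show thesis by (rule that[OF w, of "\<Sum>j\<le>n. (T ^^ j) d x0"]) (use n x0 defect ne in \<open>auto simp: add.commute\<close>)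
qed

end

theorem cone_family_fixed_point:
 fixes S :: "'a::euclidean_space set" and T :: "real => ('a => real) => 'a => real"
 assumes op: "!!l. l0 <= l ==> cone_operator S (T l) d0"
  and anti: "!!l l' w x. l0 <= l ==> l <= l' ==> w : cone_on S ==> x : S ==> T l' w x <= T l w x"
  and cont: "!!l e. l0 <= l ==> 0 < e ==> EX d>0. ALL l'>=l0. \<bar>l' - l\<bar> < d -->
     (ALL x:S. \<bar>T l' (%_. 1) x - T l (%_. 1) x\<bar> <= e)"
  and start: "w0 : cone_on S" "x1 : S" "w0 x1 ~= 0" "!!x. x : S ==> w0 x <= T l0 w0 x"
  and bound: "EX L. ALL l>=L. ALL x:S. T l (%_. 1) x <= 1/2"
 shows "EX r>=l0. EX z. continuous_on S z & (ALL x:S. 0 < z x) & (ALL x:S. T r z x = z x)"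
proof -
 have Scomp: "compact S" using op[of l0] by (simp add: cone_operator_def)
 define sub where "sub l w \<longleftrightarrow> w : cone_on S & (EX x:S. w x = 1) & (ALL x:S. w x <= 1) & (ALL x:S. w x <= T l w x)" for l w
 define La where "La = {l. l0 <= l & (EX w. sub l w)}"
 have normalise: "EX w. sub l w" if l: "l0 <= l" and w: "w : cone_on S" "EX x:S. w x ~= 0" "!!x. x : S ==> w x <= T l w x" for l w
 proof -
  interpret cone_operator S "T l" d0 by (rule op[OF l])
  obtain x0 where x0: "x0 : S" "!!x. x : S ==> w x <= w x0" using continuous_attains_sup[OF S_compact _ cone_onD(1)[OF w(1)]] w(2) by blast
  have pos: "0 < w x0"
  proof -
   obtain x where "x : S" "w x ~= 0" using w(2) by blast
   then show ?thesis using x0(2)[of x] cone_onD(2)[OF w(1), of x] by linarith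
  qed
  have "sub l (%x. (1 / w x0) * w x)" unfolding sub_def
  proof (intro conjI ballI bexI[OF _ x0(1)])
   show "(%x. (1 / w x0) * w x) : cone_on S" using pos w by (intro cone_on_scale) auto
   fix x assume x: "x : S"
   show "(1 / w x0) * w x <= 1" using pos x0(2)[OF x] by simp
   have "(1 / w x0) * w x <= (1 / w x0) * T l w x" using pos w(3)[OF x] by (intro mult_left_mono) auto
   then show "(1 / w x0) * w x <= T l (%x. (1 / w x0) * w x) x" using T_scale[OF _ w(1) x, of "1 / w x0"] pos by simp
  qed (use pos in simp)
  then show ?thesis by blast
 qed
 have l0_in: "l0 : La" unfolding La_def using normalise[of l0 w0] start by blast
 have bdd: "bdd_above La"
 proof -
  obtain L where L: "!!l x. L <= l ==> x : S ==> T l (%_. 1) x <= 1/2" using bound by blast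
  have "l <= L" if "l : La" for l
  proof (rule ccontr)
   assume "~ l <= L"
   obtain w where w: "sub l w" and l: "l0 <= l" using \<open>l : La\<close> by (auto simp: La_def)
   interpret cone_operator S "T l" d0 by (rule op[OF l])
   obtain x where x: "x : S" "w x = 1" using w by (auto simp: sub_def)
   have "w x <= T l w x" using w x by (auto simp: sub_def)
   also have "... <= 1 * T l (%_. 1) x" using w x by (intro T_le_const) (auto simp: sub_def)
   also have "... <= 1/2" using L[of l x] x \<open>~ l <= L\<close> by auto
   finally show False using x by simp
  qed
  then show ?thesis by (rule bdd_aboveI)
 qed
 define r where "r = Sup La"
 have r_ge: "l0 <= r" unfolding r_def using l0_in bdd by (rule cSup_upper)
 interpret R: cone_operator S "T r" d0 by (rule op[OF r_ge])
 have gap: "T l w x <= T l' w x + (T l (%_. 1) x - T l' (%_. 1) x)"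
  if "l0 <= l" "l <= l'" "w : cone_on S" "!!x. x : S ==> w x <= 1" "x : S" for l l' w x
 proof -
  interpret L: cone_operator S "T l" d0 by (rule op) fact
  interpret L': cone_operator S "T l'" d0 by (rule op) (use that in auto)
  define v where "v = (%x. 1 - w x)"
  have v: "v : cone_on S" using that by (auto simp: v_def cone_on_def intro: continuous_intros)
  have "T l (%x. v x + w x) x = T l v x + T l w x" by (rule L.T_add[OF v that(3,5)])
  moreover have "T l' (%x. v x + w x) x = T l' v x + T l' w x" by (rule L'.T_add[OF v that(3,5)])
  moreover have "T l' v x <= T l v x" by (rule anti[OF that(1,2) v that(5)])
  ultimately show ?thesis by (simp add: v_def)
 qed
 have "EX l w. l <= r & l0 <= l & sub l w & (ALL x:S. T l (%_. 1) x - T r (%_. 1) x <= 1 / Suc n)" for n :: nat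
 proof -
  obtain d where d: "d > 0" "!!l' x. l' >= l0 ==> \<bar>l' - r\<bar> < d ==> x : S ==> \<bar>T l' (%_. 1) x - T r (%_. 1) x\<bar> <= 1 / Suc n"
   using cont[OF r_ge, of "1 / Suc n"] by auto
  obtain l where l: "l : La" "r - d < l" using less_cSup_iff[OF _ bdd, of "r - d"] l0_in d by (auto simp: r_def)
  have "l <= r" unfolding r_def using l(1) bdd by (rule cSup_upper)
  then show ?thesis using l d(2)[of l] by (fastforce simp: La_def abs_le_iff)
 qed
 then obtain L W where LW: "!!n. L n <= r" "!!n. l0 <= L n" "!!n. sub (L n) (W n)"
   "!!n x. x : S ==> T (L n) (%_. 1) x - T r (%_. 1) x <= 1 / Suc n" by metis
 have Wc: "W n : cone_on S" and W1: "x : S ==> W n x <= 1" for n x using LW(3)[of n] by (auto simp: sub_def)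
 have Wle: "W n x <= T r (W n) x + 1 / Suc n" if "x : S" for n x
 proof -
  have "W n x <= T (L n) (W n) x" using LW(3)[of n] that by (auto simp: sub_def)
  moreover have "T (L n) (W n) x <= T r (W n) x + (T (L n) (%_. 1) x - T r (%_. 1) x)" by (rule gap[OF LW(2) LW(1) Wc]) (use W1 that in auto)
  ultimately show ?thesis using LW(4)[OF that, of n] by linarith
 qed
 have one_in: "(%_. 1) : cone_on S" by (rule cone_on_const) simp
 obtain Bd where Bd: "!!x. x : S ==> T r (%_. 1) x <= Bd" "0 <= Bd"
 proof -
  obtain x0 where "x0 : S" "!!x. x : S ==> T r (%_. 1) x <= T r (%_. 1) x0"
   using continuous_attains_sup[OF Scomp _ cone_onD(1)[OF R.T_in[OF one_in]]] start(2) by blast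
  then show ?thesis using that cone_onD(2)[OF R.T_in[OF one_in]] by blast
 qed
 have Tbd: "T r (W n) x <= Bd" if "x : S" for n x
 proof -
  have "T r (W n) x <= 1 * T r (%_. 1) x" by (rule R.T_le_const[OF Wc]) (use W1 that in auto)
  then show ?thesis using Bd(1)[OF that] by simp
 qed
 obtain z ka where z: "continuous_on S z" "strict_mono (ka :: nat => nat)"
   "!!e. 0 < e ==> EX N. ALL n x. n >= N & x : S --> norm (T r (W (ka n)) x - z x) < e"
 proof (rule Arzela_Ascoli[OF Scomp, of "%n. T r (W n)" Bd])
  show "norm (T r (W n) x) <= Bd" if "x : S" for n x using Tbd[OF that] cone_onD(2)[OF R.T_in[OF Wc] that] by simp
  show "EX d>0. ALL n y. y : S & norm (x - y) < d --> norm (T r (W n) x - T r (W n) y) < e"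
   if "x : S" "0 < e" for x e
  proof -
   obtain d where d: "d > 0" "ALL w:cone_on S. (ALL y:S. w y <= 1) -->
     (ALL y:S. norm (x - y) < d --> \<bar>T r w x - T r w y\<bar> < e)" using R.T_equi[OF \<open>x : S\<close> \<open>0 < e\<close>] by blast
   have "norm (T r (W n) x - T r (W n) y) < e" if "y : S" "norm (x - y) < d" for n y using d(2)[rule_format, OF Wc[of n] _ that] W1[of _ n] by simp
   then show ?thesis using d(1) by blast
  qed
 qed auto
 have z_nonneg: "0 <= z x" if "x : S" for x
 proof (rule field_le_epsilon)
  fix e :: real assume "0 < e"
  from z(3)[OF this] obtain N where "ALL n x. n >= N & x : S --> norm (T r (W (ka n)) x - z x) < e" by (elim exE)
  with \<open>x : S\<close> have "norm (T r (W (ka N)) x - z x) < e" by simp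
  then show "0 <= z x + e" using cone_onD(2)[OF R.T_in[OF Wc[of "ka N"]] that] by (auto simp: abs_less_iff)
 qed
 have zc: "z : cone_on S" using z(1) z_nonneg by (auto simp: cone_on_def)
 have close: "EX n. (ALL x:S. \<bar>T r (W n) x - z x\<bar> < e) & 1 / real (Suc n) < e" if "0 < e" for e
 proof -
  obtain N where N: "ALL n x. n >= N & x : S --> norm (T r (W (ka n)) x - z x) < e" using z(3)[OF \<open>0 < e\<close>] by blast
  obtain m where m: "1 / real (Suc m) < e" using nat_approx_posE[OF \<open>0 < e\<close>] by blast
  define n where "n = max N m"
  have "m <= ka n" using seq_suble[OF z(2), of n] by (simp add: n_def)
  then have "1 / real (Suc (ka n)) <= 1 / real (Suc m)" by (simp add: frac_le)
  then show ?thesis using N m by (intro exI[of _ "ka n"]) (auto simp: n_def)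
 qed
 have z_sub: "z x <= T r z x" if x: "x : S" for x
 proof (rule field_le_epsilon)
  fix e :: real assume e: "0 < e"
  define e' where "e' = e / (1 + 2 * Bd)"
  have e': "0 < e'" using e Bd(2) by (simp add: e'_def)
  obtain n where n: "ALL x:S. \<bar>T r (W n) x - z x\<bar> < e'" "1 / real (Suc n) < e'" using close[OF e'] by blast
  have "W n y <= z y + 2 * e' * 1" if "y : S" for y using Wle[OF that, of n] n that by (fastforce simp: abs_less_iff)
  then have "T r (W n) x <= T r (%y. z y + 2 * e' * 1) x" using e' x by (intro R.T_mono Wc cone_on_add zc cone_on_const) auto
  also have "... = T r z x + 2 * e' * T r (%_. 1) x"
   using e' x one_in zc by (subst R.T_add) (auto simp: R.T_scale[of "2*e'" "%_. 1", simplified] intro: cone_on_const)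
  also have "... <= T r z x + 2 * e' * Bd" using Bd(1)[OF x] e' by simp
  finally have "z x <= T r z x + e' * (1 + 2 * Bd)" using n(1) x by (fastforce simp: abs_less_iff algebra_simps)
  also have "e' * (1 + 2 * Bd) = e" using Bd(2) by (simp add: e'_def)
  finally show "z x <= T r z x + e" .
 qed
 obtain xz where xz: "xz : S" "z xz ~= 0"
 proof -
  obtain n where n: "ALL x:S. \<bar>T r (W n) x - z x\<bar> < 1/3" "1 / real (Suc n) < 1/3" using close[of "1/3"] by auto
  obtain x where x: "x : S" "W n x = 1" using LW(3)[of n] by (auto simp: sub_def)
  then have "z x ~= 0" using Wle[OF x(1), of n] n(1)[rule_format, OF x(1)] n(2) by linarith
  then show ?thesis using that x by blast
 qed
 have fix_eq: "T r z x = z x" if x: "x : S" for x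
 proof (rule ccontr)
  assume ne: "T r z x ~= z x"
  obtain w ep where w: "w : cone_on S" "0 < ep" "EX x:S. w x ~= 0" "!!x. x : S ==> w x + ep <= T r w x"
   using R.strict_subsolution[OF zc z_sub x ne] by blast
  obtain x0 where x0: "x0 : S" "!!x. x : S ==> w x <= w x0" using continuous_attains_sup[OF Scomp _ cone_onD(1)[OF w(1)]] x by blast
  define c where "c = w x0 + 1"
  have c: "0 < c" "!!x. x : S ==> w x <= c" using x0 cone_onD(2)[OF w(1) x0(1)] by (auto simp: c_def intro: add_increasing2)
  obtain d where d: "d > 0" "!!l' x. l' >= l0 ==> \<bar>l' - r\<bar> < d ==> x : S ==> \<bar>T l' (%_. 1) x - T r (%_. 1) x\<bar> <= ep / c"
   using cont[OF r_ge, of "ep / c"] w c by auto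
  define l where "l = r + d / 2"
  have l: "l0 <= l" "r < l" "\<bar>l - r\<bar> < d" using r_ge d by (auto simp: l_def)
  interpret L: cone_operator S "T l" d0 by (rule op[OF l(1)])
  have wl: "w x <= T l w x" if x: "x : S" for x
  proof -
   have wc: "(%x. (1 / c) * w x) : cone_on S" using c w by (intro cone_on_scale) auto
   have "T r (%x. (1 / c) * w x) x <= T l (%x. (1 / c) * w x) x + (T r (%_. 1) x - T l (%_. 1) x)" by (rule gap[OF r_ge _ wc _ x]) (use l c in auto)
   then have "(1 / c) * T r w x <= (1 / c) * T l w x + ep / c" using d(2)[OF l(1,3) x] c w x L.T_scale[of "1/c" w x] R.T_scale[of "1/c" w x] by auto
   then have "T r w x <= T l w x + ep" using c by (simp add: divide_simps)
   then show ?thesis using w(4)[OF x] by simp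
  qed
  have "l : La" using normalise[OF l(1) w(1,3) wl] l by (auto simp: La_def)
  then have "l <= r" unfolding r_def using bdd by (rule cSup_upper)
  then show False using l by simp
 qed
 have "0 < z x" if "x : S" for x by (rule R.fixed_point_positive[OF zc fix_eq xz that])
 then show ?thesis using r_ge z(1) fix_eq by blast
qed

lemma measurable_pair_caratheodory:
 fixes f :: "'a => 'b::{metric_space, second_countable_topology} => 'c::metric_space"
 assumes meas: "!!x. x : X ==> (%a. f a x) : BM A"
  and cont: "!!a. a : space A ==> continuous_on X (f a)"
  and N: "space N = X" "(%x. x) : BM N"
 shows "(%p. f (fst p) (snd p)) : BM (A \<Otimes>\<^sub>M N)"
proof (cases "X = {}")
 case True
 then show ?thesis by (intro measurableI) (auto simp: space_pair_measure N)
next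
 case False
 obtain C where C: "countable C" "C <= X" "X <= closure C" using separable[of X] by blast
 with False have "C ~= {}" by auto
 define d where "d = from_nat_into C"
 have d: "d i : C" for i unfolding d_def by (rule from_nat_into[OF \<open>C ~= {}\<close>])
 define k where "k n x = (LEAST i. dist (d i) x < 1 / real (Suc n))" for n x
 have close: "dist (d (k n x)) x < 1 / real (Suc n)" if "x : X" for n x
 proof -
  have "x : closure C" using C that by auto
  then obtain c where "c : C" "dist c x < 1 / real (Suc n)"
   unfolding closure_approachable by (metis of_nat_0_less_iff zero_less_Suc zero_less_divide_1_iff)
  moreover obtain i where "d i = c" unfolding d_def using from_nat_into_surj[OF C(1) \<open>c : C\<close>] by blast
  ultimately show ?thesis unfolding k_def by (intro LeastI[where P="%i. dist (d i) x < 1 / real (Suc n)"]) auto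
 qed
 note N(2)[measurable]
 have k_meas[measurable]: "k n : measurable N (count_space UNIV)" for n unfolding k_def by measurable
 show ?thesis
 proof (rule borel_measurable_LIMSEQ_metric)
  show "(%p. f (fst p) (d (k n (snd p)))) : BM (A \<Otimes>\<^sub>M N)" for n
  proof (rule measurable_compose_countable[where g="%p. k n (snd p)" and f="%i p. f (fst p) (d i)"])
   show "(%p. f (fst p) (d i)) : BM (A \<Otimes>\<^sub>M N)" for i using measurable_compose[OF measurable_fst meas] d C by blast
  qed measurable
  fix p assume "p : space (A \<Otimes>\<^sub>M N)"
  then have p: "fst p : space A" "snd p : X" by (auto simp: space_pair_measure N)
  have "(%n. d (k n (snd p))) \<longlonglongrightarrow> snd p"
  proof (rule metric_LIMSEQ_I)
   fix r :: real assume "0 < r"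
   then obtain m where m: "1 / real (Suc m) < r" using nat_approx_posE by blast
   have "dist (d (k n (snd p))) (snd p) < r" if "m <= n" for n
   proof -
    have "1 / real (Suc n) <= 1 / real (Suc m)" using that by (simp add: frac_le)
    then show ?thesis using close[OF p(2), of n] m by linarith
   qed
   then show "EX m. ALL n>=m. dist (d (k n (snd p))) (snd p) < r" by blast
  qed
  then show "(%n. f (fst p) (d (k n (snd p)))) \<longlonglongrightarrow> f (fst p) (snd p)"
   using cont[OF p(1)] p(2) d C(2) by (auto simp: continuous_on_sequentially o_def subset_eq)
 qed
qed

lemma continuous_version:
 fixes f :: "'a => 'b::euclidean_space => real" and E :: "nat => 'a set"
 assumes S: "compact S" "S = closure C" "countable C"
  and meas: "!!x. x : S ==> (%a. f a x) : BM A"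
  and E: "!!a. a : space A ==> EX n. a : E n"
  and cont: "!!n x e. x : S ==> 0 < e ==> EX d>0. ALL y:S. dist y x < d -->
     (AE a in A. a : E n --> \<bar>f a y - f a x\<bar> <= e)"
 obtains g where "!!a. a : space A ==> continuous_on S (g a)"
  "!!x. x : S ==> AE a in A. g a x = f a x"
  "!!x. x : S ==> (%a. g a x) : BM A"
proof -
 have CS: "C <= S" using S(2) closure_subset by blast
 have unif: "EX d>0. ALL x:S. ALL y:S. dist x y < d --> (AE a in A. a : E n --> \<bar>f a x - f a y\<bar> <= e)"
  if "0 < e" for n e
 proof -
  have "ALL x:S. EX d>0. ALL y:S. dist y x < d --> (AE a in A. a : E n --> \<bar>f a y - f a x\<bar> <= e / 2)" using cont[of _ "e/2" n] that by auto
  from bchoice[OF this] obtain dl where dl': "ALL x:S. 0 < dl x & (ALL y:S. dist y x < dl x -->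
    (AE a in A. a : E n --> \<bar>f a y - f a x\<bar> <= e / 2))" by (elim exE)
  then have dl: "!!x. x : S ==> 0 < dl x"
    "!!x y. x : S ==> y : S ==> dist y x < dl x ==> (AE a in A. a : E n --> \<bar>f a y - f a x\<bar> <= e / 2)" by auto
  obtain d where d: "0 < d" "!!x. x : S ==> EX G:(%x. ball x (dl x)) ` S. ball x d <= G"
   by (rule Heine_Borel_lemma[OF S(1), of "(%x. ball x (dl x)) ` S"]) (use dl(1) in force)+
  have "AE a in A. a : E n --> \<bar>f a x - f a y\<bar> <= e" if xy: "x : S" "y : S" "dist x y < d" for x y
  proof -
   obtain z where z: "z : S" "ball x d <= ball z (dl z)" using d(2)[OF xy(1)] by blast
   have "x : ball x d" "y : ball x d" using xy d(1) by auto
   then have "x : ball z (dl z)" "y : ball z (dl z)" using z(2) by blast+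
   then have "AE a in A. a : E n --> \<bar>f a x - f a z\<bar> <= e / 2" "AE a in A. a : E n --> \<bar>f a y - f a z\<bar> <= e / 2"
    using dl(2) z(1) xy by (auto simp: dist_commute)
   then show ?thesis
   proof eventually_elim
    case (elim a)
    show ?case by (intro impI) (use elim in \<open>simp, linarith\<close>)
   qed
  qed
  then show ?thesis using d(1) by blast
 qed
 define dl where "dl n m = (SOME d. 0 < d & (ALL x:S. ALL y:S. dist x y < d -->
   (AE a in A. a : E n --> \<bar>f a x - f a y\<bar> <= 1 / real (Suc m))))" for n m
 have dl': "0 < dl n m & (ALL x:S. ALL y:S. dist x y < dl n m -->
   (AE a in A. a : E n --> \<bar>f a x - f a y\<bar> <= 1 / real (Suc m)))" for n m unfolding dl_def by (rule someI_ex, rule unif) simp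
 then have dl: "!!n m. 0 < dl n m"
   "!!n m x y. x : S ==> y : S ==> dist x y < dl n m ==>
     (AE a in A. a : E n --> \<bar>f a x - f a y\<bar> <= 1 / real (Suc m))" by blast+
 have "AE a in A. ALL n m. ALL x:C. ALL y:C. dist x y < dl n m --> a : E n --> \<bar>f a x - f a y\<bar> <= 1 / real (Suc m)"
  unfolding AE_all_countable AE_ball_countable[OF S(3)]
 proof (intro allI ballI)
  fix n m x y assume "x : C" "y : C"
  then show "AE a in A. dist x y < dl n m --> a : E n --> \<bar>f a x - f a y\<bar> <= 1 / real (Suc m)"
   using dl(2)[of x y n m] CS by (cases "dist x y < dl n m") auto
 qed
 then obtain N where N: "N : null_sets A"
   "!!a n m x y. a : space A - N ==> x : C ==> y : C ==> dist x y < dl n m ==> a : E n ==> \<bar>f a x - f a y\<bar> <= 1 / real (Suc m)"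
  by (elim AE_E3) auto
 have "EX g. continuous_on S g & (ALL x:C. g x = f a x)" if a: "a : space A - N" for a
 proof -
  obtain n where n: "a : E n" using E a by blast
  have "uniformly_continuous_on C (f a)" unfolding uniformly_continuous_on_def
  proof (intro allI impI)
   fix e :: real assume "0 < e"
   then obtain m where m: "1 / real (Suc m) < e" using nat_approx_posE by blast
   have "dist (f a x') (f a x) < e" if "x : C" "x' : C" "dist x' x < dl n m" for x x' using N(2)[OF a that(2,1,3) n] m by (simp add: dist_real_def)
   then show "EX d>0. ALL x:C. ALL x':C. dist x' x < d --> dist (f a x') (f a x) < e" using dl(1) by blast
  qed
  then obtain g where "uniformly_continuous_on (closure C) g" "!!x. x : C ==> f a x = g x"
   by (rule uniformly_continuous_on_extension_on_closure) blast
  then show ?thesis using S(2) uniformly_continuous_imp_continuous by metis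
 qed
 then obtain g0 where g0: "!!a. a : space A - N ==> continuous_on S (g0 a)"
   "!!a x. a : space A - N ==> x : C ==> g0 a x = f a x" by metis
 define g where "g a = (if a : N then (%_. 0) else g0 a)" for a
 have g_cont: "continuous_on S (g a)" if "a : space A" for a using g0(1)[of a] that by (auto simp: g_def)
 have N_sets[measurable]: "N : sets A" using N(1) by auto
 have g_C[measurable]: "(%a. g a c) : BM A" if "c : C" for c
 proof -
  have [measurable]: "(%a. f a c) : BM A" using meas CS that by auto
  have "(%a. if a : N then 0 else f a c) : BM A" by measurable
  then show ?thesis by (rule measurable_cong[THEN iffD1, rotated]) (auto simp: g_def g0(2) that)
 qed
 have g_meas: "(%a. g a x) : BM A" if x: "x : S" for x
 proof -
  obtain c where c: "!!n. c n : C" "c \<longlonglongrightarrow> x" using x S(2) closure_sequential[of x C] by auto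
  show ?thesis
  proof (rule borel_measurable_LIMSEQ_metric[OF g_C])
   show "c n : C" for n by (rule c)
   show "(%i. g a (c i)) \<longlonglongrightarrow> g a x" if "a : space A" for a
    using g_cont[OF that] c CS x by (auto simp: continuous_on_sequentially o_def subset_eq)
  qed
 qed
 have g_eq: "AE a in A. g a x = f a x" if x: "x : S" for x
 proof -
  have "EX c:C. dist c x < min (dl n m) (1 / real (Suc m))" for n m
  proof -
   have "0 < min (dl n m) (1 / real (Suc m))" using dl(1)[of n m] by simp
   then show ?thesis using x unfolding S(2) closure_approachable by blast
  qed
  then have "ALL n m. EX c. c : C & dist c x < min (dl n m) (1 / real (Suc m))" by blast
  then obtain c where c: "!!n m. c n m : C" "!!n m. dist (c n m) x < min (dl n m) (1 / real (Suc m))" unfolding choice_iff by blast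
  have "AE a in A. ALL n m. a : E n --> \<bar>f a (c n m) - f a x\<bar> <= 1 / real (Suc m)" unfolding AE_all_countable
  proof (intro allI)
   fix n m
   show "AE a in A. a : E n --> \<bar>f a (c n m) - f a x\<bar> <= 1 / real (Suc m)" by (rule dl(2)) (use c(1)[of n m] c(2)[of n m] CS x in auto)
  qed
  moreover have "AE a in A. a : space A - N" using N(1) AE_not_in AE_space by fastforce
  ultimately show ?thesis
  proof eventually_elim
   case (elim a)
   obtain n where n: "a : E n" using E elim by blast
   have inv: "(%m. 1 / real (Suc m)) \<longlonglongrightarrow> 0" by (rule LIMSEQ_Suc[OF lim_1_over_n])
   have "(%m. dist (c n m) x) \<longlonglongrightarrow> 0"
    by (rule tendsto_sandwich[OF _ _ tendsto_const inv]) (use c(2) in \<open>auto intro!: always_eventually less_imp_le\<close>)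
   then have "(%m. c n m) \<longlonglongrightarrow> x" by (simp add: tendsto_dist_iff[symmetric])
   then have "(%m. g a (c n m)) \<longlonglongrightarrow> g a x"
    using g_cont[of a] elim c(1) CS x by (auto simp: continuous_on_sequentially o_def subset_eq)
   then have 1: "(%m. f a (c n m)) \<longlonglongrightarrow> g a x" using elim g0(2)[of a] c(1) by (simp add: g_def)
   have "(%m. \<bar>f a (c n m) - f a x\<bar>) \<longlonglongrightarrow> 0"
    by (rule tendsto_sandwich[OF _ _ tendsto_const inv]) (use elim n in \<open>auto intro!: always_eventually\<close>)
   then have "(%m. f a (c n m)) \<longlonglongrightarrow> f a x" by (simp add: tendsto_rabs_zero_iff LIM_zero_iff)
   with 1 show ?case by (rule LIMSEQ_unique)
  qed
 qed
 show thesis by (rule that[OF g_cont g_eq g_meas])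
qed

lemma continuous_on_lebesgue_integral_AE:
 fixes F :: "'a::metric_space => 'b => 'c::{banach, second_countable_topology}"
 assumes "!!x. x : S ==> F x : BM M" "integrable M w"
  and "AE t in M. ALL x:S. norm (F x t) <= w t"
  and "AE t in M. continuous_on S (%x. F x t)"
 shows "continuous_on S (%x. integral\<^sup>L M (F x))" unfolding continuous_on_sequentially
proof (intro allI ballI impI)
 fix xs x assume x: "x : S" and xs: "(ALL n. xs n : S) & xs \<longlonglongrightarrow> x"
 have "(%n. integral\<^sup>L M (F (xs n))) \<longlonglongrightarrow> integral\<^sup>L M (F x)"
 proof (rule integral_dominated_convergence[where w=w])
  show "AE t in M. (%n. F (xs n) t) \<longlonglongrightarrow> F x t"
   using assms(4) by eventually_elim (use x xs in \<open>auto simp: continuous_on_sequentially o_def\<close>)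
  show "AE t in M. norm (F (xs n) t) <= w t" for n using assms(3) by eventually_elim (use xs in auto)
 qed (use assms x xs in auto)
 then show "((%x. integral\<^sup>L M (F x)) \<circ> xs) \<longlonglongrightarrow> integral\<^sup>L M (F x)" by (simp add: o_def)
qed

lemma continuous_on_lebesgue_integral:
 fixes F :: "'a::metric_space => 'b => 'c::{banach, second_countable_topology}"
 assumes "!!x. x : S ==> F x : BM M" "integrable M w"
  and "!!x t. x : S ==> t : space M ==> norm (F x t) <= w t"
  and "!!t. t : space M ==> continuous_on S (%x. F x t)"
 shows "continuous_on S (%x. integral\<^sup>L M (F x))" by (rule continuous_on_lebesgue_integral_AE) (use assms in auto)

section \<open>The age-structured model\<close>

lemma sigma_finite_lebesgue: "sigma_finite_measure (lebesgue :: 'a::euclidean_space measure)"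
proof
 obtain C :: "'a set set" where C: "countable C" "C <= sets lborel" "\<Union>C = space lborel" "ALL a:C. emeasure lborel a ~= \<infinity>"
  using lborel.sigma_finite_countable by blast
 then show "EX A::'a set set. countable A & A <= sets lebesgue & \<Union>A = space lebesgue & (ALL a:A. emeasure lebesgue a ~= \<infinity>)"
  by (intro exI[of _ C]) (auto simp: subset_eq)
qed

lemma indicator_lessThan_measurable[measurable (raw)]:
 fixes f g :: "'a => real"
 assumes [measurable]: "f : BM N" "g : BM N"
 shows "(%w. ind {..<f w} (g w) :: ennreal) : BM N"
  "(%w. ind {f w<..} (g w) :: ennreal) : BM N"
  "(%w. ind {0<..f w} (g w) :: real) : BM N"
  "(%w. ind {..<f w} (g w) :: real) : BM N"
  "(%w. ind {f w<..} (g w) :: real) : BM N" unfolding indicator_def by (simp_all add: if_distrib[symmetric])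

locale age_model =
 fixes Om :: "(real^'n) set" and ahat :: ereal and D mut B M JB j0 d0 :: real
  and J :: "real^'n => real" and beta mu :: "real => real^'n => real" and b0 :: "real => real"
 assumes Om_open: "open Om" and Om_conn: "connected Om" and Om_bdd: "bounded Om" and Om_ne: "Om ~= {}"
  and ahat_pos: "0 < ahat" and D_pos: "0 < D" and mut_pos: "0 < mut" and JB_pos: "0 < JB"
  and j0_pos: "0 < j0" and d0_pos: "0 < d0"
  and J_cont: "continuous_on UNIV J" and J_nonneg: "!!x. 0 <= J x" and J_le: "!!x. J x <= JB"
  and J_ge: "!!x. norm x < d0 ==> j0 <= J x"
  and beta_cont: "!!a. a : ages ahat ==> continuous_on (closure Om) (beta a)"
  and mu_cont: "!!a. a : ages ahat ==> continuous_on (closure Om) (mu a)"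
  and beta_meas: "!!x. x : closure Om ==> (%a. beta a x) : BM (lebesgue_on (ages ahat))"
  and mu_meas: "!!x. x : closure Om ==> (%a. mu a x) : BM (lebesgue_on (ages ahat))"
  and b0_meas: "b0 : BM (lebesgue_on (ages ahat))"
  and b0_nonneg: "!!a. a : ages ahat ==> 0 <= b0 a"
  and beta_ge: "!!a x. a : ages ahat ==> x : closure Om ==> b0 a <= beta a x"
  and beta_le: "!!a x. a : ages ahat ==> x : closure Om ==> beta a x <= B"
  and mu_ge: "!!a x. a : ages ahat ==> x : closure Om ==> mut <= mu a x"
  and mu_le: "!!a x. a : ages ahat ==> x : closure Om ==> mu a x <= M"
  and b0_nontriv: "~ (AE a in lebesgue_on (ages ahat). b0 a = 0)"
begin

abbreviation Ag where "Ag == ages ahat"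
abbreviation S where "S \<equiv> closure Om"

definition AM :: "real measure" where "AM = lebesgue_on (Ag)"
definition OM :: "(real^'n) measure" where "OM = lebesgue_on Om"

abbreviation "PM == AM \<Otimes>\<^sub>M OM"

lemma ages_sets: "Ag : sets lebesgue"
proof -
 have "Ag = {0<..} \<inter> {a. ereal a < ahat}" by (auto simp: ages_def)
 moreover have "{a::real. ereal a < ahat} : sets borel" by measurable
 ultimately have "Ag : sets borel" by auto
 then show ?thesis by (rule sets_completionI_sets[of _ lborel, simplified])
qed

lemma Om_sets: "Om : sets lebesgue" using Om_open by (simp add: borel_open)

lemma S_compact: "compact S" using Om_bdd by simp
lemma S_conn: "connected S" using Om_conn by (rule connected_imp_connected_closure)
lemma Om_S: "x : Om ==> x : S" using closure_subset by blast

lemma space_AM[simp]: "space AM = Ag" by (simp add: AM_def)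
lemma space_OM[simp]: "space OM = Om" by (simp add: OM_def)

lemma id_AM[measurable (raw)]: "(%x. x) : BM AM" unfolding AM_def by (auto intro!: measurable_restrict_space1 measurable_completion)

lemma id_OM[measurable (raw)]: "(%x. x) : BM OM" unfolding OM_def by (auto intro!: measurable_restrict_space1 measurable_completion)

lemma fst_AM[measurable]: "fst : BM (AM \<Otimes>\<^sub>M N)" by (rule measurable_compose[OF measurable_fst id_AM])
lemma snd_AM[measurable]: "snd : BM (N \<Otimes>\<^sub>M AM)" by (rule measurable_compose[OF measurable_snd id_AM])
lemma fst_OM[measurable]: "fst : BM (OM \<Otimes>\<^sub>M N)" by (rule measurable_compose[OF measurable_fst id_OM])
lemma snd_OM[measurable]: "snd : BM (N \<Otimes>\<^sub>M OM)" by (rule measurable_compose[OF measurable_snd id_OM])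

sublocale AM: sigma_finite_measure AM unfolding AM_def using ages_sets by (intro sigma_finite_measure_restrict_space sigma_finite_lebesgue) auto

sublocale OM: finite_measure OM unfolding OM_def using Om_bdd Om_sets by (intro finite_measure_lebesgue_on bounded_set_imp_lmeasurable)

sublocale P: pair_sigma_finite AM OM ..
sublocale AA: pair_sigma_finite AM AM ..
sublocale OO: pair_sigma_finite OM OM ..

lemma J_meas[measurable]: "J : borel_measurable borel" using J_cont by (rule borel_measurable_continuous_onI)

lemma cont_OM: "continuous_on S w ==> w : BM OM" for w :: "_ => 'b::topological_space" unfolding OM_def using Om_open closure_subset
 by (intro continuous_imp_measurable_on_sets_lebesgue) (auto intro: continuous_on_subset simp: borel_open)

lemma beta_AM: "x : S ==> f : measurable N AM ==> (%w. beta (f w) x) : BM N" using measurable_compose[OF _ beta_meas[folded AM_def]] by blast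
lemma mu_AM: "x : S ==> f : measurable N AM ==> (%w. mu (f w) x) : BM N" using measurable_compose[OF _ mu_meas[folded AM_def]] by blast
lemma b0_AM[measurable]: "b0 : BM AM" using b0_meas by (simp add: AM_def)

lemma beta_nonneg: "a : Ag ==> x : S ==> 0 <= beta a x" using beta_ge b0_nonneg order_trans by blast

lemma B_nonneg: "0 <= B"
proof -
 obtain a where "a : Ag"
 proof (cases "Ag = {}")
  case True
  then have "AE a in lebesgue_on (Ag). b0 a = 0" by (intro AE_I2) simp
  then show ?thesis using b0_nontriv by simp
 qed blast
 moreover obtain x where "x : S" using Om_ne Om_S by blast
 ultimately show ?thesis using beta_nonneg beta_le order_trans by blast
qed

lemma caratheodory_AM_OM:
 fixes f :: "real => real^'n => 'c::metric_space"
 assumes "!!x. x : Om ==> (%a. f a x) : BM AM"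
  and "!!a. a : Ag ==> continuous_on Om (f a)"
 shows "(%p. f (fst p) (snd p)) : BM PM" by (rule measurable_pair_caratheodory[where X=Om]) (use assms in auto)

lemma pair_compose:
 assumes "(%p. f (fst p) (snd p)) : BM PM"
  and [measurable]: "g : measurable N AM" "h : measurable N OM"
 shows "(%w. f (g w) (h w)) : BM N" using measurable_compose[OF measurable_Pair[OF assms(2,3)] assms(1)] by simp

lemma continuous_on_Om: "continuous_on S f ==> continuous_on Om f" by (rule continuous_on_subset[OF _ closure_subset])

lemma beta_pair:
 assumes "g : measurable N AM" "h : measurable N OM"
 shows "(%w. beta (g w) (h w)) : BM N" by (rule pair_compose[OF caratheodory_AM_OM assms])
  (auto intro: beta_AM beta_cont continuous_on_Om simp: Om_S)

lemma ages_down: "a : Ag ==> 0 < s ==> s <= a ==> s : Ag" by (auto simp: ages_def) (metis ereal_less_eq(3) order_le_less_trans)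

lemma nn_integral_AM_le_lborel:
 "NI AM (%a. f a) <= NI lborel (%a. f a)"
proof -
 have "NI AM (%a. f a) = NI lebesgue (%a. f a * indicator (Ag) a)" unfolding AM_def by (rule nn_integral_restrict_space) (use ages_sets in simp)
 also have "... <= NI lebesgue (%a. f a)" by (intro nn_integral_mono) (auto simp: indicator_def)
 also have "... = NI lborel (%a. f a)" by (rule nn_integral_completion)
 finally show ?thesis .
qed

lemma emeasure_AM_interval:
 assumes "a : Ag" "0 <= s" "s <= a"
 shows "emeasure AM {s<..a} = en (a - s)"
proof -
 have sub: "{s<..a} <= Ag" using assms ages_down by fastforce
 then have "emeasure AM {s<..a} = emeasure lebesgue {s<..a}" unfolding AM_def by (subst emeasure_restrict_space) (use ages_sets in auto)
 then show ?thesis using assms by simp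
qed

lemma interval_AM: "a : Ag ==> 0 <= s ==> {s<..a} : sets AM"
 unfolding AM_def using ages_down by (auto simp: sets_restrict_space_iff[OF _ ] ages_sets sets_restrict_space image_iff intro!: bexI[of _ "{s<..a}"])

definition mm :: "real => real^'n => real" where
 "mm a x = (LINT s|AM. ind {0<..a} s * mu s x)"

definition qq :: "real => real^'n => real" where "qq a x = exp (- D * a - mm a x)"

lemma integrable_interval:
 assumes "a : Ag" "0 <= s"
 shows "integrable AM (%t. ind {s<..a} t * c :: real)"
proof -
 have "emeasure AM {s<..a} < \<infinity>" by (cases "s <= a") (use emeasure_AM_interval[OF assms(1,2)] in auto)
 then show ?thesis using interval_AM[OF assms] by (intro integrable_mult_left integrable_real_indicator) auto
qed

lemma integrable_mu:
 assumes "a : Ag" "0 <= s" "x : S"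
 shows "integrable AM (%t. ind {s<..a} t * mu t x)"
proof (rule Bochner_Integration.integrable_bound[OF integrable_interval[OF assms(1,2), of "\<bar>M\<bar>"]])
 have [measurable]: "{s<..a} : sets AM" by (rule interval_AM[OF assms(1,2)])
 note [measurable] = mu_AM[OF assms(3)]
 show "(%t. ind {s<..a} t * mu t x) : BM AM" by measurable
 show "AE t in AM. norm (ind {s<..a} t * mu t x) <= norm (ind {s<..a} t * \<bar>M\<bar>)"
 proof (rule AE_I2)
  fix t assume "t : space AM"
  then have "mut <= mu t x" "mu t x <= M" using mu_ge mu_le assms by auto
  then show "norm (ind {s<..a} t * mu t x) <= norm (ind {s<..a} t * \<bar>M\<bar>)" using mut_pos by (auto simp: indicator_def)
 qed
qed

lemma LINT_interval: "a : Ag ==> 0 <= s ==> s <= a ==> (LINT t|AM. ind {s<..a} t * c) = (a - s) * (c::real)"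
proof -
 assume a: "a : Ag" "0 <= s" "s <= a"
 have "{s<..a} \<inter> Ag = {s<..a}" using sets.sets_into_space[OF interval_AM[OF a(1,2)]] by auto
 then show ?thesis using emeasure_AM_interval[OF a] a by (simp add: measure_def)
qed

lemma mm_diff:
 assumes "a : Ag" "0 <= s" "s <= a" "x : S"
 shows "mm a x - mm s x = (LINT t|AM. ind {s<..a} t * mu t x)"
proof (cases "s = 0")
 case True
 then show ?thesis by (simp add: mm_def)
next
 case False
 then have s: "s : Ag" using ages_down assms by auto
 have "mm a x - mm s x = (LINT t|AM. ind {0<..a} t * mu t x - ind {0<..s} t * mu t x)"
  unfolding mm_def by (rule Bochner_Integration.integral_diff[symmetric]) (auto intro: integrable_mu assms s)
 also have "... = (LINT t|AM. ind {s<..a} t * mu t x)"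
  by (rule Bochner_Integration.integral_cong) (use assms in \<open>auto simp: indicator_def\<close>)
 finally show ?thesis .
qed

lemma mm_diff_bounds:
 assumes "a : Ag" "0 <= s" "s <= a" "x : S"
 shows "mut * (a - s) <= mm a x - mm s x" "mm a x - mm s x <= M * (a - s)"
proof -
 have *: "mm a x - mm s x = (LINT t|AM. ind {s<..a} t * mu t x)" by (rule mm_diff[OF assms])
 have "(LINT t|AM. ind {s<..a} t * mut) <= (LINT t|AM. ind {s<..a} t * mu t x)"
  by (intro integral_mono integrable_interval integrable_mu assms) (use mu_ge assms in \<open>auto simp: indicator_def\<close>)
 then show "mut * (a - s) <= mm a x - mm s x" unfolding * LINT_interval[OF assms(1-3)] by (simp only: mult.commute)
 have "(LINT t|AM. ind {s<..a} t * mu t x) <= (LINT t|AM. ind {s<..a} t * M)"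
  by (intro integral_mono integrable_interval integrable_mu assms) (use mu_le assms in \<open>auto simp: indicator_def\<close>)
 then show "mm a x - mm s x <= M * (a - s)" unfolding * LINT_interval[OF assms(1-3)] by (simp only: mult.commute)
qed

lemma qq_0[simp]: "qq 0 x = 1" by (simp add: qq_def mm_def)
lemma qq_pos[simp]: "0 < qq a x" "0 <= qq a x" "qq a x ~= 0" by (auto simp: qq_def)

lemma qq_ratio_le:
 assumes "a : Ag" "0 <= s" "s <= a" "x : S"
 shows "qq a x / qq s x <= exp (- (D + mut) * (a - s))"
proof -
 have "qq a x / qq s x = exp (- D * (a - s) - (mm a x - mm s x))" by (simp add: qq_def exp_diff[symmetric] algebra_simps)
 then show ?thesis using mm_diff_bounds(1)[OF assms] by (simp add: algebra_simps)
qed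

lemma qq_ratio_ge:
 assumes "a : Ag" "0 <= s" "s <= a" "x : S"
 shows "exp (- (D + M) * (a - s)) <= qq a x / qq s x"
proof -
 have "qq a x / qq s x = exp (- D * (a - s) - (mm a x - mm s x))" by (simp add: qq_def exp_diff[symmetric] algebra_simps)
 then show ?thesis using mm_diff_bounds(2)[OF assms] by (simp add: algebra_simps)
qed

lemma qq_le: "a : Ag ==> x : S ==> qq a x <= exp (- (D + mut) * a)" using qq_ratio_le[of a 0 x] by (auto simp: ages_def)
lemma qq_ge: "a : Ag ==> x : S ==> exp (- (D + M) * a) <= qq a x" using qq_ratio_ge[of a 0 x] by (auto simp: ages_def)
lemma qq_ratio_le_1: "a : Ag ==> 0 <= s ==> s <= a ==> x : S ==> qq a x / qq s x <= 1"
proof -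
 assume a: "a : Ag" "0 <= s" "s <= a" "x : S"
 have "qq a x / qq s x <= exp (- (D + mut) * (a - s))" by (rule qq_ratio_le[OF a])
 also have "... <= 1" using a D_pos mut_pos by (auto intro!: mult_nonpos_nonneg)
 finally show ?thesis .
qed

lemma mm_cont: "a : Ag ==> continuous_on S (mm a)" unfolding mm_def
proof (rule continuous_on_lebesgue_integral[where w="%s. ind {0<..a} s * \<bar>M\<bar>"])
 assume a: "a : Ag"
 show "integrable AM (%s. ind {0<..a} s * \<bar>M\<bar>)" by (rule integrable_interval[OF a]) simp
 show "(%s. ind {0<..a} s * mu s x) : BM AM" if "x : S" for x using integrable_mu[OF a _ that, of 0] by (intro borel_measurable_integrable) simp
 fix t assume t: "t : space AM"
 show "continuous_on S (%x. ind {0<..a} t * mu t x)" using mu_cont t by (intro continuous_intros) auto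
 fix x assume "x : S"
 then have "mut <= mu t x" "mu t x <= M" using mu_ge mu_le t by auto
 then show "norm (ind {0<..a} t * mu t x) <= ind {0<..a} t * \<bar>M\<bar>" using mut_pos by (auto simp: indicator_def)
qed

lemma qq_cont: "a : Ag ==> continuous_on S (qq a)" unfolding qq_def by (intro continuous_intros mm_cont)

lemma qq_AM:
 assumes "x : S" and [measurable]: "f : measurable N AM"
 shows "(%w. qq (f w) x) : BM N"
proof -
 note [measurable] = mu_AM[OF assms(1)]
 have "(%a. mm a x) : BM AM" unfolding mm_def by measurable
 then have "(%a. qq a x) : BM AM" unfolding qq_def by measurable
 from measurable_compose[OF assms(2) this] show ?thesis .
qed

lemma qq_pair:
 assumes "g : measurable N AM" "h : measurable N OM"
 shows "(%w. qq (g w) (h w)) : BM N" by (rule pair_compose[OF caratheodory_AM_OM assms])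
  (auto intro: qq_AM qq_cont continuous_on_Om simp: Om_S)

end

lemma ennreal_absorb:
 fixes x y :: ennreal
 assumes "x <= y + en ta * x" "x < \<infinity>" "0 <= ta" "ta < 1"
 shows "x <= en (1 / (1 - ta)) * y"
proof (cases y)
 case (real r)
 obtain t where t: "x = en t" "0 <= t" using assms(2) by (cases x) auto
 have "en t <= en (r + ta * t)" using assms(1,3) real t by (simp add: ennreal_plus ennreal_mult)
 then have "t <= r + ta * t" using real t assms by (subst (asm) ennreal_le_iff) auto
 then have "t <= 1 / (1 - ta) * r" using assms(4) by (simp add: field_simps)
 then show ?thesis using real t assms by (simp add: ennreal_mult[symmetric] ennreal_leI)
next
 case top
 then show ?thesis using assms(4) by (simp add: ennreal_mult_top)
qed

context age_model
begin

definition mb :: "(real => real^'n => ennreal) => bool" where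
 "mb H \<longleftrightarrow> (%p. H (fst p) (snd p)) : BM PM"

lemma mbD:
 assumes "mb H" "g : measurable N AM" "h : measurable N OM"
 shows "(%w. H (g w) (h w)) : BM N" using pair_compose[OF _ assms(2,3)] assms(1) by (auto simp: mb_def)

text \<open>With \<open>qq a x\<close> the probability to reach age \<open>a\<close> at \<open>x\<close> without dispersing or dying, \<open>Rn r e + Vn r F\<close> is
  the second component of the resolvent of \<open>B\<^sub>1\<close> at \<open>r\<close> applied to \<open>(e, F)\<close>, \<open>Sn r\<close> is its composition with \<open>D K\<close>,
  \<open>bn\<close> is the birth functional of \<open>C\<close>, and \<open>vn r 0\<close> is \<open>G\<^sub>r\<close>. Names ending in \<open>n\<close> denote operators on
  \<open>[0,\<infinity>]\<close>-valued functions, those ending in \<open>c\<close> their complex counterparts.\<close>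

definition Kn :: "(real => real^'n => ennreal) => real => real^'n => ennreal" where
 "Kn H s x = NI OM (%z. en (J (x - z)) * H s z)"
definition Vn :: "real => (real => real^'n => ennreal) => real => real^'n => ennreal" where
 "Vn r F a x = NI AM (%s. ind {..<a} s * en (exp (- r * (a - s)) * (qq a x / qq s x)) * F s x)"
definition Sn :: "real => (real => real^'n => ennreal) => real => real^'n => ennreal" where
 "Sn r H = Vn r (%s x. en D * Kn H s x)"
definition Rn :: "real => (real^'n => ennreal) => real => real^'n => ennreal" where
 "Rn r e a x = en (exp (- r * a) * qq a x) * e x"
definition bn :: "(real => real^'n => ennreal) => real^'n => ennreal" where
 "bn H x = NI AM (%a. en (beta a x) * H a x)"
definition vn :: "real => real => real^'n => ennreal" where
 "vn r s x = NI AM (%a. ind {s<..} a * en (beta a x * exp (- r * (a - s)) * (qq a x / qq s x)))"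
definition I2 :: "(real => real^'n => ennreal) => ennreal" where
 "I2 H = NI AM (%a. (NI OM (%x. H a x)))"

lemma mb_add: "mb F ==> mb G ==> mb (%a x. F a x + G a x)" by (auto simp: mb_def)
lemma mb_cmult: "mb F ==> mb (%a x. c * F a x)" by (auto simp: mb_def)

lemma Kn_AM: "mb H ==> f : measurable N AM ==> (%w. Kn H (f w) x) : BM N"
proof -
 assume H: "mb H" and f: "f : measurable N AM"
 note [measurable] = mbD[OF H]
 have "(%s. Kn H s x) : BM AM" unfolding Kn_def by measurable
 from measurable_compose[OF f this] show ?thesis .
qed

lemma mb_Kn: "mb H ==> mb (Kn H)"
proof -
 assume H: "mb H"
 note [measurable] = mbD[OF H]
 show ?thesis unfolding Kn_def mb_def by measurable
qed

lemma Vn_AM: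
 assumes "x : S" and F[measurable]: "(%s. F s x) : BM AM"
  and f: "f : measurable N AM"
 shows "(%w. Vn r F (f w) x) : BM N"
proof -
 note [measurable] = qq_AM[OF assms(1)]
 have "(%a. Vn r F a x) : BM AM" unfolding Vn_def by measurable
 from measurable_compose[OF f this] show ?thesis .
qed

lemma mb_Vn: "mb F ==> mb (Vn r F)"
proof -
 assume F: "mb F"
 note [measurable] = mbD[OF F] qq_pair
 show ?thesis unfolding Vn_def mb_def by measurable
qed

lemma mb_Sn: "mb H ==> mb (Sn r H)" unfolding Sn_def by (intro mb_Vn mb_cmult mb_Kn)
lemma Sn_AM: "x : S ==> mb H ==> f : measurable N AM ==> (%w. Sn r H (f w) x) : BM N"
 unfolding Sn_def by (intro Vn_AM borel_measurable_times_ennreal Kn_AM) auto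
lemma mb_Rn: "e : BM OM ==> mb (Rn r e)"
proof -
 assume [measurable]: "e : BM OM"
 note [measurable] = qq_pair
 show ?thesis unfolding mb_def Rn_def by measurable
qed
lemma Rn_AM:
 assumes "x : S" and [measurable]: "f : measurable N AM"
 shows "(%w. Rn r e (f w) x) : BM N"
proof -
 note [measurable] = qq_AM[OF assms(1)]
 have "(%a. Rn r e a x) : BM AM" unfolding Rn_def by measurable
 from measurable_compose[OF assms(2) this] show ?thesis .
qed
lemma bn_OM: "mb H ==> bn H : BM OM"
proof -
 assume H: "mb H"
 note [measurable] = mbD[OF H] beta_pair
 show ?thesis unfolding bn_def by measurable
qed

lemma I2_swap: "mb H ==> I2 H = NI OM (%x. (NI AM (%a. H a x)))" unfolding I2_def mb_def by (rule P.Fubini'[symmetric]) (simp add: case_prod_beta')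

lemma I2_pair: "mb H ==> I2 H = NI PM (%p. H (fst p) (snd p))" unfolding I2_def mb_def using OM.nn_integral_fst[of "%p. H (fst p) (snd p)" AM] by simp

lemma I2_add: "mb F ==> mb G ==> I2 (%a x. F a x + G a x) = I2 F + I2 G" by (subst (1 2 3) I2_pair) (auto intro: mb_add nn_integral_add simp: mb_def)
lemma I2_cmult: "mb F ==> I2 (%a x. c * F a x) = c * I2 F" by (subst (1 2) I2_pair) (auto intro: mb_cmult nn_integral_cmult simp: mb_def)
lemma I2_mono_AE: "mb F ==> mb G ==> AE p in PM. F (fst p) (snd p) <= G (fst p) (snd p) ==> I2 F <= I2 G"
 by (subst (1 2) I2_pair) (auto intro: nn_integral_mono_AE)
lemma I2_mono: "(!!a x. a : Ag ==> x : Om ==> F a x <= G a x) ==> I2 F <= I2 G" unfolding I2_def by (intro nn_integral_mono) auto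

lemma Kn_mono: "(!!z. z : Om ==> H s z <= H' s z) ==> Kn H s x <= Kn H' s x" unfolding Kn_def by (intro nn_integral_mono mult_left_mono) auto
lemma Vn_mono: "(!!s. s : Ag ==> F s x <= F' s x) ==> Vn r F a x <= Vn r F' a x" unfolding Vn_def by (intro nn_integral_mono mult_left_mono) auto
lemma Sn_mono: "(!!s z. s : Ag ==> z : Om ==> H s z <= H' s z) ==> Sn r H a x <= Sn r H' a x"
 unfolding Sn_def by (intro Vn_mono mult_left_mono Kn_mono) auto
lemma Sn_mono_AE:
 assumes "AE p in PM. H (fst p) (snd p) <= H' (fst p) (snd p)"
 shows "Sn r H a x <= Sn r H' a x"
proof -
 have "AE s in AM. AE z in OM. H s z <= H' s z" using P.AE_pair[OF assms] by simp
 then have "AE s in AM. Kn H s x <= Kn H' s x"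
  unfolding Kn_def by eventually_elim (auto intro!: nn_integral_mono_AE mult_left_mono elim: eventually_mono)
 then show ?thesis unfolding Sn_def Vn_def by (auto intro!: nn_integral_mono_AE mult_left_mono elim: eventually_mono)
qed
lemma bn_mono: "(!!a. a : Ag ==> H a x <= H' a x) ==> bn H x <= bn H' x" unfolding bn_def by (intro nn_integral_mono mult_left_mono) auto

lemma section_meas: "mb H ==> s : Ag ==> H s : BM OM" using mbD[of H "%_. s" OM "%x. x"] by simp
lemma section_meas2: "mb H ==> x : Om ==> (%a. H a x) : BM AM" using mbD[of H "%a. a" AM "%_. x"] by simp

lemma Vn_add:
 assumes "x : S" and [measurable]: "(%s. F s x) : BM AM" "(%s. G s x) : BM AM"
 shows "Vn r (%s x. F s x + G s x) a x = Vn r F a x + Vn r G a x"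
proof -
 note [measurable] = qq_AM[OF assms(1)]
 show ?thesis unfolding Vn_def by (subst nn_integral_add[symmetric]) (auto simp: distrib_left)
qed

lemma Vn_cmult:
 assumes "x : S" and [measurable]: "(%s. F s x) : BM AM"
 shows "Vn r (%s x. c * F s x) a x = c * Vn r F a x"
proof -
 note [measurable] = qq_AM[OF assms(1)]
 show ?thesis unfolding Vn_def by (subst nn_integral_cmult[symmetric]) (auto simp: mult_ac)
qed

lemma Sn_cong: "(!!s z. s : Ag ==> z : Om ==> H s z = H' s z) ==> Sn r H a x = Sn r H' a x" by (intro antisym Sn_mono) auto

lemma Kn_add: "mb H ==> mb H' ==> s : Ag ==> Kn (%a x. H a x + H' a x) s x = Kn H s x + Kn H' s x"
proof -
 assume s: "mb H" "mb H'" "s : Ag"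
 have [measurable]: "H s : BM OM" "H' s : BM OM" using s section_meas by auto
 show ?thesis unfolding Kn_def by (subst nn_integral_add[symmetric]) (auto simp: distrib_left)
qed

lemma Kn_cmult: "mb H ==> s : Ag ==> Kn (%a x. c * H a x) s x = c * Kn H s x"
proof -
 assume s: "mb H" "s : Ag"
 have [measurable]: "H s : BM OM" using s section_meas by auto
 show ?thesis unfolding Kn_def by (subst nn_integral_cmult[symmetric]) (auto simp: mult_ac)
qed

lemma Vn_cong: "(!!s. s : Ag ==> F s x = F' s x) ==> Vn r F a x = Vn r F' a x" by (intro antisym Vn_mono) auto

lemma Sn_add:
 assumes "mb H" "mb H'" "x : S"
 shows "Sn r (%a x. H a x + H' a x) a x = Sn r H a x + Sn r H' a x"
proof -
 have "Sn r (%a x. H a x + H' a x) a x = Vn r (%s x. en D * Kn H s x + en D * Kn H' s x) a x"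
  unfolding Sn_def by (rule Vn_cong) (simp add: Kn_add assms distrib_left)
 also have "... = Sn r H a x + Sn r H' a x" unfolding Sn_def using assms by (intro Vn_add borel_measurable_times_ennreal Kn_AM) auto
 finally show ?thesis .
qed

lemma Sn_cmult:
 assumes "mb H" "x : S"
 shows "Sn r (%a x. c * H a x) a x = c * Sn r H a x"
proof -
 have "Sn r (%a x. c * H a x) a x = Vn r (%s x. c * (en D * Kn H s x)) a x" unfolding Sn_def by (rule Vn_cong) (simp add: Kn_cmult assms mult_ac)
 also have "... = c * Sn r H a x" unfolding Sn_def using assms by (intro Vn_cmult borel_measurable_times_ennreal Kn_AM) auto
 finally show ?thesis .
qed

lemma bn_add:
 assumes "x : S" and [measurable]: "(%a. F a x) : BM AM" "(%a. G a x) : BM AM"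
 shows "bn (%a x. F a x + G a x) x = bn F x + bn G x"
proof -
 note [measurable] = beta_AM[OF assms(1)]
 show ?thesis unfolding bn_def by (subst nn_integral_add[symmetric]) (auto simp: distrib_left)
qed

lemma bn_cmult:
 assumes "x : S" and [measurable]: "(%a. F a x) : BM AM"
 shows "bn (%a x. c x * F a x) x = c x * bn F x"
proof -
 note [measurable] = beta_AM[OF assms(1)]
 show ?thesis unfolding bn_def by (subst nn_integral_cmult[symmetric]) (auto simp: mult_ac)
qed

lemma bn_le: "bn H x <= en B * NI AM (%a. H a x)" if "x : S" and [measurable]: "(%a. H a x) : BM AM"
 unfolding bn_def by (subst nn_integral_cmult[symmetric]) (use that beta_le in \<open>auto intro!: nn_integral_mono mult_right_mono ennreal_leI\<close>)

definition okr :: "real => bool" where "okr ka \<longleftrightarrow> ka > 0 | ahat ~= \<infinity>"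

lemma exp_integral:
 assumes "0 < ka"
 shows "NI AM (%a. ind {s<..} a * en (exp (- ka * (a - s)))) <= en (1 / ka)"
proof -
 have "(NI AM (%a. ind {s<..} a * en (exp (- ka * (a - s)))))
   <= NI lborel (%a. ind {s<..} a * en (exp (- ka * (a - s))))" by (rule nn_integral_AM_le_lborel)
 also have "... <= NI lborel (%a. en (exp (- ka * (a - s))) * ind {s..} a)" by (intro nn_integral_mono) (auto simp: indicator_def)
 also have "... = en (0 - (- exp (- ka * (s - s)) / ka))"
 proof (rule nn_integral_FTC_atLeast[where F="%a. - exp (- ka * (a - s)) / ka"])
  show "((%a. - exp (- ka * (a - s)) / ka) \<longlongrightarrow> 0) at_top" using assms by real_asymp
 qed (use assms in \<open>auto intro!: derivative_eq_intros\<close>)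
 finally show ?thesis by simp
qed

lemma emeasure_AM_finite: "ahat ~= \<infinity> ==> emeasure AM (Ag) < \<infinity>"
proof -
 assume "ahat ~= \<infinity>"
 then obtain b where b: "ahat = ereal b" using ahat_pos by (cases ahat) auto
 have "emeasure AM (Ag) = emeasure lebesgue (Ag)" unfolding AM_def using ages_sets by (subst emeasure_restrict_space) auto
 also have "... <= emeasure lebesgue {0..b}" by (intro emeasure_mono) (auto simp: ages_def b)
 also have "... < \<infinity>" by (simp add: emeasure_lborel_Icc_eq)
 finally show ?thesis .
qed

lemma exp_integral_bdd:
 assumes "okr ka"
 shows "EX C>0. ALL s>=0. (NI AM (%a. ind {s<..} a * en (exp (- ka * (a - s))))) <= en C"
proof (cases "ka > 0")
 case True
 then show ?thesis using exp_integral by (intro exI[of _ "1/ka"]) auto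
next
 case False
 then have fin: "ahat ~= \<infinity>" using assms by (auto simp: okr_def)
 then obtain b where b: "ahat = ereal b" "b > 0" using ahat_pos by (cases ahat) auto
 obtain m where m: "emeasure AM (Ag) = en m" "0 <= m" using emeasure_AM_finite[OF fin] by (cases "emeasure AM (Ag)") auto
 have "NI AM (%a. ind {s<..} a * en (exp (- ka * (a - s)))) <= en (exp (- ka * b) * (m + 1))" if "0 <= s" for s
 proof -
  have "NI AM (%a. ind {s<..} a * en (exp (- ka * (a - s)))) <= NI AM (%a. en (exp (- ka * b)))"
  proof (rule nn_integral_mono)
   fix a assume "a : space AM"
   then have "ereal a < ahat" by (simp add: ages_def)
   then have "a < b" using b(1) by simp
   then have "- ka * (a - s) <= - ka * b" using False that by (intro mult_left_mono) auto
   then show "ind {s<..} a * en (exp (- ka * (a - s))) <= en (exp (- ka * b))" by (auto simp: indicator_def intro!: ennreal_leI)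
  qed
  also have "... = en (exp (- ka * b) * m)" by (simp add: m ennreal_mult)
  also have "... <= en (exp (- ka * b) * (m + 1))" by (intro ennreal_leI mult_left_mono) auto
  finally show ?thesis .
 qed
 then show ?thesis using m by (intro exI[of _ "exp (- ka * b) * (m + 1)"]) auto
qed

lemma Vn_weighted:
 assumes x: "x : S" and F[measurable]: "(%s. F s x) : BM AM"
  and C: "!!s. s : Ag ==> (NI AM (%a. ind {s<..} a * en (exp (- (c + r + D + mut) * (a - s))))) <= en C"
 shows "NI AM (%a. en (exp (- c * a)) * Vn r F a x) <= en C * NI AM (%s. en (exp (- c * s)) * F s x)"
proof -
 note [measurable] = qq_AM[OF x]
 have "(NI AM (%a. en (exp (- c * a)) * Vn r F a x))
   = NI AM (%a. NI AM (%s. en (exp (- c * a)) * (ind {..<a} s * en (exp (- r * (a - s)) * (qq a x / qq s x)) * F s x)))"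
  unfolding Vn_def by (intro nn_integral_cong nn_integral_cmult[symmetric]) measurable
 also have "... = NI AM (%s. NI AM (%a. en (exp (- c * a)) * (ind {..<a} s * en (exp (- r * (a - s)) * (qq a x / qq s x)) * F s x)))"
  by (rule AA.Fubini') measurable
 also have "... <= NI AM (%s. NI AM (%a. (ind {s<..} a * en (exp (- (c + r + D + mut) * (a - s)))) * (en (exp (- c * s)) * F s x)))"
 proof (intro nn_integral_mono)
  fix s a assume "s : space AM" "a : space AM"
  then have sa: "a : Ag" "0 <= s" by (auto simp: ages_def)
  show "en (exp (- c * a)) * (ind {..<a} s * en (exp (- r * (a - s)) * (qq a x / qq s x)) * F s x)
    <= (ind {s<..} a * en (exp (- (c + r + D + mut) * (a - s)))) * (en (exp (- c * s)) * F s x)"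
  proof (cases "s < a")
   case True
   have "exp (- c * a) * (exp (- r * (a - s)) * (qq a x / qq s x)) <= exp (- c * a) * (exp (- r * (a - s)) * exp (- (D + mut) * (a - s)))"
    using qq_ratio_le[OF sa(1,2) _ x] True by (intro mult_left_mono) auto
   also have "... = exp (- (c + r + D + mut) * (a - s)) * exp (- c * s)" by (simp add: exp_add[symmetric] algebra_simps)
   finally have "en (exp (- c * a)) * en (exp (- r * (a - s)) * (qq a x / qq s x)) <= en (exp (- (c + r + D + mut) * (a - s))) * en (exp (- c * s))"
    by (simp add: ennreal_mult[symmetric] ennreal_leI)
   then have "en (exp (- c * a)) * en (exp (- r * (a - s)) * (qq a x / qq s x)) * F s x <= en (exp (- (c + r + D + mut) * (a - s))) * en (exp (- c * s)) * F s x"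
    by (rule mult_right_mono) simp
   then show ?thesis using True by (simp add: mult.assoc)
  qed simp
 qed
 also have "... = NI AM (%s. (NI AM (%a. ind {s<..} a * en (exp (- (c + r + D + mut) * (a - s))))) * (en (exp (- c * s)) * F s x))"
  by (intro nn_integral_cong nn_integral_multc) measurable
 also have "... <= NI AM (%s. en C * (en (exp (- c * s)) * F s x))" by (intro nn_integral_mono mult_right_mono C) auto
 also have "... = en C * NI AM (%s. en (exp (- c * s)) * F s x)" by (rule nn_integral_cmult) measurable
 finally show ?thesis .
qed

lemma I2_Vn:
 assumes "okr (r + D + mut)"
 shows "EX C>0. ALL F. mb F --> I2 (Vn r F) <= en C * I2 F"
proof -
 obtain C where C: "C > 0" "!!s. s >= 0 ==> (NI AM (%a. ind {s<..} a * en (exp (- (r + D + mut) * (a - s))))) <= en C"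
  using exp_integral_bdd[OF assms] by blast
 have "I2 (Vn r F) <= en C * I2 F" if F: "mb F" for F
 proof -
  have m: "(%x. NI AM (%s. F s x)) : BM OM"
  proof -
   note [measurable] = mbD[OF F]
   show ?thesis by measurable
  qed
  have "I2 (Vn r F) = NI OM (%x. (NI AM (%a. Vn r F a x)))" by (rule I2_swap[OF mb_Vn[OF F]])
  also have "... <= NI OM (%x. en C * NI AM (%s. F s x))"
  proof (rule nn_integral_mono)
   fix x assume "x : space OM"
   then have x: "x : Om" by simp
   show "NI AM (%a. Vn r F a x) <= en C * NI AM (%s. F s x)"
    using Vn_weighted[of x F 0 r C, OF Om_S[OF x] section_meas2[OF F x]] C(2) by (auto simp: ages_def)
  qed
  also have "... = en C * I2 F" unfolding I2_swap[OF F] by (rule nn_integral_cmult[OF m])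
  finally show ?thesis .
 qed
 then show ?thesis using C(1) by blast
qed

lemma Kn_le:
 assumes "mb H" "s : Ag" shows "Kn H s x <= en JB * NI OM (%z. H s z)"
proof -
 have [measurable]: "H s : BM OM" using assms section_meas by auto
 show ?thesis unfolding Kn_def by (subst nn_integral_cmult[symmetric]) (auto intro!: nn_integral_mono mult_right_mono ennreal_leI J_le)
qed

lemma Sn_le_I2:
 assumes "mb H" "x : S" "a : Ag"
 shows "Sn r H a x <= en (D * JB * exp (\<bar>r\<bar> * a)) * I2 H"
proof -
 have m: "(%s. NI OM (%z. H s z)) : BM AM"
 proof -
  note [measurable] = mbD[OF assms(1)]
  show ?thesis by measurable
 qed
 have "Sn r H a x <= NI AM (%s. en (D * JB * exp (\<bar>r\<bar> * a)) * NI OM (%z. H s z))" unfolding Sn_def Vn_def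
 proof (rule nn_integral_mono)
  fix s assume "s : space AM"
  then have s: "s : Ag" "0 <= s" by (auto simp: ages_def)
  show "ind {..<a} s * en (exp (- r * (a - s)) * (qq a x / qq s x)) * (en D * Kn H s x)
    <= en (D * JB * exp (\<bar>r\<bar> * a)) * NI OM (%z. H s z)"
  proof (cases "s < a")
   case True
   have "- r * (a - s) <= \<bar>r\<bar> * (a - s)" using True by (intro mult_right_mono) auto
   also have "... <= \<bar>r\<bar> * a" using s by (intro mult_left_mono) auto
   finally have "exp (- r * (a - s)) * (qq a x / qq s x) <= exp (\<bar>r\<bar> * a) * 1"
    using qq_ratio_le_1[OF assms(3) s(2) _ assms(2)] True by (intro mult_mono) auto
   then have "en (exp (- r * (a - s)) * (qq a x / qq s x)) * (en D * Kn H s x)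
    <= en (exp (\<bar>r\<bar> * a)) * (en D * (en JB * NI OM (%z. H s z)))" by (intro mult_mono ennreal_leI Kn_le[OF assms(1) s(1)]) auto
   also have "... = en (D * JB * exp (\<bar>r\<bar> * a)) * NI OM (%z. H s z)" using D_pos JB_pos by (simp add: ennreal_mult mult_ac)
   finally show ?thesis using True by simp
  qed simp
 qed
 also have "... = en (D * JB * exp (\<bar>r\<bar> * a)) * I2 H" unfolding I2_def by (rule nn_integral_cmult[OF m])
 finally show ?thesis .
qed

lemma bn_Vn:
 assumes x: "x : S" and F[measurable]: "(%s. F s x) : BM AM"
 shows "bn (Vn r F) x = NI AM (%s. vn r s x * F s x)"
proof -
 note [measurable] = qq_AM[OF x] beta_AM[OF x]
 have "bn (Vn r F) x = NI AM (%a. NI AM (%s. en (beta a x) * (ind {..<a} s * en (exp (- r * (a - s)) * (qq a x / qq s x)) * F s x)))"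
  unfolding Vn_def bn_def by (intro nn_integral_cong nn_integral_cmult[symmetric]) measurable
 also have "... = NI AM (%s. NI AM (%a. en (beta a x) * (ind {..<a} s * en (exp (- r * (a - s)) * (qq a x / qq s x)) * F s x)))"
  by (rule AA.Fubini') measurable
 also have "... = NI AM (%s. NI AM (%a. (ind {s<..} a * en (beta a x * exp (- r * (a - s)) * (qq a x / qq s x))) * F s x))"
  by (intro nn_integral_cong) (use beta_nonneg x in \<open>auto simp: indicator_def ennreal_mult' mult.assoc simp del: times_divide_eq_right times_divide_eq_left split: if_splits\<close>)
 also have "... = NI AM (%s. vn r s x * F s x)" unfolding vn_def by (intro nn_integral_cong nn_integral_multc) measurable
 finally show ?thesis .
qed

lemma vn_bdd:
 assumes "okr (r + D + mut)"
 shows "EX C>0. ALL s>=0. ALL x:S. vn r s x <= en C"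
proof -
 obtain C where C: "C > 0" "!!s. s >= 0 ==> (NI AM (%a. ind {s<..} a * en (exp (- (r + D + mut) * (a - s))))) <= en C"
  using exp_integral_bdd[OF assms] by blast
 have "vn r s x <= en (B * C + 1)" if s: "0 <= s" and x: "x : S" for s x
 proof -
  have "vn r s x <= NI AM (%a. en B * (ind {s<..} a * en (exp (- (r + D + mut) * (a - s)))))" unfolding vn_def
  proof (rule nn_integral_mono)
   fix a assume a: "a : space AM"
   show "ind {s<..} a * en (beta a x * exp (- r * (a - s)) * (qq a x / qq s x))
    <= en B * (ind {s<..} a * en (exp (- (r + D + mut) * (a - s))))"
   proof (cases "s < a")
    case True
    have "beta a x * exp (- r * (a - s)) * (qq a x / qq s x) <= B * exp (- r * (a - s)) * exp (- (D + mut) * (a - s))"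
     using a x s True beta_le beta_nonneg B_nonneg qq_ratio_le[of a s x] by (intro mult_mono) auto
    also have "... = B * exp (- (r + D + mut) * (a - s))" by (simp add: exp_add[symmetric] algebra_simps)
    finally show ?thesis using True B_nonneg by (simp add: ennreal_mult[symmetric] ennreal_leI)
   qed simp
  qed
  also have "... = en B * NI AM (%a. ind {s<..} a * en (exp (- (r + D + mut) * (a - s))))" by (rule nn_integral_cmult) measurable
  also have "... <= en B * en C" by (intro mult_left_mono C s) auto
  also have "... <= en (B * C + 1)" using B_nonneg C by (subst ennreal_mult[symmetric]) (auto intro!: ennreal_leI)
  finally show ?thesis .
 qed
 then show ?thesis using B_nonneg C by (intro exI[of _ "B * C + 1"]) (auto intro!: add_nonneg_pos)
qed

lemma bn_Sn_le:
 assumes "okr (r + D + mut)"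
 shows "EX C>0. ALL H. mb H --> (ALL x:S. bn (Sn r H) x <= en C * I2 H)"
proof -
 obtain C where C: "C > 0" "!!s x. s >= 0 ==> x : S ==> vn r s x <= en C" using vn_bdd[OF assms] by blast
 have "bn (Sn r H) x <= en (C * (D * JB)) * I2 H" if H: "mb H" and x: "x : S" for H x
 proof -
  have m: "(%s. NI OM (%z. H s z)) : BM AM"
  proof -
   note [measurable] = mbD[OF H]
   show ?thesis by measurable
  qed
  have "bn (Sn r H) x = NI AM (%s. vn r s x * (en D * Kn H s x))"
   unfolding Sn_def using H x by (intro bn_Vn borel_measurable_times_ennreal Kn_AM) auto
  also have "... <= NI AM (%s. en (C * (D * JB)) * NI OM (%z. H s z))"
  proof (rule nn_integral_mono)
   fix s assume "s : space AM"
   then have s: "s : Ag" "0 <= s" by (auto simp: ages_def)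
   have "vn r s x * (en D * Kn H s x) <= en C * (en D * (en JB * NI OM (%z. H s z)))" by (intro mult_mono C Kn_le H s x) auto
   also have "... = en (C * (D * JB)) * NI OM (%z. H s z)" using D_pos JB_pos C by (simp add: ennreal_mult mult_ac)
   finally show "vn r s x * (en D * Kn H s x) <= en (C * (D * JB)) * NI OM (%z. H s z)" .
  qed
  also have "... = en (C * (D * JB)) * I2 H" unfolding I2_def by (rule nn_integral_cmult[OF m])
  finally show ?thesis .
 qed
 then show ?thesis using C D_pos JB_pos by (intro exI[of _ "C * (D * JB)"]) auto
qed

lemma I2_Sn:
 assumes "okr (r + D + mut)"
 shows "EX C>0. ALL H. mb H --> I2 (Sn r H) <= en C * I2 H"
proof -
 obtain C where C: "C > 0" "!!F. mb F ==> I2 (Vn r F) <= en C * I2 F" using I2_Vn[OF assms] by blast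
 define m where "m = measure OM Om"
 have "I2 (Sn r H) <= en (C * (D * JB * (m + 1))) * I2 H" if H: "mb H" for H
 proof -
  have mm: "(%s. NI OM (%z. H s z)) : BM AM"
  proof -
   note [measurable] = mbD[OF H]
   show ?thesis by measurable
  qed
  have "I2 (%s x. en D * Kn H s x) <= NI AM (%s. en (D * JB * (m + 1)) * NI OM (%z. H s z))" unfolding I2_def
  proof (rule nn_integral_mono)
   fix s assume "s : space AM"
   then have s: "s : Ag" by simp
   have "NI OM (%x. en D * Kn H s x) <= NI OM (%x. en D * (en JB * NI OM (%z. H s z)))" by (intro nn_integral_mono mult_left_mono Kn_le H s) auto
   also have "... = en (D * JB * m) * NI OM (%z. H s z)" using D_pos JB_pos by (simp add: m_def OM.emeasure_eq_measure ennreal_mult mult_ac)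
   also have "... <= en (D * JB * (m + 1)) * NI OM (%z. H s z)" using D_pos JB_pos by (intro mult_right_mono ennreal_leI mult_left_mono) auto
   finally show "NI OM (%x. en D * Kn H s x) <= en (D * JB * (m + 1)) * NI OM (%z. H s z)" .
  qed
  also have "... = en (D * JB * (m + 1)) * I2 H" unfolding I2_def by (rule nn_integral_cmult[OF mm])
  finally have 1: "I2 (%s x. en D * Kn H s x) <= en (D * JB * (m + 1)) * I2 H" .
  have "I2 (Sn r H) <= en C * I2 (%s x. en D * Kn H s x)" unfolding Sn_def by (intro C mb_cmult mb_Kn H)
  also have "... <= en C * (en (D * JB * (m + 1)) * I2 H)" by (intro mult_left_mono 1) auto
  also have "... = en (C * (D * JB * (m + 1))) * I2 H" using C D_pos JB_pos by (simp add: m_def ennreal_mult mult_ac)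
  finally show ?thesis .
 qed
 then show ?thesis using C D_pos JB_pos by (intro exI[of _ "C * (D * JB * (m + 1))"]) (auto simp: m_def intro!: mult_pos_pos add_nonneg_pos)
qed

lemma I2_Rn:
 assumes "okr (r + D + mut)"
 shows "EX C>0. ALL e:BM OM. I2 (Rn r e) <= en C * NI OM (%x. e x)"
proof -
 obtain C where C: "C > 0" "!!s. s >= 0 ==> (NI AM (%a. ind {s<..} a * en (exp (- (r + D + mut) * (a - s))))) <= en C"
  using exp_integral_bdd[OF assms] by blast
 have "I2 (Rn r e) <= en C * NI OM (%x. e x)" if e[measurable]: "e : BM OM" for e
 proof -
  have "I2 (Rn r e) <= NI AM (%a. ind {0<..} a * en (exp (- (r + D + mut) * (a - 0))) * NI OM (%x. e x))" unfolding I2_def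
  proof (rule nn_integral_mono)
   fix a assume a: "a : space AM"
   have "NI OM (%x. Rn r e a x) <= NI OM (%x. en (exp (- (r + D + mut) * a)) * e x)"
   proof (rule nn_integral_mono)
    fix x assume x: "x : space OM"
    have "exp (- r * a) * qq a x <= exp (- r * a) * exp (- (D + mut) * a)" using a x qq_le Om_S by (intro mult_left_mono) auto
    also have "... = exp (- (r + D + mut) * a)" by (simp add: exp_add[symmetric] algebra_simps)
    finally show "Rn r e a x <= en (exp (- (r + D + mut) * a)) * e x" unfolding Rn_def by (intro mult_right_mono ennreal_leI) auto
   qed
   also have "... = en (exp (- (r + D + mut) * a)) * NI OM (%x. e x)" by (rule nn_integral_cmult) measurable
   finally show "NI OM (%x. Rn r e a x) <= ind {0<..} a * en (exp (- (r + D + mut) * (a - 0))) * NI OM (%x. e x)" using a by (simp add: ages_def)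
  qed
  also have "... = NI AM (%a. ind {0<..} a * en (exp (- (r + D + mut) * (a - 0)))) * NI OM (%x. e x)" by (rule nn_integral_multc) measurable
  also have "... <= en C * NI OM (%x. e x)" by (intro mult_right_mono C) auto
  finally show ?thesis .
 qed
 then show ?thesis using C by blast
qed

lemma I2_Sn_finite: "okr (r + D + mut) ==> mb H ==> I2 H < \<infinity> ==> I2 (Sn r H) < \<infinity>"
proof -
 assume a: "okr (r + D + mut)" "mb H" "I2 H < \<infinity>"
 obtain C where "I2 (Sn r H) <= en C * I2 H" using I2_Sn[OF a(1)] a(2) by blast
 also have "... < \<infinity>" using a(3) by (simp add: ennreal_mult_less_top)
 finally show ?thesis .
qed

lemma I2_Rn_finite: "okr (r + D + mut) ==> e : BM OM ==> (NI OM (%x. e x)) < \<infinity> ==> I2 (Rn r e) < \<infinity>"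
proof -
 assume a: "okr (r + D + mut)" "e : BM OM" "NI OM (%x. e x) < \<infinity>"
 obtain C where "I2 (Rn r e) <= en C * NI OM (%x. e x)" using I2_Rn[OF a(1)] a(2) by blast
 also have "... < \<infinity>" using a(3) by (simp add: ennreal_mult_less_top)
 finally show ?thesis .
qed

end

context age_model
begin

lemma AE_pair_swap:
 assumes "AE p in PM. Q (fst p) (snd p)"
 shows "AE x in OM. AE a in AM. Q a x"
proof -
 obtain N where N: "N : null_sets PM" "{p : space PM. ~ Q (fst p) (snd p)} <= N" using assms by (auto simp: eventually_ae_filter)
 have N'[measurable]: "N : sets PM" using N(1) by auto
 have "AE p in PM. (fst p, snd p) \<notin> N" using AE_not_in[OF N(1)] by simp
 from P.AE_pair[OF this] have "AE a in AM. AE x in OM. (a, x) \<notin> N" by simp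
 moreover have "{p : space PM. (fst p, snd p) \<notin> N} : sets PM" by measurable
 ultimately have "AE x in OM. AE a in AM. (a, x) \<notin> N" using P.AE_commute[of "%a x. (a, x) \<notin> N"] by simp
 with AE_space show ?thesis
 proof eventually_elim
  case (elim x)
  from elim(2) AE_space show ?case
  proof eventually_elim
   case (elim a)
   then show ?case using N(2) \<open>x : space OM\<close> by (auto simp: space_pair_measure)
  qed
 qed
qed

lemma vn_meas:
 assumes "x : S" shows "(%s. vn r s x) : BM AM"
proof -
 note [measurable] = qq_AM[OF assms] beta_AM[OF assms]
 show ?thesis unfolding vn_def by measurable
qed

definition vr :: "real => real => real^'n => real" where "vr r s x = enn2real (vn r s x)"

lemma vr_nonneg[simp]: "0 <= vr r s x" by (simp add: vr_def)

lemma vn_eq_vr: "okr (r + D + mut) ==> 0 <= s ==> x : S ==> vn r s x = en (vr r s x)"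
 unfolding vr_def using vn_bdd[of r] by (metis ennreal_enn2real ennreal_less_top order_le_less_trans)

lemma vr_bdd: "okr (r + D + mut) ==> EX C>0. ALL s>=0. ALL x:S. vr r s x <= C"
proof -
 assume "okr (r + D + mut)"
 then obtain C where C: "C > 0" "!!s x. s >= 0 ==> x : S ==> vn r s x <= en C" using vn_bdd by blast
 have "vr r s x <= C" if "s >= 0" "x : S" for s x unfolding vr_def using C that by (intro enn2real_leI) auto
 then show ?thesis using C by blast
qed

lemma exp_integrable:
 assumes "okr ka" "0 <= s"
 shows "integrable AM (%a. ind {s<..} a * exp (- ka * (a - s)))"
proof (rule integrableI_nonneg)
 obtain C where C: "NI AM (%a. ind {s<..} a * en (exp (- ka * (a - s)))) <= en C" using exp_integral_bdd[OF assms(1)] assms(2) by blast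
 have "NI AM (%a. en (ind {s<..} a * exp (- ka * (a - s)))) = NI AM (%a. ind {s<..} a * en (exp (- ka * (a - s))))"
  by (intro nn_integral_cong) (auto simp: indicator_def)
 also have "... < \<infinity>" using C by (rule order_le_less_trans) simp
 finally show "NI AM (%a. en (ind {s<..} a * exp (- ka * (a - s)))) < \<infinity>" .
qed auto

lemma vr_cont:
 assumes ok: "okr (r + D + mut)" and s: "0 <= s" "s = 0 | s : Ag"
 shows "continuous_on S (vr r s)"
proof -
 define F where "F x a = ind {s<..} a * (beta a x * exp (- r * (a - s)) * (qq a x / qq s x))" for x a
 have F_nonneg: "0 <= F x a" if "x : S" "a : Ag" for x a using that beta_nonneg by (auto simp: F_def indicator_def)
 have F_meas: "F x : BM AM" if "x : S" for x
 proof -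
  note [measurable] = qq_AM[OF that] beta_AM[OF that]
  show ?thesis unfolding F_def by measurable
 qed
 have eq: "vr r s x = integral\<^sup>L AM (F x)" if x: "x : S" for x
 proof -
  have "vn r s x = NI AM (%a. en (F x a))" unfolding vn_def F_def by (intro nn_integral_cong) (auto simp: indicator_def)
  then show ?thesis unfolding vr_def by (subst integral_eq_nn_integral) (use F_meas x F_nonneg in \<open>auto intro!: AE_I2\<close>)
 qed
 have "continuous_on S (%x. integral\<^sup>L AM (F x))"
 proof (rule continuous_on_lebesgue_integral[where w="%a. B * (ind {s<..} a * exp (- (r + D + mut) * (a - s)))"])
  show "integrable AM (%a. B * (ind {s<..} a * exp (- (r + D + mut) * (a - s))))" using exp_integrable[OF ok s(1)] by (rule integrable_mult_right)
  show "F x : BM AM" if "x : S" for x by (rule F_meas[OF that])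
  fix a assume "a : space AM"
  then have a: "a : Ag" by simp
  have "continuous_on S (qq s)" using s(2) qq_cont by (auto simp: continuous_on_cong[OF refl qq_0])
  then show "continuous_on S (%x. F x a)" unfolding F_def using beta_cont[OF a] qq_cont[OF a] by (intro continuous_intros) auto
  fix x assume x: "x : S"
  show "norm (F x a) <= B * (ind {s<..} a * exp (- (r + D + mut) * (a - s)))"
  proof (cases "s < a")
   case True
   have "beta a x * exp (- r * (a - s)) * (qq a x / qq s x) <= B * exp (- r * (a - s)) * exp (- (D + mut) * (a - s))"
    using a x s True beta_le beta_nonneg B_nonneg qq_ratio_le[of a s x] by (intro mult_mono) auto
   also have "... = B * exp (- (r + D + mut) * (a - s))" by (simp add: exp_add[symmetric] algebra_simps)
   finally show ?thesis using True F_nonneg[OF x a] by (simp add: F_def)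
  qed (simp add: F_def)
 qed
 then show ?thesis by (subst continuous_on_cong[OF refl eq]) auto
qed

lemma vr_meas: "x : S ==> (%s. vr r s x) : BM AM" unfolding vr_def using vn_meas by (intro measurable_compose[OF _ borel_measurable_enn2real]) auto

lemma bn_Rn: "x : S ==> bn (Rn r e) x = vn r 0 x * e x"
proof -
 assume x: "x : S"
 note [measurable] = qq_AM[OF x] beta_AM[OF x]
 have "bn (Rn r e) x = NI AM (%a. (ind {0<..} a * en (beta a x * exp (- r * (a - 0)) * (qq a x / qq 0 x))) * e x)"
  unfolding bn_def Rn_def using beta_nonneg x by (intro nn_integral_cong) (auto simp: ages_def ennreal_mult' mult.assoc)
 also have "... = vn r 0 x * e x" unfolding vn_def by (rule nn_integral_multc) measurable
 finally show ?thesis .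
qed

text \<open>\<open>kern r x\<close> is the kernel of the smoothing operator \<open>bn \<circ> Sn r\<close>, which maps \<open>L\<^sup>1\<close> to \<open>C(S)\<close>.\<close>

definition kern :: "real => real^'n => real \<times> (real^'n) => real" where
 "kern r x p = D * (vr r (fst p) x * J (x - snd p))"

lemma kern_meas: "x : S ==> kern r x : BM PM"
proof -
 assume x: "x : S"
 note [measurable] = vr_meas[OF x]
 show ?thesis unfolding kern_def by measurable
qed

lemma kern_nonneg: "0 <= kern r x p" using D_pos J_nonneg by (simp add: kern_def)

lemma kern_bdd: "okr (r + D + mut) ==> EX C>0. ALL x:S. ALL p:space PM. kern r x p <= C"
proof -
 assume "okr (r + D + mut)"
 then obtain C where C: "C > 0" "!!s x. s >= 0 ==> x : S ==> vr r s x <= C" using vr_bdd by blast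
 have "kern r x p <= D * (C * JB)" if "x : S" "p : space PM" for x p unfolding kern_def using that C J_le J_nonneg D_pos JB_pos
  by (intro mult_left_mono mult_mono) (auto simp: space_pair_measure ages_def)
 then show ?thesis using C D_pos JB_pos by (intro exI[of _ "D * (C * JB)"]) auto
qed

lemma bn_Sn_kern:
 assumes ok: "okr (r + D + mut)" and H: "mb H" and x: "x : S"
 shows "bn (Sn r H) x = NI PM (%p. en (kern r x p) * H (fst p) (snd p))"
proof -
 note [measurable] = mbD[OF H] kern_meas[OF x]
 have "bn (Sn r H) x = NI AM (%s. vn r s x * (en D * Kn H s x))" unfolding Sn_def using H x by (intro bn_Vn borel_measurable_times_ennreal Kn_AM) auto
 also have "... = NI AM (%s. NI OM (%z. en (kern r x (s, z)) * H s z))"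
 proof (rule nn_integral_cong)
  fix s assume s: "s : space AM"
  have [measurable]: "H s : BM OM" using section_meas[OF H] s by simp
  have "vn r s x * (en D * Kn H s x) = NI OM (%z. (vn r s x * en D) * (en (J (x - z)) * H s z))"
   unfolding Kn_def by (subst nn_integral_cmult) (auto simp: mult.assoc)
  also have "... = NI OM (%z. en (kern r x (s, z)) * H s z)" using s D_pos J_nonneg vn_eq_vr[OF ok _ x, of s]
   by (intro nn_integral_cong) (simp add: kern_def ennreal_mult mult_ac ages_def)
  finally show "vn r s x * (en D * Kn H s x) = NI OM (%z. en (kern r x (s, z)) * H s z)" .
 qed
 also have "... = NI PM (%p. en (kern r x p) * H (fst p) (snd p))" by (subst OM.nn_integral_fst[symmetric]) auto
 finally show ?thesis .
qed

lemma I2_finite_AE: "mb H ==> I2 H < \<infinity> ==> AE p in PM. H (fst p) (snd p) ~= \<infinity>"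
 unfolding I2_pair by (intro nn_integral_PInf_AE) (auto simp: mb_def)

lemma integrable_enn2real:
 assumes "mb H" "I2 H < \<infinity>"
 shows "integrable PM (%p. enn2real (H (fst p) (snd p)))"
proof (rule integrableI_nonneg)
 note [measurable] = mbD[OF assms(1)]
 show "(%p. enn2real (H (fst p) (snd p))) : BM PM" by measurable
 have "NI PM (%p. en (enn2real (H (fst p) (snd p)))) <= I2 H"
  unfolding I2_pair[OF assms(1)] by (intro nn_integral_mono) (simp add: ennreal_enn2real_if)
 then show "NI PM (%p. en (enn2real (H (fst p) (snd p)))) < \<infinity>" using assms(2) by (rule order_le_less_trans)
qed auto

lemma bn_Sn_real:
 assumes ok: "okr (r + D + mut)" and H: "mb H" "I2 H < \<infinity>" and x: "x : S"
 shows "bn (Sn r H) x = en (LINT p|PM. kern r x p * enn2real (H (fst p) (snd p)))"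
  and "integrable PM (%p. kern r x p * enn2real (H (fst p) (snd p)))"
proof -
 note [measurable] = mbD[OF H(1)] kern_meas[OF x]
 obtain C where C: "!!p. p : space PM ==> kern r x p <= C" using kern_bdd[OF ok] x by blast
 show int: "integrable PM (%p. kern r x p * enn2real (H (fst p) (snd p)))"
  by (rule Bochner_Integration.integrable_bound[OF integrable_mult_right[OF integrable_enn2real[OF H], of "\<bar>C\<bar>"]])
   (use kern_nonneg C in \<open>auto intro!: AE_I2 mult_right_mono simp: abs_mult intro: order_trans[OF _ abs_ge_self]\<close>)
 have "bn (Sn r H) x = NI PM (%p. en (kern r x p * enn2real (H (fst p) (snd p))))" unfolding bn_Sn_kern[OF ok H(1) x]
  by (rule nn_integral_cong_AE) (use I2_finite_AE[OF H] kern_nonneg in \<open>auto simp: ennreal_mult less_top elim!: eventually_mono\<close>)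
 also have "... = en (LINT p|PM. kern r x p * enn2real (H (fst p) (snd p)))" by (rule nn_integral_eq_integral[OF int]) (use kern_nonneg in auto)
 finally show "bn (Sn r H) x = en (LINT p|PM. kern r x p * enn2real (H (fst p) (snd p)))" .
qed

lemma kern_cont:
 assumes "okr (r + D + mut)" "p : space PM"
 shows "continuous_on S (%x. kern r x p)"
proof -
 have "continuous_on S (vr r (fst p))" using assms by (intro vr_cont) (auto simp: space_pair_measure ages_def)
 moreover have "continuous_on S (%x. J (x - snd p))" by (rule continuous_on_compose2[OF J_cont]) (auto intro: continuous_intros)
 ultimately show ?thesis unfolding kern_def by (intro continuous_intros)
qed

lemma bn_Sn_equicont:
 assumes ok: "okr (r + D + mut)" and H0: "mb H0" "I2 H0 < \<infinity>" and x: "x : S" and e: "0 < e"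
 shows "EX d>0. ALL H. mb H --> (ALL a:Ag. ALL z:Om. H a z <= H0 a z) -->
  (ALL y:S. norm (x - y) < d --> \<bar>enn2real (bn (Sn r H) x) - enn2real (bn (Sn r H) y)\<bar> < e)"
proof -
 define Ph where "Ph y = (LINT p|PM. \<bar>kern r x p - kern r y p\<bar> * enn2real (H0 (fst p) (snd p)))" for y
 obtain C where C: "C > 0" "!!x p. x : S ==> p : space PM ==> kern r x p <= C" using kern_bdd[OF ok] by blast
 note [measurable] = mbD[OF H0(1)]
 have diff: "\<bar>kern r x p - kern r y p\<bar> <= C" if "y : S" "p : space PM" for y p
  using C(2)[OF x that(2)] C(2)[OF that] kern_nonneg[of r x p] kern_nonneg[of r y p] by (auto simp: abs_le_iff)
 have int0: "integrable PM (%p. C * enn2real (H0 (fst p) (snd p)))" by (rule integrable_mult_right[OF integrable_enn2real[OF H0]])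
 have meas: "(%p. \<bar>kern r x p - kern r y p\<bar> * enn2real (H0 (fst p) (snd p))) : BM PM" if "y : S" for y
 proof -
  note [measurable] = kern_meas[OF that] kern_meas[OF x]
  show ?thesis by measurable
 qed
 have "continuous_on S Ph" unfolding Ph_def
 proof (rule continuous_on_lebesgue_integral[OF meas int0])
  show "norm (\<bar>kern r x p - kern r y p\<bar> * enn2real (H0 (fst p) (snd p))) <= C * enn2real (H0 (fst p) (snd p))"
   if "y : S" "p : space PM" for y p using diff[OF that] by (simp add: abs_mult mult_right_mono)
  show "continuous_on S (%y. \<bar>kern r x p - kern r y p\<bar> * enn2real (H0 (fst p) (snd p)))" if "p : space PM" for p
   by (intro continuous_intros kern_cont[OF ok that])
 qed auto
 moreover have "Ph x = 0" by (simp add: Ph_def)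
 ultimately obtain d where d: "d > 0" "!!y. y : S ==> dist y x < d ==> \<bar>Ph y\<bar> < e"
  using x e by (fastforce simp: continuous_on_iff dist_real_def)
 have "\<bar>enn2real (bn (Sn r H) x) - enn2real (bn (Sn r H) y)\<bar> < e"
  if H: "mb H" and le: "ALL a:Ag. ALL z:Om. H a z <= H0 a z" and y: "y : S" "norm (x - y) < d" for H y
 proof -
  have HH: "I2 H < \<infinity>" using I2_mono[of H H0] le H0(2) by (auto intro: order_le_less_trans)
  note [measurable] = mbD[OF H] kern_meas[OF x] kern_meas[OF y(1)]
  let ?L = "%x. LINT p|PM. kern r x p * enn2real (H (fst p) (snd p))"
  have intx: "integrable PM (%p. kern r x p * enn2real (H (fst p) (snd p)))"
   and inty: "integrable PM (%p. kern r y p * enn2real (H (fst p) (snd p)))" using bn_Sn_real(2)[OF ok H HH] x y by auto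
  have eq: "enn2real (bn (Sn r H) y) = ?L y" if "y : S" for y
   unfolding bn_Sn_real(1)[OF ok H HH that] by (intro enn2real_ennreal integral_nonneg_AE) (auto simp: kern_nonneg)
  have "\<bar>?L x - ?L y\<bar> = \<bar>LINT p|PM. (kern r x p * enn2real (H (fst p) (snd p)) - kern r y p * enn2real (H (fst p) (snd p)))\<bar>"
   using intx inty by (subst Bochner_Integration.integral_diff) auto
  also have "... <= (LINT p|PM. \<bar>kern r x p * enn2real (H (fst p) (snd p)) - kern r y p * enn2real (H (fst p) (snd p))\<bar>)"
   by (rule integral_abs_bound)
  also have "... <= Ph y" unfolding Ph_def
  proof (rule integral_mono_AE)
   show "integrable PM (%p. \<bar>kern r x p * enn2real (H (fst p) (snd p)) - kern r y p * enn2real (H (fst p) (snd p))\<bar>)"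
    using intx inty by auto
   show "integrable PM (%p. \<bar>kern r x p - kern r y p\<bar> * enn2real (H0 (fst p) (snd p)))"
    by (rule Bochner_Integration.integrable_bound[OF int0 meas[OF y(1)]])
     (use diff[OF y(1)] C(1) in \<open>auto intro!: AE_I2 mult_right_mono simp: abs_mult\<close>)
   show "AE p in PM. \<bar>kern r x p * enn2real (H (fst p) (snd p)) - kern r y p * enn2real (H (fst p) (snd p))\<bar>
     <= \<bar>kern r x p - kern r y p\<bar> * enn2real (H0 (fst p) (snd p))" using I2_finite_AE[OF H0] AE_space
   proof eventually_elim
    case (elim p)
    have "enn2real (H (fst p) (snd p)) <= enn2real (H0 (fst p) (snd p))"
     using le elim by (intro enn2real_mono) (auto simp: space_pair_measure less_top)
    then have "\<bar>kern r x p - kern r y p\<bar> * enn2real (H (fst p) (snd p)) <= \<bar>kern r x p - kern r y p\<bar> * enn2real (H0 (fst p) (snd p))"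
     by (intro mult_left_mono) auto
    then show ?case by (simp add: abs_mult left_diff_distrib[symmetric])
   qed
  qed
  also have "... < e" using d(2)[OF y(1)] y(2) by (auto simp: dist_norm norm_minus_commute)
  finally show ?thesis by (simp add: eq x y)
 qed
 then show ?thesis using d(1) by blast
qed

lemma bn_Sn_finite: "okr (r + D + mut) ==> mb H ==> I2 H < \<infinity> ==> x : S ==> bn (Sn r H) x < \<infinity>" using bn_Sn_real(1) by simp

lemma bn_Sn_cont:
 assumes ok: "okr (r + D + mut)" and H: "mb H" "I2 H < \<infinity>"
 shows "continuous_on S (%x. enn2real (bn (Sn r H) x))" unfolding continuous_on_iff
proof (intro ballI allI impI)
 fix x e assume "x : S" "(0::real) < e"
 from bn_Sn_equicont[OF ok H this] H(1)
 obtain d where "d > 0" "!!y. y : S ==> norm (x - y) < d ==> \<bar>enn2real (bn (Sn r H) x) - enn2real (bn (Sn r H) y)\<bar> < e" by blast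
 then show "EX d>0. ALL x':S. dist x' x < d --> dist (enn2real (bn (Sn r H) x')) (enn2real (bn (Sn r H) x)) < e"
  by (intro exI[of _ d]) (auto simp: dist_norm norm_minus_commute abs_minus_commute)
qed

end

locale age_model_w = age_model Om ahat D mut B M JB j0 d0 J beta mu b0
 for Om :: "(real^'n) set" and ahat D mut B M JB j0 d0 J beta mu b0 +
 fixes phis :: "real^'n => real" and kk :: real
 assumes phis_cont: "continuous_on (closure Om) phis" and phis_pos: "!!x. x : closure Om ==> 0 < phis x"
  and kk_pos: "0 < kk"
  and phis_eq: "!!z. z : Om ==> (NI (lebesgue_on Om) (%x. en (phis x * J (x - z)))) = en (kk * phis z)"
begin

definition good :: "real => bool" where "good r \<longleftrightarrow> (ahat = \<infinity> --> - D - mut + D * kk < r)"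

lemma good_okr: "good r ==> okr (r + D + mut)"
proof -
 assume *: "good r"
 have "0 < D * kk" using D_pos kk_pos by simp
 then have "0 < r + D + mut" if "ahat = \<infinity>" using * that unfolding good_def by linarith
 then show ?thesis by (auto simp: okr_def)
qed

lemma good_mono: "good r ==> r <= r' ==> good r'" by (auto simp: good_def)

lemma phis_meas[measurable]: "phis : BM OM" by (rule cont_OM[OF phis_cont])

lemma phis_Kn:
 assumes H: "mb H" and s: "s : Ag"
 shows "NI OM (%x. en (phis x) * Kn H s x) = NI OM (%z. en (kk * phis z) * H s z)"
proof -
 have [measurable]: "H s : BM OM" using section_meas[OF H s] .
 have "NI OM (%x. en (phis x) * Kn H s x) = NI OM (%x. NI OM (%z. en (phis x) * (en (J (x - z)) * H s z)))"
  unfolding Kn_def by (intro nn_integral_cong nn_integral_cmult[symmetric]) measurable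
 also have "... = NI OM (%z. NI OM (%x. en (phis x) * (en (J (x - z)) * H s z)))" by (rule OO.Fubini') measurable
 also have "... = NI OM (%z. NI OM (%x. en (phis x * J (x - z)) * H s z))"
  using phis_pos J_nonneg by (intro nn_integral_cong) (auto simp: ennreal_mult' mult.assoc Om_S less_imp_le)
 also have "... = NI OM (%z. (NI OM (%x. en (phis x * J (x - z)))) * H s z)" by (intro nn_integral_cong nn_integral_multc) measurable
 also have "... = NI OM (%z. en (kk * phis z) * H s z)" by (intro nn_integral_cong) (simp add: phis_eq[folded OM_def])
 finally show ?thesis .
qed

lemma Volterra_bound:
 assumes "good r"
 shows "EX C>0. ALL H g. mb H --> mb g --> I2 H < \<infinity> -->
  (AE p in PM. H (fst p) (snd p) <= g (fst p) (snd p) + Sn r H (fst p) (snd p)) --> I2 H <= en C * I2 g"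
proof -
 define c where "c = (if ahat = \<infinity> then 0 else max 0 (D * kk - (r + D + mut) + 1))"
 define ka where "ka = c + r + D + mut"
 have Dk: "0 < D * kk" using D_pos kk_pos by simp
 have c: "0 <= c" "D * kk < ka" "ahat = \<infinity> --> c = 0" using assms by (auto simp: c_def ka_def good_def)
 have ka: "0 < ka" using c Dk by linarith
 define ta where "ta = D * kk / ka"
 have ta: "0 <= ta" "ta < 1" using c ka Dk by (auto simp: ta_def)
 define k where "k a x = en (exp (- c * a)) * en (phis x)" for a x
 define W where "W H = I2 (%a x. k a x * H a x)" for H
 have mbk: "mb (%a x. k a x * H a x)" if "mb H" for H using that unfolding mb_def k_def by measurable
 have W_Sn: "W (Sn r H) <= en ta * W H" if H: "mb H" for H
 proof -
  have "W (Sn r H) = NI OM (%x. (NI AM (%a. k a x * Sn r H a x)))" unfolding W_def by (rule I2_swap[OF mbk[OF mb_Sn[OF H]]])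
  also have "... <= NI OM (%x. (NI AM (%s. en (D / ka) * (k s x * Kn H s x))))"
  proof (rule nn_integral_mono)
   fix x assume "x : space OM"
   then have x: "x : S" by (auto simp: Om_S)
   have [measurable]: "(%s. Kn H s x) : BM AM" "(%a. Sn r H a x) : BM AM" using Kn_AM[OF H, of "%s. s"] Sn_AM[OF x H, of "%s. s"] by simp_all
   have "NI AM (%a. k a x * Sn r H a x) = en (phis x) * NI AM (%a. en (exp (- c * a)) * Sn r H a x)"
    unfolding k_def by (subst nn_integral_cmult[symmetric]) (auto simp: mult_ac)
   also have "... <= en (phis x) * (en (1 / ka) * NI AM (%s. en (exp (- c * s)) * (en D * Kn H s x)))"
    unfolding Sn_def by (intro mult_left_mono Vn_weighted[where F="%s x. en D * Kn H s x", OF x]) (use exp_integral[OF ka] in \<open>auto simp: ka_def\<close>)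
   also have "... = NI AM (%s. en (phis x) * en (1 / ka) * (en (exp (- c * s)) * (en D * Kn H s x)))"
    by (subst nn_integral_cmult) (auto simp: mult.assoc)
   also have "... = NI AM (%s. en (D / ka) * (k s x * Kn H s x))" using ka D_pos ennreal_mult[of D "1/ka"] by (simp add: k_def mult_ac)
   finally show "NI AM (%a. k a x * Sn r H a x) <= ..." .
  qed
  also have "... = I2 (%s x. en (D / ka) * (k s x * Kn H s x))" by (rule I2_swap[symmetric]) (intro mb_cmult mbk mb_Kn H)
  also have "... = en (D / ka) * I2 (%s x. k s x * Kn H s x)" by (rule I2_cmult[OF mbk[OF mb_Kn[OF H]]])
  also have "I2 (%s x. k s x * Kn H s x) = en kk * W H" unfolding W_def I2_cmult[OF mbk[OF H], symmetric] unfolding I2_def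
  proof (rule nn_integral_cong)
   fix s assume "s : space AM"
   then have s: "s : Ag" by simp
   note [measurable] = section_meas[OF H s] section_meas[OF mb_Kn[OF H] s]
   have "NI OM (%x. k s x * Kn H s x) = en (exp (- c * s)) * NI OM (%x. en (phis x) * Kn H s x)"
    unfolding k_def by (subst nn_integral_cmult[symmetric]) (auto simp: mult_ac)
   also have "... = NI OM (%z. en (exp (- c * s)) * (en (kk * phis z) * H s z))"
    unfolding phis_Kn[OF H s] by (rule nn_integral_cmult[symmetric]) measurable
   also have "... = NI OM (%x. en kk * (k s x * H s x))" using kk_pos by (intro nn_integral_cong) (simp add: k_def ennreal_mult' mult_ac)
   finally show "NI OM (%x. k s x * Kn H s x) = ..." .
  qed
  also have "en (D / ka) * (en kk * W H) = en ta * W H" using D_pos ka kk_pos ennreal_mult[of "D/ka" kk] by (simp add: ta_def mult.assoc[symmetric])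
  finally show ?thesis .
 qed
 obtain e0 where e0: "0 < e0" "!!a. a : Ag ==> e0 <= exp (- c * a)"
 proof (cases "ahat = \<infinity>")
  case True
  then show ?thesis using c that[of 1] by auto
 next
  case False
  then obtain b where b: "ahat = ereal b" using ahat_pos by (cases ahat) auto
  have "exp (- c * b) <= exp (- c * a)" if "ereal a < ereal b" for a using that c by (auto intro: mult_left_mono)
  then show ?thesis using that[of "exp (- c * b)"] b by (auto simp: ages_def)
 qed
 have Sne: "S ~= {}" using Om_ne by auto
 obtain x0 where x0: "x0 : S" "!!x. x : S ==> phis x0 <= phis x" using continuous_attains_inf[OF S_compact Sne phis_cont] by blast
 obtain x1 where x1: "x1 : S" "!!x. x : S ==> phis x <= phis x1" using continuous_attains_sup[OF S_compact Sne phis_cont] by blast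
 define p0 where "p0 = e0 * phis x0"
 have p0: "0 < p0" using e0 phis_pos[OF x0(1)] by (simp add: p0_def)
 have lower: "en p0 * I2 H <= W H" if H: "mb H" for H
  unfolding W_def I2_cmult[OF H, symmetric] k_def p0_def ennreal_mult[OF less_imp_le[OF e0(1)] less_imp_le[OF phis_pos[OF x0(1)]]]
  by (intro I2_mono mult_right_mono mult_mono ennreal_leI e0 x0 Om_S) auto
 have upper: "W H <= en (phis x1) * I2 H" if H: "mb H" for H
 proof -
  have "k a x <= 1 * en (phis x1)" if "a : Ag" "x : Om" for a x
   unfolding k_def using that c x1(2)[OF Om_S] by (intro mult_mono ennreal_leI) (auto simp: ages_def)
  then show ?thesis unfolding W_def I2_cmult[OF H, symmetric] by (intro I2_mono mult_right_mono) auto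
 qed
 define K where "K = 1 / (1 - ta) * phis x1"
 have K: "0 < K" using ta phis_pos[OF x1(1)] by (simp add: K_def)
 have "I2 H <= en (1 / p0 * K) * I2 g" if H: "mb H" and g: "mb g" and fin: "I2 H < \<infinity>"
  and le: "AE p in PM. H (fst p) (snd p) <= g (fst p) (snd p) + Sn r H (fst p) (snd p)" for H g
 proof -
  have "W H <= W (%a x. g a x + Sn r H a x)"
   unfolding W_def by (rule I2_mono_AE[OF mbk[OF H] mbk[OF mb_add[OF g mb_Sn[OF H]]]]) (use le in \<open>auto intro!: mult_left_mono elim!: eventually_mono\<close>)
  also have "... = W g + W (Sn r H)" unfolding W_def distrib_left by (rule I2_add[OF mbk[OF g] mbk[OF mb_Sn[OF H]]])
  also have "... <= W g + en ta * W H" by (intro add_left_mono W_Sn[OF H])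
  finally have 1: "W H <= W g + en ta * W H" .
  have 2: "W H < \<infinity>" using upper[OF H] fin by (auto intro: order_le_less_trans simp: ennreal_mult_less_top)
  have "en p0 * I2 H <= en (1 / (1 - ta)) * W g" using lower[OF H] ennreal_absorb[OF 1 2 ta] by (rule order_trans)
  also have "... <= en (1 / (1 - ta)) * (en (phis x1) * I2 g)" by (intro mult_left_mono upper g) auto
  finally have 3: "en p0 * I2 H <= en K * I2 g" unfolding K_def using ta phis_pos[OF x1(1)] by (subst ennreal_mult) (auto simp: mult.assoc)
  have "I2 H = en (1 / p0) * (en p0 * I2 H)" using p0 ennreal_mult[of "1/p0" p0] by (simp add: mult.assoc[symmetric])
  also have "... <= en (1 / p0) * (en K * I2 g)" by (intro mult_left_mono 3) auto
  also have "... = en (1 / p0 * K) * I2 g" using p0 K by (subst ennreal_mult) (auto simp: mult.assoc)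
  finally show ?thesis .
 qed
 then show ?thesis using p0 K by (intro exI[of _ "1 / p0 * K"]) auto
qed

end

section \<open>The renewal operator\<close>

lemma ennreal_suminf_head: "(\<Sum>n. f n) = f 0 + (\<Sum>n. f (Suc n))" for f :: "nat => ennreal"
proof (rule LIMSEQ_unique)
 show "(%n. sum f {..<Suc n}) \<longlonglongrightarrow> (\<Sum>n. f n)" by (rule LIMSEQ_Suc[OF summable_LIMSEQ[OF summableI]])
 show "(%n. sum f {..<Suc n}) \<longlonglongrightarrow> f 0 + (\<Sum>n. f (Suc n))"
  unfolding sum.lessThan_Suc_shift by (intro tendsto_add tendsto_const summable_LIMSEQ summableI)
qed

lemma ennreal_add_eq_left_zero:
 fixes x y z :: ennreal
 assumes "x + y = z" "z <= x" "z < \<infinity>"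
 shows "y = 0"
proof -
 have "x + y <= x + 0" using assms by simp
 then have "x = \<infinity> | y <= 0" unfolding ennreal_add_left_cancel_le by simp
 then show ?thesis using assms by auto
qed

lemma kernel_integral_zero:
 fixes Om :: "'a::euclidean_space set"
 assumes Om: "open Om" and J: "continuous_on UNIV J" "!!x. norm x < d0 ==> j0 <= J x" "0 < (j0::real)"
  and w: "continuous_on (closure Om) w" "!!x. x : closure Om ==> 0 <= w x"
  and 0: "NI (lebesgue_on Om) (%z. en (J (x - z)) * en (w z)) = 0"
  and y: "y : closure Om" "dist x y < d0"
 shows "w y = 0"
proof (rule ccontr)
 assume "w y ~= 0"
 then have "0 < w y" using w(2)[OF y(1)] by simp
 then obtain d where d: "d > 0" "!!z. z : closure Om ==> dist z y < d ==> dist (w z) (w y) < w y" using w(1) y(1) unfolding continuous_on_iff by blast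
 define U where "U = Om \<inter> ball y d \<inter> ball x d0"
 have [measurable]: "w : BM (lebesgue_on Om)" by (intro continuous_imp_measurable_on_sets_lebesgue continuous_on_subset[OF w(1) closure_subset])
   (use Om in \<open>auto simp: borel_open\<close>)
 have "continuous_on Om (%z. J (x - z))" by (rule continuous_on_compose2[OF J(1)]) (auto intro: continuous_intros)
 then have [measurable]: "(%z. J (x - z)) : BM (lebesgue_on Om)"
  by (intro continuous_imp_measurable_on_sets_lebesgue) (use Om in \<open>auto simp: borel_open\<close>)
 have "AE z in lebesgue_on Om. en (J (x - z)) * en (w z) = 0" using 0 by (subst (asm) nn_integral_0_iff_AE) auto
 then have "AE z in lebesgue_on Om. z \<notin> U" using AE_space
 proof eventually_elim
  case (elim z)
  show ?case
  proof
   assume z: "z : U"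
   then have "j0 <= J (x - z)" by (intro J) (auto simp: U_def dist_norm)
   moreover have "0 < w z" using d(2)[of z] z closure_subset[of Om] by (auto simp: U_def dist_real_def dist_commute)
   ultimately show False using elim(1) J(3) by (auto simp: ennreal_eq_0_iff)
  qed
 qed
 then have "AE z in lebesgue. z : Om --> z \<notin> U" by (subst (asm) AE_restrict_space_iff) (use Om in \<open>auto simp: borel_open\<close>)
 then have "AE z in lebesgue. z \<notin> U" by (auto simp: U_def elim: eventually_mono)
 moreover have "open U" unfolding U_def using Om by auto
 moreover have "U ~= {}"
 proof -
  have "open (ball y d \<inter> ball x d0)" "y : ball y d \<inter> ball x d0" using d y by auto
  then have "Om \<inter> (ball y d \<inter> ball x d0) ~= {}"
   using y(1) by (metis (no_types, lifting) closure_iff_nhds_not_empty disjoint_iff inf_commute subset_refl)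
  then show ?thesis by (auto simp: U_def)
 qed
 ultimately show False using AE_iff_null_sets[of U lebesgue] open_not_negligible[of U] by (auto simp: negligible_iff_null_sets borel_open)
qed

context age_model
begin

lemma mb_suminf: "(!!n. mb (H n)) ==> mb (%a x. \<Sum>n. H n a x)" unfolding mb_def by measurable

lemma Kn_suminf:
 assumes H: "!!n. mb (H n)" and s: "s : Ag"
 shows "Kn (%a x. \<Sum>n. H n a x) s x = (\<Sum>n. Kn (H n) s x)"
proof -
 have [measurable]: "H n s : BM OM" for n using section_meas[OF H s] .
 show ?thesis unfolding Kn_def by (subst nn_integral_suminf[symmetric]) (auto simp: ennreal_suminf_cmult)
qed

lemma Sn_suminf:
 assumes H: "!!n. mb (H n)" and x: "x : S"
 shows "Sn r (%a x. \<Sum>n. H n a x) a x = (\<Sum>n. Sn r (H n) a x)"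
proof -
 note [measurable] = qq_AM[OF x]
 have [measurable]: "(%s. Kn (H n) s x) : BM AM" for n using Kn_AM[OF H, of "%s. s"] by simp
 have "Sn r (%a x. \<Sum>n. H n a x) a x = NI AM (%s. (\<Sum>n. ind {..<a} s * en (exp (- r * (a - s)) * (qq a x / qq s x)) * (en D * Kn (H n) s x)))"
  unfolding Sn_def Vn_def by (intro nn_integral_cong) (simp add: Kn_suminf[OF H] ennreal_suminf_cmult)
 also have "... = (\<Sum>n. Sn r (H n) a x)" unfolding Sn_def Vn_def by (rule nn_integral_suminf) measurable
 finally show ?thesis .
qed

definition hn :: "real => (real^'n => ennreal) => real => real^'n => ennreal" where
 "hn r e a x = (\<Sum>n. (Sn r ^^ n) (Rn r e) a x)"

lemma mb_iter: "e : BM OM ==> mb ((Sn r ^^ n) (Rn r e))" by (induction n) (auto intro: mb_Rn mb_Sn)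

lemma mb_hn: "e : BM OM ==> mb (hn r e)" unfolding hn_def using mb_suminf[OF mb_iter] by simp

lemma hn_eq:
 assumes e: "e : BM OM" and x: "x : S"
 shows "hn r e a x = Rn r e a x + Sn r (hn r e) a x"
proof -
 have "hn r e a x = (Sn r ^^ 0) (Rn r e) a x + (\<Sum>n. (Sn r ^^ Suc n) (Rn r e) a x)" unfolding hn_def by (rule ennreal_suminf_head)
 also have "(\<Sum>n. (Sn r ^^ Suc n) (Rn r e) a x) = Sn r (hn r e) a x"
  using Sn_suminf[OF mb_iter[OF e] x, where r=r and a=a] by (simp add: hn_def[abs_def])
 finally show ?thesis by simp
qed

lemma iter_mono:
 assumes "!!x. x : S ==> e x <= e' x" "x : S"
 shows "(Sn r ^^ n) (Rn r e) a x <= (Sn r ^^ n) (Rn r e') a x" using assms(2)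
proof (induction n arbitrary: a x)
 case 0
 then show ?case using assms(1) by (auto simp: Rn_def intro!: mult_left_mono)
next
 case (Suc n)
 then show ?case by (auto intro!: Sn_mono simp: Om_S)
qed

lemma hn_mono: "(!!x. x : S ==> e x <= e' x) ==> x : S ==> hn r e a x <= hn r e' a x" unfolding hn_def by (intro suminf_le iter_mono summableI) auto

lemma iter_add:
 assumes e: "e : BM OM" "e' : BM OM" and x: "x : S"
 shows "(Sn r ^^ n) (Rn r (%x. e x + e' x)) a x = (Sn r ^^ n) (Rn r e) a x + (Sn r ^^ n) (Rn r e') a x" using x
proof (induction n arbitrary: a x)
 case 0
 then show ?case by (simp add: Rn_def distrib_left)
next
 case (Suc n)
 have "(Sn r ^^ Suc n) (Rn r (%x. e x + e' x)) a x = Sn r (%a x. (Sn r ^^ n) (Rn r e) a x + (Sn r ^^ n) (Rn r e') a x) a x"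
  by simp (rule Sn_cong, rule Suc.IH, rule Om_S)
 also have "... = (Sn r ^^ Suc n) (Rn r e) a x + (Sn r ^^ Suc n) (Rn r e') a x" using Suc.prems by (simp add: Sn_add mb_iter e)
 finally show ?case .
qed

lemma hn_add:
 assumes "e : BM OM" "e' : BM OM" "x : S"
 shows "hn r (%x. e x + e' x) a x = hn r e a x + hn r e' a x" unfolding hn_def by (simp only: iter_add[OF assms] suminf_add[OF summableI summableI])

lemma iter_cmult:
 assumes e: "e : BM OM" and x: "x : S"
 shows "(Sn r ^^ n) (Rn r (%x. c * e x)) a x = c * (Sn r ^^ n) (Rn r e) a x" using x
proof (induction n arbitrary: a x)
 case 0
 then show ?case by (simp add: Rn_def mult_ac)
next
 case (Suc n)
 have "(Sn r ^^ Suc n) (Rn r (%x. c * e x)) a x = Sn r (%a x. c * (Sn r ^^ n) (Rn r e) a x) a x" by simp (rule Sn_cong, rule Suc.IH, rule Om_S)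
 also have "... = c * (Sn r ^^ Suc n) (Rn r e) a x" using Suc.prems by (simp add: Sn_cmult mb_iter e)
 finally show ?case .
qed

lemma hn_cmult:
 assumes "e : BM OM" "x : S"
 shows "hn r (%x. c * e x) a x = c * hn r e a x" unfolding hn_def by (simp only: iter_cmult[OF assms] ennreal_suminf_cmult)

lemma Sn_shift:
 assumes H: "mb H" and x: "x : S"
 shows "Sn (r + dl) (%a x. en (exp (- dl * a)) * H a x) a x = en (exp (- dl * a)) * Sn r H a x"
proof -
 note [measurable] = qq_AM[OF x]
 have [measurable]: "(%s. Kn H s x) : BM AM" using Kn_AM[OF H, of "%s. s"] by simp
 have "Sn (r + dl) (%a x. en (exp (- dl * a)) * H a x) a x =
  NI AM (%s. en (exp (- dl * a)) * (ind {..<a} s * en (exp (- r * (a - s)) * (qq a x / qq s x)) * (en D * Kn H s x)))" unfolding Sn_def Vn_def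
 proof (rule nn_integral_cong)
  fix s assume s: "s : space AM"
  have [measurable]: "H s : BM OM" using section_meas[OF H] s by simp
  have K: "Kn (%a x. en (exp (- dl * a)) * H a x) s x = en (exp (- dl * s)) * Kn H s x"
   unfolding Kn_def by (subst nn_integral_cmult[symmetric]) (auto simp: mult_ac)
  have "exp (- (r + dl) * (a - s)) * (qq a x / qq s x) * exp (- dl * s) = exp (- dl * a) * (exp (- r * (a - s)) * (qq a x / qq s x))"
   by (simp add: exp_add[symmetric] algebra_simps)
  then have E: "en (exp (- (r + dl) * (a - s)) * (qq a x / qq s x)) * en (exp (- dl * s)) = en (exp (- dl * a)) * en (exp (- r * (a - s)) * (qq a x / qq s x))"
   by (simp add: ennreal_mult[symmetric])
  have "ind {..<a} s * en (exp (- (r + dl) * (a - s)) * (qq a x / qq s x)) * (en D * (en (exp (- dl * s)) * Kn H s x))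
   = ind {..<a} s * (en (exp (- (r + dl) * (a - s)) * (qq a x / qq s x)) * en (exp (- dl * s))) * (en D * Kn H s x)" by (simp only: mult_ac)
  also have "... = en (exp (- dl * a)) * (ind {..<a} s * en (exp (- r * (a - s)) * (qq a x / qq s x)) * (en D * Kn H s x))"
   unfolding E by (simp only: mult_ac)
  finally show "ind {..<a} s * en (exp (- (r + dl) * (a - s)) * (qq a x / qq s x)) * (en D * Kn (%a x. en (exp (- dl * a)) * H a x) s x)
   = en (exp (- dl * a)) * (ind {..<a} s * en (exp (- r * (a - s)) * (qq a x / qq s x)) * (en D * Kn H s x))" unfolding K .
 qed
 also have "... = en (exp (- dl * a)) * Sn r H a x" unfolding Sn_def Vn_def by (rule nn_integral_cmult) measurable
 finally show ?thesis .
qed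

lemma Rn_shift: "Rn (r + dl) e a x = en (exp (- dl * a)) * Rn r e a x"
proof -
 have "exp (- (r + dl) * a) * qq a x = exp (- dl * a) * (exp (- r * a) * qq a x)" by (simp add: exp_add[symmetric] algebra_simps)
 then show ?thesis unfolding Rn_def by (simp add: ennreal_mult mult.assoc)
qed

lemma iter_shift:
 assumes e: "e : BM OM" and x: "x : S"
 shows "(Sn (r + dl) ^^ n) (Rn (r + dl) e) a x = en (exp (- dl * a)) * (Sn r ^^ n) (Rn r e) a x" using x
proof (induction n arbitrary: a x)
 case 0
 then show ?case by (simp add: Rn_shift)
next
 case (Suc n)
 have "(Sn (r + dl) ^^ Suc n) (Rn (r + dl) e) a x = Sn (r + dl) (%a x. en (exp (- dl * a)) * (Sn r ^^ n) (Rn r e) a x) a x"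
  unfolding funpow.simps o_apply by (rule Sn_cong, rule Suc.IH, rule Om_S)
 also have "... = en (exp (- dl * a)) * (Sn r ^^ Suc n) (Rn r e) a x" using Sn_shift[OF mb_iter[OF e] Suc.prems] by simp
 finally show ?case .
qed

lemma hn_shift:
 assumes "e : BM OM" "x : S"
 shows "hn (r + dl) e a x = en (exp (- dl * a)) * hn r e a x" unfolding hn_def by (simp only: iter_shift[OF assms] ennreal_suminf_cmult)

lemma Sn_hn_shift:
 assumes e: "e : BM OM" and x: "x : S"
 shows "Sn (r + dl) (hn (r + dl) e) a x = en (exp (- dl * a)) * Sn r (hn r e) a x"
proof -
 have "Sn (r + dl) (hn (r + dl) e) a x = Sn (r + dl) (%a x. en (exp (- dl * a)) * hn r e a x) a x" by (rule Sn_cong, rule hn_shift[OF e], rule Om_S)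
 also have "... = en (exp (- dl * a)) * Sn r (hn r e) a x" by (rule Sn_shift[OF mb_hn[OF e] x])
 finally show ?thesis .
qed

definition Nn :: "real => (real^'n => ennreal) => real^'n => ennreal" where
 "Nn r e x = bn (Sn r (hn r e)) x"

lemma bn_hn:
 assumes e: "e : BM OM" and x: "x : S"
 shows "bn (hn r e) x = vn r 0 x * e x + Nn r e x"
proof -
 have "bn (hn r e) x = bn (%a x. Rn r e a x + Sn r (hn r e) a x) x" unfolding bn_def by (intro nn_integral_cong) (simp add: hn_eq[OF e x])
 also have "... = bn (Rn r e) x + bn (Sn r (hn r e)) x" using Rn_AM[OF x, of "%a. a"] Sn_AM[OF x mb_hn[OF e], of "%a. a"] by (intro bn_add[OF x]) auto
 finally show ?thesis by (simp add: bn_Rn[OF x] Nn_def)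
qed

lemma exp_lip:
 assumes "0 < ep" "ep <= t" "t <= t'" "0 <= (a::real)"
 shows "exp (- t * a) <= exp (- t' * a) + (t' - t) / ep"
proof -
 have "1 - exp (- (t' - t) * a) <= (t' - t) * a" using exp_ge_add_one_self[of "- (t' - t) * a"] by (simp add: algebra_simps)
 then have "exp (- t * a) * (1 - exp (- (t' - t) * a)) <= exp (- t * a) * ((t' - t) * a)" by (rule mult_left_mono) simp
 moreover have "exp (- t * a) * (1 - exp (- (t' - t) * a)) = exp (- t * a) - exp (- t' * a)"
  by (simp add: right_diff_distrib exp_add[symmetric] algebra_simps)
 moreover have "exp (- t * a) * ((t' - t) * a) <= (t' - t) / ep"
 proof -
  have "ep * a <= exp (ep * a)" using exp_ge_add_one_self[of "ep * a"] by linarith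
  also have "... <= exp (t * a)" using assms by (simp add: mult_right_mono)
  finally have "exp (- t * a) * (ep * a) <= exp (- t * a) * exp (t * a)" by (rule mult_left_mono) simp
  then have "exp (- t * a) * a <= 1 / ep" using assms by (simp add: exp_add[symmetric] field_simps)
  then have "(t' - t) * (exp (- t * a) * a) <= (t' - t) * (1 / ep)" using assms by (intro mult_left_mono) auto
  then show ?thesis by (simp add: mult_ac)
 qed
 ultimately show ?thesis by linarith
qed

lemma bn_exp_lip:
 assumes "0 < ep" "ep <= t" "t <= t'" and x: "x : S" and Y[measurable]: "(%a. Y a x) : BM AM"
 shows "bn (%a x. en (exp (- t * a)) * Y a x) x <= bn (%a x. en (exp (- t' * a)) * Y a x) x + en ((t' - t) / ep) * bn Y x"
proof -
 note [measurable] = beta_AM[OF x]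
 have "bn (%a x. en (exp (- t * a)) * Y a x) x <= bn (%a x. en (exp (- t' * a)) * Y a x + en ((t' - t) / ep) * Y a x) x"
 proof (rule bn_mono)
  fix a assume "a : Ag"
  then have "en (exp (- t * a)) <= en (exp (- t' * a) + (t' - t) / ep)" using assms by (intro ennreal_leI exp_lip) (auto simp: ages_def)
  also have "... = en (exp (- t' * a)) + en ((t' - t) / ep)" using assms by (intro ennreal_plus) auto
  finally have "en (exp (- t * a)) <= en (exp (- t' * a)) + en ((t' - t) / ep)" .
  then have "en (exp (- t * a)) * Y a x <= (en (exp (- t' * a)) + en ((t' - t) / ep)) * Y a x" by (rule mult_right_mono) simp
  then show "en (exp (- t * a)) * Y a x <= en (exp (- t' * a)) * Y a x + en ((t' - t) / ep) * Y a x" by (simp add: distrib_right)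
 qed
 also have "... = bn (%a x. en (exp (- t' * a)) * Y a x) x + bn (%a x. en ((t' - t) / ep) * Y a x) x" by (rule bn_add[OF x]) measurable
 also have "bn (%a x. en ((t' - t) / ep) * Y a x) x = en ((t' - t) / ep) * bn Y x" by (rule bn_cmult[OF x]) measurable
 finally show ?thesis .
qed

lemma Nn_shift:
 assumes e: "e : BM OM" and x: "x : S"
 shows "Nn (r + dl) e x = bn (%a x. en (exp (- dl * a)) * Sn r (hn r e) a x) x" unfolding Nn_def bn_def by (simp add: Sn_hn_shift[OF e x])

lemma vn_shift: "x : S ==> vn (r + dl) 0 x = bn (%a x. en (exp (- dl * a)) * Rn r (%_. 1) a x) x"
 using bn_Rn[of x "r + dl" "%_. 1"] by (simp add: bn_def Rn_shift)

lemma Nn_anti: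
 assumes e: "e : BM OM" and x: "x : S" and "r <= r'"
 shows "Nn r' e x <= Nn r e x"
proof -
 have "Nn (r + (r' - r)) e x <= Nn r e x" unfolding Nn_shift[OF e x] unfolding Nn_def
 proof (rule bn_mono)
  fix a assume "a : Ag"
  then have "exp (- (r' - r) * a) <= 1" using \<open>r <= r'\<close> by (auto simp: ages_def mult_nonpos_nonneg)
  then have "en (exp (- (r' - r) * a)) <= 1" using ennreal_leI by fastforce
  then have "en (exp (- (r' - r) * a)) * Sn r (hn r e) a x <= 1 * Sn r (hn r e) a x" by (rule mult_right_mono) simp
  then show "en (exp (- (r' - r) * a)) * Sn r (hn r e) a x <= Sn r (hn r e) a x" by simp
 qed
 then show ?thesis by simp
qed

lemma vn_anti:
 assumes x: "x : S" and "r <= r'"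
 shows "vn r' 0 x <= vn r 0 x" unfolding vn_def
proof (rule nn_integral_mono)
 fix a assume a: "a : space AM"
 then have "exp (- r' * (a - 0)) <= exp (- r * (a - 0))" using \<open>r <= r'\<close> by (auto simp: ages_def mult_right_mono)
 then show "ind {0<..} a * en (beta a x * exp (- r' * (a - 0)) * (qq a x / qq 0 x)) <= ind {0<..} a * en (beta a x * exp (- r * (a - 0)) * (qq a x / qq 0 x))"
  using a x beta_nonneg by (intro mult_left_mono ennreal_leI mult_right_mono) auto
qed

lemma bn_strict:
 assumes x: "x : S" and Y[measurable]: "(%a. Y a x) : BM AM"
  and pos: "!!a. a : Ag ==> 0 < Y a x" and fin: "bn Y x < \<infinity>" and dl: "0 < dl"
 shows "bn (%a x. en (exp (- dl * a)) * Y a x) x < bn Y x"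
proof (rule ccontr)
 note [measurable] = beta_AM[OF x]
 assume "~ ?thesis"
 then have ge: "bn Y x <= bn (%a x. en (exp (- dl * a)) * Y a x) x" by simp
 have split: "en (exp (- dl * a)) * Y a x + en (1 - exp (- dl * a)) * Y a x = Y a x" if "a : Ag" for a
 proof -
  have "exp (- dl * a) <= 1" using that dl by (auto simp: ages_def)
  then have "en (exp (- dl * a)) + en (1 - exp (- dl * a)) = 1" by (subst ennreal_plus[symmetric]) auto
  then show ?thesis by (simp add: distrib_right[symmetric])
 qed
 have "bn (%a x. en (exp (- dl * a)) * Y a x) x + bn (%a x. en (1 - exp (- dl * a)) * Y a x) x
   = bn (%a x. en (exp (- dl * a)) * Y a x + en (1 - exp (- dl * a)) * Y a x) x" by (rule bn_add[OF x, symmetric]) measurable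
 also have "... = bn Y x" unfolding bn_def by (intro nn_integral_cong) (simp only: space_AM split)
 finally have sum: "bn (%a x. en (exp (- dl * a)) * Y a x) x + bn (%a x. en (1 - exp (- dl * a)) * Y a x) x = bn Y x" .
 from ennreal_add_eq_left_zero[OF this ge fin] have "bn (%a x. en (1 - exp (- dl * a)) * Y a x) x = 0" .
 then have "AE a in AM. en (beta a x) * (en (1 - exp (- dl * a)) * Y a x) = 0" unfolding bn_def by (subst (asm) nn_integral_0_iff_AE) auto
 then have "AE a in AM. b0 a = 0" using AE_space
 proof eventually_elim
  case (elim a)
  then have a: "a : Ag" by simp
  have "exp (- dl * a) < 1" using a dl by (auto simp: ages_def)
  then have "en (1 - exp (- dl * a)) * Y a x ~= 0" using pos[OF a] by auto
  then have "beta a x <= 0" using elim(1) by (auto simp: ennreal_eq_0_iff)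
  then show ?case using beta_ge[OF a x] b0_nonneg[OF a] by linarith
 qed
 then show False using b0_nontriv unfolding AM_def by blast
qed

lemma Rn_pos: "0 < e x ==> 0 < Rn r e a x" by (simp add: Rn_def ennreal_zero_less_mult_iff)

lemma vr_strict:
 assumes ok: "okr (r + D + mut)" and x: "x : S" and "r < r'"
 shows "vr r' 0 x < vr r 0 x"
proof -
 have fin: "bn (Rn r (%_. 1)) x < \<infinity>" using vn_eq_vr[OF ok _ x, of 0] by (simp add: bn_Rn[OF x])
 have ok': "okr (r' + D + mut)" using ok \<open>r < r'\<close> by (auto simp: okr_def)
 have "vn (r + (r' - r)) 0 x < vn r 0 x"
  unfolding vn_shift[OF x] using bn_strict[OF x _ _ fin, of "r' - r"] Rn_AM[OF x, of "%a. a"] \<open>r < r'\<close> by (simp add: bn_Rn[OF x] Rn_pos)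
 then show ?thesis using vn_eq_vr[OF ok _ x, of 0] vn_eq_vr[OF ok' _ x, of 0] by (simp add: ennreal_less_iff)
qed

definition Kx :: "(real^'n => ennreal) => real^'n => ennreal" where
 "Kx e x = NI OM (%z. en (J (x - z)) * e z)"

lemma Nn_lower:
 "EX c>0. ALL e:BM OM. ALL x:S. en c * Kx e x <= Nn r e x"
proof -
 define ka where "ka = r + D + M"
 let ?B = "%s. NI AM (%a. ind {..<a} s * en (b0 a * exp (- ka * a)))"
 let ?b = "%a. en (b0 a * exp (- ka * a))"
 define C0 where "C0 = NI AM (%a. (NI AM (%s. ind {..<a} s * ?b a)))"
 have C0_pos: "C0 ~= 0"
 proof
  assume "C0 = 0"
  then have "AE a in AM. (NI AM (%s. ind {..<a} s * ?b a)) = 0" unfolding C0_def by (subst (asm) nn_integral_0_iff_AE) auto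
  then have "AE a in AM. b0 a = 0" using AE_space
  proof eventually_elim
   case (elim a)
   then have a: "a : Ag" "0 < a" by (auto simp: ages_def)
   then have a2: "a / 2 : Ag" using ages_down[of a "a/2"] by simp
   have "?b a * en (a / 2) = NI AM (%s. ?b a * ind {0<..a/2} s)"
    using emeasure_AM_interval[OF a2, of 0] interval_AM[OF a2, of 0] a by (simp add: nn_integral_cmult_indicator)
   also have "... <= NI AM (%s. ind {..<a} s * ?b a)" using a by (intro nn_integral_mono) (auto simp: indicator_def)
   finally have "?b a * en (a / 2) = 0" using elim(1) by simp
   then have "b0 a * exp (- ka * a) <= 0" using a by (auto simp: ennreal_eq_0_iff)
   then show ?case using b0_nonneg[OF a(1)] by (simp add: mult_le_0_iff)
  qed
  then show False using b0_nontriv unfolding AM_def by blast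
 qed
 obtain c where c: "c > 0" "en c <= en D * C0"
 proof (cases "en D * C0")
  case (real t)
  then have "0 < t" using C0_pos D_pos by (cases "t = 0") auto
  then show ?thesis using that[of t] real by simp
 next
  case top
  then show ?thesis using that[of 1] by simp
 qed
 have "en c * Kx e x <= Nn r e x" if e[measurable]: "e : BM OM" and x: "x : S" for e x
 proof -
  note [measurable] = qq_AM[OF x] beta_AM[OF x] vn_meas[OF x]
  have mbR: "mb (Rn r e)" by (rule mb_Rn[OF e])
  have [measurable]: "(%s. Kn (Rn r e) s x) : BM AM" using Kn_AM[OF mbR, of "%s. s"] by simp
  have "en c * Kx e x <= en D * C0 * Kx e x" by (intro mult_right_mono c) auto
  also have "en D * C0 * Kx e x = NI AM (%s. ?B s * (en D * Kx e x))"
  proof -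
   have "C0 = NI AM (%s. ?B s)" unfolding C0_def by (rule AA.Fubini') measurable
   then have "en D * C0 * Kx e x = NI AM (%s. ?B s) * (en D * Kx e x)" by (simp add: mult_ac)
   also have "... = NI AM (%s. ?B s * (en D * Kx e x))" by (rule nn_integral_multc[symmetric]) measurable
   finally show ?thesis .
  qed
  also have "... <= NI AM (%s. vn r s x * (en D * Kn (Rn r e) s x))"
  proof (rule nn_integral_mono)
   fix s assume "s : space AM"
   then have s: "s : Ag" "0 <= s" by (auto simp: ages_def)
   let ?e = "en (exp (- ka * s))"
   have 1: "?e * Kx e x <= Kn (Rn r e) s x"
   proof -
    have "?e * Kx e x = NI OM (%z. ?e * (en (J (x - z)) * e z))" unfolding Kx_def by (rule nn_integral_cmult[symmetric]) measurable
    also have "... <= Kn (Rn r e) s x" unfolding Kn_def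
    proof (rule nn_integral_mono)
     fix z assume z: "z : space OM"
     have "exp (- ka * s) = exp (- r * s) * exp (- (D + M) * s)" by (simp add: ka_def exp_add[symmetric] algebra_simps)
     also have "... <= exp (- r * s) * qq s z" using qq_ge[OF s(1)] z Om_S by (intro mult_left_mono) auto
     finally have "?e <= en (exp (- r * s) * qq s z)" by (rule ennreal_leI)
     then have "?e * (en (J (x - z)) * e z) <= en (exp (- r * s) * qq s z) * (en (J (x - z)) * e z)" by (rule mult_right_mono) simp
     then show "?e * (en (J (x - z)) * e z) <= en (J (x - z)) * Rn r e s z" by (simp add: Rn_def mult_ac)
    qed
    finally show ?thesis .
   qed
   have 2: "?B s <= vn r s x * ?e"
   proof -
    have "?B s
     <= NI AM (%a. ind {s<..} a * en (beta a x * exp (- r * (a - s)) * (qq a x / qq s x)) * ?e)"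
    proof (rule nn_integral_mono)
     fix a assume "a : space AM"
     then have a: "a : Ag" by simp
     show "ind {..<a} s * ?b a <= ind {s<..} a * en (beta a x * exp (- r * (a - s)) * (qq a x / qq s x)) * ?e"
     proof (cases "s < a")
     case True
     have "b0 a * exp (- ka * a) = b0 a * exp (- r * (a - s)) * exp (- (D + M) * (a - s)) * exp (- ka * s)"
     by (simp add: ka_def mult.assoc exp_add[symmetric] algebra_simps)
     also have "... <= beta a x * exp (- r * (a - s)) * (qq a x / qq s x) * exp (- ka * s)"
     using True beta_ge[OF a x] b0_nonneg[OF a] beta_nonneg[OF a x] qq_ratio_ge[OF a s(2) _ x] by (intro mult_mono mult_right_mono) auto
     finally show ?thesis using True beta_nonneg[OF a x] by (simp add: ennreal_mult[symmetric] ennreal_leI del: times_divide_eq_right)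
     qed simp
    qed
    also have "... = vn r s x * ?e" unfolding vn_def by (rule nn_integral_multc) measurable
    finally show ?thesis .
   qed
   have "?B s * (en D * Kx e x) <= vn r s x * ?e * (en D * Kx e x)" by (intro mult_right_mono 2) auto
   also have "... = vn r s x * (en D * (?e * Kx e x))" by (simp add: mult_ac)
   also have "... <= vn r s x * (en D * Kn (Rn r e) s x)" by (intro mult_left_mono 1) auto
   finally show "?B s * (en D * Kx e x) <= vn r s x * (en D * Kn (Rn r e) s x)" .
  qed
  also have "... = bn (Sn r (Rn r e)) x" unfolding Sn_def by (rule bn_Vn[OF x, symmetric]) measurable
  also have "... <= Nn r e x" unfolding Nn_def by (intro bn_mono Sn_mono) (use hn_eq[OF e] Om_S in auto)
  finally show ?thesis .
 qed
 then show ?thesis using c(1) by blast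
qed

lemma Kx_zero:
 assumes w: "continuous_on S w" "!!x. x : S ==> 0 <= w x" and "Kx (%z. en (w z)) x = 0"
  and y: "y : S" "dist x y < d0"
 shows "w y = 0" using kernel_integral_zero[OF Om_open J_cont J_ge j0_pos w _ y] assms(3) by (simp add: Kx_def OM_def)

end

lemma kernel_operator_eigenfunction:
 fixes Om :: "'a::euclidean_space set"
 assumes Om: "open Om" "connected Om" "bounded Om" "Om ~= {}"
  and J: "continuous_on UNIV J" "!!x. 0 <= J x" "!!x. J x <= (JB::real)" "!!x. norm x < d0 ==> j0 <= J x" "0 < j0" "0 < d0"
 shows "EX k>0. EX ph. continuous_on (closure Om) ph & (ALL x:closure Om. 0 < ph x) &
  (ALL x:closure Om. integrable (lebesgue_on Om) (%z. J (x - z) * ph z) &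
   (LINT z|lebesgue_on Om. J (x - z) * ph z) = k * ph x)"
proof -
 let ?S = "closure Om"
 let ?M = "lebesgue_on Om"
 have fin: "finite_measure ?M" using Om by (intro finite_measure_lebesgue_on bounded_set_imp_lmeasurable) (auto simp: borel_open)
 interpret finite_measure ?M by (rule fin)
 have Sc: "compact ?S" using Om by simp
 have Sconn: "connected ?S" using Om by (simp add: connected_imp_connected_closure)
 have Jm[measurable]: "(%z. J (x - z)) : borel_measurable ?M" for x
 proof -
  have "continuous_on Om (%z. J (x - z))" by (rule continuous_on_compose2[OF J(1)]) (auto intro: continuous_intros)
  then show ?thesis by (intro continuous_imp_measurable_on_sets_lebesgue) (use Om in \<open>auto simp: borel_open\<close>)
 qed
 have wm: "w : borel_measurable ?M" if "w : cone_on ?S" for w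
  by (rule continuous_imp_measurable_on_sets_lebesgue[OF continuous_on_subset[OF cone_onD(1)[OF that] closure_subset]])
   (use Om in \<open>auto simp: borel_open\<close>)
 have JBn: "0 <= JB" using J(2,3) order_trans by blast
 have Om_S: "x : ?S" if "x : Om" for x using that closure_subset by blast
 have int: "integrable ?M (%z. J (x - z) * w z)" if w: "w : cone_on ?S" for x w
 proof -
  obtain c where c: "!!z. z : ?S ==> norm (w z) <= c"
   using compact_imp_bounded[OF compact_continuous_image[OF cone_onD(1)[OF w] Sc]] by (auto simp: bounded_iff)
  note [measurable] = wm[OF w]
  show ?thesis by (rule Bochner_Integration.integrable_bound[of _ "%z. JB * \<bar>c\<bar>"])
    (use J(2,3) c Om_S JBn in \<open>auto intro!: AE_I2 mult_mono simp: abs_mult intro: order_trans[OF _ abs_ge_self]\<close>)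
 qed
 define K where "K w x = (LINT z|?M. J (x - z) * w z)" for w x
 define T where "T t w x = K w x / t" for t w x
 have K_nonneg: "0 <= K w x" if "w : cone_on ?S" for w x unfolding K_def using J(2) cone_onD(2)[OF that] Om_S by (intro integral_nonneg_AE AE_I2) auto
 define m where "m = measure ?M Om"
 have one: "(%_. 1) : cone_on ?S" by (rule cone_on_const) simp
 have K_equi: "EX d>0. ALL w:cone_on ?S. (ALL y:?S. w y <= 1) --> (ALL y:?S. norm (x - y) < d --> \<bar>K w x - K w y\<bar> < e)"
  if x: "x : ?S" and e: "0 < e" for x e
 proof -
  define Ph where "Ph y = (LINT z|?M. \<bar>J (x - z) - J (y - z)\<bar>)" for y
  have Jd: "\<bar>J a - J b\<bar> <= JB" for a b using J(2,3)[of a] J(2,3)[of b] by (auto simp: abs_le_iff intro: order_trans)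
  have "continuous_on UNIV Ph" unfolding Ph_def
  proof (rule continuous_on_lebesgue_integral[where w="%_. JB"])
   show "continuous_on UNIV (%y. \<bar>J (x - z) - J (y - z)\<bar>)" for z by (intro continuous_intros continuous_on_compose2[OF J(1)]) auto
  qed (use Jd in auto)
  then obtain d where d: "d > 0" "!!y. dist y x < d ==> dist (Ph y) (Ph x) < e" using e unfolding continuous_on_iff by blast
  have "\<bar>K w x - K w y\<bar> < e" if w: "w : cone_on ?S" "ALL y:?S. w y <= 1" and y: "norm (x - y) < d" for w y
  proof -
   note [measurable] = wm[OF w(1)]
   have intd: "integrable ?M (%z. \<bar>J (x - z) - J (y - z)\<bar>)"
    by (rule Bochner_Integration.integrable_bound[of _ "%_. JB"]) (use Jd JBn in auto)
   have "\<bar>K w x - K w y\<bar> = \<bar>LINT z|?M. (J (x - z) * w z - J (y - z) * w z)\<bar>"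
    unfolding K_def by (subst Bochner_Integration.integral_diff[OF int int]) (use w in auto)
   also have "... <= (LINT z|?M. \<bar>J (x - z) * w z - J (y - z) * w z\<bar>)" by (rule integral_abs_bound)
   also have "... <= Ph y" unfolding Ph_def
   proof (rule integral_mono_AE)
    show "integrable ?M (%z. \<bar>J (x - z) * w z - J (y - z) * w z\<bar>)" using int[OF w(1)] by auto
    show "AE z in ?M. \<bar>J (x - z) * w z - J (y - z) * w z\<bar> <= \<bar>J (x - z) - J (y - z)\<bar>"
    proof (rule AE_I2)
     fix z assume "z : space ?M"
     then have z: "z : ?S" using Om_S by auto
     have "\<bar>J (x - z) * w z - J (y - z) * w z\<bar> = \<bar>J (x - z) - J (y - z)\<bar> * w z"
     using cone_onD(2)[OF w(1) z] by (simp add: abs_mult left_diff_distrib[symmetric])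
     also have "... <= \<bar>J (x - z) - J (y - z)\<bar> * 1" using w(2) z by (intro mult_left_mono) auto
     finally show "\<bar>J (x - z) * w z - J (y - z) * w z\<bar> <= \<bar>J (x - z) - J (y - z)\<bar>" by simp
    qed
   qed (rule intd)
   also have "... < e" using d(2)[of y] y by (auto simp: dist_norm norm_minus_commute Ph_def)
   finally show ?thesis .
  qed
  then show ?thesis using d(1) by blast
 qed
 have K_scale: "K (%x. c * w x) x = c * K w x" for c w x
 proof -
  have "K (%x. c * w x) x = (LINT z|?M. c * (J (x - z) * w z))" unfolding K_def by (simp add: mult_ac)
  then show ?thesis by (simp add: K_def)
 qed
 have K_in: "K w : cone_on ?S" if w: "w : cone_on ?S" for w
 proof -
  obtain c where c: "!!z. z : ?S ==> norm (w z) <= c"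
   using compact_imp_bounded[OF compact_continuous_image[OF cone_onD(1)[OF w] Sc]] by (auto simp: bounded_iff)
  have "continuous_on ?S (K w)" unfolding K_def
  proof (rule continuous_on_lebesgue_integral[where w="%z. JB * \<bar>c\<bar>"])
   show "(%z. J (x - z) * w z) : borel_measurable ?M" for x using wm[OF w] by measurable
   show "continuous_on ?S (%x. J (x - z) * w z)" for z by (intro continuous_intros continuous_on_compose2[OF J(1)]) auto
   show "norm (J (x - z) * w z) <= JB * \<bar>c\<bar>" if "z : space ?M" for x z
    using J(2,3) c[of z] that Om_S JBn unfolding norm_mult by (intro mult_mono) (auto intro: order_trans[OF _ abs_ge_self])
  qed auto
  then show ?thesis using K_nonneg[OF w] by (auto simp: cone_on_def)
 qed
 have op: "cone_operator ?S (T t) d0" if "0 < t" for t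
 proof
  show "compact ?S" "connected ?S" "0 < d0" by (fact Sc Sconn J(6))+
  show "T t w : cone_on ?S" if "w : cone_on ?S" for w
   using cone_on_scale[OF _ K_in[OF that], of "1/t"] \<open>0 < t\<close> by (simp add: T_def[abs_def])
  show "T t (%x. v x + w x) x = T t v x + T t w x" if "v : cone_on ?S" "w : cone_on ?S" for v w x
   using int[OF that(1), of x] int[OF that(2), of x] by (simp add: T_def K_def distrib_left add_divide_distrib)
  show "T t (%x. c * w x) x = c * T t w x" for c w x by (simp add: T_def K_scale)
  show "T t v x <= T t w x" if "v : cone_on ?S" "w : cone_on ?S" "!!y. y : ?S ==> v y <= w y" for v w x
   unfolding T_def K_def using that J(2) Om_S \<open>0 < t\<close> int by (intro divide_right_mono integral_mono) (auto intro!: mult_left_mono)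
  show "w y = 0" if w: "w : cone_on ?S" "T t w x = 0" "y : ?S" "dist x y < d0" for w x y
  proof (rule kernel_integral_zero[OF Om(1) J(1,4,5)])
   show "(NI ?M (%z. en (J (x - z)) * en (w z))) = 0"
   proof -
    have "(NI ?M (%z. en (J (x - z)) * en (w z))) = (NI ?M (%z. en (J (x - z) * w z)))"
     using J(2) by (intro nn_integral_cong) (simp add: ennreal_mult')
    also have "... = en (K w x)" unfolding K_def using J(2) cone_onD(2)[OF w(1)] Om_S by (intro nn_integral_eq_integral int[OF w(1)] AE_I2) auto
    also have "K w x = 0" using w(2) \<open>0 < t\<close> by (simp add: T_def)
    finally show ?thesis by simp
   qed
  qed (use w cone_onD[OF w(1)] in auto)
  show "EX d>0. ALL w:cone_on ?S. (ALL y:?S. w y <= 1) --> (ALL y:?S. norm (x - y) < d --> \<bar>T t w x - T t w y\<bar> < e)"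
   if "x : ?S" "0 < e" for x e
  proof -
   obtain d where d: "d > 0" "ALL w:cone_on ?S. (ALL y:?S. w y <= 1) --> (ALL y:?S. norm (x - y) < d --> \<bar>K w x - K w y\<bar> < e * t)"
    using K_equi[OF \<open>x : ?S\<close>, of "e * t"] \<open>0 < e\<close> \<open>0 < t\<close> by auto
   have "\<bar>T t w x - T t w y\<bar> < e" if "\<bar>K w x - K w y\<bar> < e * t" for w y
   proof -
    have "\<bar>T t w x - T t w y\<bar> = \<bar>K w x - K w y\<bar> / t"
     using \<open>0 < t\<close> by (simp add: T_def diff_divide_distrib[symmetric])
    then show ?thesis using that \<open>0 < t\<close> by (simp add: divide_less_eq)
   qed
   then show ?thesis using d by blast
  qed
 qed
 have K1_pos: "0 < K (%_. 1) x" if x: "x : ?S" for x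
 proof (rule ccontr)
  assume "~ 0 < K (%_. 1) x"
  then have "T 1 (%_. 1) x = 0" using K_nonneg[OF one, of x] by (simp add: T_def)
  then show False using cone_operator.T_loc[OF op[of 1] one x _ x] J(6) by simp
 qed
 have Sne: "?S ~= {}" using Om by auto
 obtain x0 where x0: "x0 : ?S" "!!x. x : ?S ==> K (%_. 1) x0 <= K (%_. 1) x"
  using continuous_attains_inf[OF Sc Sne cone_onD(1)[OF K_in[OF one]]] by blast
 obtain x1 where x1: "x1 : ?S" "!!x. x : ?S ==> K (%_. 1) x <= K (%_. 1) x1"
  using continuous_attains_sup[OF Sc Sne cone_onD(1)[OF K_in[OF one]]] by blast
 define l0 where "l0 = K (%_. 1) x0"
 have l0: "0 < l0" using K1_pos[OF x0(1)] by (simp add: l0_def)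
 define b where "b = K (%_. 1) x1"
 have b: "0 < b" "!!x. x : ?S ==> K (%_. 1) x <= b" using K1_pos[OF x1(1)] x1 by (auto simp: b_def)
 have "EX r>=l0. EX z. continuous_on ?S z & (ALL x:?S. 0 < z x) & (ALL x:?S. T r z x = z x)"
 proof (rule cone_family_fixed_point[of l0 ?S T d0 "%_. 1" x0])
  show "cone_operator ?S (T l) d0" if "l0 <= l" for l using op that l0 by auto
  show "T l' w x <= T l w x" if "l0 <= l" "l <= l'" "w : cone_on ?S" for l l' w x
   unfolding T_def using that l0 K_nonneg[OF that(3), of x] by (intro divide_left_mono) auto
  show "EX d>0. ALL l'>=l0. \<bar>l' - l\<bar> < d --> (ALL x:?S. \<bar>T l' (%_. 1) x - T l (%_. 1) x\<bar> <= e)" if l: "l0 <= l" and e: "0 < e" for l e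
  proof (intro exI[of _ "e * l0 * l0 / b"] conjI allI impI ballI)
   show "0 < e * l0 * l0 / b" using e l0 b by simp
   fix l' x assume l': "l0 <= l'" "\<bar>l' - l\<bar> < e * l0 * l0 / b" and x: "x : ?S"
   have "T l' (%_. 1) x - T l (%_. 1) x = K (%_. 1) x * (l - l') / (l' * l)" unfolding T_def using l l' l0 by (simp add: field_simps)
   then have "\<bar>T l' (%_. 1) x - T l (%_. 1) x\<bar> = K (%_. 1) x * \<bar>l' - l\<bar> / (l' * l)"
    using l l' l0 K_nonneg[OF one, of x] by (simp add: abs_mult abs_minus_commute)
   also have "... <= b * (e * l0 * l0 / b) / (l0 * l0)" using l l' l0 b(2)[OF x] b(1) e K_nonneg[OF one, of x] by (intro frac_le mult_mono) auto
   also have "... = e" using l0 b by simp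
   finally show "\<bar>T l' (%_. 1) x - T l (%_. 1) x\<bar> <= e" .
  qed
  show "1 <= T l0 (%_. 1) x" if "x : ?S" for x unfolding T_def using x0(2)[OF that] l0 by (simp add: l0_def)
  show "EX L. ALL l>=L. ALL x:?S. T l (%_. 1) x <= 1/2"
  proof (intro exI[of _ "2 * b"] allI impI ballI)
   fix l x assume "2 * b <= l" "x : ?S"
   then show "T l (%_. 1) x <= 1/2" using b(2)[of x] b(1) unfolding T_def by (simp add: divide_le_eq)
  qed
 qed (use one x0 in auto)
 then obtain r z where z: "l0 <= r" "continuous_on ?S z" "!!x. x : ?S ==> 0 < z x" "!!x. x : ?S ==> T r z x = z x" by blast
 have "z : cone_on ?S" using z by (auto simp: cone_on_def less_imp_le)
 then show ?thesis using z l0 int[of z] by (intro exI[of _ r] conjI exI[of _ z]) (auto simp: T_def K_def divide_eq_eq mult.commute)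
qed

context age_model_w
begin

lemma Sn_sum: "(!!j::nat. mb (t j)) ==> x : S ==> Sn r (%a x. \<Sum>j<n. t j a x) a x = (\<Sum>j<n. Sn r (t j) a x)"
proof (induction n)
 case 0
 then show ?case by (simp add: Sn_def Vn_def Kn_def)
next
 case (Suc n)
 have "mb (%a x. \<Sum>j<n. t j a x)" using Suc.prems(1) unfolding mb_def by measurable
 then show ?case using Suc by (simp add: Sn_add)
qed

lemma mb_sum: "(!!j::nat. mb (t j)) ==> mb (%a x. \<Sum>j<n. t j a x)" unfolding mb_def by measurable

lemma I2_sum: "(!!j::nat. mb (t j)) ==> I2 (%a x. \<Sum>j<n. t j a x) = (\<Sum>j<n. I2 (t j))"
proof (induction n)
 case 0
 then show ?case by (simp add: I2_def)
next
 case (Suc n)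
 then show ?case by (simp add: I2_add mb_sum)
qed

lemma hn_I2:
 assumes "good r"
 shows "EX C>0. ALL e:BM OM. (NI OM (%x. e x)) < \<infinity> --> I2 (hn r e) <= en C * NI OM (%x. e x)"
proof -
 have ok: "okr (r + D + mut)" by (rule good_okr[OF assms])
 obtain C1 where C1: "C1 > 0" "!!H g. mb H ==> mb g ==> I2 H < \<infinity> ==>
   (AE p in PM. H (fst p) (snd p) <= g (fst p) (snd p) + Sn r H (fst p) (snd p)) ==> I2 H <= en C1 * I2 g" using Volterra_bound[OF assms] by blast
 obtain C2 where C2: "C2 > 0" "!!e. e : BM OM ==> I2 (Rn r e) <= en C2 * NI OM (%x. e x)" using I2_Rn[OF ok] by blast
 have "I2 (hn r e) <= en (C1 * C2) * NI OM (%x. e x)" if e: "e : BM OM" "NI OM (%x. e x) < \<infinity>" for e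
 proof -
  define t where "t j = (Sn r ^^ j) (Rn r e)" for j
  have mt: "mb (t j)" for j unfolding t_def by (rule mb_iter[OF e(1)])
  have ft: "I2 (t j) < \<infinity>" for j
  proof (induction j)
   case 0
   then show ?case using I2_Rn_finite[OF ok e] by (simp add: t_def)
  next
   case (Suc j)
   then show ?case using I2_Sn_finite[OF ok mt[of j]] by (simp add: t_def)
  qed
  have part: "(\<Sum>j<n. I2 (t j)) <= en (C1 * C2) * NI OM (%x. e x)" for n
  proof -
   have "I2 (%a x. \<Sum>j<n. t j a x) <= en C1 * I2 (Rn r e)"
   proof (rule C1(2)[OF mb_sum[OF mt] mb_Rn[OF e(1)]])
    show "I2 (%a x. \<Sum>j<n. t j a x) < \<infinity>" proof -
     have "I2 (t j) ~= top" for j using ft[of j] by (simp add: less_top)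
     then have "(\<Sum>j<n. I2 (t j)) ~= top" by (induction n) auto
     then show ?thesis unfolding I2_sum[OF mt] by (simp add: less_top)
    qed
    show "AE p in PM. (\<Sum>j<n. t j (fst p) (snd p)) <= Rn r e (fst p) (snd p) + Sn r (%a x. \<Sum>j<n. t j a x) (fst p) (snd p)"
    proof (rule AE_I2)
     fix p assume "p : space PM"
     then have "snd p : S" by (auto simp: space_pair_measure Om_S)
     have "Rn r e (fst p) (snd p) + Sn r (%a x. \<Sum>j<n. t j a x) (fst p) (snd p) = (\<Sum>j<Suc n. t j (fst p) (snd p))"
     unfolding Sn_sum[OF mt \<open>snd p : S\<close>] sum.lessThan_Suc_shift by (simp add: t_def)
     then show "(\<Sum>j<n. t j (fst p) (snd p)) <= Rn r e (fst p) (snd p) + Sn r (%a x. \<Sum>j<n. t j a x) (fst p) (snd p)" by simp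
    qed
   qed
   also have "... <= en C1 * (en C2 * NI OM (%x. e x))" by (intro mult_left_mono C2 e) auto
   also have "... = en (C1 * C2) * NI OM (%x. e x)" using C1 C2 by (simp add: ennreal_mult mult.assoc)
   finally show ?thesis unfolding I2_sum[OF mt] .
  qed
  have "I2 (hn r e) = NI PM (%p. (\<Sum>j. t j (fst p) (snd p)))" unfolding I2_pair[OF mb_hn[OF e(1)]] by (simp add: hn_def t_def)
  also have "... = (\<Sum>j. I2 (t j))" unfolding I2_pair[OF mt] using mt by (intro nn_integral_suminf) (auto simp: mb_def)
  also have "... <= en (C1 * C2) * NI OM (%x. e x)" by (rule suminf_le_const[OF summableI part])
  finally show ?thesis .
 qed
 then show ?thesis using C1 C2 by (intro exI[of _ "C1 * C2"]) auto
qed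

lemma hn_I2_finite: "good r ==> e : BM OM ==> (NI OM (%x. e x)) < \<infinity> ==> I2 (hn r e) < \<infinity>"
proof -
 assume a: "good r" "e : BM OM" "NI OM (%x. e x) < \<infinity>"
 obtain C where "I2 (hn r e) <= en C * NI OM (%x. e x)" using hn_I2[OF a(1)] a by blast
 also have "... < \<infinity>" using a(3) by (simp add: ennreal_mult_less_top)
 finally show ?thesis .
qed

lemma cont_int_finite:
 assumes "continuous_on S w"
 shows "NI OM (%x. en (w x)) < \<infinity>"
proof -
 obtain c where c: "!!z. z : S ==> norm (w z) <= c"
  using compact_imp_bounded[OF compact_continuous_image[OF assms S_compact]] by (auto simp: bounded_iff)
 have "NI OM (%x. en (w x)) <= NI OM (%x. en \<bar>c\<bar>)"
  using c Om_S by (intro nn_integral_mono ennreal_leI) (auto simp: abs_le_iff intro: order_trans[OF _ abs_ge_self])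
 also have "... < \<infinity>" by (simp add: OM.emeasure_eq_measure ennreal_mult_less_top)
 finally show ?thesis .
qed

lemma Nn_finite: "good r ==> e : BM OM ==> (NI OM (%x. e x)) < \<infinity> ==> x : S ==> Nn r e x < \<infinity>"
 unfolding Nn_def by (rule bn_Sn_finite[OF good_okr mb_hn hn_I2_finite])

definition TT :: "real => (real^'n => real) => real^'n => real" where
 "TT r w x = enn2real (Nn r (%x. en (w x)) x) / (1 - vr r 0 x)"

lemma cone_meas: "w : cone_on S ==> (%x. en (w x)) : BM OM" using cont_OM[OF cone_onD(1)] by simp

lemma Nn_cone_finite: "good r ==> w : cone_on S ==> x : S ==> Nn r (%x. en (w x)) x < \<infinity>"
 by (intro Nn_finite cone_meas cont_int_finite cone_onD(1))

lemma Nn_mono: "(!!x. x : S ==> e x <= e' x) ==> Nn r e x <= Nn r e' x" unfolding Nn_def by (intro bn_mono Sn_mono hn_mono) (auto simp: Om_S)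

lemma Nn_add:
 assumes e: "e : BM OM" "e' : BM OM" and x: "x : S"
 shows "Nn r (%x. e x + e' x) x = Nn r e x + Nn r e' x"
proof -
 have "Sn r (hn r (%x. e x + e' x)) a x = Sn r (hn r e) a x + Sn r (hn r e') a x" for a
 proof -
  have "Sn r (hn r (%x. e x + e' x)) a x = Sn r (%a x. hn r e a x + hn r e' a x) a x" by (rule Sn_cong) (simp add: hn_add[OF e] Om_S)
  then show ?thesis by (simp add: Sn_add[OF mb_hn[OF e(1)] mb_hn[OF e(2)] x])
 qed
 then have "Nn r (%x. e x + e' x) x = bn (%a x. Sn r (hn r e) a x + Sn r (hn r e') a x) x" unfolding Nn_def bn_def by simp
 also have "... = Nn r e x + Nn r e' x" unfolding Nn_def
  using Sn_AM[OF x mb_hn[OF e(1)], of "%a. a"] Sn_AM[OF x mb_hn[OF e(2)], of "%a. a"] by (intro bn_add[OF x]) auto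
 finally show ?thesis .
qed

lemma Nn_cmult:
 assumes e: "e : BM OM" and x: "x : S"
 shows "Nn r (%x. c * e x) x = c * Nn r e x"
proof -
 have "Sn r (hn r (%x. c * e x)) a x = c * Sn r (hn r e) a x" for a
 proof -
  have "Sn r (hn r (%x. c * e x)) a x = Sn r (%a x. c * hn r e a x) a x" by (rule Sn_cong) (simp add: hn_cmult[OF e] Om_S)
  then show ?thesis by (simp add: Sn_cmult[OF mb_hn[OF e] x])
 qed
 then have "Nn r (%x. c * e x) x = bn (%a x. (%_. c) x * Sn r (hn r e) a x) x" unfolding Nn_def bn_def by simp
 also have "... = c * Nn r e x" unfolding Nn_def using Sn_AM[OF x mb_hn[OF e], of "%a. a"] by (intro bn_cmult[OF x]) auto
 finally show ?thesis .
qed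

lemma TT_cone:
 assumes g: "good r" and lt: "!!x. x : S ==> vr r 0 x < 1"
 shows "cone_operator S (TT r) d0"
proof
 have ok: "okr (r + D + mut)" by (rule good_okr[OF g])
 have pos: "0 < 1 - vr r 0 x" if "x : S" for x using lt[OF that] by simp
 have vc: "continuous_on S (vr r 0)" by (rule vr_cont[OF ok]) auto
 have Nc: "continuous_on S (%x. enn2real (Nn r (%x. en (w x)) x))" if "w : cone_on S" for w
  unfolding Nn_def using that by (intro bn_Sn_cont ok mb_hn hn_I2_finite g cone_meas cont_int_finite cone_onD(1))
 show "compact S" "connected S" "0 < d0" by (fact S_compact S_conn d0_pos)+
 show "TT r w : cone_on S" if "w : cone_on S" for w unfolding cone_on_def TT_def using Nc[OF that] vc pos
  by (auto intro!: continuous_intros divide_nonneg_pos less_imp_neq[THEN not_sym] simp del: diff_gt_0_iff_gt)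
 show "TT r (%x. v x + w x) x = TT r v x + TT r w x" if vw: "v : cone_on S" "w : cone_on S" and x: "x : S" for v w x
 proof -
  have "Nn r (%x. en (v x + w x)) x = Nn r (%x. en (v x) + en (w x)) x"
   by (intro antisym Nn_mono) (auto simp: ennreal_plus cone_onD(2)[OF vw(1)] cone_onD(2)[OF vw(2)])
  also have "... = Nn r (%x. en (v x)) x + Nn r (%x. en (w x)) x" by (intro Nn_add cone_meas vw x)
  finally show ?thesis using Nn_cone_finite[OF g vw(1) x] Nn_cone_finite[OF g vw(2) x] by (simp add: TT_def enn2real_plus add_divide_distrib)
 qed
 show "TT r (%x. c * w x) x = c * TT r w x" if c: "0 <= c" and w: "w : cone_on S" and x: "x : S" for c w x
 proof -
  have "Nn r (%x. en (c * w x)) x = Nn r (%x. en c * en (w x)) x" using c by (simp add: ennreal_mult')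
  also have "... = en c * Nn r (%x. en (w x)) x" by (intro Nn_cmult cone_meas w x)
  finally show ?thesis using c by (simp add: TT_def enn2real_mult)
 qed
 show "TT r v x <= TT r w x" if vw: "v : cone_on S" "w : cone_on S" and le: "!!y. y : S ==> v y <= w y" and x: "x : S" for v w x
  unfolding TT_def using Nn_cone_finite[OF g vw(2) x] pos[OF x] le by (intro divide_right_mono enn2real_mono Nn_mono ennreal_leI) auto
 show "w y = 0" if w: "w : cone_on S" and x: "x : S" and 0: "TT r w x = 0" and y: "y : S" "dist x y < d0" for w x y
 proof (rule Kx_zero[OF cone_onD[OF w] _ y])
  obtain c where c: "c > 0" "en c * Kx (%x. en (w x)) x <= Nn r (%x. en (w x)) x" using Nn_lower[of r] cone_meas[OF w] x by blast
  have "enn2real (Nn r (%x. en (w x)) x) = 0" using 0 pos[OF x] by (simp add: TT_def)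
  then have "Nn r (%x. en (w x)) x = 0" using Nn_cone_finite[OF g w x] by (auto simp: enn2real_eq_0_iff)
  then show "Kx (%x. en (w x)) x = 0" using c by simp
 qed
 show "EX d>0. ALL w:cone_on S. (ALL y:S. w y <= 1) --> (ALL y:S. norm (x - y) < d --> \<bar>TT r w x - TT r w y\<bar> < e)"
  if x: "x : S" and e: "0 < e" for x e
 proof -
  let ?n = "%w x. enn2real (Nn r (%x. en (w x)) x)"
  let ?g = "%x. 1 / (1 - vr r 0 x)"
  have one: "(%_. 1) : cone_on S" by (rule cone_on_const) simp
  have m1: "(%_. 1::ennreal) : BM OM" by simp
  have H0: "mb (hn r (%_. 1))" "I2 (hn r (%_. 1)) < \<infinity>" using mb_hn[OF m1] hn_I2_finite[OF g m1] by (auto simp: OM.emeasure_eq_measure)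
  have gc: "continuous_on S ?g" using vc pos by (intro continuous_intros) force+
  define K where "K = ?n (%_. 1) x + 1"
  have K: "0 < K" by (simp add: K_def add_nonneg_pos)
  define G where "G = ?g x + 1"
  have gx: "0 < ?g x" using pos[OF x] by simp
  have G: "0 < G" unfolding G_def using gx by linarith
  define e1 where "e1 = min 1 (e / (2 * G))"
  define e2 where "e2 = min 1 (e / (2 * K))"
  have e12: "0 < e1" "0 < e2" using e G K by (auto simp: e1_def e2_def)
  obtain da where da: "da > 0" "ALL H. mb H --> (ALL a:Ag. ALL z:Om. H a z <= hn r (%_. 1) a z) -->
    (ALL y:S. norm (x - y) < da --> \<bar>enn2real (bn (Sn r H) x) - enn2real (bn (Sn r H) y)\<bar> < e1)"
   using bn_Sn_equicont[OF ok H0 x e12(1)] by blast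
  obtain db where db: "db > 0" "!!y. y : S ==> dist y x < db ==> dist (?g y) (?g x) < e2" using gc x e12(2) unfolding continuous_on_iff by blast
  show ?thesis
  proof (intro exI[of _ "min da db"] conjI ballI impI)
   show "0 < min da db" using da db by simp
   fix w y assume w: "w : cone_on S" "ALL y:S. w y <= 1" and y: "y : S" "norm (x - y) < min da db"
   have le: "hn r (%x. en (w x)) a z <= hn r (%_. 1) a z" if "z : Om" for a z using w(2) by (intro hn_mono) (auto simp: Om_S that ennreal_le_1)
   have 1: "\<bar>?n w x - ?n w y\<bar> < e1" using da(2)[rule_format, OF mb_hn[OF cone_meas[OF w(1)]] _ y(1)] le y(2) by (auto simp: Nn_def)
   have 2: "\<bar>?g x - ?g y\<bar> < e2" using db(2)[OF y(1)] y(2) by (auto simp: dist_norm norm_minus_commute abs_minus_commute)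
   have nx: "?n w x <= ?n (%_. 1) x" using Nn_cone_finite[OF g one x] w(2) by (intro enn2real_mono Nn_mono ennreal_leI) auto
   have "TT r w x - TT r w y = (?n w x) * (?g x - ?g y) + (?n w x - ?n w y) * ?g y" unfolding TT_def by (simp add: algebra_simps)
   then have "\<bar>TT r w x - TT r w y\<bar> <= \<bar>?n w x\<bar> * \<bar>?g x - ?g y\<bar> + \<bar>?n w x - ?n w y\<bar> * \<bar>?g y\<bar>"
    using abs_triangle_ineq[of "?n w x * (?g x - ?g y)" "(?n w x - ?n w y) * ?g y"] by (simp only: abs_mult)
   also have "... <= ?n (%_. 1) x * \<bar>?g x - ?g y\<bar> + \<bar>?n w x - ?n w y\<bar> * G"
   proof (intro add_mono mult_right_mono mult_left_mono)
    show "\<bar>?g y\<bar> <= G" using 2 gx e2_def unfolding G_def by linarith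
   qed (use nx in auto)
   also have "... < K * (e / (2 * K)) + (e / (2 * G)) * G"
   proof (rule add_le_less_mono)
    show "?n (%_. 1) x * \<bar>?g x - ?g y\<bar> <= K * (e / (2 * K))" using 2 by (intro mult_mono) (auto simp: K_def e2_def)
    show "\<bar>?n w x - ?n w y\<bar> * G < (e / (2 * G)) * G" using 1 G by (intro mult_strict_right_mono) (auto simp: e1_def)
   qed
   also have "... = e" using K G by (simp add: field_simps)
   finally show "\<bar>TT r w x - TT r w y\<bar> < e" .
  qed
 qed
qed

end

section \<open>Existence of a positive solution\<close>

lemma enn2real_le_add:
 fixes a b c :: ennreal
 assumes "a <= b + en t * c" "b < \<infinity>" "c < \<infinity>" "0 <= t"
 shows "enn2real a <= enn2real b + t * enn2real c"
proof -
 obtain b' where b: "b = en b'" "0 <= b'" using assms(2) by (cases b) auto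
 obtain c' where c: "c = en c'" "0 <= c'" using assms(3) by (cases c) auto
 have "a <= en (b' + t * c')" using assms b c by (simp add: ennreal_plus ennreal_mult)
 then have "enn2real a <= b' + t * c'" using b c assms by (intro enn2real_leI) auto
 then show ?thesis using b c by simp
qed

context age_model
begin

lemma vn_lip:
 assumes "0 < ep" "ep <= t" "t <= t'" and x: "x : S"
 shows "vn (lm + t) 0 x <= vn (lm + t') 0 x + en ((t' - t) / ep) * vn lm 0 x"
 using bn_exp_lip[OF assms, of "Rn lm (%_. 1)"] Rn_AM[OF x, of "%a. a"] bn_Rn[OF x, of lm "%_. 1"] by (simp add: vn_shift[OF x])

lemma Nn_lip:
 assumes "0 < ep" "ep <= t" "t <= t'" and x: "x : S" and e: "e : BM OM"
 shows "Nn (lm + t) e x <= Nn (lm + t') e x + en ((t' - t) / ep) * Nn lm e x"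
 using bn_exp_lip[OF assms(1-4), of "Sn lm (hn lm e)"] Sn_AM[OF x mb_hn[OF e], of "%a. a"] unfolding Nn_shift[OF e x] by (simp add: Nn_def)

lemma vr_lip:
 assumes ok: "okr (lm + D + mut)" and "0 < ep" "ep <= t" "t <= t'" and x: "x : S"
 shows "vr (lm + t) 0 x <= vr (lm + t') 0 x + (t' - t) / ep * vr lm 0 x"
proof -
 have ok': "okr (lm + t' + D + mut)" using ok assms by (auto simp: okr_def)
 show ?thesis unfolding vr_def using vn_lip[OF assms(2-5), of lm] vn_eq_vr[OF ok _ x, of 0] vn_eq_vr[OF ok' _ x, of 0] assms
  by (intro enn2real_le_add) auto
qed

lemma vr_anti: "okr (r + D + mut) ==> x : S ==> r <= r' ==> vr r' 0 x <= vr r 0 x"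
 unfolding vr_def using vn_eq_vr[of r 0 x] by (intro enn2real_mono vn_anti) auto

lemma okr_open: "okr (r + D + mut) ==> EX ep>0. okr (r - ep + D + mut)"
proof (cases "ahat = \<infinity>")
 case True
 assume "okr (r + D + mut)"
 then have "0 < r + D + mut" using True unfolding okr_def by simp
 then show ?thesis by (intro exI[of _ "(r + D + mut) / 2"]) (auto simp: okr_def field_simps)
next
 case False
 then show ?thesis by (intro exI[of _ 1]) (simp add: okr_def)
qed

end

context age_model_w
begin

lemma good_open: "good r ==> EX ep>0. good (r - ep)"
proof (cases "ahat = \<infinity>")
 case True
 assume "good r"
 then have "- D - mut + D * kk < r" using True unfolding good_def by simp
 then show ?thesis by (intro exI[of _ "(r - (- D - mut + D * kk)) / 2"]) (auto simp: good_def field_simps)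
next
 case False
 then show ?thesis by (intro exI[of _ 1]) (simp add: good_def)
qed

theorem principal_solution:
 assumes g0: "good l0" and lt: "!!x. x : S ==> vr l0 0 x < 1"
  and start: "w0 : cone_on S" "x1 : S" "w0 x1 ~= 0" "!!x. x : S ==> w0 x <= TT l0 w0 x"
 shows "EX r>=l0. EX z. continuous_on S z & (ALL x:S. 0 < z x) & (ALL x:S. bn (hn r (%x. en (z x))) x = en (z x))"
proof -
 let ?e = "%_::real^'n. 1 :: ennreal"
 have e1: "?e : BM OM" "NI OM (%x. ?e x) < \<infinity>" by (auto simp: OM.emeasure_eq_measure)
 have one: "(%_. 1) : cone_on S" by (rule cone_on_const) simp
 have ok0: "okr (l0 + D + mut)" by (rule good_okr[OF g0])
 have lt': "vr l 0 x < 1" if "l0 <= l" "x : S" for l x using vr_anti[OF ok0 that(2,1)] lt[OF that(2)] by simp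
 have gl: "good l" if "l0 <= l" for l using good_mono[OF g0 that] .
 obtain ep where ep: "ep > 0" "good (l0 - ep)" using good_open[OF g0] by blast
 define lm where "lm = l0 - ep"
 have glm: "good lm" using ep by (simp add: lm_def)
 have oklm: "okr (lm + D + mut)" by (rule good_okr[OF glm])
 have I: "I2 (hn lm ?e) < \<infinity>" by (rule hn_I2_finite[OF glm e1])
 obtain K1 where K1: "!!x. x : S ==> enn2real (Nn lm ?e x) <= K1"
 proof -
  obtain C where C: "!!x. x : S ==> bn (Sn lm (hn lm ?e)) x <= en C * I2 (hn lm ?e)" using bn_Sn_le[OF oklm] mb_hn[OF e1(1)] by blast
  have "enn2real (Nn lm ?e x) <= enn2real (en C * I2 (hn lm ?e))" if "x : S" for x
   unfolding Nn_def using I by (intro enn2real_mono C that) (auto simp: ennreal_mult_less_top)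
  then show ?thesis using that by blast
 qed
 obtain K2 where K2: "!!x. x : S ==> vr lm 0 x <= K2" using vr_bdd[OF oklm] by blast
 define K where "K = max 1 (max K1 K2)"
 have K: "0 < K" "!!x. x : S ==> enn2real (Nn lm ?e x) <= K" "!!x. x : S ==> vr lm 0 x <= K" using K1 K2 by (auto simp: K_def le_max_iff_disj)
 define n where "n l x = enn2real (Nn l ?e x)" for l x
 have nfin: "Nn l ?e x < \<infinity>" if "l0 - ep <= l" "x : S" for l x by (rule Nn_finite[OF good_mono[OF ep(2) that(1)] e1 that(2)])
 have n_anti: "n l' x <= n l x" if "l0 <= l" "l <= l'" "x : S" for l l' x
  unfolding n_def using nfin[of l x] ep that by (intro enn2real_mono Nn_anti e1) auto
 have n_le: "n l x <= K" if "l0 <= l" "x : S" for l x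
  using K(2)[OF that(2)] enn2real_mono[OF Nn_anti[OF e1(1) that(2), of lm l]] nfin[of lm x] ep that by (force simp: n_def lm_def)
 have n_lip: "n l x <= n l' x + (l' - l) / ep * K" if l: "l0 <= l" "l <= l'" and x: "x : S" for l l' x
 proof -
  have "n l x <= n l' x + ((l' - lm) - (l - lm)) / ep * n lm x"
   unfolding n_def using Nn_lip[OF ep(1), of "l - lm" "l' - lm" x ?e lm] l x e1 nfin[of l' x] nfin[of lm x] ep
   by (intro enn2real_le_add) (auto simp: lm_def)
  also have "... <= n l' x + (l' - l) / ep * K" using K(2)[OF x] l ep by (intro add_left_mono mult_mono) (auto simp: n_def)
  finally show ?thesis .
 qed
 have v_lip: "vr l 0 x <= vr l' 0 x + (l' - l) / ep * K" if l: "l0 <= l" "l <= l'" and x: "x : S" for l l' x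
 proof -
  have "vr l 0 x <= vr l' 0 x + ((l' - lm) - (l - lm)) / ep * vr lm 0 x"
   using vr_lip[OF oklm ep(1), of "l - lm" "l' - lm" x] l x ep by (auto simp: lm_def)
  also have "... <= vr l' 0 x + (l' - l) / ep * K" using K(3)[OF x] l ep by (intro add_left_mono mult_mono) auto
  finally show ?thesis .
 qed
 have Sne: "S ~= {}" using Om_ne by auto
 have "continuous_on S (vr l0 0)" by (rule vr_cont[OF ok0]) auto
 then obtain x0 where x0: "x0 : S" "!!x. x : S ==> vr l0 0 x <= vr l0 0 x0" using continuous_attains_sup[OF S_compact Sne] by blast
 define c0 where "c0 = 1 - vr l0 0 x0"
 have c0: "0 < c0" using lt[OF x0(1)] by (simp add: c0_def)
 have c0_le: "c0 <= 1 - vr l 0 x" if "l0 <= l" "x : S" for l x using vr_anti[OF ok0 that(2,1)] x0(2)[OF that(2)] by (simp add: c0_def)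
 have TT1: "TT l (%_. 1) x = n l x / (1 - vr l 0 x)" for l x by (simp add: TT_def n_def)
 define L where "L = K / ep / c0 + K * (K / ep) / (c0 * c0)"
 have L: "0 < L" using K ep c0 by (simp add: L_def add_pos_pos)
 have T_lip: "\<bar>TT l (%_. 1) x - TT l' (%_. 1) x\<bar> <= (l' - l) * L" if l: "l0 <= l" "l <= l'" and x: "x : S" for l l' x
 proof -
  let ?g = "vr l 0 x" and ?g' = "vr l' 0 x"
  have g: "c0 <= 1 - ?g" "c0 <= 1 - ?g'" using c0_le l x by auto
  have "TT l (%_. 1) x - TT l' (%_. 1) x = (n l x - n l' x) / (1 - ?g) + n l' x * (?g - ?g') / ((1 - ?g) * (1 - ?g'))"
  proof -
   have "s / p - s' / p' = (s - s') / p + s' * (p' - p) / (p * p')" if "p ~= 0" "p' ~= 0" for s s' p p' :: real using that by (simp add: field_simps)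
   from this[of "1 - ?g" "1 - ?g'" "n l x" "n l' x"] show ?thesis unfolding TT1 using g c0 by simp
  qed
  moreover have "0 <= (n l x - n l' x) / (1 - ?g)" using n_anti[OF l x] g c0 by simp
  moreover have "0 <= n l' x * (?g - ?g') / ((1 - ?g) * (1 - ?g'))" using vr_anti[OF good_okr[OF gl[OF l(1)]] x l(2)] g c0 by (simp add: n_def)
  moreover have "(n l x - n l' x) / (1 - ?g) <= ((l' - l) / ep * K) / c0" using n_lip[OF l x] n_anti[OF l x] g c0 by (intro frac_le) auto
  moreover have "n l' x * (?g - ?g') / ((1 - ?g) * (1 - ?g')) <= (K * ((l' - l) / ep * K)) / (c0 * c0)"
   using v_lip[OF l x] n_le[of l' x] l x g c0 K ep(1) vr_anti[OF good_okr[OF gl[OF l(1)]] x l(2)] by (intro frac_le mult_mono) (auto simp: n_def)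
  moreover have "((l' - l) / ep * K) / c0 + (K * ((l' - l) / ep * K)) / (c0 * c0) = (l' - l) * L" by (simp add: L_def algebra_simps)
  ultimately show ?thesis by linarith
 qed
 have "EX r>=l0. EX z. continuous_on S z & (ALL x:S. 0 < z x) & (ALL x:S. TT r z x = z x)"
 proof (rule cone_family_fixed_point[of l0 S TT d0 w0 x1])
  show "cone_operator S (TT l) d0" if "l0 <= l" for l using TT_cone[OF gl[OF that] lt'[OF that]] .
  show "TT l' w x <= TT l w x" if l: "l0 <= l" "l <= l'" and w: "w : cone_on S" and x: "x : S" for l l' w x unfolding TT_def
  proof (rule frac_le)
   show "enn2real (Nn l' (%x. en (w x)) x) <= enn2real (Nn l (%x. en (w x)) x)"
    using Nn_cone_finite[OF gl[OF l(1)] w x] by (intro enn2real_mono Nn_anti cone_meas w x l) auto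
   show "0 < 1 - vr l 0 x" using lt'[OF l(1) x] by simp
   show "1 - vr l 0 x <= 1 - vr l' 0 x" using vr_anti[OF good_okr[OF gl[OF l(1)]] x l(2)] by simp
  qed simp
  show "EX d>0. ALL l'>=l0. \<bar>l' - l\<bar> < d --> (ALL x:S. \<bar>TT l' (%_. 1) x - TT l (%_. 1) x\<bar> <= e)"
   if l: "l0 <= l" and e: "0 < e" for l e
  proof (intro exI[of _ "e / L"] conjI allI impI ballI)
   show "0 < e / L" using e L by simp
   fix l' x assume l': "l0 <= l'" "\<bar>l' - l\<bar> < e / L" and x: "x : S"
   have "\<bar>TT l' (%_. 1) x - TT l (%_. 1) x\<bar> <= \<bar>l' - l\<bar> * L"
   proof (cases "l <= l'")
    case True
    then show ?thesis using T_lip[OF l True x] by (simp add: abs_minus_commute)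
   next
    case False
    then show ?thesis using T_lip[OF l'(1) _ x, of l] by simp
   qed
   also have "... <= e" using l'(2) L by (simp add: less_divide_eq)
   finally show "\<bar>TT l' (%_. 1) x - TT l (%_. 1) x\<bar> <= e" .
  qed
  show "EX L. ALL l>=L. ALL x:S. TT l (%_. 1) x <= 1/2"
  proof -
   define Q where "Q = B * (D * JB * enn2real (I2 (hn lm ?e)))"
   have Q0: "0 <= Q" using B_nonneg D_pos JB_pos by (simp add: Q_def)
   have Q: "n l x <= Q / (l - lm - \<bar>lm\<bar>)" if l: "lm + \<bar>lm\<bar> < l" and x: "x : S" for l x
   proof -
    define ka where "ka = l - lm - \<bar>lm\<bar>"
    have ka: "0 < ka" using l by (simp add: ka_def)
    have "Nn (lm + (l - lm)) ?e x <= NI AM (%a. en Q * (ind {0<..} a * en (exp (- ka * (a - 0)))))" unfolding Nn_shift[OF e1(1) x] bn_def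
    proof (rule nn_integral_mono)
     fix a assume "a : space AM"
     then have a: "a : Ag" "0 < a" by (auto simp: ages_def)
     have "Sn lm (hn lm ?e) a x <= en (D * JB * exp (\<bar>lm\<bar> * a)) * I2 (hn lm ?e)" by (rule Sn_le_I2[OF mb_hn[OF e1(1)] x a(1)])
     also have "... = en (D * JB * exp (\<bar>lm\<bar> * a) * enn2real (I2 (hn lm ?e)))"
     using I D_pos JB_pos by (simp add: ennreal_mult ennreal_enn2real)
     finally have "en (beta a x) * (en (exp (- (l - lm) * a)) * Sn lm (hn lm ?e) a x)
     <= en B * (en (exp (- (l - lm) * a)) * en (D * JB * exp (\<bar>lm\<bar> * a) * enn2real (I2 (hn lm ?e))))"
     using beta_le[OF a(1) x] by (intro mult_mono ennreal_leI) auto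
     also have "... = en (B * (exp (- (l - lm) * a) * (D * JB * exp (\<bar>lm\<bar> * a) * enn2real (I2 (hn lm ?e)))))"
     using B_nonneg D_pos JB_pos by (simp add: ennreal_mult)
     also have "B * (exp (- (l - lm) * a) * (D * JB * exp (\<bar>lm\<bar> * a) * enn2real (I2 (hn lm ?e)))) = Q * exp (- ka * (a - 0))"
     proof -
     have "exp (- ka * (a - 0)) = exp (- (l - lm) * a) * exp (\<bar>lm\<bar> * a)" by (simp add: ka_def exp_add[symmetric] algebra_simps)
     then show ?thesis by (simp add: Q_def mult_ac)
     qed
     also have "en (Q * exp (- ka * (a - 0))) = en Q * (ind {0<..} a * en (exp (- ka * (a - 0))))" using a Q0 by (simp add: ennreal_mult)
     finally show "en (beta a x) * (en (exp (- (l - lm) * a)) * Sn lm (hn lm ?e) a x) <= en Q * (ind {0<..} a * en (exp (- ka * (a - 0))))" .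
    qed
    also have "... = en Q * NI AM (%a. ind {0<..} a * en (exp (- ka * (a - 0))))" by (rule nn_integral_cmult) measurable
    also have "... <= en Q * en (1 / ka)" by (intro mult_left_mono exp_integral[OF ka]) auto
    also have "... = en (Q / ka)" using Q0 ka ennreal_mult[of Q "1/ka"] by simp
    finally show ?thesis using Q0 ka unfolding n_def ka_def by (intro enn2real_leI) auto
   qed
   show ?thesis
   proof (intro exI[of _ "max l0 (lm + \<bar>lm\<bar> + 1 + 2 * Q / c0)"] allI impI ballI)
    fix l x assume l: "max l0 (lm + \<bar>lm\<bar> + 1 + 2 * Q / c0) <= l" and x: "x : S"
    have Qc: "0 <= 2 * Q / c0" using Q0 c0 by simp
    have pos: "0 < l - lm - \<bar>lm\<bar>" "2 * Q / c0 <= l - lm - \<bar>lm\<bar>" using l Qc by auto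
    have "n l x <= Q / (l - lm - \<bar>lm\<bar>)" using Q[of l x] pos x by auto
    also have "... <= c0 / 2" using pos c0 by (simp add: field_simps)
    finally have "n l x <= c0 / 2" .
    then have "TT l (%_. 1) x <= (c0 / 2) / c0" unfolding TT1 using c0_le[of l x] l x c0 by (intro frac_le) (auto simp: n_def)
    then show "TT l (%_. 1) x <= 1/2" using c0 by simp
   qed
  qed
 qed (use start in auto)
 then obtain r z where z: "l0 <= r" "continuous_on S z" "!!x. x : S ==> 0 < z x" "!!x. x : S ==> TT r z x = z x" by blast
 have zc: "z : cone_on S" using z by (auto simp: cone_on_def less_imp_le)
 have "bn (hn r (%x. en (z x))) x = en (z x)" if x: "x : S" for x
 proof -
  have v1: "vr r 0 x < 1" by (rule lt'[OF z(1) x])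
  have "enn2real (Nn r (%x. en (z x)) x) = (1 - vr r 0 x) * z x" using z(4)[OF x] v1 by (simp add: TT_def field_simps)
  then have N: "Nn r (%x. en (z x)) x = en ((1 - vr r 0 x) * z x)"
   using Nn_cone_finite[OF gl[OF z(1)] zc x] by (metis ennreal_enn2real infinity_ennreal_def)
  show ?thesis unfolding bn_hn[OF cone_meas[OF zc] x] N vn_eq_vr[OF good_okr[OF gl[OF z(1)]] order_refl x]
   using v1 z(3)[OF x] by (simp add: ennreal_mult[symmetric] ennreal_plus[symmetric] algebra_simps)
 qed
 then show ?thesis using z by blast
qed

lemma start_blowup:
 assumes ok: "okr (al + D + mut)" and le: "!!x. x : S ==> vr al 0 x <= 1" and gg: "!!r. al < r ==> good r"
  and xs: "xs : S" "!!d. 0 < d ==> (NI OM (%x. indicator (ball xs d) x / (1 - vn al 0 x))) = \<infinity>"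
 shows "EX l0>al. EX w0:cone_on S. (EX x:S. w0 x ~= 0) & (ALL x:S. w0 x <= TT l0 w0 x)"
proof -
 obtain c where c: "c > 0" "!!e x. e : BM OM ==> x : S ==> ennreal c * Kx e x <= Nn (al + 1) e x" using Nn_lower[of "al + 1"] by blast
 define dl where "dl = d0 / 3"
 have dl: "0 < dl" using d0_pos by (simp add: dl_def)
 define U where "U = ball xs (dl / 2)"
 define rn where "rn n = al + 1 / real (Suc n)" for n
 have rn: "al < rn n" "rn n <= al + 1" for n by (auto simp: rn_def)
 have ltn: "vr (rn n) 0 x < 1" if "x : S" for n x using vr_strict[OF ok that rn(1)] le[OF that] by (rule less_le_trans)
 have okn: "okr (rn n + D + mut)" for n by (rule good_okr[OF gg[OF rn(1)]])
 define X where "X n = NI OM (%z. indicator U z * en (1 / (1 - vr (rn n) 0 z)))" for n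
 obtain ep where ep: "ep > 0" "okr (al - ep + D + mut)" using okr_open[OF ok] by blast
 have conv: "(%n. vr (rn n) 0 x) \<longlonglongrightarrow> vr al 0 x" if x: "x : S" for x
 proof (rule tendsto_sandwich)
  show "\<forall>\<^sub>F n in sequentially. vr (rn n) 0 x <= vr al 0 x" by (intro always_eventually allI less_imp_le vr_strict[OF ok x rn(1)])
  show "\<forall>\<^sub>F n in sequentially. vr al 0 x - 1 / real (Suc n) * (vr (al - ep) 0 x / ep) <= vr (rn n) 0 x"
  proof (rule always_eventually, rule allI)
   fix n
   have "vr (al - ep + ep) 0 x <= vr (al - ep + (ep + 1 / real (Suc n))) 0 x + (ep + 1 / real (Suc n) - ep) / ep * vr (al - ep) 0 x"
    by (rule vr_lip[OF ep(2,1) _ _ x]) auto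
   then show "vr al 0 x - 1 / real (Suc n) * (vr (al - ep) 0 x / ep) <= vr (rn n) 0 x" by (simp add: rn_def)
  qed
  have "(%n. vr al 0 x - 1 / real (Suc n) * (vr (al - ep) 0 x / ep)) \<longlonglongrightarrow> vr al 0 x - 0 * (vr (al - ep) 0 x / ep)"
   by (intro tendsto_intros LIMSEQ_Suc[OF lim_1_over_n])
  then show "(%n. vr al 0 x - 1 / real (Suc n) * (vr (al - ep) 0 x / ep)) \<longlonglongrightarrow> vr al 0 x" by simp
 qed simp
 have econv: "(%n. en (1 / (1 - vr (rn n) 0 x))) \<longlonglongrightarrow> inverse (1 - vn al 0 x)" if x: "x : S" for x
 proof -
  have "(%n. en (1 - vr (rn n) 0 x)) \<longlonglongrightarrow> en (1 - vr al 0 x)" by (intro tendsto_intros conv x)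
  then have "(%n. inverse (en (1 - vr (rn n) 0 x))) \<longlonglongrightarrow> inverse (en (1 - vr al 0 x))"
   using continuous_on_inverse_ennreal[OF continuous_on_id, of UNIV] by (auto simp: continuous_on_eq_continuous_at isCont_def intro: isCont_tendsto_compose)
  moreover have "inverse (en (1 - vr (rn n) 0 x)) = en (1 / (1 - vr (rn n) 0 x))" for n
   using ltn[OF x, of n] by (simp add: inverse_ennreal inverse_eq_divide)
  moreover have "en (1 - vr al 0 x) = 1 - vn al 0 x" unfolding vn_eq_vr[OF ok order_refl x] using ennreal_minus[of "vr al 0 x" 1] by simp
  ultimately show ?thesis by simp
 qed
 have vm: "(%z. vr l 0 z) : BM OM" if "okr (l + D + mut)" for l by (rule cont_OM[OF vr_cont[OF that]]) auto
 have Um[measurable]: "(%z. indicator U z :: ennreal) : BM OM"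
 proof -
  have "(indicator U :: _ => ennreal) : borel_measurable borel" unfolding U_def by (intro borel_measurable_indicator borel_open open_ball)
  from measurable_compose[OF id_OM this] show ?thesis .
 qed
 have "EX n. en (2 / (c * j0)) < X n"
 proof (rule ccontr)
  assume "\<nexists>n. en (2 / (c * j0)) < X n"
  then have Xle: "X n <= en (2 / (c * j0))" for n by (simp add: not_less)
  have "NI OM (%x. indicator U x / (1 - vn al 0 x)) = NI OM (%x. liminf (%n. indicator U x * en (1 / (1 - vr (rn n) 0 x))))"
  proof (rule nn_integral_cong)
   fix x assume "x : space OM"
   then have x: "x : S" by (simp add: Om_S)
   show "indicator U x / (1 - vn al 0 x) = liminf (%n. indicator U x * en (1 / (1 - vr (rn n) 0 x)))"
   proof (cases "x : U")
    case True
    have "liminf (%n. en (1 / (1 - vr (rn n) 0 x))) = inverse (1 - vn al 0 x)" by (rule lim_imp_Liminf[OF _ econv[OF x]]) simp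
    then show ?thesis using True by (simp add: divide_ennreal_def)
   next
    case False
    then show ?thesis by (simp add: divide_ennreal_def Liminf_const)
   qed
  qed
  also have "... <= liminf X" unfolding X_def using vm[OF okn] by (intro nn_integral_liminf) auto
  also have "... <= en (2 / (c * j0))" using Xle by (intro Liminf_le always_eventually) auto
  finally show False using xs(2)[of "dl / 2"] dl by (auto simp: U_def top_unique)
 qed
 then obtain n where n: "en (2 / (c * j0)) < X n" by blast
 define l0 where "l0 = rn n"
 have l0: "al < l0" "l0 <= al + 1" using rn by (auto simp: l0_def)
 have pos: "0 < 1 - vr l0 0 x" if "x : S" for x using ltn[OF that, of n] by (simp add: l0_def)
 define f where "f x = max 0 (1 - dist x xs / dl)" for x
 define w0 where "w0 x = f x / (1 - vr l0 0 x)" for x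
 have okl0: "okr (l0 + D + mut)" using okn[of n] by (simp add: l0_def)
 have w0c: "w0 : cone_on S"
 proof -
  have "continuous_on S (vr l0 0)" by (rule vr_cont[OF okl0]) auto
  then have "continuous_on S w0" unfolding w0_def f_def using pos dl by (intro continuous_intros) force+
  moreover have "0 <= w0 x" if "x : S" for x unfolding w0_def f_def using pos[OF that] by (intro divide_nonneg_pos) auto
  ultimately show ?thesis by (auto simp: cone_on_def)
 qed
 have "w0 xs ~= 0" using pos[OF xs(1)] by (simp add: w0_def f_def)
 moreover have "w0 x <= TT l0 w0 x" if x: "x : S" for x
 proof -
  let ?N = "Nn l0 (%x. en (w0 x)) x"
  have "f x <= enn2real ?N"
  proof (cases "dist x xs < dl")
   case False
   then have "1 - dist x xs / dl <= 0" using dl by (simp add: field_simps)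
   then show ?thesis by (simp add: f_def)
  next
   case True
   have [measurable]: "(%x. en (w0 x)) : BM OM" by (rule cone_meas[OF w0c])
   have [measurable]: "(%z. vr l0 0 z) : BM OM" by (rule vm[OF okl0])
   have "en (j0 / 2) * X n <= Kx (%x. en (w0 x)) x"
   proof -
    have "en (j0 / 2) * X n = NI OM (%z. en (j0 / 2) * (indicator U z * en (1 / (1 - vr l0 0 z))))"
     unfolding X_def l0_def[symmetric] by (rule nn_integral_cmult[symmetric]) measurable
    also have "... <= Kx (%x. en (w0 x)) x" unfolding Kx_def
    proof (rule nn_integral_mono)
     fix z assume "z : space OM"
     then have z: "z : S" by (simp add: Om_S)
     show "en (j0 / 2) * (indicator U z * en (1 / (1 - vr l0 0 z))) <= en (J (x - z)) * en (w0 z)"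
     proof (cases "z : U")
     case zU: True
     have dz: "dist z xs < dl / 2" using zU by (simp add: U_def dist_commute)
     have "dist x z <= dist x xs + dist z xs" by (metis dist_commute dist_triangle)
     also have "... < d0" using True dz dl by (simp add: dl_def)
     finally have "j0 <= J (x - z)" by (intro J_ge) (simp add: dist_norm)
     moreover have "1 / 2 <= f z" using dz dl by (simp add: f_def field_simps)
     ultimately have "j0 * (1 / 2 / (1 - vr l0 0 z)) <= J (x - z) * w0 z"
     unfolding w0_def using j0_pos pos[OF z] by (intro mult_mono divide_right_mono) (auto intro: order_trans[OF _ \<open>1 / 2 <= f z\<close>])
     then have "en (j0 / 2 * (1 / (1 - vr l0 0 z))) <= en (J (x - z) * w0 z)" by (intro ennreal_leI) simp
     then show ?thesis using zU j0_pos J_nonneg cone_onD(2)[OF w0c z] pos[OF z] ennreal_mult[of "j0/2" "1 / (1 - vr l0 0 z)"]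
     by (simp add: ennreal_mult)
     qed simp
    qed
    finally show ?thesis .
   qed
   then have "en c * (en (j0 / 2) * X n) <= en c * Kx (%x. en (w0 x)) x" by (rule mult_left_mono) simp
   also have "... <= Nn (al + 1) (%x. en (w0 x)) x" by (rule c(2)[OF _ x]) measurable
   also have "... <= ?N" by (rule Nn_anti[OF _ x l0(2)]) measurable
   finally have "en c * (en (j0 / 2) * X n) <= ?N" .
   moreover have "1 <= en c * (en (j0 / 2) * X n)"
   proof -
    have "1 = en c * (en (j0 / 2) * en (2 / (c * j0)))"
    proof -
     have "c * (j0 / 2 * (2 / (c * j0))) = 1" using c j0_pos by simp
     then have "en (c * (j0 / 2 * (2 / (c * j0)))) = 1" by (simp only: ennreal_1)
     then show ?thesis using c(1) j0_pos by (subst (asm) ennreal_mult, simp, simp, subst (asm) ennreal_mult) auto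
    qed
    also have "... <= en c * (en (j0 / 2) * X n)" using n by (intro mult_left_mono) auto
    finally show ?thesis .
   qed
   ultimately have "1 <= ?N" by (rule order_trans[rotated])
   then have "enn2real 1 <= enn2real ?N" by (intro enn2real_mono) (use Nn_cone_finite[OF gg[OF l0(1)] w0c x] in auto)
   moreover have "f x <= 1" using dl by (simp add: f_def)
   ultimately show ?thesis by simp
  qed
  then show ?thesis unfolding w0_def[of x] TT_def using pos[OF x] by (intro divide_right_mono) auto
 qed
 ultimately show ?thesis using l0(1) w0c xs(1) by blast
qed

end

lemma ennreal_minus_le_of_le_add: "a <= c + b ==> b ~= top ==> a - b <= c" for a b c :: ennreal
 by (metis ennreal_add_diff_cancel_right ennreal_minus_mono order_refl)

lemma ennreal_le_minus_add: "a <= (a - b) + b" for a b :: ennreal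
proof (cases "b <= a")
 case False
 then have "a <= b" by simp
 also have "b <= (a - b) + b" by (simp add: add_increasing)
 finally show ?thesis .
qed (simp add: diff_add_cancel_ennreal)

context age_model_w
begin

lemma bn_mono_AE: "AE a in AM. F a x <= G a x ==> bn F x <= bn G x"
 unfolding bn_def by (intro nn_integral_mono_AE) (auto intro!: mult_left_mono elim!: eventually_mono)

lemma mb_minus: "mb F ==> mb G ==> mb (%a x. F a x - G a x)" unfolding mb_def by measurable

lemma Volterra_zero:
 assumes "good r" "mb H" "I2 H < \<infinity>" "!!a x. a : Ag ==> x : Om ==> H a x <= Sn r H a x"
 shows "I2 H = 0"
proof -
 have 0: "mb (%a x. 0)" by (simp add: mb_def)
 obtain C where C: "!!H g. mb H ==> mb g ==> I2 H < \<infinity> ==>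
   (AE p in PM. H (fst p) (snd p) <= g (fst p) (snd p) + Sn r H (fst p) (snd p)) ==> I2 H <= en C * I2 g" using Volterra_bound[OF assms(1)] by blast
 have "I2 H <= en C * I2 (%a x. 0)" by (rule C[OF assms(2) 0 assms(3)]) (use assms(4) in \<open>auto simp: space_pair_measure intro!: AE_I2\<close>)
 then show ?thesis by (simp add: I2_def)
qed

lemma FTC_AM:
 assumes a: "a : Ag" and c: "0 <= c"
 shows "NI AM (%s. ind {..<a} s * en (c * exp (c * s))) = en (exp (c * a) - 1)"
proof -
 have a0: "0 < a" using a by (simp add: ages_def)
 have "(NI AM (%s. ind {..<a} s * en (c * exp (c * s))))
   = NI lebesgue (%s. ind {..<a} s * en (c * exp (c * s)) * indicator (Ag) s)"
  unfolding AM_def by (rule nn_integral_restrict_space) (use ages_sets in simp)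
 also have "... = NI lebesgue (%s. en (c * exp (c * s)) * ind {0..a} s)"
 proof (rule nn_integral_cong_AE)
  have "AE s in lebesgue. s ~= 0" "AE s in lebesgue. s ~= a"
   using AE_completion[OF AE_lborel_singleton[of 0]] AE_completion[OF AE_lborel_singleton[of a]] by auto
  then show "AE s in lebesgue. ind {..<a} s * en (c * exp (c * s)) * indicator (Ag) s = en (c * exp (c * s)) * ind {0..a} s"
  proof eventually_elim
   case (elim s)
   have "s : Ag" if "0 < s" "s < a" using ages_down[OF a, of s] that by simp
   then show ?case using elim by (auto simp: indicator_def ages_def)
  qed
 qed
 also have "... = NI lborel (%s. en (c * exp (c * s)) * ind {0..a} s)" by (rule nn_integral_completion)
 also have "... = en (exp (c * a) - exp (c * 0))" by (rule nn_integral_FTC_Icc) (use a0 c in \<open>auto intro!: derivative_eq_intros\<close>)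
 finally show ?thesis by simp
qed

lemma start_unbounded_age:
 assumes inf: "ahat = \<infinity>" and phi: "continuous_on S phi" "!!x. x : S ==> 0 < phi x"
  and eig: "!!x. x : S ==> Kx (%x. en (phi x)) x = en (kk * phi x)"
  and mp[measurable]: "mp : BM AM" and mp0: "mp 0 = 0"
  and mp_ge: "!!a s x. a : Ag ==> 0 <= s ==> s <= a ==> x : S ==> mm a x - mm s x <= mp a - mp s"
  and lh: "- D - mut < lh" "1 <= NI AM (%a. en (b0 a * exp (- (lh + D) * a - mp a)))"
  and lt: "!!x. x : S ==> vr (lh + D * kk) 0 x < 1"
 shows "ALL x:S. phi x <= TT (lh + D * kk) phi x"
proof
 define l0 where "l0 = lh + D * kk"
 define ph where "ph x = en (phi x)" for x
 define ps where "ps a x = en (phi x * exp (- (lh + D) * a - mp a))" for a x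
 have g: "good l0" using lh(1) unfolding good_def l0_def by simp
 have ok: "okr (l0 + D + mut)" by (rule good_okr[OF g])
 have pc: "phi : cone_on S" using phi by (auto simp: cone_on_def less_imp_le)
 have phm[measurable]: "ph : BM OM" unfolding ph_def by (rule cone_meas[OF pc])
 have phm'[measurable]: "phi : BM OM" by (rule cont_OM[OF phi(1)])
 have mbps: "mb ps" unfolding mb_def ps_def by measurable
 define h where "h = hn l0 ph"
 have mbh: "mb h" unfolding h_def by (rule mb_hn[OF phm])
 have h_eq: "h a x = Rn l0 ph a x + Sn l0 h a x" if "x : S" for a x unfolding h_def by (rule hn_eq[OF phm that])
 have sub: "ps a x <= Rn l0 ph a x + Sn l0 ps a x" if a: "a : Ag" and x: "x : S" for a x
 proof -
  define E where "E = phi x * exp (- (l0 + D) * a - mp a)"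
  have E0: "0 <= E" using phi(2)[OF x] by (simp add: E_def)
  have a0: "0 < a" using a by (simp add: ages_def)
  have "mm 0 x = 0" by (simp add: mm_def)
  then have "mm a x <= mp a" using mp_ge[OF a, of 0 x] a0 x mp0 by simp
  then have "E <= exp (- l0 * a) * qq a x * phi x" unfolding E_def qq_def using phi(2)[OF x] by (simp add: exp_add[symmetric] algebra_simps)
  then have 1: "en E <= Rn l0 ph a x" unfolding Rn_def ph_def using phi(2)[OF x] by (simp add: ennreal_mult[symmetric] ennreal_leI)
  have Kchi: "Kn ps s x = en (exp (- (lh + D) * s - mp s)) * en (kk * phi x)" for s
  proof -
   have "Kn ps s x = NI OM (%z. en (exp (- (lh + D) * s - mp s)) * (en (J (x - z)) * ph z))" unfolding Kn_def ps_def ph_def using phi(2) Om_S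
    by (intro nn_integral_cong) (auto simp: ennreal_mult'' mult_ac)
   also have "... = en (exp (- (lh + D) * s - mp s)) * Kx ph x" unfolding Kx_def by (rule nn_integral_cmult) measurable
   finally show ?thesis using eig[OF x] by (simp add: ph_def[abs_def])
  qed
  have "en E * en (exp (D * kk * a) - 1) = NI AM (%s. en E * (ind {..<a} s * en (D * kk * exp (D * kk * s))))"
   using FTC_AM[OF a, of "D * kk"] D_pos kk_pos by (subst nn_integral_cmult) auto
  also have "... <= Sn l0 ps a x" unfolding Sn_def Vn_def
  proof (rule nn_integral_mono)
   fix s assume "s : space AM"
   then have s: "s : Ag" "0 <= s" by (auto simp: ages_def)
   show "en E * (ind {..<a} s * en (D * kk * exp (D * kk * s))) <= ind {..<a} s * en (exp (- l0 * (a - s)) * (qq a x / qq s x)) * (en D * Kn ps s x)"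
   proof (cases "s < a")
    case True
    have q: "exp (- D * (a - s) - (mp a - mp s)) <= qq a x / qq s x"
    proof -
     have "qq a x / qq s x = exp (- D * (a - s) - (mm a x - mm s x))" by (simp add: qq_def exp_diff[symmetric] algebra_simps)
     then show ?thesis using mp_ge[OF a s(2) _ x] True by simp
    qed
    have "E * (D * kk * exp (D * kk * s)) = (D * (kk * phi x)) * (exp (- (l0 + D) * a - mp a) * exp (D * kk * s))" by (simp add: E_def mult_ac)
    also have "exp (- (l0 + D) * a - mp a) * exp (D * kk * s) = exp (- l0 * (a - s)) * exp (- D * (a - s) - (mp a - mp s)) * exp (- (lh + D) * s - mp s)"
     by (simp add: l0_def exp_add[symmetric] algebra_simps)
    also have "(D * (kk * phi x)) * ... <= (D * (kk * phi x)) * (exp (- l0 * (a - s)) * (qq a x / qq s x) * exp (- (lh + D) * s - mp s))"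
     using q D_pos kk_pos phi(2)[OF x] by (intro mult_left_mono mult_right_mono) auto
    also have "... = exp (- l0 * (a - s)) * (qq a x / qq s x) * (D * (exp (- (lh + D) * s - mp s) * (kk * phi x)))" by (simp add: mult_ac)
    finally have "en (E * (D * kk * exp (D * kk * s))) <= en (exp (- l0 * (a - s)) * (qq a x / qq s x) * (D * (exp (- (lh + D) * s - mp s) * (kk * phi x))))"
     by (rule ennreal_leI)
    also have "en (exp (- l0 * (a - s)) * (qq a x / qq s x) * (D * (exp (- (lh + D) * s - mp s) * (kk * phi x))))
     = en (exp (- l0 * (a - s)) * (qq a x / qq s x)) * (en D * Kn ps s x)" unfolding Kchi using D_pos kk_pos phi(2)[OF x]
     by (subst ennreal_mult, simp, simp, subst ennreal_mult[of D], simp, simp, subst ennreal_mult[of "exp (- (lh + D) * s - mp s)"]) auto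
    finally show ?thesis using True E0 D_pos kk_pos by (simp add: ennreal_mult')
   qed simp
  qed
  finally have 2: "en E * en (exp (D * kk * a) - 1) <= Sn l0 ps a x" .
  have e1: "1 <= exp (D * kk * a)" using D_pos kk_pos a0 by simp
  have "exp (- (lh + D) * a - mp a) = exp (- (l0 + D) * a - mp a) * exp (D * kk * a)"
   unfolding exp_add[symmetric] by (rule arg_cong[where f=exp]) (simp add: l0_def algebra_simps)
  then have "ps a x = en (E * exp (D * kk * a))" by (simp only: ps_def E_def mult.assoc)
  also have "... = en (E + E * (exp (D * kk * a) - 1))" by (simp add: algebra_simps)
  also have "... = en E + en E * en (exp (D * kk * a) - 1)" using E0 e1 by (simp add: ennreal_plus ennreal_mult)
  also have "... <= Rn l0 ph a x + Sn l0 ps a x" by (intro add_mono 1 2)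
  finally show ?thesis .
 qed
 have Ips: "I2 ps < \<infinity>"
 proof -
  have okh: "okr (lh + D + mut)" using lh by (simp add: okr_def)
  have "I2 ps <= I2 (%a x. en (ind {0<..} a * exp (- (lh + D + mut) * (a - 0))) * ph x)"
  proof (rule I2_mono)
   fix a x assume a: "a : Ag" and x: "x : Om"
   have a0: "0 < a" using a by (simp add: ages_def)
   have "mut * a <= mm a x - mm 0 x" using mm_diff_bounds(1)[OF a, of 0 x] a0 Om_S[OF x] by simp
   also have "... <= mp a" using mp_ge[OF a, of 0 x] a0 Om_S[OF x] mp0 by simp
   finally have "phi x * exp (- (lh + D) * a - mp a) <= exp (- (lh + D + mut) * a) * phi x" using phi(2)[OF Om_S[OF x]] by (simp add: algebra_simps)
   then show "ps a x <= en (ind {0<..} a * exp (- (lh + D + mut) * (a - 0))) * ph x"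
    unfolding ps_def ph_def using a0 by (simp add: ennreal_mult[symmetric] ennreal_leI ennreal_mult'[symmetric])
  qed
  also have "... = NI AM (%a. en (ind {0<..} a * exp (- (lh + D + mut) * (a - 0))) * NI OM (%x. ph x))"
   unfolding I2_def by (intro nn_integral_cong nn_integral_cmult) measurable
  also have "... = NI AM (%a. en (ind {0<..} a * exp (- (lh + D + mut) * (a - 0)))) * NI OM (%x. ph x)" by (rule nn_integral_multc) measurable
  also have "... < \<infinity>" using exp_integrable[OF okh, of 0] cont_int_finite[OF phi(1)]
   by (auto simp: ennreal_mult_less_top ph_def[abs_def] nn_integral_eq_integral)
  finally show ?thesis .
 qed
 define d where "d a x = ps a x - h a x" for a x
 have mbd: "mb d" unfolding d_def by (rule mb_minus[OF mbps mbh])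
 have "I2 d <= I2 ps" by (rule I2_mono) (simp add: d_def diff_le_self_ennreal)
 then have Id: "I2 d < \<infinity>" using Ips by (rule order_le_less_trans)
 have "d a x <= Sn l0 d a x" if a: "a : Ag" and x: "x : Om" for a x
 proof (cases "h a x = top")
  case True
  then show ?thesis by (simp add: d_def ennreal_minus_top ps_def)
 next
  case False
  have xS: "x : S" using x by (rule Om_S)
  have "Sn l0 ps a x <= Sn l0 (%a x. d a x + h a x) a x" by (rule Sn_mono) (simp add: d_def ennreal_le_minus_add)
  also have "... = Sn l0 d a x + Sn l0 h a x" by (rule Sn_add[OF mbd mbh xS])
  finally have "ps a x <= Rn l0 ph a x + (Sn l0 d a x + Sn l0 h a x)" by (rule order_trans[OF sub[OF a xS] add_left_mono])
  then have "ps a x <= Sn l0 d a x + h a x" unfolding h_eq[OF xS] by (simp add: ac_simps)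
  then show ?thesis using ennreal_minus_le_of_le_add[OF _ False] by (simp add: d_def)
 qed
 then have "I2 d = 0" by (intro Volterra_zero[OF g mbd Id])
 then have "AE p in PM. d (fst p) (snd p) = 0" unfolding I2_pair[OF mbd] using mbd by (subst (asm) nn_integral_0_iff_AE) (auto simp: mb_def)
 then have AEle: "AE p in PM. ps (fst p) (snd p) <= h (fst p) (snd p)" by eventually_elim (simp add: d_def ennreal_minus_eq_0)
 have le: "ps a x <= h a x" if a: "a : Ag" and x: "x : S" for a x
  using sub[OF a x] Sn_mono_AE[OF AEle, of l0 a x] unfolding h_eq[OF x] by (meson add_left_mono order_trans)
 fix x assume x: "x : S"
 have "ph x <= ph x * NI AM (%a. en (b0 a * exp (- (lh + D) * a - mp a)))" using mult_left_mono[OF lh(2), of "ph x"] by simp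
 also have "... = NI AM (%a. ph x * en (b0 a * exp (- (lh + D) * a - mp a)))" by (rule nn_integral_cmult[symmetric]) measurable
 also have "... <= bn h x" unfolding bn_def
 proof (rule nn_integral_mono)
  fix a assume "a : space AM"
  then have a: "a : Ag" by simp
  have "ph x * en (b0 a * exp (- (lh + D) * a - mp a)) = en (b0 a) * ps a x"
   unfolding ph_def ps_def using b0_nonneg[OF a] phi(2)[OF x] by (simp add: ennreal_mult mult_ac)
  also have "... <= en (beta a x) * h a x" using beta_ge[OF a x] by (intro mult_mono ennreal_leI le a x) auto
  finally show "ph x * en (b0 a * exp (- (lh + D) * a - mp a)) <= en (beta a x) * h a x" .
 qed
 also have "bn h x = vn l0 0 x * ph x + Nn l0 ph x" unfolding h_def by (rule bn_hn[OF phm x])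
 finally have le2: "ph x <= Nn l0 ph x + en (vr l0 0 x) * ph x" unfolding vn_eq_vr[OF ok order_refl x] by (simp add: add.commute)
 have Nfin: "Nn l0 ph x < \<infinity>" unfolding ph_def by (rule Nn_cone_finite[OF g pc x])
 have "enn2real (ph x) <= enn2real (Nn l0 ph x) + vr l0 0 x * enn2real (ph x)" by (rule enn2real_le_add[OF le2 Nfin]) (auto simp: ph_def)
 then have "phi x <= enn2real (Nn l0 ph x) + vr l0 0 x * phi x" using phi(2)[OF x] by (simp add: ph_def)
 then have "phi x * (1 - vr l0 0 x) <= enn2real (Nn l0 ph x)" by (simp add: algebra_simps)
 then show "phi x <= TT (lh + D * kk) phi x" using lt[OF x] unfolding TT_def l0_def[symmetric] ph_def[abs_def] by (simp add: pos_le_divide_eq l0_def)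
qed

end

locale age_eig = age_model_w Om ahat D mut B M JB j0 d0 J beta mu b0 phis kk
 for Om :: "(real^'n) set" and ahat D mut B M JB j0 d0 J beta mu b0 phis kk +
 fixes r :: real and z :: "real^'n => real"
 assumes r_good: "good r" and r_lt: "!!x. x : closure Om ==> vr r 0 x < 1"
  and z_cont: "continuous_on (closure Om) z" and z_pos: "!!x. x : closure Om ==> 0 < z x"
  and z_eq: "!!x. x : closure Om ==> bn (hn r (%x. en (z x))) x = en (z x)"
begin

definition zn :: "real^'n => ennreal" where "zn x = en (z x)"

lemma zn_meas[measurable]: "zn : BM OM" unfolding zn_def using cont_OM[OF z_cont] by simp
lemma zn_int: "NI OM (%x. zn x) < \<infinity>" unfolding zn_def by (rule cont_int_finite[OF z_cont])
lemma zn_pos: "x : S ==> 0 < zn x" using z_pos by (simp add: zn_def)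

lemma rho: assumes "r <= rh"
 shows "good rh" "okr (rh + D + mut)" "!!x. x : S ==> vr rh 0 x < 1"
proof -
 show g: "good rh" by (rule good_mono[OF r_good assms])
 then show "okr (rh + D + mut)" by (rule good_okr)
 show "vr rh 0 x < 1" if "x : S" for x using vr_anti[OF good_okr[OF r_good] that assms] r_lt[OF that] by simp
qed

definition kz :: "real => real => real^'n => ennreal" where "kz rh = hn rh zn"

lemma mb_kz: "mb (kz rh)" unfolding kz_def by (rule mb_hn[OF zn_meas])
lemma kz_I2: "r <= rh ==> I2 (kz rh) < \<infinity>" unfolding kz_def by (rule hn_I2_finite[OF rho(1) zn_meas zn_int])
lemma kz_eq: "x : S ==> kz rh a x = Rn rh zn a x + Sn rh (kz rh) a x" unfolding kz_def by (rule hn_eq[OF zn_meas])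
lemma kz_fin: "r <= rh ==> a : Ag ==> x : S ==> kz rh a x < \<infinity>"
proof -
 assume *: "r <= rh" "a : Ag" "x : S"
 have "Sn rh (kz rh) a x <= en (D * JB * exp (\<bar>rh\<bar> * a)) * I2 (kz rh)" by (rule Sn_le_I2[OF mb_kz *(3,2)])
 also have "... < \<infinity>" using kz_I2[OF *(1)] by (simp add: ennreal_mult_less_top)
 finally show ?thesis unfolding kz_eq[OF *(3)] by (simp add: Rn_def zn_def ennreal_mult_less_top)
qed
lemma kz_pos: "x : S ==> 0 < kz rh a x" unfolding kz_eq using Rn_pos[OF zn_pos] by (simp add: add_pos_nonneg)
lemma kz_AM: "x : S ==> (%a. kz rh a x) : BM AM" using Rn_AM[of x "%a. a" AM rh zn] Sn_AM[OF _ mb_kz, of x "%a. a" AM rh rh] by (simp add: kz_eq)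
lemma bn_kz: "x : S ==> bn (kz r) x = zn x" unfolding kz_def zn_def[abs_def] using z_eq by simp

lemma bn_kz_strict:
 assumes "r < rh"
 shows "EX ta<1. 0 <= ta & (ALL x:S. bn (kz rh) x <= en ta * zn x)"
proof -
 have rr: "r <= rh" using assms by simp
 define f where "f x = vr rh 0 x + enn2real (Nn rh zn x) / z x" for x
 have fc: "continuous_on S f" unfolding f_def Nn_def
  by (intro continuous_intros vr_cont[OF rho(2)[OF rr]] bn_Sn_cont[OF rho(2)[OF rr]] mb_hn zn_meas hn_I2_finite[OF rho(1)[OF rr]] zn_int z_cont)
   (use z_pos in force)+
 have eq: "bn (kz rh) x = en (f x) * zn x" if x: "x : S" for x
 proof -
  obtain t where t: "Nn rh zn x = en t" "0 <= t" using Nn_finite[OF rho(1)[OF rr] zn_meas zn_int x] by (cases "Nn rh zn x") auto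
  show ?thesis unfolding kz_def bn_hn[OF zn_meas x] vn_eq_vr[OF rho(2)[OF rr] order_refl x] f_def t
   using z_pos[OF x] t(2) by (simp add: zn_def ennreal_mult[symmetric] ennreal_plus[symmetric] distrib_right del: ennreal_plus)
 qed
 have f0: "0 <= f x" if "x : S" for x using z_pos[OF that] by (simp add: f_def)
 have f1: "f x < 1" if x: "x : S" for x
 proof -
  have "bn (%a x. en (exp (- (rh - r) * a)) * kz r a x) x < bn (kz r) x"
   by (rule bn_strict[where Y="kz r", OF x kz_AM[OF x] kz_pos[OF x]]) (use assms in \<open>auto simp: bn_kz[OF x] zn_def\<close>)
  moreover have "bn (kz rh) x = bn (%a x. en (exp (- (rh - r) * a)) * kz r a x) x"
   unfolding bn_def kz_def using hn_shift[OF zn_meas x, of r "rh - r"] by simp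
  ultimately have "en (f x) * zn x < zn x" by (simp add: eq[OF x] bn_kz[OF x])
  then have "f x * z x < z x" using f0[OF x] z_pos[OF x] by (simp add: zn_def ennreal_mult[symmetric] ennreal_less_iff)
  then show ?thesis using z_pos[OF x] by simp
 qed
 have Sne: "S ~= {}" using Om_ne by auto
 obtain x0 where x0: "x0 : S" "!!x. x : S ==> f x <= f x0" using continuous_attains_sup[OF S_compact Sne fc] by blast
 show ?thesis using f1[OF x0(1)] f0[OF x0(1)] x0(2) by (intro exI[of _ "f x0"]) (auto simp: eq intro!: mult_right_mono ennreal_leI)
qed

definition Wc :: "real => real^'n => ennreal" where "Wc rh x = en (1 / (1 - vr rh 0 x))"

lemma Wc_eq: "r <= rh ==> x : S ==> 1 + vn rh 0 x * Wc rh x = Wc rh x"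
proof -
 assume *: "r <= rh" "x : S"
 have p: "0 < 1 - vr rh 0 x" using rho(3)[OF *] by simp
 have "1 + vr rh 0 x * (1 / (1 - vr rh 0 x)) = 1 / (1 - vr rh 0 x)" using p by (simp add: field_simps)
 then have "en (1 + vr rh 0 x * (1 / (1 - vr rh 0 x))) = Wc rh x" by (simp add: Wc_def)
 then show ?thesis unfolding vn_eq_vr[OF rho(2)[OF *(1)] order_refl *(2)] Wc_def
  using p by (subst (asm) ennreal_plus, simp, simp, subst (asm) ennreal_mult) auto
qed

lemma Wc_cont: "r <= rh ==> continuous_on S (%x. 1 / (1 - vr rh 0 x))" using rho(3) by (intro continuous_intros vr_cont[OF rho(2)]) force+

lemma Wc_meas[measurable]: "r <= rh ==> Wc rh : BM OM" unfolding Wc_def using cont_OM[OF Wc_cont] by simp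

definition E1 :: "real => (real => real^'n => ennreal) => real^'n => ennreal" where
 "E1 rh H x = Wc rh x * bn (Sn rh H) x"

definition yy :: "real => (real => real^'n => ennreal) => real => real^'n => ennreal" where
 "yy rh H a x = Sn rh H a x + Rn rh (E1 rh H) a x"

context
 fixes rh :: real and H :: "real => real^'n => ennreal"
 assumes rr: "r <= rh" and mbH: "mb H" and IH: "I2 H < \<infinity>"
begin

lemma E1_meas: "E1 rh H : BM OM" unfolding E1_def using Wc_meas[OF rr] bn_OM[OF mb_Sn[OF mbH]] by measurable

lemma E1_real: "x : S ==> E1 rh H x = en (enn2real (E1 rh H x))"
 using bn_Sn_finite[OF rho(2)[OF rr] mbH IH] by (simp add: E1_def Wc_def ennreal_mult_less_top ennreal_enn2real)

lemma E1_cont: "continuous_on S (%x. enn2real (E1 rh H x))"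
proof -
 have "continuous_on S (%x. (1 / (1 - vr rh 0 x)) * enn2real (bn (Sn rh H) x))"
  by (intro continuous_on_mult Wc_cont[OF rr] bn_Sn_cont[OF rho(2)[OF rr] mbH IH])
 moreover have "enn2real (E1 rh H x) = (1 / (1 - vr rh 0 x)) * enn2real (bn (Sn rh H) x)" if "x : S" for x
  using rho(3)[OF rr that] by (simp add: E1_def Wc_def enn2real_mult)
 ultimately show ?thesis using continuous_on_cong by force
qed

lemma mb_yy: "mb (yy rh H)" unfolding yy_def using mb_add[OF mb_Sn[OF mbH] mb_Rn[OF E1_meas]] .

lemma yy_I2: "I2 (yy rh H) < \<infinity>"
proof -
 have "NI OM (%x. E1 rh H x) = NI OM (%x. en (enn2real (E1 rh H x)))" by (intro nn_integral_cong E1_real) (simp add: Om_S)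
 also have "... < \<infinity>" by (rule cont_int_finite[OF E1_cont])
 finally have "I2 (Rn rh (E1 rh H)) < \<infinity>" by (rule I2_Rn_finite[OF rho(2)[OF rr] E1_meas])
 moreover have "I2 (Sn rh H) < \<infinity>" by (rule I2_Sn_finite[OF rho(2)[OF rr] mbH IH])
 ultimately show ?thesis unfolding yy_def by (subst I2_add[OF mb_Sn[OF mbH] mb_Rn[OF E1_meas]]) simp
qed

lemma bn_yy: "x : S ==> bn (yy rh H) x = E1 rh H x"
proof -
 assume x: "x : S"
 have "bn (yy rh H) x = bn (Sn rh H) x + vn rh 0 x * E1 rh H x" unfolding yy_def using Sn_AM[OF x mbH, of "%a. a"] Rn_AM[OF x, of "%a. a"]
  by (subst bn_add[OF x]) (auto simp: bn_Rn[OF x])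
 also have "... = (1 + vn rh 0 x * Wc rh x) * bn (Sn rh H) x" by (simp add: E1_def distrib_right mult.assoc)
 finally show ?thesis by (simp add: Wc_eq[OF rr x] E1_def)
qed

context
 fixes g :: "real => real^'n => ennreal"
 assumes mbg: "mb g"
  and le: "AE p in PM. H (fst p) (snd p) <= g (fst p) (snd p) + Rn rh (bn H) (fst p) (snd p) + Sn rh H (fst p) (snd p)"
begin

definition g0 :: "real => real^'n => ennreal" where
 "g0 a x = g a x + Rn rh (%x. Wc rh x * bn g x) a x"

lemma mb_g0: "mb g0" unfolding g0_def using rr bn_OM[OF mbg] by (intro mb_add[OF mbg] mb_Rn) measurable

lemma H_le: "AE p in PM. H (fst p) (snd p) <= g0 (fst p) (snd p) + yy rh H (fst p) (snd p)"
proof -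
 have "NI OM (%x. bn H x) <= NI OM (%x. en B * NI AM (%a. H a x))" using section_meas2[OF mbH] by (intro nn_integral_mono bn_le) (auto simp: Om_S)
 also have "... = en B * I2 H"
 proof -
  note [measurable] = mbD[OF mbH]
  show ?thesis unfolding I2_swap[OF mbH] by (rule nn_integral_cmult) measurable
 qed
 also have "... < \<infinity>" using IH by (simp add: ennreal_mult_less_top)
 finally have "AE x in OM. bn H x ~= \<infinity>" using bn_OM[OF mbH] by (intro nn_integral_PInf_AE) auto
 then have bnH: "AE x in OM. bn H x <= Wc rh x * bn g x + E1 rh H x" using AE_pair_swap[OF le] AE_space
 proof eventually_elim
  case (elim x)
  then have x: "x : Om" "x : S" by (auto simp: Om_S)
  have m: "(%a. g a x) : BM AM" "(%a. Rn rh (bn H) a x) : BM AM" "(%a. Sn rh H a x) : BM AM"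
   using section_meas2[OF mbg x(1)] Rn_AM[OF x(2), of "%a. a"] Sn_AM[OF x(2) mbH, of "%a. a"] by auto
  have "bn H x <= bn (%a x. g a x + Rn rh (bn H) a x + Sn rh H a x) x" by (rule bn_mono_AE) (rule elim(2))
  also have "... = bn (%a x. g a x + Rn rh (bn H) a x) x + bn (Sn rh H) x" using m by (intro bn_add[OF x(2)]) auto
  also have "bn (%a x. g a x + Rn rh (bn H) a x) x = bn g x + vn rh 0 x * bn H x" using m by (subst bn_add[OF x(2)]) (auto simp: bn_Rn[OF x(2)])
  finally have 1: "bn H x <= (bn g x + bn (Sn rh H) x) + en (vr rh 0 x) * bn H x"
   unfolding vn_eq_vr[OF rho(2)[OF rr] order_refl x(2)] by (simp add: add_ac)
  have "bn H x <= en (1 / (1 - vr rh 0 x)) * (bn g x + bn (Sn rh H) x)"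
   by (rule ennreal_absorb[OF 1]) (use elim(1) rho(3)[OF rr x(2)] in \<open>auto simp: less_top\<close>)
  then show ?case by (simp add: Wc_def E1_def distrib_left)
 qed
 have "AE p in PM. bn H (snd p) <= Wc rh (snd p) * bn g (snd p) + E1 rh H (snd p)"
 proof (rule P.AE_pair_measure)
  have [measurable]: "bn H : BM OM" "bn g : BM OM" "E1 rh H : BM OM" "Wc rh : BM OM" using bn_OM[OF mbH] bn_OM[OF mbg] E1_meas Wc_meas[OF rr] by auto
  show "{p : space PM. bn H (snd p) <= Wc rh (snd p) * bn g (snd p) + E1 rh H (snd p)} : sets PM" by measurable
 qed (use bnH in auto)
 with le show ?thesis
 proof eventually_elim
  case (elim p)
  have "Rn rh (bn H) (fst p) (snd p) <= Rn rh (%x. Wc rh x * bn g x) (fst p) (snd p) + Rn rh (E1 rh H) (fst p) (snd p)"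
   unfolding Rn_def distrib_left[symmetric] using elim(2) by (intro mult_left_mono) auto
  then have "g (fst p) (snd p) + Rn rh (bn H) (fst p) (snd p) + Sn rh H (fst p) (snd p) <= g0 (fst p) (snd p) + yy rh H (fst p) (snd p)"
   unfolding g0_def yy_def by (simp add: add_mono add_left_mono ac_simps)
  then show ?case using elim(1) by (rule order_trans[rotated])
 qed
qed

lemma yy_le: "x : S ==> yy rh H a x <= Sn rh g0 a x + Sn rh (yy rh H) a x + Rn rh (E1 rh H) a x"
 using Sn_mono_AE[OF H_le, of rh a x] unfolding yy_def[of rh H a x] by (simp add: Sn_add[OF mb_g0 mb_yy] add_right_mono)

lemma yy_minus_le:
 assumes e: "0 <= e" "!!x. x : S ==> E1 rh H x <= en e * zn x" and a: "a : Ag" and x: "x : S"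
 shows "yy rh H a x - en e * kz rh a x <= Sn rh g0 a x + Sn rh (%a x. yy rh H a x - en e * kz rh a x) a x"
proof (rule ennreal_minus_le_of_le_add)
 let ?d = "%a x. yy rh H a x - en e * kz rh a x"
 have mbd: "mb ?d" by (intro mb_minus mb_yy mb_cmult mb_kz)
 have "Sn rh (yy rh H) a x <= Sn rh (%a x. ?d a x + en e * kz rh a x) a x" by (rule Sn_mono) (rule ennreal_le_minus_add)
 also have "... = Sn rh ?d a x + en e * Sn rh (kz rh) a x" by (simp add: Sn_add[OF mbd mb_cmult[OF mb_kz] x] Sn_cmult[OF mb_kz x])
 finally have 1: "Sn rh (yy rh H) a x <= Sn rh ?d a x + en e * Sn rh (kz rh) a x" .
 have "Rn rh (E1 rh H) a x <= en (exp (- rh * a) * qq a x) * (en e * zn x)" unfolding Rn_def by (intro mult_left_mono e x) auto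
 then have 2: "Rn rh (E1 rh H) a x <= en e * Rn rh zn a x" by (simp add: Rn_def mult_ac)
 have "yy rh H a x <= Sn rh g0 a x + (Sn rh ?d a x + en e * Sn rh (kz rh) a x) + en e * Rn rh zn a x"
  using yy_le[OF x, of a] 1 2 by (meson add_mono order_refl order_trans)
 also have "... = (Sn rh g0 a x + Sn rh ?d a x) + en e * kz rh a x" by (simp add: kz_eq[OF x, of rh a] distrib_left ac_simps)
 finally show "yy rh H a x <= (Sn rh g0 a x + Sn rh ?d a x) + en e * kz rh a x" .
 show "en e * kz rh a x ~= top" using kz_fin[OF rr a x] by (simp add: ennreal_mult_eq_top_iff less_top)
qed

end

end

end

section \<open>Comparison with the positive solution\<close>

context age_model
begin

lemma age_split:
 "EX a1. ~ (AE a in AM. a < a1 --> b0 a = 0) & ~ (AE a in AM. a1 < a --> b0 a = 0)"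
proof (rule ccontr)
 assume "~ ?thesis"
 then have dich: "(AE a in AM. a < t --> b0 a = 0) | (AE a in AM. t < a --> b0 a = 0)" for t by blast
 define L where "L = {t. AE a in AM. a < t --> b0 a = 0}"
 have nt: "~ (AE a in AM. b0 a = 0)" using b0_nontriv unfolding AM_def .
 have L0: "0 : L" unfolding L_def by (auto intro!: AE_I2 simp: ages_def)
 have down: "t' : L" if "t : L" "t' <= t" for t t' using that unfolding L_def by (auto elim: eventually_mono)
 have bdd: "bdd_above L"
 proof (rule ccontr)
  assume "~ bdd_above L"
  then have "real n : L" for n using down unfolding bdd_above_def by (metis linear)
  then have "AE a in AM. ALL n. a < real n --> b0 a = 0" unfolding AE_all_countable L_def by blast
  then have "AE a in AM. b0 a = 0" by eventually_elim (use reals_Archimedean2 in blast)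
  then show False using nt by simp
 qed
 define s where "s = Sup L"
 have low: "s - 1 / real (Suc n) : L" for n
 proof -
  have "s - 1 / real (Suc n) < s" by simp
  then obtain t where "t : L" "s - 1 / real (Suc n) < t" unfolding s_def using less_cSup_iff[OF _ bdd] L0 by blast
  then show ?thesis using down by auto
 qed
 have up: "AE a in AM. s + 1 / real (Suc n) < a --> b0 a = 0" for n
 proof -
  have "s + 1 / real (Suc n) \<notin> L"
  proof
   assume "s + 1 / real (Suc n) : L"
   then have "s + 1 / real (Suc n) <= s" unfolding s_def by (rule cSup_upper[OF _ bdd])
   then show False by simp
  qed
  then show ?thesis using dich[of "s + 1 / real (Suc n)"] by (simp add: L_def)
 qed
 have "AE a in AM. ALL n. a < s - 1 / real (Suc n) --> b0 a = 0" unfolding AE_all_countable using low by (simp add: L_def)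
 moreover have "AE a in AM. ALL n. s + 1 / real (Suc n) < a --> b0 a = 0" unfolding AE_all_countable using up by simp
 moreover have "AE a in AM. a ~= s"
 proof -
  have "AE a in lebesgue. a ~= s" using AE_completion[OF AE_lborel_singleton[of s]] by simp
  then show ?thesis unfolding AM_def by (subst AE_restrict_space_iff) (use ages_sets in \<open>auto elim: eventually_mono\<close>)
 qed
 ultimately have "AE a in AM. b0 a = 0"
 proof eventually_elim
  case (elim a)
  show ?case
  proof (cases "a < s")
   case True
   then obtain n where "1 / real (Suc n) < s - a" using nat_approx_posE[of "s - a"] by auto
   then show ?thesis using elim(1) by (auto dest!: spec[of _ n])
  next
   case False
   then have "0 < a - s" using elim(3) by auto
   then obtain n where "1 / real (Suc n) < a - s" using nat_approx_posE[of "a - s"] by auto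
   then show ?thesis using elim(2) by (auto dest!: spec[of _ n])
  qed
 qed
 then show False using nt by simp
qed

lemma vr_pos:
 assumes ok: "okr (r + D + mut)" and a1: "~ (AE a in AM. a1 < a --> b0 a = 0)" and s: "s : Ag" "s < a1" and x: "x : S"
 shows "0 < vr r s x"
proof (rule ccontr)
 note [measurable] = qq_AM[OF x] beta_AM[OF x]
 have s0: "0 <= s" using s by (simp add: ages_def)
 assume "~ ?thesis"
 then have "vr r s x = 0" using vr_nonneg[of r s x] by linarith
 then have "vn r s x = 0" using vn_eq_vr[OF ok s0 x] by simp
 then have "AE a in AM. ind {s<..} a * en (beta a x * exp (- r * (a - s)) * (qq a x / qq s x)) = 0"
  unfolding vn_def by (subst (asm) nn_integral_0_iff_AE) auto
 then have "AE a in AM. a1 < a --> b0 a = 0" using AE_space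
 proof eventually_elim
  case (elim a)
  show ?case
  proof
   assume "a1 < a"
   then have "s < a" using s by simp
   then have "beta a x * exp (- r * (a - s)) * (qq a x / qq s x) <= 0" using elim(1) by (simp add: ennreal_eq_0_iff)
   then have "beta a x * (exp (- r * (a - s)) * (qq a x / qq s x)) <= 0" by (simp only: mult.assoc)
   moreover have "0 < exp (- r * (a - s)) * (qq a x / qq s x)" by simp
   ultimately have "beta a x <= 0" by (meson mult_pos_pos not_less)
   then show "b0 a = 0" using beta_ge[of a x] b0_nonneg[of a] elim(2) x by simp
  qed
 qed
 then show False using a1 by simp
qed

end

context age_eig
begin

lemma apriori:
 assumes rrh: "r < rh"
 shows "EX C>0. ALL H g. mb H --> mb g --> I2 H < \<infinity> -->
  (AE p in PM. H (fst p) (snd p) <= g (fst p) (snd p) + Rn rh (bn H) (fst p) (snd p) + Sn rh H (fst p) (snd p)) -->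
  I2 H <= en C * I2 g"
proof -
 have rr: "r <= rh" using rrh by simp
 note ok = rho(2)[OF rr]
 obtain ta where ta: "ta < 1" "0 <= ta" "!!x. x : S ==> bn (kz rh) x <= en ta * zn x" using bn_kz_strict[OF rrh] by blast
 obtain C1 where C1: "C1 > 0" "!!H g. mb H ==> mb g ==> I2 H < \<infinity> ==>
   (AE p in PM. H (fst p) (snd p) <= g (fst p) (snd p) + Sn rh H (fst p) (snd p)) ==> I2 H <= en C1 * I2 g"
  using Volterra_bound[OF rho(1)[OF rr]] by blast
 obtain C3 where C3: "C3 > 0" "!!H x. mb H ==> x : S ==> bn (Sn rh H) x <= en C3 * I2 H" using bn_Sn_le[OF ok] by blast
 obtain C4 where C4: "C4 > 0" "!!H. mb H ==> I2 (Sn rh H) <= en C4 * I2 H" using I2_Sn[OF ok] by blast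
 obtain C5 where C5: "C5 > 0" "!!e. e : BM OM ==> I2 (Rn rh e) <= en C5 * NI OM (%x. e x)" using I2_Rn[OF ok] by blast
 have Sne: "S ~= {}" using Om_ne by auto
 obtain xm where xm: "xm : S" "!!x. x : S ==> z xm <= z x" using continuous_attains_inf[OF S_compact Sne z_cont] by blast
 define zm where "zm = z xm"
 have zm: "0 < zm" "!!x. x : S ==> zm <= z x" using xm z_pos by (auto simp: zm_def)
 obtain xw where xw: "xw : S" "!!x. x : S ==> 1 / (1 - vr rh 0 x) <= 1 / (1 - vr rh 0 xw)"
  using continuous_attains_sup[OF S_compact Sne Wc_cont[OF rr]] by blast
 define Wm where "Wm = 1 / (1 - vr rh 0 xw)"
 have Wm: "0 < Wm" "!!x. x : S ==> Wc rh x <= en Wm" using xw rho(3)[OF rr xw(1)] by (auto simp: Wm_def Wc_def intro!: ennreal_leI)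
 define kI where "kI = enn2real (I2 (kz rh))"
 have kI: "I2 (kz rh) = en kI" "0 <= kI" using kz_I2[OF rr] by (auto simp: kI_def ennreal_enn2real)
 define C8 where "C8 = 1 + C5 * (Wm * B)"
 define c6 where "c6 = C3 * (1 + C1 * C4)"
 define c7 where "c7 = 1 / (1 - ta) * c6 / zm"
 define C where "C = (1 + (C1 * C4 + c7 * kI)) * C8"
 have C8: "1 <= C8" using C5 Wm B_nonneg by (simp add: C8_def)
 have c6: "0 < c6" using C3 C1 C4 by (simp add: c6_def add_pos_pos)
 have c7: "0 < c7" using c6 ta zm by (simp add: c7_def)
 have Cpos: "0 < C" unfolding C_def using C1 C4 c7 kI C8 by (intro mult_pos_pos add_pos_nonneg add_nonneg_nonneg mult_nonneg_nonneg) auto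
 have "I2 H <= en C * I2 g" if mbH: "mb H" and mbg: "mb g" and IH: "I2 H < \<infinity>" and
  le: "AE p in PM. H (fst p) (snd p) <= g (fst p) (snd p) + Rn rh (bn H) (fst p) (snd p) + Sn rh H (fst p) (snd p)" for H g
 proof (cases "I2 g = \<infinity>")
  case True
  then show ?thesis using Cpos by (simp add: ennreal_mult_top)
 next
  case False
  note hy = rr mbH IH mbg le
  define y where "y = yy rh H"
  define G where "G = g0 rh g"
  have mbG: "mb G" unfolding G_def by (rule mb_g0[OF hy])
  have mby: "mb y" unfolding y_def by (rule mb_yy[OF rr mbH IH])
  have IG: "I2 G <= en C8 * I2 g"
  proof -
   have [measurable]: "Wc rh : BM OM" "bn g : BM OM" using Wc_meas[OF rr] bn_OM[OF mbg] by auto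
   have m: "(%x. Wc rh x * bn g x) : BM OM" by measurable
   have mg: "(%x. NI AM (%a. g a x)) : BM OM"
   proof -
    note [measurable] = mbD[OF mbg]
    show ?thesis by measurable
   qed
   have "NI OM (%x. Wc rh x * bn g x) <= NI OM (%x. en (Wm * B) * NI AM (%a. g a x))"
   proof (rule nn_integral_mono)
    fix x assume "x : space OM"
    then have x: "x : Om" "x : S" by (auto simp: Om_S)
    have "Wc rh x * bn g x <= en Wm * (en B * NI AM (%a. g a x))" by (intro mult_mono Wm bn_le section_meas2[OF mbg] x) auto
    then show "Wc rh x * bn g x <= en (Wm * B) * NI AM (%a. g a x)" using Wm(1) B_nonneg by (simp add: ennreal_mult mult.assoc)
   qed
   also have "... = en (Wm * B) * I2 g" unfolding I2_swap[OF mbg] by (rule nn_integral_cmult[OF mg])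
   finally have "I2 (Rn rh (%x. Wc rh x * bn g x)) <= en C5 * (en (Wm * B) * I2 g)" using C5(2)[OF m] by (meson mult_left_mono order_trans zero_le)
   then have "I2 G <= I2 g + en C5 * (en (Wm * B) * I2 g)" unfolding G_def g0_def[OF hy] by (subst I2_add[OF mbg mb_Rn[OF m]]) (rule add_left_mono)
   also have "... = en C8 * I2 g" unfolding C8_def using C5 Wm(1) B_nonneg by (simp add: ennreal_mult distrib_right mult.assoc)
   finally show ?thesis .
  qed
  define i where "i = enn2real (I2 G)"
  have i: "I2 G = en i" "0 <= i"
  proof -
   have "I2 G < \<infinity>" using IG False by (auto intro: order_le_less_trans simp: ennreal_mult_less_top less_top)
   then show "I2 G = en i" "0 <= i" by (auto simp: i_def ennreal_enn2real)
  qed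
  obtain x0 where x0: "x0 : S" "!!x. x : S ==> enn2real (E1 rh H x) / z x <= enn2real (E1 rh H x0) / z x0"
  proof -
   have "continuous_on S (%x. enn2real (E1 rh H x) / z x)" using z_pos by (intro continuous_on_divide E1_cont[OF rr mbH IH] z_cont) force
   then show ?thesis using continuous_attains_sup[OF S_compact Sne] that by blast
  qed
  define e where "e = enn2real (E1 rh H x0) / z x0"
  have e: "0 <= e" using z_pos[OF x0(1)] by (simp add: e_def)
  have eE: "E1 rh H x <= en e * zn x" if x: "x : S" for x
  proof -
   have "enn2real (E1 rh H x) <= e * z x" using x0(2)[OF x] z_pos[OF x] by (simp add: e_def pos_divide_le_eq)
   then show ?thesis unfolding zn_def using E1_real[OF rr mbH IH x] e z_pos[OF x] by (metis ennreal_leI ennreal_mult less_imp_le)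
  qed
  have eE0: "E1 rh H x0 = en (e * z x0)" using E1_real[OF rr mbH IH x0(1)] z_pos[OF x0(1)] by (simp add: e_def)
  define y' where "y' a x = y a x - en e * kz rh a x" for a x
  have mby': "mb y'" unfolding y'_def by (intro mb_minus mby mb_cmult mb_kz)
  have y'le: "y' a x <= Sn rh G a x + Sn rh y' a x" if "a : Ag" "x : S" for a x unfolding y'_def y_def G_def by (rule yy_minus_le[OF hy e eE that])
  have Iy'fin: "I2 y' < \<infinity>"
  proof -
   have "I2 y' <= I2 y" by (rule I2_mono) (simp add: y'_def diff_le_self_ennreal)
   then show ?thesis using yy_I2[OF rr mbH IH] unfolding y_def by (rule order_le_less_trans)
  qed
  have Iy': "I2 y' <= en (C1 * C4 * i)"
  proof -
   have "I2 y' <= en C1 * I2 (Sn rh G)" by (rule C1(2)[OF mby' mb_Sn[OF mbG] Iy'fin]) (auto intro!: AE_I2 y'le simp: space_pair_measure Om_S)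
   also have "... <= en C1 * (en C4 * I2 G)" by (intro mult_left_mono C4 mbG) auto
   finally show ?thesis using C1 C4 i by (simp add: ennreal_mult mult.assoc)
  qed
  have "en (e * z x0) <= en (c6 * i) + en ta * en (e * z x0)"
  proof -
   have my': "(%a. y' a x0) : BM AM"
    unfolding y'_def y_def yy_def using Sn_AM[OF x0(1) mbH, of "%a. a"] Rn_AM[OF x0(1), of "%a. a"] kz_AM[OF x0(1), of rh] by measurable
   have mk: "(%a. en e * kz rh a x0) : BM AM" using kz_AM[OF x0(1), of rh] by measurable
   have "en (e * z x0) = bn y x0" unfolding y_def bn_yy[OF rr mbH IH x0(1)] eE0 ..
   also have "... <= bn (%a x. y' a x + en e * kz rh a x) x0" by (rule bn_mono) (simp add: y'_def ennreal_le_minus_add)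
   also have "... = bn y' x0 + bn (%a x. en e * kz rh a x) x0" by (rule bn_add[where F=y' and G="%a x. en e * kz rh a x", OF x0(1) my' mk])
   also have "bn (%a x. en e * kz rh a x) x0 = en e * bn (kz rh) x0" by (rule bn_cmult[where c="%_. en e" and F="kz rh", OF x0(1) kz_AM[OF x0(1)]])
   finally have 1: "en (e * z x0) <= bn y' x0 + en e * bn (kz rh) x0" .
   have "bn y' x0 <= bn (Sn rh (%a x. G a x + y' a x)) x0"
    by (rule bn_mono) (use y'le[OF _ x0(1)] in \<open>simp add: Sn_add[OF mbG mby' x0(1)]\<close>)
   also have "... <= en C3 * I2 (%a x. G a x + y' a x)" by (rule C3(2)[OF mb_add[OF mbG mby'] x0(1)])
   also have "I2 (%a x. G a x + y' a x) = I2 G + I2 y'" by (rule I2_add[OF mbG mby'])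
   also have "en C3 * (I2 G + I2 y') <= en C3 * (en i + en (C1 * C4 * i))" using Iy' i(1) by (intro add_mono mult_left_mono) auto
   also have "en C3 * (en i + en (C1 * C4 * i)) = en (c6 * i)"
    unfolding c6_def using C3 C1 C4 i by (simp add: ennreal_mult[symmetric] ennreal_plus[symmetric] algebra_simps del: ennreal_plus)
   finally have 2: "bn y' x0 <= en (c6 * i)" .
   have "en e * bn (kz rh) x0 <= en e * (en ta * zn x0)" by (intro mult_left_mono ta x0) auto
   also have "... = en ta * en (e * z x0)" using e z_pos[OF x0(1)] by (simp add: zn_def ennreal_mult mult_ac)
   finally show ?thesis using 1 2 by (meson add_mono order_trans)
  qed
  then have "en (e * z x0) <= en (1 / (1 - ta)) * en (c6 * i)" by (rule ennreal_absorb) (use ta in auto)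
  also have "... = en (1 / (1 - ta) * (c6 * i))" using ta c6 i by (simp add: ennreal_mult[symmetric])
  finally have "e * z x0 <= 1 / (1 - ta) * (c6 * i)" using ta c6 i by (subst (asm) ennreal_le_iff) auto
  moreover have "e * zm <= e * z x0" using e zm x0 by (intro mult_left_mono) auto
  ultimately have "e * zm <= 1 / (1 - ta) * (c6 * i)" by linarith
  then have "e <= 1 / (1 - ta) * (c6 * i) / zm" using zm(1) by (simp only: pos_le_divide_eq)
  then have e_le: "e <= c7 * i" by (simp add: c7_def)
  have "I2 y <= I2 (%a x. y' a x + en e * kz rh a x)" by (rule I2_mono) (simp add: y'_def ennreal_le_minus_add)
  also have "... = I2 y' + en e * I2 (kz rh)" by (simp add: I2_add[OF mby' mb_cmult[OF mb_kz]] I2_cmult[OF mb_kz])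
  also have "... <= en (C1 * C4 * i) + en (c7 * i) * en kI" using Iy' e_le kI by (intro add_mono mult_mono ennreal_leI) auto
  finally have Iy: "I2 y <= en (C1 * C4 * i) + en (c7 * i) * en kI" .
  have "I2 H <= I2 (%a x. G a x + y a x)" unfolding G_def y_def by (rule I2_mono_AE[OF mbH mb_add[OF mb_g0[OF hy] mb_yy[OF rr mbH IH]] H_le[OF hy]])
  also have "... = I2 G + I2 y" by (rule I2_add[OF mbG mby])
  also have "... <= en i + (en (C1 * C4 * i) + en (c7 * i) * en kI)" using Iy i(1) by (intro add_mono) auto
  also have "... = en ((1 + (C1 * C4 + c7 * kI)) * i)"
   using i C1 C4 c7 kI by (simp add: ennreal_mult[symmetric] ennreal_plus[symmetric] algebra_simps del: ennreal_plus)
  also have "... = en (1 + (C1 * C4 + c7 * kI)) * I2 G" using i C1 C4 c7 kI by (subst ennreal_mult) auto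
  also have "... <= en (1 + (C1 * C4 + c7 * kI)) * (en C8 * I2 g)" by (intro mult_left_mono IG) auto
  also have "... = en C * I2 g" unfolding C_def using C1 C4 c7 kI C8 by (subst ennreal_mult) (auto simp: mult.assoc)
  finally show ?thesis .
 qed
 then show ?thesis using Cpos by blast
qed

lemma zn_Wc: "x : S ==> zn x = Wc r x * bn (Sn r (kz r)) x"
proof -
 assume x: "x : S"
 obtain t where t: "Nn r zn x = en t" "0 <= t" using Nn_finite[OF r_good zn_meas zn_int x] by (cases "Nn r zn x") auto
 have "bn (kz r) x = en (vr r 0 x) * zn x + en t" unfolding kz_def bn_hn[OF zn_meas x] vn_eq_vr[OF good_okr[OF r_good] order_refl x] t ..
 then have "en (z x) = en (vr r 0 x * z x + t)" unfolding bn_kz[OF x] zn_def using z_pos[OF x] t(2) by (simp add: ennreal_mult ennreal_plus)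
 then have "z x = vr r 0 x * z x + t" using z_pos[OF x] t(2) by (subst (asm) ennreal_inj) (auto intro: less_imp_le)
 then have "z x = 1 / (1 - vr r 0 x) * t" using r_lt[OF x] by (simp add: field_simps)
 then show ?thesis unfolding zn_def Wc_def using t r_lt[OF x] by (simp add: kz_def Nn_def[symmetric] ennreal_mult[symmetric] del: times_divide_eq_left)
qed

text \<open>At a maximum \<open>x0\<close> of \<open>E1 r H / z\<close> the defect \<open>e * kz r - H\<close> contributes nothing to the births at \<open>x0\<close>;
  since ages above \<open>a1\<close> reproduce, it vanishes at younger ages within the dispersal distance of \<open>x0\<close>.\<close>

lemma critical_subsolution:
 assumes mbH: "mb H" and IH: "I2 H < \<infinity>" and a1: "~ (AE a in AM. a1 < a --> b0 a = 0)"
  and le: "AE p in PM. H (fst p) (snd p) <= Rn r (bn H) (fst p) (snd p) + Sn r H (fst p) (snd p)"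
 obtains e x0 where "0 <= e" "x0 : S"
  "AE p in PM. H (fst p) (snd p) <= en e * kz r (fst p) (snd p)"
  "AE p in PM. fst p < a1 --> dist x0 (snd p) < d0 --> H (fst p) (snd p) = en e * kz r (fst p) (snd p)"
proof -
 note ok = good_okr[OF r_good]
 have mb0: "mb (%a x. 0)" by (simp add: mb_def)
 have le': "AE p in PM. H (fst p) (snd p) <= 0 + Rn r (bn H) (fst p) (snd p) + Sn r H (fst p) (snd p)" using le by simp
 note hy = order_refl mbH IH mb0 le'
 have Sne: "S ~= {}" using Om_ne by auto
 obtain x0 where x0: "x0 : S" "!!x. x : S ==> enn2real (E1 r H x) / z x <= enn2real (E1 r H x0) / z x0"
 proof -
  have "continuous_on S (%x. enn2real (E1 r H x) / z x)" using z_pos by (intro continuous_on_divide E1_cont[OF order_refl mbH IH] z_cont) force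
  then show ?thesis using continuous_attains_sup[OF S_compact Sne] that by blast
 qed
 define e where "e = enn2real (E1 r H x0) / z x0"
 have e: "0 <= e" using z_pos[OF x0(1)] by (simp add: e_def)
 have eE: "E1 r H x <= en e * zn x" if x: "x : S" for x
 proof -
  have "enn2real (E1 r H x) <= e * z x" using x0(2)[OF x] z_pos[OF x] by (simp add: e_def pos_divide_le_eq)
  then show ?thesis unfolding zn_def using E1_real[OF order_refl mbH IH x] e z_pos[OF x] by (metis ennreal_leI ennreal_mult less_imp_le)
 qed
 have eE0: "E1 r H x0 = en e * zn x0" using E1_real[OF order_refl mbH IH x0(1)] z_pos[OF x0(1)] e by (simp add: e_def zn_def ennreal_mult[symmetric])
 have g00: "g0 r (%a x. 0) = (%a x. 0)" by (intro ext) (simp add: g0_def[OF hy] bn_def Rn_def)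
 have Sn0: "Sn r (%a x. 0) a x = 0" for a x by (simp add: Sn_def Vn_def Kn_def)
 define y' where "y' a x = yy r H a x - en e * kz r a x" for a x
 have mby': "mb y'" unfolding y'_def by (intro mb_minus mb_yy[OF order_refl mbH IH] mb_cmult mb_kz)
 have "I2 y' = 0"
 proof (rule Volterra_zero[OF r_good mby'])
  have "I2 y' <= I2 (yy r H)" by (rule I2_mono) (simp add: y'_def diff_le_self_ennreal)
  then show "I2 y' < \<infinity>" using yy_I2[OF order_refl mbH IH] by (rule order_le_less_trans)
  show "y' a x <= Sn r y' a x" if "a : Ag" "x : Om" for a x
   using yy_minus_le[OF hy e eE that(1) Om_S[OF that(2)]] by (simp add: y'_def[abs_def] g00 Sn0)
 qed
 then have "AE p in PM. y' (fst p) (snd p) = 0" unfolding I2_pair[OF mby'] using mby' by (subst (asm) nn_integral_0_iff_AE) (auto simp: mb_def)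
 then have AEle: "AE p in PM. H (fst p) (snd p) <= en e * kz r (fst p) (snd p)"
  using H_le[OF hy] by eventually_elim (auto simp: y'_def g00 ennreal_minus_eq_0 intro: order_trans)
 define d where "d a x = en e * kz r a x - H a x" for a x
 have mbd: "mb d" unfolding d_def by (intro mb_minus mbH mb_cmult mb_kz)
 have split: "AE p in PM. H (fst p) (snd p) + d (fst p) (snd p) = en e * kz r (fst p) (snd p)" using AEle I2_finite_AE[OF mbH IH]
  by eventually_elim (simp add: d_def add.commute diff_add_cancel_ennreal)
 have SnSplit: "Sn r H a x0 + Sn r d a x0 = en e * Sn r (kz r) a x0" for a
 proof -
  have "Sn r (%a x. H a x + d a x) a x0 = Sn r (%a x. en e * kz r a x) a x0"
   by (intro antisym Sn_mono_AE) (use split in \<open>auto elim: eventually_mono\<close>)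
  then show ?thesis by (simp add: Sn_add[OF mbH mbd x0(1)] Sn_cmult[OF mb_kz x0(1)])
 qed
 have bs: "bn (Sn r H) x0 + bn (Sn r d) x0 = en e * bn (Sn r (kz r)) x0"
 proof -
  have "bn (Sn r H) x0 + bn (Sn r d) x0 = bn (%a x. Sn r H a x + Sn r d a x) x0"
   using Sn_AM[OF x0(1) mbH, of "%a. a"] Sn_AM[OF x0(1) mbd, of "%a. a"] by (intro bn_add[OF x0(1), symmetric]) auto
  also have "... = bn (%a x. en e * Sn r (kz r) a x) x0" unfolding bn_def using SnSplit by simp
  also have "... = en e * bn (Sn r (kz r)) x0" using Sn_AM[OF x0(1) mb_kz, of "%a. a"] by (intro bn_cmult[where c="%_. en e", OF x0(1)]) auto
  finally show ?thesis .
 qed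
 have "bn (Sn r d) x0 = 0"
 proof (rule ennreal_add_eq_left_zero[OF bs])
  have W: "en (1 - vr r 0 x0) * Wc r x0 = 1" unfolding Wc_def using r_lt[OF x0(1)] by (simp add: ennreal_mult[symmetric])
  have "Wc r x0 * bn (Sn r H) x0 = Wc r x0 * (en e * bn (Sn r (kz r)) x0)" using eE0 unfolding E1_def zn_Wc[OF x0(1)] by (simp add: mult_ac)
  then have "(en (1 - vr r 0 x0) * Wc r x0) * bn (Sn r H) x0 = (en (1 - vr r 0 x0) * Wc r x0) * (en e * bn (Sn r (kz r)) x0)"
   by (simp add: mult.assoc)
  then show "en e * bn (Sn r (kz r)) x0 <= bn (Sn r H) x0" unfolding W by simp
  show "en e * bn (Sn r (kz r)) x0 < \<infinity>" using bn_Sn_finite[OF ok mb_kz kz_I2[OF order_refl] x0(1)] by (simp add: ennreal_mult_less_top)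
 qed
 then have "AE p in PM. en (kern r x0 p) * d (fst p) (snd p) = 0" unfolding bn_Sn_kern[OF ok mbd x0(1)] using mbd kern_meas[OF x0(1), of r]
  by (subst (asm) nn_integral_0_iff_AE) (auto simp: mb_def)
 then have "AE p in PM. fst p < a1 --> dist x0 (snd p) < d0 --> H (fst p) (snd p) = en e * kz r (fst p) (snd p)" using split AE_space
 proof eventually_elim
  case (elim p)
  show ?case
  proof (intro impI)
   assume p: "fst p < a1" "dist x0 (snd p) < d0"
   have s: "fst p : Ag" using elim(3) by (auto simp: space_pair_measure)
   have "0 < kern r x0 p" unfolding kern_def using D_pos vr_pos[OF ok a1 s p(1) x0(1)] J_ge[of "x0 - snd p"] j0_pos p(2) by (auto simp: dist_norm)
   then have "d (fst p) (snd p) = 0" using elim(1) by (simp add: ennreal_eq_0_iff)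
   then show "H (fst p) (snd p) = en e * kz r (fst p) (snd p)" using elim(2) by simp
  qed
 qed
 then show thesis using that[OF e x0(1) AEle] by blast
qed

end

section \<open>The resolvent equation for complex parameters\<close>

lemma norm_integral_le_nn_integral:
 fixes f :: "'a => 'b::{banach, second_countable_topology}"
 shows "en (norm (integral\<^sup>L M f)) <= NI M (%t. en (norm (f t)))"
 by (cases "integrable M f") (auto intro: integral_norm_bound_ennreal simp: not_integrable_integral_eq)

context age_model
begin

definition Vc :: "complex => (real => real^'n => complex) => real => real^'n => complex" where
 "Vc zt G a x = (LINT s|AM. of_real (ind {..<a} s * (qq a x / qq s x)) * exp (- zt * of_real (a - s)) * G s x)"
definition Rc :: "complex => (real^'n => complex) => real => real^'n => complex" where
 "Rc zt e a x = exp (- zt * of_real a) * of_real (qq a x) * e x"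
definition Kc :: "(real => real^'n => complex) => real => real^'n => complex" where
 "Kc h s x = (LINT z|OM. of_real (J (x - z)) * h s z)"
definition bc :: "(real => real^'n => complex) => real^'n => complex" where
 "bc h x = (LINT a|AM. of_real (beta a x) * h a x)"

definition nm :: "(real => real^'n => complex) => real => real^'n => ennreal" where
 "nm h a x = en (cmod (h a x))"
definition nm1 :: "(real^'n => complex) => real^'n => ennreal" where
 "nm1 e x = en (cmod (e x))"

lemma Vc_kernel_norm:
 "en (cmod (of_real (ind {..<a} s * (qq a x / qq s x)) * exp (- zt * of_real (a - s)) * G s x))
 = ind {..<a} s * en (exp (- Re zt * (a - s)) * (qq a x / qq s x)) * nm G s x"
proof -
 define E where "E = exp (- Re zt * (a - s)) * (qq a x / qq s x)"
 have E0: "0 <= E" by (simp add: E_def)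
 have eq: "cmod (of_real (ind {..<a} s * (qq a x / qq s x)) * exp (- zt * of_real (a - s)) * G s x)
  = ind {..<a} s * E * cmod (G s x)" unfolding E_def by (simp add: norm_mult norm_divide indicator_def)
 show ?thesis unfolding eq E_def[symmetric] nm_def by (cases "s < a") (simp_all add: ennreal_mult E0)
qed

lemma Vc_norm: "nm (Vc zt G) a x <= Vn (Re zt) (nm G) a x"
proof -
 have "nm (Vc zt G) a x <= NI AM (%s. en (cmod (of_real (ind {..<a} s * (qq a x / qq s x)) * exp (- zt * of_real (a - s)) * G s x)))"
  unfolding nm_def Vc_def by (rule norm_integral_le_nn_integral)
 then show ?thesis unfolding Vc_kernel_norm Vn_def .
qed

lemma Rc_norm: "nm (Rc zt e) a x = Rn (Re zt) (nm1 e) a x" unfolding nm_def nm1_def Rc_def Rn_def by (simp add: norm_mult ennreal_mult)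

lemma Kc_norm: "nm (Kc h) s x <= Kn (nm h) s x"
proof -
 have "nm (Kc h) s x <= NI OM (%z. en (cmod (of_real (J (x - z)) * h s z)))" unfolding nm_def Kc_def by (rule norm_integral_le_nn_integral)
 then show ?thesis unfolding Kn_def nm_def using J_nonneg by (simp add: norm_mult ennreal_mult)
qed

lemma bc_norm: "x : S ==> nm1 (bc h) x <= bn (nm h) x"
proof -
 assume x: "x : S"
 have "nm1 (bc h) x <= NI AM (%a. en (cmod (of_real (beta a x) * h a x)))" unfolding nm1_def bc_def by (rule norm_integral_le_nn_integral)
 also have "... = bn (nm h) x" unfolding bn_def nm_def using beta_nonneg x by (intro nn_integral_cong) (simp add: norm_mult ennreal_mult)
 finally show ?thesis .
qed

definition cm :: "(real => real^'n => complex) => bool" where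
 "cm h \<longleftrightarrow> (%p. h (fst p) (snd p)) : BM PM"

lemma cmD:
 assumes "cm H" "g : measurable N AM" "h : measurable N OM"
 shows "(%w. H (g w) (h w)) : BM N" using pair_compose[OF _ assms(2,3)] assms(1) by (auto simp: cm_def)

lemma cm_nm: "cm h ==> mb (nm h)" unfolding cm_def mb_def nm_def by measurable

lemma cm_Vc: "cm G ==> cm (Vc zt G)"
proof -
 assume "cm G"
 note [measurable] = cmD[OF this] qq_pair
 show ?thesis unfolding cm_def Vc_def by measurable
qed
lemma cm_Rc: "e : BM OM ==> cm (Rc zt e)"
proof -
 assume [measurable]: "e : BM OM"
 note [measurable] = qq_pair
 show ?thesis unfolding cm_def Rc_def by measurable
qed
lemma cm_Kc: "cm h ==> cm (Kc h)"
proof -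
 assume "cm h"
 note [measurable] = cmD[OF this]
 show ?thesis unfolding cm_def Kc_def by measurable
qed
lemma Kc_AM: "cm h ==> (%s. Kc h s x) : BM AM"
proof -
 assume "cm h"
 note [measurable] = cmD[OF this]
 show ?thesis unfolding Kc_def by measurable
qed
lemma bc_OM: "cm h ==> bc h : BM OM"
proof -
 assume "cm h"
 note [measurable] = cmD[OF this] beta_pair
 show ?thesis unfolding bc_def by measurable
qed
lemma Vc_AM:
 assumes "x : S" and [measurable]: "(%s. G s x) : BM AM"
 shows "(%a. Vc zt G a x) : BM AM"
proof -
 note [measurable] = qq_AM[OF assms(1)]
 show ?thesis unfolding Vc_def by measurable
qed
lemma Rc_AM: "x : S ==> (%a. Rc zt e a x) : BM AM"
proof -
 assume x: "x : S"
 note [measurable] = qq_AM[OF x]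
 show ?thesis unfolding Rc_def by measurable
qed

lemma AM_integral_interval:
 fixes F :: "real => complex"
 assumes a: "a : Ag" and t: "0 <= t" "t <= a" and F: "continuous_on UNIV F"
 shows "(LINT s|AM. ind {t<..<a} s *\<^sub>R F s) = (LINT s|lborel. ind {t..a} s *\<^sub>R F s)"
proof -
 have Fb: "F : borel_measurable borel" using F by (rule borel_measurable_continuous_onI)
 have [measurable]: "Ag : sets lebesgue" by (rule ages_sets)
 have "(LINT s|AM. ind {t<..<a} s *\<^sub>R F s) = (LINT s|lebesgue. indicator (Ag) s *\<^sub>R (ind {t<..<a} s *\<^sub>R F s))"
  unfolding AM_def by (rule integral_restrict_space) (use ages_sets in simp)
 also have "... = (LINT s|lebesgue. ind {t..a} s *\<^sub>R F s)"
 proof (rule integral_cong_AE)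
  have [measurable (raw)]: "(%x::real. x) : borel_measurable lebesgue" by (rule measurable_completion) simp
  have Fl[measurable]: "F : borel_measurable lebesgue" by (rule measurable_completion) (use Fb in simp)
  show "(%s. indicator (Ag) s *\<^sub>R (ind {t<..<a} s *\<^sub>R F s)) : borel_measurable lebesgue" by measurable
  show "(%s. ind {t..a} s *\<^sub>R F s) : borel_measurable lebesgue" by measurable
  have "AE s in lebesgue. s ~= t" "AE s in lebesgue. s ~= a"
   using AE_completion[OF AE_lborel_singleton[of t]] AE_completion[OF AE_lborel_singleton[of a]] by auto
  then show "AE s in lebesgue. indicator (Ag) s *\<^sub>R (ind {t<..<a} s *\<^sub>R F s) = ind {t..a} s *\<^sub>R F s"
  proof eventually_elim
   case (elim s)
   have "s : Ag" if "t < s" "s < a" using ages_down[OF a, of s] that t by simp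
   then show ?case using elim by (auto simp: indicator_def)
  qed
 qed
 also have "... = (LINT s|lborel. ind {t..a} s *\<^sub>R F s)" by (rule integral_completion) (use Fb in measurable)
 finally show ?thesis .
qed

lemma AM_FTC:
 fixes dl :: complex
 assumes a: "a : Ag" and t: "0 <= t" "t <= a"
 shows "(LINT s|AM. ind {t<..<a} s *\<^sub>R (dl * exp (dl * of_real s))) = exp (dl * of_real a) - exp (dl * of_real t)"
proof -
 have "(LINT s|AM. ind {t<..<a} s *\<^sub>R (dl * exp (dl * of_real s))) = (LINT s|lborel. ind {t..a} s *\<^sub>R (dl * exp (dl * of_real s)))"
  by (rule AM_integral_interval[OF a t]) (intro continuous_intros)
 also have "... = exp (dl * of_real a) - exp (dl * of_real t)"
 proof (rule integral_FTC_Icc[OF t(2)])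
  show "((%s. exp (dl * of_real s)) has_vector_derivative dl * exp (dl * of_real s)) (at s within {t..a})" for s
   by (rule has_vector_derivative_at_within, rule has_vector_derivative_real_field) (auto intro!: derivative_eq_intros)
  show "continuous_on {t..a} (%s. dl * exp (dl * of_real s))" by (intro continuous_intros)
 qed
 finally show ?thesis .
qed

lemma AM_ibp:
 fixes f :: "real => complex"
 assumes a: "a : Ag" and f: "integrable AM (%s. ind {..<a} s *\<^sub>R f s)" and fm[measurable]: "f : BM AM"
 shows "(LINT s|AM. ind {..<a} s *\<^sub>R (dl * exp (dl * of_real s) * (LINT t|AM. ind {..<s} t *\<^sub>R f t)))
   = (LINT t|AM. ind {..<a} t *\<^sub>R (f t * (exp (dl * of_real a) - exp (dl * of_real t))))"
  and "integrable AM (%s. ind {..<a} s *\<^sub>R (dl * exp (dl * of_real s) * (LINT t|AM. ind {..<s} t *\<^sub>R f t)))"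
proof -
 let ?E = "%s. exp (dl * of_real s)" and ?F = "%s. LINT t|AM. ind {..<s} t *\<^sub>R f t"
 let ?G = "%t. ind {..<a} t *\<^sub>R (f t * (?E a - ?E t))" and ?H = "%s. ind {..<a} s *\<^sub>R (dl * ?E s * ?F s)"
 define k where "k s t = ind {..<a} s *\<^sub>R (ind {..<s} t *\<^sub>R (dl * ?E s * f t))" for s t
 define K where "K = cmod dl * exp (\<bar>Re dl\<bar> * a)"
 have K0: "0 <= K" by (simp add: K_def)
 have a0: "0 < a" using a by (simp add: ages_def)
 have kint: "integrable (AM \<Otimes>\<^sub>M AM) (case_prod k)"
 proof (rule integrableI_bounded)
  show "case_prod k : BM (AM \<Otimes>\<^sub>M AM)" unfolding k_def case_prod_beta' by measurable
  have "NI (AM \<Otimes>\<^sub>M AM) (%p. en (norm (case_prod k p))) = NI AM (%s. NI AM (%t. en (norm (k s t))))"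
   by (subst AM.nn_integral_fst[symmetric]) (auto simp: k_def case_prod_beta')
  also have "... <= NI AM (%s. NI AM (%t. (en K * ind {0<..a} s) * en (norm (ind {..<a} t *\<^sub>R f t))))"
  proof (intro nn_integral_mono)
   fix s t assume "s : space AM" "t : space AM"
   then have st: "0 < s" "0 < t" by (auto simp: ages_def)
   show "en (norm (k s t)) <= (en K * ind {0<..a} s) * en (norm (ind {..<a} t *\<^sub>R f t))"
   proof (cases "t < s & s < a")
    case True
    have "Re dl * s <= \<bar>Re dl\<bar> * a" using True st by (intro mult_mono) auto
    then have "cmod dl * exp (Re dl * s) * cmod (f t) <= K * cmod (f t)" unfolding K_def by (intro mult_right_mono mult_left_mono) auto
    then have "norm (k s t) <= K * cmod (f t)" using True by (simp add: k_def norm_mult)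
    then show ?thesis using True st K0 by (simp add: ennreal_mult[symmetric] ennreal_leI)
   next
    case False
    then show ?thesis by (auto simp: k_def indicator_def)
   qed
  qed
  also have "... = NI AM (%s. (en K * ind {0<..a} s) * NI AM (%t. en (norm (ind {..<a} t *\<^sub>R f t))))"
   by (intro nn_integral_cong nn_integral_cmult) measurable
  also have "... = NI AM (%s. en K * ind {0<..a} s) * NI AM (%t. en (norm (ind {..<a} t *\<^sub>R f t)))"
   using interval_AM[OF a order_refl] by (intro nn_integral_multc) auto
  also have "... < \<infinity>" using f emeasure_AM_interval[OF a order_refl] a0 interval_AM[OF a order_refl]
   by (auto simp: integrable_iff_bounded nn_integral_cmult_indicator ennreal_mult_less_top)
  finally show "NI (AM \<Otimes>\<^sub>M AM) (%p. en (norm (case_prod k p))) < \<infinity>" .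
 qed
 have inner: "(LINT t|AM. k s t) = ?H s" for s
 proof -
  have "(LINT t|AM. k s t) = (LINT t|AM. (ind {..<a} s *\<^sub>R (dl * ?E s)) * (ind {..<s} t *\<^sub>R f t))"
   unfolding k_def by (intro Bochner_Integration.integral_cong) (auto simp: indicator_def)
  also have "... = (ind {..<a} s *\<^sub>R (dl * ?E s)) * ?F s" by (rule integral_mult_right_zero)
  finally show ?thesis by (simp only: mult_scaleR_left)
 qed
 have inner2: "(LINT s|AM. k s t) = ?G t" if "t : space AM" for t
 proof (cases "t < a")
  case True
  have t: "0 <= t" using that by (auto simp: ages_def)
  have "(LINT s|AM. k s t) = (LINT s|AM. (ind {t<..<a} s *\<^sub>R (dl * ?E s)) * f t)"
   unfolding k_def by (intro Bochner_Integration.integral_cong) (auto simp: indicator_def)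
  also have "... = (LINT s|AM. (ind {t<..<a} s *\<^sub>R (dl * ?E s))) * f t" by (rule integral_mult_left_zero)
  also have "... = (?E a - ?E t) * f t" using AM_FTC[OF a t, of dl] True by simp
  finally show ?thesis using True by (simp add: mult.commute)
 next
  case False
  then have "k s t = 0" for s by (auto simp: k_def indicator_def)
  then show ?thesis using False by simp
 qed
 have "(LINT s|AM. LINT t|AM. k s t) = (LINT t|AM. LINT s|AM. k s t)" by (rule AA.Fubini_integral[OF kint, symmetric])
 also have "... = (LINT t|AM. ?G t)" by (intro Bochner_Integration.integral_cong refl inner2)
 finally show "(LINT s|AM. ?H s)
   = (LINT t|AM. ?G t)" unfolding inner .
 show "integrable AM (%s. ?H s)" using AA.integrable_fst[OF kint] unfolding inner .
qed

lemma resolvent_identity: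
 assumes x: "x : S" and G: "integrable AM (%s. G s x)" and a: "a : Ag"
  and h: "!!s. s : Ag ==> h s x = Rc nu e s x + Vc nu G s x"
 shows "Rc zt e a x + Vc zt (%s x. G s x + (zt - nu) * h s x) a x = h a x"
proof -
 note [measurable] = qq_AM[OF x] borel_measurable_integrable[OF G]
 define q where "q s = complex_of_real (qq s x)" for s
 have q0: "q s ~= 0" for s by (simp add: q_def)
 have [measurable]: "q : BM AM" unfolding q_def by measurable
 define f where "f s = exp (nu * of_real s) * G s x / q s" for s
 have fm[measurable]: "f : BM AM" unfolding f_def by measurable
 define Ph where "Ph a = (LINT s|AM. ind {..<a} s *\<^sub>R f s)" for a
 define dl where "dl = zt - nu"
 let ?E = "%s. exp (dl * of_real s)" and ?Z = "%s. exp (- zt * of_real s)" and ?N = "%s. exp (- nu * of_real s)"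
 let ?I = "%s. ind {..<a} s *\<^sub>R (?E s * f s)" and ?K = "%s. ind {0<..<a} s *\<^sub>R (dl * ?E s) * e x"
  and ?L = "%s. ind {..<a} s *\<^sub>R (dl * ?E s * Ph s)" and ?V = "Vc zt (%s x. G s x + (zt - nu) * h s x) a x"
 have a0: "0 < a" using a by (simp add: ages_def)
 have DM: "0 <= D + M" using mu_ge[OF a x] mu_le[OF a x] mut_pos D_pos by linarith
 define c0 where "c0 = exp (\<bar>Re nu\<bar> * a) * exp ((D + M) * a)"
 have fint: "integrable AM (%s. ind {..<a} s *\<^sub>R f s)"
 proof (rule Bochner_Integration.integrable_bound[OF integrable_mult_right[OF integrable_norm[OF G], of c0]])
  show "AE s in AM. norm (ind {..<a} s *\<^sub>R f s) <= norm (c0 * norm (G s x))"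
  proof (rule AE_I2)
   fix s assume "s : space AM"
   then have s: "s : Ag" "0 < s" by (auto simp: ages_def)
   show "norm (ind {..<a} s *\<^sub>R f s) <= norm (c0 * norm (G s x))"
   proof (cases "s < a")
    case True
    have "Re nu * s <= \<bar>Re nu\<bar> * a" using True s by (intro mult_mono) auto
    moreover have "1 / qq s x <= exp ((D + M) * a)"
    proof -
     have e: "1 / exp (- y) = exp y" for y :: real by (simp add: exp_minus field_simps)
     have "exp (- (D + M) * a) <= exp (- (D + M) * s)"
     unfolding exp_le_cancel_iff minus_mult_left[symmetric] neg_le_iff_le using True DM by (intro mult_left_mono) auto
     also have "... <= qq s x" by (rule qq_ge[OF s(1) x])
     finally have "1 / qq s x <= 1 / exp (- (D + M) * a)" by (intro divide_left_mono) auto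
     then show ?thesis using e[of "(D + M) * a"] by (simp only: minus_mult_left)
    qed
    ultimately have "exp (Re nu * s) * (1 / qq s x) * cmod (G s x) <= c0 * cmod (G s x)" unfolding c0_def by (intro mult_right_mono mult_mono) auto
    then show ?thesis using True by (simp add: f_def q_def norm_mult norm_divide c0_def)
   qed simp
  qed
 qed measurable
 have Vnu: "Vc nu G s x = q s * ?N s * Ph s" for s
 proof -
  have "Vc nu G s x = (LINT t|AM. (q s * ?N s) * (ind {..<s} t *\<^sub>R f t))" unfolding Vc_def
  proof (intro Bochner_Integration.integral_cong refl)
   fix t
   have "exp (- nu * of_real (s - t)) = ?N s * exp (nu * of_real t)" by (simp add: exp_add[symmetric] algebra_simps)
   then show "of_real (ind {..<s} t * (qq s x / qq t x)) * exp (- nu * of_real (s - t)) * G t x = (q s * ?N s) * (ind {..<s} t *\<^sub>R f t)"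
    by (simp add: f_def q_def scaleR_conv_of_real indicator_def)
  qed
  also have "... = q s * ?N s * Ph s" unfolding Ph_def by (rule integral_mult_right_zero)
  finally show ?thesis .
 qed
 have hs: "h s x = q s * ?N s * (e x + Ph s)" if "s : Ag" for s unfolding h[OF that] Vnu by (simp add: Rc_def q_def algebra_simps)
 have Vzt: "?V = q a * ?Z a *
  (LINT s|AM. ?I s + (?K s
    + ?L s))"
 proof -
  have "?V = (LINT s|AM. (q a * ?Z a) *
   (?I s + (?K s
    + ?L s)))" unfolding Vc_def
  proof (intro Bochner_Integration.integral_cong refl)
   fix s assume "s : space AM"
   then have s: "s : Ag" "0 < s" by (auto simp: ages_def)
   have e1: "exp (- zt * of_real (a - s)) = ?Z a * exp (zt * of_real s)" by (simp add: exp_add[symmetric] algebra_simps)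
   have e2: "exp (zt * of_real s) = ?E s * exp (nu * of_real s)" by (simp add: dl_def exp_add[symmetric] algebra_simps)
   have e3: "exp (nu * of_real s) * ?N s = 1" by (simp add: exp_add[symmetric])
   have "exp (zt * of_real s) * (G s x + (zt - nu) * h s x) / q s = ?E s * f s + dl * ?E s * (e x + Ph s)"
   proof -
    have "exp (zt * of_real s) * (G s x + (zt - nu) * h s x) / q s
     = ?E s * (exp (nu * of_real s) * G s x / q s) + dl * ?E s * ((exp (nu * of_real s) * ?N s) * (e x + Ph s))"
     unfolding e2 hs[OF s(1)] using q0[of s] by (simp add: dl_def field_simps)
    then show ?thesis unfolding e3 f_def by simp
   qed
   then show "of_real (ind {..<a} s * (qq a x / qq s x)) * exp (- zt * of_real (a - s)) * (G s x + (zt - nu) * h s x)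
    = (q a * ?Z a) * (?I s + (?K s
    + ?L s))"
   proof (cases "s < a")
    case True
    let ?X = "G s x + (zt - nu) * h s x"
    assume F: "exp (zt * of_real s) * ?X / q s = ?E s * f s + dl * ?E s * (e x + Ph s)"
    have q1: "of_real (ind {..<a} s * (qq a x / qq s x)) = q a / q s" using True by (simp add: q_def)
    have "of_real (ind {..<a} s * (qq a x / qq s x)) * exp (- zt * of_real (a - s)) * ?X
     = (q a * ?Z a) * (exp (zt * of_real s) * ?X / q s)" unfolding e1 q1 by (simp only: times_divide_eq_left times_divide_eq_right mult_ac)
    then show ?thesis unfolding F using True s by (simp add: distrib_left)
   next
    case False
    then show ?thesis by (simp add: indicator_def)
   qed
  qed
  also have "... = (q a * ?Z a) * (LINT s|AM. ?I s + (?K s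
    + ?L s))" by (rule integral_mult_right_zero)
  finally show ?thesis .
 qed
 have i1: "integrable AM (%s. ?I s)"
 proof (rule Bochner_Integration.integrable_bound[OF integrable_mult_right[OF integrable_norm[OF fint], of "exp (\<bar>Re dl\<bar> * a)"]])
  show "AE s in AM. norm (?I s) <= norm (exp (\<bar>Re dl\<bar> * a) * norm (ind {..<a} s *\<^sub>R f s))"
  proof (rule AE_I2)
   fix s assume "s : space AM"
   then have s: "0 < s" by (auto simp: ages_def)
   show "norm (?I s) <= norm (exp (\<bar>Re dl\<bar> * a) * norm (ind {..<a} s *\<^sub>R f s))"
   proof (cases "s < a")
    case True
    have "Re dl * s <= \<bar>Re dl\<bar> * a" using True s by (intro mult_mono) auto
    then show ?thesis using True by (auto simp: norm_mult intro!: mult_right_mono)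
   qed simp
  qed
 qed measurable
 have i3: "integrable AM (%s. ?L s)" unfolding Ph_def by (rule AM_ibp(2)[OF a fint fm])
 have i2: "integrable AM (%s. ?K s)"
 proof (rule Bochner_Integration.integrable_bound[OF integrable_interval[OF a order_refl, of "cmod dl * exp (\<bar>Re dl\<bar> * a) * cmod (e x)"]])
  show "AE s in AM. norm (?K s) <= norm (ind {0<..a} s * (cmod dl * exp (\<bar>Re dl\<bar> * a) * cmod (e x)))"
  proof (rule AE_I2)
   fix s
   show "norm (?K s) <= norm (ind {0<..a} s * (cmod dl * exp (\<bar>Re dl\<bar> * a) * cmod (e x)))"
   proof (cases "0 < s & s < a")
    case True
    have "Re dl * s <= \<bar>Re dl\<bar> * a" using True by (intro mult_mono) auto
    then show ?thesis using True by (auto simp: norm_mult abs_mult intro!: mult_right_mono mult_left_mono)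
   qed (auto simp: indicator_def)
  qed
  have "(%s. ?K s) = (%s. (ind {..<a} s * ind {0<..} s) *\<^sub>R (dl * ?E s) * e x)" by (auto simp: fun_eq_iff indicator_def)
  then show "(%s. ?K s) : BM AM" by simp
 qed
 have "(LINT s|AM. ?I s + (?K s
    + ?L s))
  = (LINT s|AM. ?I s) + ((LINT s|AM. ?K s)
    + (LINT s|AM. ?L s))" using i1 i2 i3 by (subst Bochner_Integration.integral_add, simp, simp, subst Bochner_Integration.integral_add) auto
 also have "(LINT s|AM. ?K s) = (?E a - 1) * e x"
 proof -
  have "(LINT s|AM. ?K s) = (LINT s|AM. ind {0<..<a} s *\<^sub>R (dl * ?E s)) * e x" by (rule integral_mult_left_zero)
  then show ?thesis unfolding AM_FTC[OF a order_refl less_imp_le[OF a0]] by simp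
 qed
 also have "(LINT s|AM. ?L s) = (LINT t|AM. ind {..<a} t *\<^sub>R (f t * (?E a - ?E t)))" unfolding Ph_def by (rule AM_ibp(1)[OF a fint fm])
 also have "... = (LINT t|AM. ?E a * (ind {..<a} t *\<^sub>R f t) - ind {..<a} t *\<^sub>R (?E t * f t))"
  by (intro Bochner_Integration.integral_cong refl) (simp add: algebra_simps indicator_def)
 also have "... = ?E a * Ph a - (LINT s|AM. ?I s)"
  unfolding Ph_def by (subst Bochner_Integration.integral_diff[OF integrable_mult_right[OF fint] i1]) (simp only: integral_mult_right_zero)
 finally have I: "(LINT s|AM. ?I s + (?K s
    + ?L s)) = (?E a - 1) * e x + ?E a * Ph a" by simp
 have "?V = q a * ?Z a * ((?E a - 1) * e x + ?E a * Ph a)" unfolding Vzt I ..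
 then have "Rc zt e a x + ?V = q a * (?Z a * ?E a) * (e x + Ph a)" by (simp add: Rc_def q_def algebra_simps)
 also have "?Z a * ?E a = ?N a" by (simp add: dl_def exp_add[symmetric] algebra_simps)
 finally show ?thesis unfolding hs[OF a] .
qed

end

context age_model
begin

definition L1c :: "(real => real^'n => complex) => bool" where
 "L1c h \<longleftrightarrow> cm h & I2 (nm h) < \<infinity>"

lemma L1cD: "L1c h ==> cm h" "L1c h ==> I2 (nm h) < \<infinity>" "L1c h ==> mb (nm h)" by (auto simp: L1c_def cm_nm)

lemma L1c_iff: "L1c h \<longleftrightarrow> integrable PM (%p. h (fst p) (snd p))"
proof
 assume "L1c h"
 then show "integrable PM (%p. h (fst p) (snd p))"
  using I2_pair[OF L1cD(3)[OF \<open>L1c h\<close>]] by (intro integrableI_bounded) (auto simp: L1c_def cm_def nm_def)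
next
 assume i: "integrable PM (%p. h (fst p) (snd p))"
 then have "cm h" unfolding cm_def by (rule borel_measurable_integrable)
 then show "L1c h" using i I2_pair[OF cm_nm[OF \<open>cm h\<close>]] by (auto simp: L1c_def nm_def integrable_iff_bounded)
qed

lemma L1c_diff: "L1c u ==> L1c v ==> L1c (%a x. u a x - v a x)" unfolding L1c_iff by simp
lemma L1c_add: "L1c u ==> L1c v ==> L1c (%a x. u a x + v a x)" unfolding L1c_iff by simp
lemma L1c_cmult: "L1c u ==> L1c (%a x. c * u a x)" unfolding L1c_iff by simp
lemma L1c_sum: "(!!j. L1c (u j)) ==> L1c (%a x. \<Sum>j<(n::nat). u j a x)" unfolding L1c_iff by simp

lemma L1c_le:
 assumes "cm h" "mb F" "I2 F < \<infinity>" "AE p in PM. nm h (fst p) (snd p) <= F (fst p) (snd p)"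
 shows "L1c h" unfolding L1c_def using assms I2_mono_AE[OF cm_nm[OF assms(1)] assms(2,4)] by (auto intro: order_le_less_trans)

lemma L1c_section_x: "L1c h ==> AE x in OM. integrable AM (%a. h a x)"
proof -
 assume h: "L1c h"
 have "integrable (OM \<Otimes>\<^sub>M AM) (%(x, a). h a x)" using P.integrable_product_swap[OF h[unfolded L1c_iff]] by (simp add: case_prod_beta')
 interpret Q: pair_sigma_finite OM AM ..
 show ?thesis using Q.AE_integrable_fst[of "%x a. h a x"] \<open>integrable (OM \<Otimes>\<^sub>M AM) (%(x, a). h a x)\<close> by simp
qed

lemma L1c_section_a: "L1c h ==> AE a in AM. integrable OM (h a)" using P.AE_integrable_fst[of h] by (simp add: L1c_iff case_prod_beta')

lemma cm_section: "cm h ==> x : Om ==> (%a. h a x) : BM AM" using cmD[of h "%a. a" AM "%_. x"] by simp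

lemma cm_section_a: "cm h ==> a : Ag ==> h a : BM OM" using cmD[of h "%_. a" OM "%x. x"] by simp

lemma bc_integrable:
 fixes h :: "real => real^'n => complex"
 assumes "x : S" "integrable AM (%a. h a x)"
 shows "integrable AM (%a. of_real (beta a x) * h a x)"
proof -
 note [measurable] = beta_AM[OF assms(1)] borel_measurable_integrable[OF assms(2)]
 show ?thesis
 proof (rule Bochner_Integration.integrable_bound[OF integrable_mult_right[OF assms(2), of "of_real B"]])
  show "AE a in AM. norm (of_real (beta a x) * h a x) <= norm (of_real B * h a x)"
   using beta_nonneg beta_le assms(1) B_nonneg by (intro AE_I2) (auto simp: norm_mult intro!: mult_right_mono)
 qed measurable
qed

lemma bc_diff:
 assumes "x : S" "integrable AM (%a. u a x)" "integrable AM (%a. v a x)"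
 shows "bc (%a x. u a x - v a x) x = bc u x - bc v x" unfolding bc_def using bc_integrable[of x u, OF assms(1,2)] bc_integrable[of x v, OF assms(1,3)]
 by (subst Bochner_Integration.integral_diff[symmetric]) (auto simp: right_diff_distrib)

lemma bc_add:
 assumes "x : S" "integrable AM (%a. u a x)" "integrable AM (%a. v a x)"
 shows "bc (%a x. u a x + v a x) x = bc u x + bc v x" unfolding bc_def using bc_integrable[of x u, OF assms(1,2)] bc_integrable[of x v, OF assms(1,3)]
 by (subst Bochner_Integration.integral_add[symmetric]) (auto simp: distrib_left)

lemma Kc_integrable:
 fixes h :: "real => real^'n => complex"
 assumes "integrable OM (h s)"
 shows "integrable OM (%z. of_real (J (x - z)) * h s z)"
proof -
 note [measurable] = borel_measurable_integrable[OF assms]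
 show ?thesis by (rule Bochner_Integration.integrable_bound[OF integrable_mult_right[OF assms, of "of_real JB"]])
   (use J_nonneg J_le JB_pos in \<open>auto simp: norm_mult intro!: AE_I2 mult_right_mono\<close>)
qed

lemma Kc_diff: "integrable OM (u s) ==> integrable OM (v s) ==> Kc (%a x. u a x - v a x) s x = Kc u s x - Kc v s x"
 unfolding Kc_def using Kc_integrable[of u s x] Kc_integrable[of v s x]
 by (subst Bochner_Integration.integral_diff[symmetric]) (auto simp: right_diff_distrib)

definition Sc :: "complex => (real => real^'n => complex) => real => real^'n => complex" where
 "Sc zt h = Vc zt (%s x. of_real D * Kc h s x)"

lemma nm_DKc: "nm (%s x. of_real D * Kc h s x) s x <= en D * Kn (nm h) s x"
 using Kc_norm[of h s x] D_pos by (simp add: nm_def norm_mult ennreal_mult mult_left_mono)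

lemma Sc_norm: "nm (Sc zt h) a x <= Sn (Re zt) (nm h) a x"
proof -
 have "nm (Sc zt h) a x <= Vn (Re zt) (nm (%s x. of_real D * Kc h s x)) a x" unfolding Sc_def by (rule Vc_norm)
 also have "... <= Sn (Re zt) (nm h) a x" unfolding Sn_def by (intro Vn_mono nm_DKc)
 finally show ?thesis .
qed

lemma cm_Sc: "cm h ==> cm (Sc zt h)"
proof -
 assume "cm h"
 then have "cm (%s x. of_real D * Kc h s x)" using cm_Kc[OF \<open>cm h\<close>] by (simp add: cm_def)
 then show ?thesis unfolding Sc_def by (rule cm_Vc)
qed

lemma Vc_kernel_integrable:
 assumes x: "x : S" and G[measurable]: "(%s. G s x) : BM AM" and fin: "Vn (Re zt) (nm G) a x < \<infinity>"
 shows "integrable AM (%s. of_real (ind {..<a} s * (qq a x / qq s x)) * exp (- zt * of_real (a - s)) * G s x)"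
proof (rule integrableI_bounded)
 note [measurable] = qq_AM[OF x]
 show "(%s. of_real (ind {..<a} s * (qq a x / qq s x)) * exp (- zt * of_real (a - s)) * G s x) : BM AM" by measurable
 show "NI AM (%s. en (norm (of_real (ind {..<a} s * (qq a x / qq s x)) * exp (- zt * of_real (a - s)) * G s x))) < \<infinity>"
  unfolding Vc_kernel_norm using fin by (simp add: Vn_def)
qed

lemma Vc_add:
 assumes x: "x : S" and G: "(%s. G s x) : BM AM" "(%s. F s x) : BM AM"
  and fin: "Vn (Re zt) (nm G) a x < \<infinity>" "Vn (Re zt) (nm F) a x < \<infinity>"
 shows "Vc zt (%s x. G s x + F s x) a x = Vc zt G a x + Vc zt F a x"
 unfolding Vc_def using Vc_kernel_integrable[OF x G(1) fin(1)] Vc_kernel_integrable[OF x G(2) fin(2)]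
 by (subst Bochner_Integration.integral_add[symmetric]) (auto simp: distrib_left)

lemma Vc_AE:
 assumes x: "x : S" and [measurable]: "(%s. G s x) : BM AM" "(%s. F s x) : BM AM"
  and eq: "AE s in AM. G s x = F s x"
 shows "Vc zt G a x = Vc zt F a x"
proof -
 note [measurable] = qq_AM[OF x]
 show ?thesis unfolding Vc_def by (rule integral_cong_AE) (use eq in \<open>auto elim!: eventually_mono\<close>)
qed

lemma Vn_finite_integrable:
 assumes x: "x : S" and G: "integrable AM (%s. G s x)" and a: "a : Ag"
 shows "Vn r (nm G) a x < \<infinity>"
proof -
 have "Vn r (nm G) a x <= NI AM (%s. en (exp (\<bar>r\<bar> * a)) * en (cmod (G s x)))" unfolding Vn_def
 proof (rule nn_integral_mono)
  fix s assume "s : space AM"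
  then have s: "0 <= s" by (auto simp: ages_def)
  show "ind {..<a} s * en (exp (- r * (a - s)) * (qq a x / qq s x)) * nm G s x <= en (exp (\<bar>r\<bar> * a)) * en (cmod (G s x))"
  proof (cases "s < a")
   case True
   have "- r * (a - s) <= \<bar>r\<bar> * (a - s)" using True by (intro mult_right_mono) auto
   also have "... <= \<bar>r\<bar> * a" using s by (intro mult_left_mono) auto
   finally have "exp (- r * (a - s)) * (qq a x / qq s x) <= exp (\<bar>r\<bar> * a) * 1"
    using qq_ratio_le_1[OF a s _ x] True by (intro mult_mono) auto
   then show ?thesis using True unfolding nm_def by (auto intro!: mult_right_mono ennreal_leI)
  qed simp
 qed
 also have "... = en (exp (\<bar>r\<bar> * a)) * NI AM (%s. en (cmod (G s x)))"
  using borel_measurable_integrable[OF G] by (intro nn_integral_cmult) measurable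
 also have "... < \<infinity>" using G by (auto simp: integrable_iff_bounded ennreal_mult_less_top)
 finally show ?thesis .
qed

lemma Vn_mono_nm_finite: "Vn r (nm (%s x. of_real D * Kc h s x)) a x < \<infinity>" if "L1c h" "x : S" "a : Ag"
proof -
 have "Vn r (nm (%s x. of_real D * Kc h s x)) a x <= Sn r (nm h) a x" unfolding Sn_def by (intro Vn_mono nm_DKc)
 also have "... <= en (D * JB * exp (\<bar>r\<bar> * a)) * I2 (nm h)" by (rule Sn_le_I2[OF L1cD(3)[OF that(1)] that(2,3)])
 also have "... < \<infinity>" using L1cD(2)[OF that(1)] by (simp add: ennreal_mult_less_top)
 finally show ?thesis .
qed

lemma nm_minus: "nm (%s x. - G s x) = nm G" by (simp add: nm_def fun_eq_iff)

lemma Sc_add: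
 assumes u: "L1c u" and v: "L1c v" and x: "x : S" and a: "a : Ag"
 shows "Sc zt (%a x. u a x - v a x) a x = Sc zt u a x - Sc zt v a x"
proof -
 have m: "(%s. of_real D * Kc h s x) : BM AM" if "cm h" for h using Kc_AM[OF that, of x] by measurable
 have mv: "(%s. - (of_real D * Kc v s x)) : BM AM" using m[OF L1cD(1)[OF v]] by measurable
 have "AE s in AM. of_real D * Kc (%a x. u a x - v a x) s x = of_real D * Kc u s x + - (of_real D * Kc v s x)"
  using L1c_section_a[OF u] L1c_section_a[OF v] by eventually_elim (simp add: Kc_diff right_diff_distrib)
 then have "Sc zt (%a x. u a x - v a x) a x = Vc zt (%s x. of_real D * Kc u s x + - (of_real D * Kc v s x)) a x"
  unfolding Sc_def using m[OF L1cD(1)[OF L1c_diff[OF u v]]] m[OF L1cD(1)[OF u]] mv by (intro Vc_AE[OF x]) auto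
 also have "... = Vc zt (%s x. of_real D * Kc u s x) a x + Vc zt (%s x. - (of_real D * Kc v s x)) a x"
  using Vn_mono_nm_finite[OF u x a] Vn_mono_nm_finite[OF v x a]
  by (intro Vc_add[where G="%s x. of_real D * Kc u s x" and F="%s x. - (of_real D * Kc v s x)",
     OF x m[OF L1cD(1)[OF u]] mv]) (auto simp: nm_minus)
 also have "Vc zt (%s x. - (of_real D * Kc v s x)) a x = - Sc zt v a x" unfolding Sc_def Vc_def by simp
 finally show ?thesis by (simp add: Sc_def)
qed

lemma Sc_AE:
 assumes u: "cm u" and v: "cm v" and x: "x : S" and eq: "AE p in PM. u (fst p) (snd p) = v (fst p) (snd p)"
 shows "Sc zt u a x = Sc zt v a x" and "AE s in AM. ALL y. Kc u s y = Kc v s y"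
proof -
 have "AE s in AM. AE z in OM. u s z = v s z" using P.AE_pair[OF eq] by simp
 then show K: "AE s in AM. ALL y. Kc u s y = Kc v s y" using AE_space
 proof eventually_elim
  case (elim s)
  have [measurable]: "u s : BM OM" "v s : BM OM" using cm_section_a u v elim by auto
  show ?case unfolding Kc_def by (intro allI integral_cong_AE) (use elim(1) in \<open>auto elim!: eventually_mono\<close>)
 qed
 have m: "(%s. of_real D * Kc h s x) : BM AM" if "cm h" for h using Kc_AM[OF that, of x] by measurable
 show "Sc zt u a x = Sc zt v a x" unfolding Sc_def
  by (rule Vc_AE[where G="%s x. of_real D * Kc u s x" and F="%s x. of_real D * Kc v s x", OF x m[OF u] m[OF v]])
   (use K in \<open>eventually_elim, simp\<close>)
qed

lemma bc_AE:
 assumes u: "cm u" and v: "cm v" and eq: "AE p in PM. u (fst p) (snd p) = v (fst p) (snd p)"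
 shows "AE x in OM. bc u x = bc v x" using AE_pair_swap[of "%a x. u a x = v a x", OF eq] AE_space
proof eventually_elim
 case (elim x)
 then have x: "x : Om" "x : S" by (auto simp: Om_S)
 note [measurable] = cm_section[OF u x(1)] cm_section[OF v x(1)] beta_AM[OF x(2)]
 show ?case unfolding bc_def by (rule integral_cong_AE) (use elim(1) in \<open>auto elim!: eventually_mono\<close>)
qed

lemma bn_int_le: "mb H ==> (NI OM (%x. bn H x)) <= en B * I2 H"
proof -
 assume H: "mb H"
 have "NI OM (%x. bn H x) <= NI OM (%x. en B * NI AM (%a. H a x))" using section_meas2[OF H] by (intro nn_integral_mono bn_le) (auto simp: Om_S)
 also have "... = en B * I2 H"
 proof -
  note [measurable] = mbD[OF H]
  show ?thesis unfolding I2_swap[OF H] by (rule nn_integral_cmult) measurable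
 qed
 finally show ?thesis .
qed

definition Qn :: "real => (real => real^'n => ennreal) => real => real^'n => ennreal" where
 "Qn rh H a x = Rn rh (bn H) a x + Sn rh H a x"
definition Qc :: "complex => (real => real^'n => complex) => real => real^'n => complex" where
 "Qc zt h a x = Rc zt (bc h) a x + Sc zt h a x"

lemma mb_Qn: "mb H ==> mb (Qn rh H)" unfolding Qn_def using mb_add[OF mb_Rn[OF bn_OM] mb_Sn] by simp

lemma I2_Qn:
 assumes ok: "okr (rh + D + mut)"
 shows "EX C>0. ALL H. mb H --> I2 (Qn rh H) <= en C * I2 H"
proof -
 obtain C4 where C4: "C4 > 0" "!!H. mb H ==> I2 (Sn rh H) <= en C4 * I2 H" using I2_Sn[OF ok] by blast
 obtain C5 where C5: "C5 > 0" "!!e. e : BM OM ==> I2 (Rn rh e) <= en C5 * NI OM (%x. e x)" using I2_Rn[OF ok] by blast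
 have "I2 (Qn rh H) <= en (C5 * B + C4) * I2 H" if H: "mb H" for H
 proof -
  have "I2 (Qn rh H) = I2 (Rn rh (bn H)) + I2 (Sn rh H)" unfolding Qn_def by (rule I2_add[OF mb_Rn[OF bn_OM[OF H]] mb_Sn[OF H]])
  also have "... <= en C5 * (en B * I2 H) + en C4 * I2 H" by (intro add_mono C4 H order_trans[OF C5(2)[OF bn_OM[OF H]]] mult_left_mono bn_int_le) auto
  also have "... = en (C5 * B + C4) * I2 H" using C4 C5 B_nonneg by (simp add: ennreal_mult distrib_right mult.assoc)
  finally show ?thesis .
 qed
 then show ?thesis using C4 C5 B_nonneg by (intro exI[of _ "C5 * B + C4"]) (auto intro!: add_nonneg_pos)
qed

lemma nm_add: "nm (%a x. u a x + v a x) a x <= nm u a x + nm v a x"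
 unfolding nm_def ennreal_plus[symmetric, OF norm_ge_zero norm_ge_zero] by (intro ennreal_leI norm_triangle_ineq)

lemma Qc_norm: "x : S ==> nm (Qc zt h) a x <= Qn (Re zt) (nm h) a x"
proof -
 assume x: "x : S"
 have "nm (Qc zt h) a x <= nm (Rc zt (bc h)) a x + nm (Sc zt h) a x" unfolding Qc_def by (rule nm_add)
 also have "... <= Qn (Re zt) (nm h) a x"
  unfolding Qn_def Rc_norm using bc_norm[OF x, of h] Sc_norm[of zt h a x] by (intro add_mono) (auto simp: Rn_def intro!: mult_left_mono)
 finally show ?thesis .
qed

lemma cm_Qc: "cm h ==> cm (Qc zt h)"
proof -
 assume h: "cm h"
 show ?thesis using cm_Rc[OF bc_OM[OF h], of zt] cm_Sc[OF h, of zt] unfolding Qc_def cm_def by measurable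
qed

lemma AE_P_of_OM:
 assumes "AE x in OM. Q x"
 shows "AE p in PM. Q (snd p)"
proof -
 obtain N where N: "N : null_sets OM" "{x : space OM. ~ Q x} <= N" using assms by (auto simp: eventually_ae_filter)
 have [measurable]: "N : sets OM" using N(1) by auto
 have "AE p in PM. snd p \<notin> N"
 proof (rule P.AE_pair_measure)
  show "{p : space PM. snd p \<notin> N} : sets PM" by measurable
 qed (use AE_not_in[OF N(1)] in auto)
 with AE_space show ?thesis by eventually_elim (use N(2) in \<open>auto simp: space_pair_measure\<close>)
qed

lemma AE_P_of_AM:
 assumes "AE a in AM. Q a"
 shows "AE p in PM. Q (fst p)"
proof -
 obtain N where N: "N : null_sets AM" "{x : space AM. ~ Q x} <= N" using assms by (auto simp: eventually_ae_filter)
 have [measurable]: "N : sets AM" using N(1) by auto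
 have "AE p in PM. fst p \<notin> N"
 proof (rule P.AE_pair_measure)
  show "{p : space PM. fst p \<notin> N} : sets PM" by measurable
  show "AE a in AM. AE x in OM. fst (a, x) \<notin> N" using AE_not_in[OF N(1)] by eventually_elim auto
 qed
 with AE_space show ?thesis by eventually_elim (use N(2) in \<open>auto simp: space_pair_measure\<close>)
qed

lemma Qc_diff:
 assumes u: "L1c u" and v: "L1c v"
 shows "AE p in PM. Qc zt (%a x. u a x - v a x) (fst p) (snd p) = Qc zt u (fst p) (snd p) - Qc zt v (fst p) (snd p)"
proof -
 have "AE x in OM. bc (%a x. u a x - v a x) x = bc u x - bc v x"
  using L1c_section_x[OF u] L1c_section_x[OF v] AE_space by eventually_elim (auto intro!: bc_diff simp: Om_S)
 from AE_P_of_OM[OF this] AE_space show ?thesis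
 proof eventually_elim
  case (elim p)
  then have p: "fst p : Ag" "snd p : S" by (auto simp: space_pair_measure Om_S)
  show ?case unfolding Qc_def Rc_def elim(1) Sc_add[OF u v p(2,1)] by (simp add: algebra_simps)
 qed
qed

lemma I2_zero_AE: "mb H ==> I2 H = 0 ==> AE p in PM. H (fst p) (snd p) = 0" by (simp add: I2_pair nn_integral_0_iff_AE mb_def)

lemma L1c_Qc: "okr (Re zt + D + mut) ==> L1c h ==> L1c (Qc zt h)"
proof -
 assume ok: "okr (Re zt + D + mut)" and h: "L1c h"
 obtain C where "I2 (Qn (Re zt) (nm h)) <= en C * I2 (nm h)" using I2_Qn[OF ok] L1cD(3)[OF h] by blast
 then have "I2 (Qn (Re zt) (nm h)) < \<infinity>" using L1cD(2)[OF h] by (auto intro: order_le_less_trans simp: ennreal_mult_less_top)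
 then show ?thesis by (rule L1c_le[OF cm_Qc[OF L1cD(1)[OF h]] mb_Qn[OF L1cD(3)[OF h]]]) (auto intro!: AE_I2 Qc_norm simp: space_pair_measure Om_S)
qed

end

context age_eig
begin

lemma Neumann:
 assumes rrh: "r < Re zt" and g: "L1c g"
 shows "EX h. L1c h & (AE p in PM. h (fst p) (snd p) = g (fst p) (snd p) + Qc zt h (fst p) (snd p))"
proof -
 define rh where "rh = Re zt"
 have rr: "r <= rh" using rrh by (simp add: rh_def)
 note ok = rho(2)[OF rr]
 obtain C where C: "C > 0" "!!H g. mb H ==> mb g ==> I2 H < \<infinity> ==>
  (AE p in PM. H (fst p) (snd p) <= g (fst p) (snd p) + Rn rh (bn H) (fst p) (snd p) + Sn rh H (fst p) (snd p)) ==>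
  I2 H <= en C * I2 g" using apriori[of rh] rrh unfolding rh_def by blast
 obtain CQ where CQ: "CQ > 0" "!!H. mb H ==> I2 (Qn rh H) <= en CQ * I2 H" using I2_Qn[OF ok] by blast
 define G where "G n = (Qc zt ^^ n) g" for n
 have GS: "G (Suc n) = Qc zt (G n)" for n by (simp add: G_def)
 have GL: "L1c (G n)" for n
 proof (induction n)
  case 0 then show ?case using g by (simp add: G_def)
 next
  case (Suc n) then show ?case unfolding GS using L1c_Qc ok rh_def by blast
 qed
 have mbG: "mb (nm (G n))" for n by (rule L1cD(3)[OF GL])
 have bn_sum: "bn (%a x. \<Sum>j<n. nm (G j) a x) x = (\<Sum>j<n. bn (nm (G j)) x)" if x: "x : Om" for n x
 proof (induction n)
  case 0 then show ?case by (simp add: bn_def)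
 next
  case (Suc n)
  show ?case unfolding sum.lessThan_Suc by (subst bn_add[where F="%a x. \<Sum>j<n. nm (G j) a x" and G="nm (G n)",
     OF Om_S[OF x] section_meas2[OF mb_sum[OF mbG] x] section_meas2[OF mbG x]]) (simp add: Suc)
 qed
 have part: "(\<Sum>j<n. I2 (nm (G j))) <= en C * I2 (nm g)" for n
 proof -
  have "I2 (%a x. \<Sum>j<n. nm (G j) a x) <= en C * I2 (nm g)"
  proof (rule C(2)[OF mb_sum[OF mbG] L1cD(3)[OF g]])
   have "I2 (nm (G j)) ~= top" for j using L1cD(2)[OF GL[of j]] by (simp add: less_top)
   then have "(\<Sum>j<n. I2 (nm (G j))) ~= top" by (induction n) auto
   then show "I2 (%a x. \<Sum>j<n. nm (G j) a x) < \<infinity>" unfolding I2_sum[OF mbG] by (simp add: less_top)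
   show "AE p in PM. (\<Sum>j<n. nm (G j) (fst p) (snd p)) <= nm g (fst p) (snd p) + Rn rh (bn (%a x. \<Sum>j<n. nm (G j) a x)) (fst p) (snd p) + Sn rh (%a x. \<Sum>j<n. nm (G j) a x) (fst p) (snd p)"
   proof (rule AE_I2)
    fix p assume "p : space PM"
    then have p: "snd p : Om" "snd p : S" by (auto simp: space_pair_measure Om_S)
    have "(\<Sum>j<n. nm (G j) (fst p) (snd p)) <= (\<Sum>j<Suc n. nm (G j) (fst p) (snd p))" by simp
    also have "... = nm g (fst p) (snd p) + (\<Sum>j<n. nm (G (Suc j)) (fst p) (snd p))" unfolding sum.lessThan_Suc_shift by (simp add: G_def)
    also have "... <= nm g (fst p) (snd p) + (\<Sum>j<n. Qn rh (nm (G j)) (fst p) (snd p))"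
     unfolding GS rh_def by (intro add_left_mono sum_mono Qc_norm p)
    also have "(\<Sum>j<n. Qn rh (nm (G j)) (fst p) (snd p)) = Rn rh (bn (%a x. \<Sum>j<n. nm (G j) a x)) (fst p) (snd p) + Sn rh (%a x. \<Sum>j<n. nm (G j) a x) (fst p) (snd p)"
     unfolding Qn_def Rn_def bn_sum[OF p(1)] Sn_sum[OF mbG p(2)] by (simp add: sum.distrib sum_distrib_left)
    finally show "(\<Sum>j<n. nm (G j) (fst p) (snd p)) <= nm g (fst p) (snd p) + Rn rh (bn (%a x. \<Sum>j<n. nm (G j) a x)) (fst p) (snd p) + Sn rh (%a x. \<Sum>j<n. nm (G j) a x) (fst p) (snd p)"
     by (simp add: add.assoc)
   qed
  qed
  then show ?thesis unfolding I2_sum[OF mbG] .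
 qed
 define h where "h a x = (\<Sum>n. G n a x)" for a x
 have tot: "(\<Sum>n. I2 (nm (G n))) <= en C * I2 (nm g)" by (rule suminf_le_const[OF summableI part])
 have totfin: "(\<Sum>n. I2 (nm (G n))) < \<infinity>" using tot L1cD(2)[OF g] by (auto intro: order_le_less_trans simp: ennreal_mult_less_top)
 have cmh: "cm h"
 proof -
  have [measurable]: "(%p. G n (fst p) (snd p)) : BM PM" for n using L1cD(1)[OF GL[of n]] by (simp add: cm_def)
  show ?thesis unfolding cm_def h_def by measurable
 qed
 have mbT: "mb (%a x. \<Sum>j. nm (G (j + n)) a x)" for n by (rule mb_suminf[OF mbG])
 have I2T: "I2 (%a x. \<Sum>j. nm (G (j + n)) a x) = (\<Sum>j. I2 (nm (G (j + n))))" for n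
 proof -
  have "I2 (%a x. \<Sum>j. nm (G (j + n)) a x) = NI PM (%p. (\<Sum>j. nm (G (j + n)) (fst p) (snd p)))" by (rule I2_pair[OF mbT])
  also have "... = (\<Sum>j. I2 (nm (G (j + n))))" unfolding I2_pair[OF mbG] using mbG by (intro nn_integral_suminf) (auto simp: mb_def)
  finally show ?thesis .
 qed
 have AEfin: "AE p in PM. (\<Sum>j. nm (G j) (fst p) (snd p)) ~= \<infinity>" using I2_finite_AE[OF mbT[of 0]] I2T[of 0] totfin by simp
 have tail: "AE p in PM. nm (%a x. h a x - (\<Sum>j<n. G j a x)) (fst p) (snd p) <= (\<Sum>j. nm (G (j + n)) (fst p) (snd p))" for n using AEfin
 proof eventually_elim
  case (elim p)
  have s: "summable (%j. cmod (G j (fst p) (snd p)))" by (rule summable_suminf_not_top) (use elim in \<open>simp_all add: nm_def\<close>)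
  then have sG: "summable (%j. G j (fst p) (snd p))" by (rule summable_norm_cancel)
  have sn: "summable (%j. cmod (G (j + n) (fst p) (snd p)))" using s by (rule summable_ignore_initial_segment)
  have "h (fst p) (snd p) - (\<Sum>j<n. G j (fst p) (snd p)) = (\<Sum>j. G (j + n) (fst p) (snd p))"
   unfolding h_def using suminf_minus_initial_segment[OF sG, of n] by simp
  then have "cmod (h (fst p) (snd p) - (\<Sum>j<n. G j (fst p) (snd p))) <= (\<Sum>j. cmod (G (j + n) (fst p) (snd p)))"
   using summable_norm[OF sn] by simp
  then have "nm (%a x. h a x - (\<Sum>j<n. G j a x)) (fst p) (snd p) <= en (\<Sum>j. cmod (G (j + n) (fst p) (snd p)))"
   unfolding nm_def by (rule ennreal_leI)
  also have "... = (\<Sum>j. nm (G (j + n)) (fst p) (snd p))" unfolding nm_def using sn by (intro suminf_ennreal2[symmetric]) auto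
  finally show ?case .
 qed
 have Lh: "L1c h" by (rule L1c_le[OF cmh mbT[of 0]]) (use tail[of 0] I2T[of 0] totfin in auto)
 define s where "s n = (%a x. \<Sum>j<n. G j a x)" for n
 have Ls: "L1c (s n)" for n unfolding s_def by (rule L1c_sum[OF GL])
 define d where "d n = (%a x. h a x - s n a x)" for n
 have Ld: "L1c (d n)" for n unfolding d_def by (rule L1c_diff[OF Lh Ls])
 have Id: "I2 (nm (d n)) <= (\<Sum>j. I2 (nm (G (j + n))))" for n
  unfolding I2T[symmetric] d_def s_def by (rule I2_mono_AE[OF _ mbT tail]) (use L1cD(3)[OF Ld[of n]] in \<open>simp add: d_def s_def\<close>)
 have Id0: "(%n. I2 (nm (d n))) \<longlonglongrightarrow> 0"
 proof (rule tendsto_sandwich[OF _ _ tendsto_const])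
  obtain c where c: "!!j. I2 (nm (G j)) = en (c j)" "!!j. 0 <= c j"
  proof -
   have "EX c. I2 (nm (G j)) = en c & 0 <= c" for j using L1cD(2)[OF GL[of j]] by (cases "I2 (nm (G j))") auto
   then show ?thesis using that by metis
  qed
  have sc: "summable c" by (rule summable_suminf_not_top) (use totfin c in \<open>simp_all add: less_top\<close>)
  have "(\<Sum>j. I2 (nm (G (j + n)))) = en (\<Sum>j. c (j + n))" for n
   unfolding c using c(2) sc by (intro suminf_ennreal2) (auto intro: summable_ignore_initial_segment)
  moreover have "(%n. \<Sum>j. c (j + n)) \<longlonglongrightarrow> 0" by (rule suminf_exist_split2[OF sc])
  ultimately show "(%n. \<Sum>j. I2 (nm (G (j + n)))) \<longlonglongrightarrow> 0" using tendsto_ennrealI[of _ 0] by fastforce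
 qed (use Id in auto)
 define R where "R = (%a x. h a x - g a x - Qc zt h a x)"
 have LQ: "L1c (Qc zt u)" if "L1c u" for u using L1c_Qc[OF _ that] ok rh_def by blast
 have LR: "L1c R" unfolding R_def by (intro L1c_diff Lh g LQ)
 have sQ: "AE p in PM. Qc zt (s n) (fst p) (snd p) = (\<Sum>j<n. G (Suc j) (fst p) (snd p))" for n
 proof (induction n)
  case 0
  show ?case by (rule AE_I2) (simp add: s_def Qc_def Rc_def bc_def Sc_def Vc_def Kc_def)
 next
  case (Suc n)
  have eq: "s n = (%a x. s (Suc n) a x - G n a x)" by (simp add: s_def)
  have "AE p in PM. Qc zt (s n) (fst p) (snd p) = Qc zt (s (Suc n)) (fst p) (snd p) - Qc zt (G n) (fst p) (snd p)"
   using Qc_diff[OF Ls[of "Suc n"] GL[of n], of zt] unfolding eq[symmetric] .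
  with Suc show ?case by eventually_elim (simp add: GS diff_eq_eq)
 qed
 have "AE p in PM. nm R (fst p) (snd p) <= nm (d (Suc n)) (fst p) (snd p) + Qn rh (nm (d n)) (fst p) (snd p)" for n
  using sQ[of n] Qc_diff[OF Lh Ls[of n], of zt] AE_space
 proof eventually_elim
  case (elim p)
  have p: "snd p : S" using elim(3) by (auto simp: space_pair_measure Om_S)
  have "s (Suc n) (fst p) (snd p) = g (fst p) (snd p) + (\<Sum>j<n. G (Suc j) (fst p) (snd p))"
   unfolding s_def sum.lessThan_Suc_shift by (simp add: G_def)
  then have "R (fst p) (snd p) = d (Suc n) (fst p) (snd p) + (- Qc zt (d n) (fst p) (snd p))" using elim(1,2) unfolding R_def by (simp add: d_def)
  then have "nm R (fst p) (snd p) <= nm (d (Suc n)) (fst p) (snd p) + nm (Qc zt (d n)) (fst p) (snd p)"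
   using norm_triangle_ineq[of "d (Suc n) (fst p) (snd p)" "- Qc zt (d n) (fst p) (snd p)"]
   unfolding nm_def ennreal_plus[symmetric, OF norm_ge_zero norm_ge_zero] by (intro ennreal_leI) simp
  also have "... <= nm (d (Suc n)) (fst p) (snd p) + Qn rh (nm (d n)) (fst p) (snd p)" unfolding rh_def by (intro add_left_mono Qc_norm p)
  finally show ?case .
 qed
 then have "I2 (nm R) <= I2 (nm (d (Suc n))) + en CQ * I2 (nm (d n))" for n
  using I2_mono_AE[OF L1cD(3)[OF LR] mb_add[OF L1cD(3)[OF Ld] mb_Qn[OF L1cD(3)[OF Ld]]], of "Suc n" rh n]
   I2_add[OF L1cD(3)[OF Ld] mb_Qn[OF L1cD(3)[OF Ld]], of "Suc n" rh n] CQ(2)[OF L1cD(3)[OF Ld[of n]]]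
  by (metis (no_types, lifting) add_left_mono order_trans)
 moreover have "(%n. I2 (nm (d (Suc n))) + en CQ * I2 (nm (d n))) \<longlonglongrightarrow> 0 + en CQ * 0"
  by (intro tendsto_add LIMSEQ_Suc[OF Id0] ennreal_tendsto_cmult Id0) simp
 ultimately have "I2 (nm R) <= 0" using LIMSEQ_le_const[of _ "0 + en CQ * 0" "I2 (nm R)"] by auto
 then have "I2 (nm R) = 0" by simp
 then have "AE p in PM. nm R (fst p) (snd p) = 0" by (rule I2_zero_AE[OF L1cD(3)[OF LR]])
 then have "AE p in PM. h (fst p) (snd p) = g (fst p) (snd p) + Qc zt h (fst p) (snd p)" by eventually_elim (simp add: nm_def R_def algebra_simps)
 then show ?thesis using Lh by blast
qed

end

section \<open>The resolvent on integrable functions\<close>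

context age_model
begin

lemma integral_Icc_eq_AM:
 fixes F :: "real => 'b::{banach, second_countable_topology}"
 assumes F: "F : BM AM" and a: "a : Ag" and s: "0 <= s"
  and X: "{s<..<a} <= X" "X <= {s..a}" "X : sets borel"
 shows "integral\<^sup>L (lebesgue_on {s..a}) F = (LINT t|AM. indicator X t *\<^sub>R F t)"
proof -
 have a0: "0 < a" using a by (simp add: ages_def)
 have [measurable]: "Ag : sets lebesgue" by (rule ages_sets)
 have [measurable (raw)]: "(%x::real. x) : borel_measurable lebesgue" by (rule measurable_completion) simp
 have [measurable]: "X : sets lebesgue" using X(3) by (simp add: sets_completionI_sets)
 define ph where "ph t = indicator (Ag) t *\<^sub>R F t" for t
 have phm[measurable]: "ph : borel_measurable lebesgue"
  using F unfolding AM_def ph_def by (subst (asm) borel_measurable_restrict_space_iff) (use ages_sets in auto)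
 have "integral\<^sup>L (lebesgue_on {s..a}) F = (LINT t|lebesgue. ind {s..a} t *\<^sub>R F t)" by (rule integral_restrict_space) simp
 also have "... = (LINT t|lebesgue. indicator (Ag) t *\<^sub>R (indicator X t *\<^sub>R F t))"
 proof (rule integral_cong_AE)
  have "t : Ag" if "t : {s..a}" "t ~= 0" for t using ages_down[OF a, of t] that s by auto
  then have e: "ind {s..a} t *\<^sub>R F t = ind {s..a} t *\<^sub>R ph t + indicator ({s..a} - Ag) t *\<^sub>R F 0" for t
   by (auto simp: ph_def indicator_def)
  show "(%t. ind {s..a} t *\<^sub>R F t) : borel_measurable lebesgue" unfolding e by measurable
  have "(%t. indicator (Ag) t *\<^sub>R (indicator X t *\<^sub>R F t)) = (%t. indicator X t *\<^sub>R ph t)" by (auto simp: ph_def fun_eq_iff)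
  then show "(%t. indicator (Ag) t *\<^sub>R (indicator X t *\<^sub>R F t)) : borel_measurable lebesgue" by simp
  have "AE t in lebesgue. t ~= s" "AE t in lebesgue. t ~= a"
   using AE_completion[OF AE_lborel_singleton[of s]] AE_completion[OF AE_lborel_singleton[of a]] by auto
  then show "AE t in lebesgue. ind {s..a} t *\<^sub>R F t = indicator (Ag) t *\<^sub>R (indicator X t *\<^sub>R F t)"
  proof eventually_elim
   case (elim t)
   show ?case
   proof (cases "t : {s<..<a}")
    case True
    then have "t : Ag" using ages_down[OF a, of t] s by auto
    then show ?thesis using True X(1) by (auto simp: indicator_def)
   next
    case False
    then show ?thesis using elim X(2) by (auto simp: indicator_def)
   qed
  qed
 qed
 also have "... = (LINT t|AM. indicator X t *\<^sub>R F t)" unfolding AM_def by (rule integral_restrict_space[symmetric]) (use ages_sets in simp)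
 finally show ?thesis .
qed

lemma pi_surv_qq:
 assumes a: "a : Ag" and s: "0 <= s" "s <= a" and x: "x : S"
 shows "exp (- D * (a - s)) * pi_surv mu s a x = qq a x / qq s x"
proof -
 have "integral\<^sup>L (lebesgue_on {s..a}) (%t. mu t x) = (LINT t|AM. ind {s<..a} t *\<^sub>R mu t x)"
  using mu_AM[OF x, of "%t. t"] by (intro integral_Icc_eq_AM[OF _ a s(1)]) auto
 then have "integral\<^sup>L (lebesgue_on {s..a}) (%t. mu t x) = mm a x - mm s x" using mm_diff[OF a s x] by simp
 then show ?thesis unfolding pi_surv_def qq_def by (simp add: exp_diff[symmetric] exp_add[symmetric] algebra_simps)
qed

lemma R0_eq:
 assumes a: "a : Ag" and x: "x : S" and p: "(%s. snd p s x) : BM AM"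
 shows "R0 mu D p a x = Rc 0 (fst p) a x + Vc 0 (snd p) a x"
proof -
 note [measurable] = qq_AM[OF x] p
 have a0: "0 < a" using a by (simp add: ages_def)
 have "integral\<^sup>L (lebesgue_on {0..a}) (%s. complex_of_real (exp (- D * (a - s)) * pi_surv mu s a x) * snd p s x)
   = integral\<^sup>L (lebesgue_on {0..a}) (%s. complex_of_real (qq a x / qq s x) * snd p s x)"
  by (intro Bochner_Integration.integral_cong refl) (use pi_surv_qq[OF a _ _ x] in auto)
 also have "... = (LINT s|AM. ind {0<..<a} s *\<^sub>R (complex_of_real (qq a x / qq s x) * snd p s x))"
  using a0 by (intro integral_Icc_eq_AM[OF _ a order_refl]) auto
 also have "... = Vc 0 (snd p) a x" unfolding Vc_def by (intro Bochner_Integration.integral_cong refl) (auto simp: indicator_def ages_def)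
 finally show ?thesis unfolding R0_def Rc_def using pi_surv_qq[OF a order_refl less_imp_le[OF a0] x] by simp
qed

definition hR :: "(real^'n => complex) => (real => real^'n => complex) => real => real^'n => complex" where
 "hR p1 p2 a x = Rc 0 p1 a x + Vc 0 p2 a x"
definition F1 :: "(real^'n => complex) => (real => real^'n => complex) => real^'n => complex" where
 "F1 p1 p2 x = p1 x - bc (hR p1 p2) x"
definition F2 :: "complex => (real^'n => complex) => (real => real^'n => complex) => real => real^'n => complex" where
 "F2 zt p1 p2 a x = zt * hR p1 p2 a x + p2 a x - of_real D * Kc (hR p1 p2) a x"

definition LL :: "complex => 'n elt => 'n elt" where
 "LL zt p = diffXX (scaleXX zt (domA_elt mu D p)) (opA_img Om ahat D J beta mu p)"

lemma LL_eq:
 assumes p: "!!x. x : Om ==> (%s. snd p s x) : BM AM"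
 shows "x : S ==> (%s. snd p s x) : BM AM ==> fst (LL zt p) x = F1 (fst p) (snd p) x"
  and "a : Ag ==> x : S ==> (%s. snd p s x) : BM AM ==> snd (LL zt p) a x = F2 zt (fst p) (snd p) a x"
proof -
 assume x: "x : S" "(%s. snd p s x) : BM AM"
 have "(LINT a|AM. complex_of_real (beta a x) * R0 mu D p a x) = bc (hR (fst p) (snd p)) x"
  unfolding bc_def hR_def by (intro Bochner_Integration.integral_cong refl) (simp add: R0_eq[OF _ x])
 then show "fst (LL zt p) x = F1 (fst p) (snd p) x" unfolding LL_def F1_def diffXX_def scaleXX_def domA_elt_def opA_img_def Let_def AM_def by simp
next
 assume a: "a : Ag" and x: "x : S" "(%s. snd p s x) : BM AM"
 have "(LINT y|OM. complex_of_real (J (x - y)) * R0 mu D p a y) = Kc (hR (fst p) (snd p)) a x"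
  unfolding Kc_def hR_def by (intro Bochner_Integration.integral_cong refl) (simp add: R0_eq[OF a] Om_S p)
 then show "snd (LL zt p) a x = F2 zt (fst p) (snd p) a x" unfolding LL_def F2_def diffXX_def scaleXX_def domA_elt_def opA_img_def Let_def OM_def
  by (simp add: R0_eq[OF a x] hR_def)
qed

lemma prodM_eq: "prodM ahat Om = PM" by (simp add: prodM_def AM_def OM_def)

lemma inXX_XL1: "inXX XL1 Om ahat p \<longleftrightarrow> integrable OM (fst p) & L1c (snd p)"
proof -
 have "set_integrable lebesgue Om (fst p) \<longleftrightarrow> integrable OM (fst p)"
  unfolding set_integrable_def OM_def using Om_sets by (subst integrable_restrict_space) auto
 then show ?thesis by (cases p) (simp add: inXX_def prodM_eq L1c_iff)
qed

lemma eqXX_XL1: "eqXX XL1 Om ahat p p' \<longleftrightarrow> (AE x in OM. fst p x = fst p' x) &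
 (AE q in PM. snd p (fst q) (snd q) = snd p' (fst q) (snd q))" unfolding eqXX_def prodM_eq OM_def[symmetric] by (cases p; cases p') simp

lemma normXX_XL1:
 assumes "integrable OM e" "L1c h"
 shows "en (normXX XL1 Om ahat (e, h)) = NI OM (%x. nm1 e x) + I2 (nm h)"
proof -
 have "NI OM (%x. nm1 e x) = en (LINT x|OM. cmod (e x))" unfolding nm1_def using assms(1) by (intro nn_integral_eq_integral) auto
 moreover have "I2 (nm h) = en (LINT p|PM. cmod (h (fst p) (snd p)))"
  unfolding I2_pair[OF L1cD(3)[OF assms(2)]] nm_def using assms(2) by (intro nn_integral_eq_integral) (auto simp: L1c_iff)
 ultimately show ?thesis unfolding normXX_def prodM_eq by (simp add: OM_def[symmetric] ennreal_plus)
qed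

lemma normXX_XL1_cong:
 assumes "!!x. x : Om ==> e x = e' x" "!!a x. a : Ag ==> x : Om ==> h a x = h' a x"
 shows "normXX XL1 Om ahat (e, h) = normXX XL1 Om ahat (e', h')" unfolding normXX_def prodM_eq OM_def[symmetric] using assms
 by (auto intro!: arg_cong2[where f="(+)"] Bochner_Integration.integral_cong simp: space_pair_measure)

lemma okr0: "okr (0 + D + mut)" using D_pos mut_pos by (simp add: okr_def)

lemma nm1_int: "integrable OM e ==> (NI OM (%x. nm1 e x)) < \<infinity>" by (simp add: integrable_iff_bounded nm1_def)
lemma nm1_meas: "e : BM OM ==> nm1 e : BM OM" unfolding nm1_def by measurable

lemma L1c_Rc_Vc:
 assumes ok: "okr (Re zt + D + mut)" and e: "integrable OM e" and G: "L1c G"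
 shows "L1c (%a x. Rc zt e a x + Vc zt G a x)"
proof (intro L1c_add)
 have em: "e : BM OM" using e by (rule borel_measurable_integrable)
 show "L1c (Rc zt e)" unfolding L1c_def
 proof
  show "cm (Rc zt e)" by (rule cm_Rc[OF em])
  have "nm (Rc zt e) = Rn (Re zt) (nm1 e)" by (intro ext Rc_norm)
  then show "I2 (nm (Rc zt e)) < \<infinity>" using I2_Rn_finite[OF ok nm1_meas[OF em] nm1_int[OF e]] by simp
 qed
 obtain C where "I2 (Vn (Re zt) (nm G)) <= en C * I2 (nm G)" using I2_Vn[OF ok] L1cD(3)[OF G] by blast
 then have "I2 (Vn (Re zt) (nm G)) < \<infinity>" using L1cD(2)[OF G] by (auto intro: order_le_less_trans simp: ennreal_mult_less_top)
 then show "L1c (Vc zt G)" by (rule L1c_le[OF cm_Vc[OF L1cD(1)[OF G]] mb_Vn[OF L1cD(3)[OF G]]]) (auto intro!: AE_I2 Vc_norm)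
qed

lemma L1c_hR: "integrable OM p1 ==> L1c p2 ==> L1c (hR p1 p2)" unfolding hR_def using L1c_Rc_Vc[of 0] okr0 by simp

lemma L1c_DKc: "L1c h ==> L1c (%s x. of_real D * Kc h s x)"
proof (intro L1c_cmult)
 assume h: "L1c h"
 have m: "(%s. NI OM (%z. nm h s z)) : BM AM"
 proof -
  note [measurable] = mbD[OF L1cD(3)[OF h]]
  show ?thesis by measurable
 qed
 have "I2 (Kn (nm h)) <= NI AM (%s. en (JB * measure OM Om) * NI OM (%z. nm h s z))" unfolding I2_def
 proof (rule nn_integral_mono)
  fix s assume "s : space AM"
  then have s: "s : Ag" by simp
  have "NI OM (%x. Kn (nm h) s x) <= NI OM (%x. en JB * NI OM (%z. nm h s z))" by (intro nn_integral_mono Kn_le L1cD(3)[OF h] s)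
  then show "NI OM (%x. Kn (nm h) s x) <= en (JB * measure OM Om) * NI OM (%z. nm h s z)"
   using JB_pos by (simp add: OM.emeasure_eq_measure ennreal_mult mult_ac)
 qed
 also have "... = en (JB * measure OM Om) * I2 (nm h)" unfolding I2_def by (rule nn_integral_cmult[OF m])
 also have "... < \<infinity>" using L1cD(2)[OF h] by (simp add: ennreal_mult_less_top)
 finally show "L1c (Kc h)" by (rule L1c_le[OF cm_Kc[OF L1cD(1)[OF h]] mb_Kn[OF L1cD(3)[OF h]]]) (auto intro!: AE_I2 Kc_norm)
qed

lemma bc_integrable_OM: "L1c h ==> integrable OM (bc h)"
proof (rule integrableI_bounded)
 assume h: "L1c h"
 show "bc h : BM OM" by (rule bc_OM[OF L1cD(1)[OF h]])
 have "NI OM (%x. en (norm (bc h x))) <= NI OM (%x. bn (nm h) x)" using bc_norm[of _ h] by (intro nn_integral_mono) (auto simp: nm1_def Om_S)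
 also have "... <= en B * I2 (nm h)" by (rule bn_int_le[OF L1cD(3)[OF h]])
 also have "... < \<infinity>" using L1cD(2)[OF h] by (simp add: ennreal_mult_less_top)
 finally show "NI OM (%x. en (norm (bc h x))) < \<infinity>" .
qed

lemma hR_identity:
 assumes "x : S" "integrable AM (%s. p2 s x)" "a : Ag"
 shows "hR p1 p2 a x = Rc zt (%x. F1 p1 p2 x + bc (hR p1 p2) x) a x
   + Vc zt (%s x. F2 zt p1 p2 s x + of_real D * Kc (hR p1 p2) s x) a x"
proof -
 have "Rc zt p1 a x + Vc zt (%s x. p2 s x + (zt - 0) * hR p1 p2 s x) a x = hR p1 p2 a x"
  by (rule resolvent_identity[where G=p2 and h="hR p1 p2" and nu=0, OF assms]) (simp add: hR_def)
 moreover have "(%x. F1 p1 p2 x + bc (hR p1 p2) x) = p1" by (simp add: F1_def)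
 moreover have "(%s x. F2 zt p1 p2 s x + of_real D * Kc (hR p1 p2) s x) = (%s x. p2 s x + (zt - 0) * hR p1 p2 s x)" by (simp add: F2_def fun_eq_iff)
 ultimately show ?thesis by simp
qed

lemma hR_bound:
 assumes x: "x : S" and p2: "integrable AM (%s. p2 s x)" and a: "a : Ag"
  and h: "cm (hR p1 p2)"
 shows "nm (hR p1 p2) a x <= Rn (Re zt) (nm1 (F1 p1 p2)) a x + Vn (Re zt) (nm (F2 zt p1 p2)) a x
  + Rn (Re zt) (bn (nm (hR p1 p2))) a x + Sn (Re zt) (nm (hR p1 p2)) a x"
proof -
 let ?h = "hR p1 p2" and ?f1 = "F1 p1 p2" and ?f2 = "F2 zt p1 p2"
 note [measurable] = borel_measurable_integrable[OF p2] Kc_AM[OF h]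
 have [measurable]: "(%s. ?h s x) : BM AM" unfolding hR_def using Rc_AM[OF x] Vc_AM[OF x, of p2] by measurable
 have m: "(%s. nm ?f2 s x) : BM AM" unfolding F2_def nm_def by measurable
 have mK: "(%s. en D * Kn (nm ?h) s x) : BM AM" using Kn_AM[OF cm_nm[OF h], of "%s. s"] by measurable
 have "nm ?h a x = nm (%a x. Rc zt (%x. ?f1 x + bc ?h x) a x + Vc zt (%s x. ?f2 s x + of_real D * Kc ?h s x) a x) a x"
  unfolding nm_def using hR_identity[OF x _ a, of p2 p1 zt] p2 by simp
 also have "... <= nm (Rc zt (%x. ?f1 x + bc ?h x)) a x + nm (Vc zt (%s x. ?f2 s x + of_real D * Kc ?h s x)) a x" by (rule nm_add)
 also have "nm (Rc zt (%x. ?f1 x + bc ?h x)) a x <= Rn (Re zt) (nm1 ?f1) a x + Rn (Re zt) (bn (nm ?h)) a x"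
 proof -
  have "nm1 (%x. ?f1 x + bc ?h x) x <= nm1 ?f1 x + nm1 (bc ?h) x"
   unfolding nm1_def ennreal_plus[symmetric, OF norm_ge_zero norm_ge_zero] by (intro ennreal_leI norm_triangle_ineq)
  also have "... <= nm1 ?f1 x + bn (nm ?h) x" by (intro add_left_mono bc_norm[OF x])
  finally show ?thesis unfolding Rc_norm Rn_def distrib_left[symmetric] by (rule mult_left_mono) simp
 qed
 also have "nm (Vc zt (%s x. ?f2 s x + of_real D * Kc ?h s x)) a x <= Vn (Re zt) (nm ?f2) a x + Sn (Re zt) (nm ?h) a x"
 proof -
  have "nm (Vc zt (%s x. ?f2 s x + of_real D * Kc ?h s x)) a x <= Vn (Re zt) (nm (%s x. ?f2 s x + of_real D * Kc ?h s x)) a x" by (rule Vc_norm)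
  also have "... <= Vn (Re zt) (%s x. nm ?f2 s x + en D * Kn (nm ?h) s x) a x" by (intro Vn_mono order_trans[OF nm_add] add_left_mono nm_DKc)
  also have "... = Vn (Re zt) (nm ?f2) a x + Sn (Re zt) (nm ?h) a x"
   unfolding Sn_def by (rule Vn_add[where F="nm ?f2" and G="%s x. en D * Kn (nm ?h) s x", OF x m mK])
  finally show ?thesis .
 qed
 finally show ?thesis by (simp add: add_mono ac_simps)
qed

end

context age_eig
begin

lemma XL1_bound:
 assumes rrh: "r < Re zt"
 shows "EX C>0. ALL p1 p2. integrable OM p1 --> L1c p2 -->
  I2 (nm (hR p1 p2)) <= en C * (NI OM (%x. nm1 (F1 p1 p2) x) + I2 (nm (F2 zt p1 p2)))"
proof -
 define rh where "rh = Re zt"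
 have rr: "r <= rh" using rrh by (simp add: rh_def)
 note ok = rho(2)[OF rr]
 obtain C where C: "C > 0" "!!H g. mb H ==> mb g ==> I2 H < \<infinity> ==>
  (AE p in PM. H (fst p) (snd p) <= g (fst p) (snd p) + Rn rh (bn H) (fst p) (snd p) + Sn rh H (fst p) (snd p)) ==>
  I2 H <= en C * I2 g" using apriori[of rh] rrh unfolding rh_def by blast
 obtain C5 where C5: "C5 > 0" "!!e. e : BM OM ==> I2 (Rn rh e) <= en C5 * NI OM (%x. e x)" using I2_Rn[OF ok] by blast
 obtain C6 where C6: "C6 > 0" "!!F. mb F ==> I2 (Vn rh F) <= en C6 * I2 F" using I2_Vn[OF ok] by blast
 have "I2 (nm (hR p1 p2)) <= en (C * (C5 + C6)) * (NI OM (%x. nm1 (F1 p1 p2) x) + I2 (nm (F2 zt p1 p2)))"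
  if p1: "integrable OM p1" and p2: "L1c p2" for p1 p2
 proof -
  let ?h = "hR p1 p2" and ?f1 = "F1 p1 p2" and ?f2 = "F2 zt p1 p2"
  have Lh: "L1c ?h" by (rule L1c_hR[OF p1 p2])
  have f1: "nm1 ?f1 : BM OM"
   by (rule nm1_meas) (use borel_measurable_integrable[OF p1] bc_OM[OF L1cD(1)[OF Lh]] in \<open>simp add: F1_def[abs_def]\<close>)
  have f2: "mb (nm ?f2)" by (rule L1cD(3)) (unfold F2_def[abs_def], intro L1c_diff L1c_add L1c_cmult Lh p2 L1c_DKc)
  have "I2 (nm ?h) <= en C * I2 (%a x. Rn rh (nm1 ?f1) a x + Vn rh (nm ?f2) a x)"
  proof (rule C(2)[OF L1cD(3)[OF Lh] mb_add[OF mb_Rn[OF f1] mb_Vn[OF f2]] L1cD(2)[OF Lh]])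
   from AE_P_of_OM[OF L1c_section_x[OF p2]] AE_space
   show "AE p in PM. nm ?h (fst p) (snd p) <= Rn rh (nm1 ?f1) (fst p) (snd p) + Vn rh (nm ?f2) (fst p) (snd p) + Rn rh (bn (nm ?h)) (fst p) (snd p) + Sn rh (nm ?h) (fst p) (snd p)"
    unfolding rh_def
   proof eventually_elim
    case (elim p)
    then have p: "fst p : Ag" "snd p : S" by (auto simp: space_pair_measure Om_S)
    show ?case by (rule hR_bound[OF p(2) _ p(1) L1cD(1)[OF Lh]]) (use elim in simp)
   qed
  qed
  also have "I2 (%a x. Rn rh (nm1 ?f1) a x + Vn rh (nm ?f2) a x) = I2 (Rn rh (nm1 ?f1)) + I2 (Vn rh (nm ?f2))"
   by (rule I2_add[OF mb_Rn[OF f1] mb_Vn[OF f2]])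
  also have "en C * ... <= en C * (en (C5 + C6) * NI OM (%x. nm1 ?f1 x) + en (C5 + C6) * I2 (nm ?f2))"
   using C5(1) C6(1) by (intro mult_left_mono add_mono order_trans[OF C5(2)[OF f1]] order_trans[OF C6(2)[OF f2]] mult_right_mono ennreal_leI) auto
  also have "... = en (C * (C5 + C6)) * (NI OM (%x. nm1 ?f1 x) + I2 (nm ?f2))"
   using C(1) C5(1) C6(1) by (simp add: ennreal_mult distrib_left[symmetric] mult.assoc del: ennreal_plus)
  finally show ?thesis .
 qed
 then show ?thesis using C C5 C6 by (intro exI[of _ "C * (C5 + C6)"]) auto
qed

lemma XL1_solve:
 assumes rrh: "r < Re zt" and f1: "integrable OM f1" and f2: "L1c f2"
 obtains h0 where "L1c h0"
  "AE p in PM. h0 (fst p) (snd p) = Rc zt (%x. f1 x + bc h0 x) (fst p) (snd p) + Vc zt (%s x. f2 s x + of_real D * Kc h0 s x) (fst p) (snd p)"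
proof -
 have ok: "okr (Re zt + D + mut)" using rho(2) rrh by simp
 obtain h0 where h0: "L1c h0" "AE p in PM. h0 (fst p) (snd p) = (Rc zt f1 (fst p) (snd p) + Vc zt f2 (fst p) (snd p)) + Qc zt h0 (fst p) (snd p)"
  using Neumann[OF rrh L1c_Rc_Vc[OF ok f1 f2]] by blast
 have "AE p in PM. h0 (fst p) (snd p) = Rc zt (%x. f1 x + bc h0 x) (fst p) (snd p) + Vc zt (%s x. f2 s x + of_real D * Kc h0 s x) (fst p) (snd p)"
  using h0(2) AE_P_of_OM[OF L1c_section_x[OF f2]] AE_space
 proof eventually_elim
  case (elim p)
  then have p: "fst p : Ag" "snd p : Om" "snd p : S" by (auto simp: space_pair_measure Om_S)
  have mK: "(%s. of_real D * Kc h0 s (snd p)) : BM AM" using Kc_AM[OF L1cD(1)[OF h0(1)], of "snd p"] by measurable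
  have "Vc zt (%s x. f2 s x + of_real D * Kc h0 s x) (fst p) (snd p) = Vc zt f2 (fst p) (snd p) + Vc zt (%s x. of_real D * Kc h0 s x) (fst p) (snd p)"
   by (rule Vc_add[where G=f2 and F="%s x. of_real D * Kc h0 s x", OF p(3) borel_measurable_integrable[OF elim(2)] mK
     Vn_finite_integrable[where G=f2, OF p(3) elim(2) p(1)] Vn_mono_nm_finite[OF h0(1) p(3,1)]])
  then show ?case using elim(1) by (simp add: Qc_def Rc_def Sc_def algebra_simps)
 qed
 then show thesis using that h0(1) by blast
qed

lemma XL1_resolvent:
 assumes rrh: "r < Re zt"
 shows "zt : resolvent_A XL1 Om ahat D J beta mu"
proof -
 have surj: "EX p. inXX XL1 Om ahat p & eqXX XL1 Om ahat (LL zt p) f" if f: "inXX XL1 Om ahat f" for f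
 proof -
  define f1 f2 where "f1 = fst f" and "f2 = snd f"
  have f1: "integrable OM f1" and f2: "L1c f2" using f by (auto simp: inXX_XL1 f1_def f2_def)
  obtain h0 where h0: "L1c h0"
   "AE p in PM. h0 (fst p) (snd p) = Rc zt (%x. f1 x + bc h0 x) (fst p) (snd p) + Vc zt (%s x. f2 s x + of_real D * Kc h0 s x) (fst p) (snd p)"
   by (rule XL1_solve[OF rrh f1 f2])
  have ok: "okr (Re zt + D + mut)" using rho(2) rrh by simp
  define p1 where "p1 x = f1 x + bc h0 x" for x
  define G where "G s x = f2 s x + of_real D * Kc h0 s x" for s x
  define h where "h a x = Rc zt p1 a x + Vc zt G a x" for a x
  define p2 where "p2 a x = G a x + (0 - zt) * h a x" for a x
  have p1: "integrable OM p1" unfolding p1_def using f1 bc_integrable_OM[OF h0(1)] by simp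
  have LG: "L1c G" unfolding G_def by (intro L1c_add f2 L1c_DKc h0(1))
  have Lh: "L1c h" unfolding h_def by (rule L1c_Rc_Vc[OF ok p1 LG])
  have p2: "L1c p2" unfolding p2_def by (intro L1c_add LG L1c_cmult Lh)
  have hh0: "AE p in PM. h (fst p) (snd p) = h0 (fst p) (snd p)" using h0(2) by eventually_elim (simp add: h_def p1_def[abs_def] G_def[abs_def])
  have hRh_x: "AE x in OM. ALL a:Ag. hR p1 p2 a x = h a x" using L1c_section_x[OF LG] AE_space
  proof eventually_elim
   case (elim x)
   then have x: "x : S" by (simp add: Om_S)
   show ?case
   proof
    fix a assume a: "a : Ag"
    have "Rc 0 p1 a x + Vc 0 (%s x. G s x + (0 - zt) * h s x) a x = h a x"
     by (rule resolvent_identity[where G=G and h=h and nu=zt, OF x elim(1) a]) (simp add: h_def)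
    then show "hR p1 p2 a x = h a x" by (simp add: hR_def p2_def[abs_def])
   qed
  qed
  have hRh: "AE p in PM. hR p1 p2 (fst p) (snd p) = h (fst p) (snd p)"
   using AE_P_of_OM[OF hRh_x] AE_space by eventually_elim (auto simp: space_pair_measure)
  have cmhR: "cm (hR p1 p2)" by (rule L1cD(1)[OF L1c_hR[OF p1 p2]])
  have hR0: "AE p in PM. hR p1 p2 (fst p) (snd p) = h0 (fst p) (snd p)" using hRh hh0 by eventually_elim simp
  have sec: "(%s. snd (p1, p2) s x) : BM AM" if "x : Om" for x using cm_section[OF L1cD(1)[OF p2] that] by simp
  have "AE x in OM. fst (LL zt (p1, p2)) x = f1 x" using bc_AE[OF cmhR L1cD(1)[OF h0(1)] hR0] AE_space
  proof eventually_elim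
   case (elim x)
   then show ?case using LL_eq(1)[OF sec _ sec, of x] by (simp add: Om_S F1_def p1_def[of x])
  qed
  moreover obtain xx where xx: "xx : S" using Om_ne Om_S by blast
  have "AE p in PM. snd (LL zt (p1, p2)) (fst p) (snd p) = f2 (fst p) (snd p)"
   using hRh AE_P_of_AM[OF Sc_AE(2)[OF cmhR L1cD(1)[OF h0(1)] xx hR0]] AE_space
  proof eventually_elim
   case (elim p)
   then have p: "fst p : Ag" "snd p : Om" "snd p : S" by (auto simp: space_pair_measure Om_S)
   show ?case using elim(1,2) by (simp add: LL_eq(2)[OF sec p(1,3) sec[OF p(2)]] F2_def p2_def[of "fst p" "snd p"] G_def[of "fst p" "snd p"])
  qed
  ultimately show ?thesis using p1 p2 by (intro exI[of _ "(p1, p2)"]) (simp add: inXX_XL1 eqXX_XL1 f1_def f2_def)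
 qed
 obtain C where C: "C > 0" "!!p1 p2. integrable OM p1 ==> L1c p2 ==>
  I2 (nm (hR p1 p2)) <= en C * (NI OM (%x. nm1 (F1 p1 p2) x) + I2 (nm (F2 zt p1 p2)))" using XL1_bound[OF rrh] by blast
 have bound: "normXX XL1 Om ahat (domA_elt mu D p) <= C * normXX XL1 Om ahat (LL zt p)" if p: "inXX XL1 Om ahat p" for p
 proof -
  define p1 p2 where "p1 = fst p" and "p2 = snd p"
  have pe: "p = (p1, p2)" by (simp add: p1_def p2_def)
  have p1: "integrable OM p1" and p2: "L1c p2" using p by (auto simp: inXX_XL1 p1_def p2_def)
  have sec: "(%s. snd p s x) : BM AM" if "x : Om" for x using cm_section[OF L1cD(1)[OF p2] that] by (simp add: p2_def)
  have Lh: "L1c (hR p1 p2)" by (rule L1c_hR[OF p1 p2])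
  have F1i: "integrable OM (F1 p1 p2)" unfolding F1_def[abs_def] using p1 bc_integrable_OM[OF Lh] by simp
  have F2i: "L1c (F2 zt p1 p2)" unfolding F2_def[abs_def] by (intro L1c_diff L1c_add L1c_cmult Lh p2 L1c_DKc)
  have n1: "normXX XL1 Om ahat (domA_elt mu D p) = normXX XL1 Om ahat (%_. 0, hR p1 p2)"
   unfolding domA_elt_def by (rule normXX_XL1_cong) (simp_all add: R0_eq sec Om_S hR_def p1_def p2_def)
  have n2: "normXX XL1 Om ahat (LL zt p) = normXX XL1 Om ahat (F1 p1 p2, F2 zt p1 p2)" by (subst prod.collapse[symmetric], rule normXX_XL1_cong)
    (simp_all add: LL_eq(1)[OF sec _ sec] LL_eq(2)[OF sec _ _ sec] Om_S p1_def p2_def)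
  have nn: "0 <= normXX XL1 Om ahat (F1 p1 p2, F2 zt p1 p2)" unfolding normXX_def by simp
  have "en (normXX XL1 Om ahat (domA_elt mu D p)) = I2 (nm (hR p1 p2))" unfolding n1 using normXX_XL1[of "%_. 0", OF _ Lh] by (simp add: nm1_def)
  also have "... <= en C * en (normXX XL1 Om ahat (LL zt p))" unfolding n2 normXX_XL1[OF F1i F2i] by (rule C(2)[OF p1 p2])
  also have "... = en (C * normXX XL1 Om ahat (LL zt p))" using C(1) nn n2 by (simp add: ennreal_mult)
  finally show ?thesis using C(1) nn n2 by (subst (asm) ennreal_le_iff) auto
 qed
 show ?thesis unfolding resolvent_A_def Let_def mem_Collect_eq LL_def[symmetric] using surj bound by blast
qed

end

section \<open>The resolvent on continuous functions\<close>

context age_model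
begin

definition Cd :: "(real^'n) set" where "Cd = (SOME C. countable C & C <= S & S <= closure C)"

lemma Cd: "countable Cd" "Cd <= S" "closure Cd = S"
proof -
 obtain C where "countable C" "C <= S" "S <= closure C" using separable[of S] by blast
 then have "EX C. countable C & C <= S & S <= closure C" by blast
 then have *: "countable Cd & Cd <= S & S <= closure Cd" unfolding Cd_def by (rule someI_ex)
 then show "countable Cd" "Cd <= S" by auto
 show "closure Cd = S" using * closure_minimal[of Cd S] by auto
qed

definition ns :: "(real => real^'n => complex) => real => ennreal" where
 "ns G a = (SUP x\<in>Cd. nm G a x)"

abbreviation (input) "NS G == nn_integral AM (ns G)"

definition XCd :: "(real => real^'n => complex) => bool" where
 "XCd G \<longleftrightarrow> (ALL x:S. (%a. G a x) : BM AM) & (AE a in AM. continuous_on S (G a)) & NS G < \<infinity>"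

lemma XCdD: "XCd G ==> x : S ==> (%a. G a x) : BM AM" "XCd G ==> AE a in AM. continuous_on S (G a)"
 "XCd G ==> NS G < \<infinity>" by (auto simp: XCd_def)

lemma nm_le_ns:
 assumes c: "continuous_on S (G a)" and x: "x : S"
 shows "nm G a x <= ns G a"
proof (cases "ns G a")
 case (real c)
 have "cmod (G a x) <= c"
 proof (rule continuous_on_closure_norm_le[of Cd "G a"])
  show "ALL y:Cd. cmod (G a y) <= c"
  proof
   fix y assume "y : Cd"
   then have "nm G a y <= ns G a" unfolding ns_def by (rule SUP_upper)
   then show "cmod (G a y) <= c" using real by (simp add: nm_def)
  qed
 qed (use c x Cd in auto)
 then show ?thesis using real by (simp add: nm_def ennreal_leI)
qed simp

lemma ns_le: "(!!x. x : S ==> nm G a x <= c) ==> ns G a <= c" unfolding ns_def using Cd(2) by (intro SUP_least) auto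

lemma ns_SUP: "continuous_on S (G a) ==> ns G a = (SUP x\<in>S. en (cmod (G a x)))"
 unfolding nm_def[symmetric] by (intro antisym ns_le SUP_upper SUP_least nm_le_ns)

lemma ns_AM: "(!!x. x : S ==> (%a. G a x) : BM AM) ==> ns G : BM AM"
proof -
 assume *: "!!x. x : S ==> (%a. G a x) : BM AM"
 have "(%a. nm G a x) : BM AM" if "x : Cd" for x
 proof -
  have [measurable]: "(%a. G a x) : BM AM" using * that Cd(2) by auto
  show ?thesis unfolding nm_def by measurable
 qed
 then show ?thesis unfolding ns_def[abs_def] using Cd(1) by (intro borel_measurable_SUP)
qed

lemma XCd_bound: "XCd G ==> AE a in AM. ALL x:S. nm G a x <= ns G a" by (drule XCdD(2)) (auto elim!: eventually_mono intro: nm_le_ns)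

lemma XCd_le:
 assumes "!!x. x : S ==> (%a. G a x) : BM AM" "AE a in AM. continuous_on S (G a)"
  and m: "AE a in AM. ALL x:S. nm G a x <= m a" "NI AM (%a. m a) <= c" "c < \<infinity>"
 shows "XCd G & NS G <= c"
proof -
 have "AE a in AM. ns G a <= m a" using m(1) by eventually_elim (auto intro: ns_le)
 then have "NS G <= c" using m(2) nn_integral_mono_AE order_trans by blast
 then show ?thesis using assms by (auto simp: XCd_def intro: order_le_less_trans)
qed

lemma XCd_add:
 assumes u: "XCd u" and v: "XCd v"
 shows "XCd (%a x. u a x + v a x)" "NI AM (%a. ns (%a x. u a x + v a x) a) <= NS u + NS v"
proof -
 have [measurable]: "ns u : BM AM" "ns v : BM AM" using XCdD(1) u v by (auto intro: ns_AM)
 have "XCd (%a x. u a x + v a x) & (NI AM (%a. ns (%a x. u a x + v a x) a)) <= NS u + NS v"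
 proof (rule XCd_le)
  show "(%a. u a x + v a x) : BM AM" if "x : S" for x using XCdD(1)[OF u that] XCdD(1)[OF v that] by measurable
  show "AE a in AM. continuous_on S (%x. u a x + v a x)" using XCdD(2)[OF u] XCdD(2)[OF v] by eventually_elim (intro continuous_intros)
  show "AE a in AM. ALL x:S. nm (%a x. u a x + v a x) a x <= ns u a + ns v a"
   using XCd_bound[OF u] XCd_bound[OF v] by eventually_elim (blast intro: order_trans[OF nm_add] add_mono)
  show "NI AM (%a. ns u a + ns v a) <= NS u + NS v" by (simp add: nn_integral_add)
 qed (use XCdD(3)[OF u] XCdD(3)[OF v] in simp)
 then show "XCd (%a x. u a x + v a x)" "NI AM (%a. ns (%a x. u a x + v a x) a) <= NS u + NS v" by auto
qed

lemma XCd_cmult: "XCd u ==> XCd (%a x. c * u a x)"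
proof -
 assume u: "XCd u"
 have [measurable]: "ns u : BM AM" using XCdD(1) u by (auto intro: ns_AM)
 have "XCd (%a x. c * u a x) & (NI AM (%a. ns (%a x. c * u a x) a)) <= en (cmod c) * NS u"
 proof (rule XCd_le)
  show "(%a. c * u a x) : BM AM" if "x : S" for x using XCdD(1)[OF u that] by measurable
  show "AE a in AM. continuous_on S (%x. c * u a x)" using XCdD(2)[OF u] by eventually_elim (intro continuous_intros)
  show "AE a in AM. ALL x:S. nm (%a x. c * u a x) a x <= en (cmod c) * ns u a"
   using XCd_bound[OF u] by eventually_elim (auto simp: nm_def norm_mult ennreal_mult intro!: mult_left_mono)
 qed (use XCdD(3)[OF u] in \<open>auto simp: nn_integral_cmult ennreal_mult_less_top\<close>)
 then show ?thesis ..
qed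

lemma XCd_int: "XCd G ==> x : S ==> integrable AM (%a. G a x)"
proof (rule integrableI_bounded)
 assume G: "XCd G" and x: "x : S"
 show "(%a. G a x) : BM AM" by (rule XCdD(1)[OF G x])
 have "NI AM (%a. en (norm (G a x))) <= NS G"
  unfolding nm_def[symmetric] by (rule nn_integral_mono_AE) (use XCd_bound[OF G] x in \<open>auto elim: eventually_mono\<close>)
 then show "NI AM (%a. en (norm (G a x))) < \<infinity>" using XCdD(3)[OF G] by (rule order_le_less_trans)
qed

lemma XCd_majorant:
 assumes "XCd G"
 shows "integrable AM (%s. c * enn2real (ns G s))" "AE s in AM. ALL x:S. cmod (G s x) <= enn2real (ns G s)"
proof -
 have [measurable]: "ns G : BM AM" using XCdD(1) assms by (auto intro: ns_AM)
 have fin: "AE s in AM. ns G s ~= \<infinity>" using XCdD(3)[OF assms] by (intro nn_integral_PInf_AE) auto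
 have "NI AM (%s. en (norm (enn2real (ns G s)))) = NI AM (%s. ns G s)"
  by (rule nn_integral_cong_AE) (use fin in \<open>eventually_elim, simp add: ennreal_enn2real_if\<close>)
 then have "integrable AM (%s. enn2real (ns G s))" using XCdD(3)[OF assms] by (intro integrableI_bounded) auto
 then show "integrable AM (%s. c * enn2real (ns G s))" by simp
 show "AE s in AM. ALL x:S. cmod (G s x) <= enn2real (ns G s)" using fin XCd_bound[OF assms]
 proof eventually_elim
  case (elim s)
  then show ?case by (cases "ns G s") (auto simp: nm_def)
 qed
qed

lemma SUP_AE: "AE a in AM. continuous_on S (g a) ==> (NI AM (%a. (SUP x\<in>S. en (cmod (g a x))))) = NS g"
 by (rule nn_integral_cong_AE) (auto elim!: eventually_mono simp: ns_SUP)

lemma inXX_XC: "inXX XC Om ahat p \<longleftrightarrow> continuous_on S (fst p) & XCd (snd p)"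
 unfolding inXX_def AM_def[symmetric] XCd_def by (cases p) (auto simp: SUP_AE)

lemma eqXX_XC: "eqXX XC Om ahat p p' \<longleftrightarrow> (ALL x:S. fst p x = fst p' x) & (AE a in AM. ALL x:S. snd p a x = snd p' a x)"
 unfolding eqXX_def AM_def[symmetric] by (cases p; cases p') simp

lemma normXX_XC: "XCd (snd p) ==> normXX XC Om ahat p = (SUP x\<in>S. cmod (fst p x)) + enn2real (NI AM (%a. ns (snd p) a))"
 unfolding normXX_def AM_def[symmetric] using SUP_AE[OF XCdD(2)] by (cases p) simp

lemma normXX_XC_cong:
 assumes "eqXX XC Om ahat p p'"
 shows "normXX XC Om ahat p = normXX XC Om ahat p'"
proof -
 note * = assms[unfolded eqXX_XC]
 have "(SUP x\<in>S. cmod (fst p x)) = (SUP x\<in>S. cmod (fst p' x))" using * by (intro SUP_cong) auto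
 moreover have "NI AM (%a. (SUP x\<in>S. en (cmod (snd p a x)))) = NI AM (%a. (SUP x\<in>S. en (cmod (snd p' a x))))"
  by (rule nn_integral_cong_AE) (use * in \<open>auto elim!: eventually_mono intro!: SUP_cong\<close>)
 ultimately show ?thesis unfolding normXX_def AM_def[symmetric] by (cases p; cases p') simp
qed

lemma XCd_I2: "XCd G ==> cm G ==> I2 (nm G) <= en (measure OM Om) * NS G"
proof -
 assume G: "XCd G" "cm G"
 have [measurable]: "ns G : BM AM" using XCdD(1) G by (auto intro: ns_AM)
 have "I2 (nm G) <= NI AM (%a. en (measure OM Om) * ns G a)" unfolding I2_def
 proof (rule nn_integral_mono_AE)
  show "AE a in AM. (NI OM (%x. nm G a x)) <= en (measure OM Om) * ns G a" using XCd_bound[OF G(1)]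
  proof eventually_elim
   case (elim a)
   then have "NI OM (%x. nm G a x) <= NI OM (%x. ns G a)" by (intro nn_integral_mono) (auto simp: Om_S)
   then show ?case by (simp add: OM.emeasure_eq_measure mult.commute)
  qed
 qed
 then show ?thesis by (simp add: nn_integral_cmult)
qed

lemma XCd_nice:
 assumes G: "XCd G"
 obtains G' where "XCd G'" "L1c G'" "AE a in AM. ALL x. G' a x = G a x"
proof -
 obtain N where N: "{a : space AM. ~ continuous_on S (G a)} <= N" "N : null_sets AM" using XCdD(2)[OF G] by (auto elim!: AE_E simp: null_sets_def)
 then have [measurable]: "N : sets AM" by auto
 define G' where "G' a x = (if a : N then 0 else G a x)" for a x
 have eq: "AE a in AM. ALL x. G' a x = G a x" using AE_not_in[OF N(2)] by eventually_elim (simp add: G'_def)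
 have m: "(%a. G' a x) : BM AM" if "x : S" for x using XCdD(1)[OF G that] unfolding G'_def by measurable
 have c: "continuous_on S (G' a)" if "a : Ag" for a using that N(1) by (cases "a : N") (auto simp: G'_def[abs_def])
 have X: "XCd G' & (NI AM (%a. ns G' a)) <= NS G"
 proof (rule XCd_le[OF m])
  show "AE a in AM. ALL x:S. nm G' a x <= ns G a" using eq XCd_bound[OF G] by eventually_elim (simp add: nm_def)
 qed (use c XCdD(3)[OF G] in auto)
 have "cm G'" unfolding cm_def by (rule caratheodory_AM_OM) (use m c in \<open>auto intro: continuous_on_Om simp: Om_S\<close>)
 then have "L1c G'" using XCd_I2[of G'] X XCdD(3) unfolding L1c_def by (auto intro!: order_le_less_trans[OF XCd_I2] simp: ennreal_mult_less_top)
 then show thesis using that X eq by blast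
qed

lemma XCd_Kc:
 assumes h: "L1c h"
 shows "XCd (%s x. of_real D * Kc h s x) & (NI AM (%a. ns (%s x. of_real D * Kc h s x) a)) <= en (D * JB) * I2 (nm h)"
proof (rule XCd_le)
 show "(%a. of_real D * Kc h a x) : BM AM" for x using Kc_AM[OF L1cD(1)[OF h], of x] by measurable
 show "AE a in AM. continuous_on S (%x. of_real D * Kc h a x)" using L1c_section_a[OF h]
 proof eventually_elim
  case (elim a)
  have "continuous_on S (%x. Kc h a x)" unfolding Kc_def
  proof (rule continuous_on_lebesgue_integral[where w="%y. JB * cmod (h a y)"])
   show "(%y. of_real (J (x - y)) * h a y) : BM OM" for x using Kc_integrable[of h a x] elim by (auto intro: borel_measurable_integrable)
   show "continuous_on S (%x. complex_of_real (J (x - t)) * h a t)" for t by (intro continuous_intros continuous_on_compose2[OF J_cont]) auto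
   show "norm (complex_of_real (J (x - t)) * h a t) <= JB * cmod (h a t)" for x t
    using J_nonneg J_le by (auto simp: norm_mult intro!: mult_right_mono)
  qed (use elim in auto)
  then show ?case by (intro continuous_intros)
 qed
 have [measurable]: "(%s. NI OM (%z. nm h s z)) : BM AM"
 proof -
  note [measurable] = mbD[OF L1cD(3)[OF h]]
  show ?thesis by measurable
 qed
 have "nm (%s x. of_real D * Kc h s x) a x <= en (D * JB) * NI OM (%z. nm h a z)" if "a : Ag" for a x
  using mult_left_mono[OF Kn_le[OF L1cD(3)[OF h] that, of x], of "en D"] D_pos JB_pos
  by (intro order_trans[OF nm_DKc]) (simp add: ennreal_mult mult.assoc)
 then show "AE a in AM. ALL x:S. nm (%s x. of_real D * Kc h s x) a x <= en (D * JB) * NI OM (%z. nm h a z)" by (intro AE_I2) auto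
 show "NI AM (%a. en (D * JB) * NI OM (%z. nm h a z)) <= en (D * JB) * I2 (nm h)" unfolding I2_def by (simp add: nn_integral_cmult)
qed (use L1cD(2)[OF h] in \<open>simp add: ennreal_mult_less_top\<close>)

definition Wx :: "real => (real => ennreal) => real => ennreal" where
 "Wx k m a = NI AM (%s. (ind {s<..} a * en (exp (- k * (a - s)))) * m s)"

lemma Wx_int:
 assumes m[measurable]: "m : BM AM"
  and C: "!!s. s >= 0 ==> (NI AM (%a. ind {s<..} a * en (exp (- k * (a - s))))) <= en C"
 shows "NI AM (%a. Wx k m a) <= en C * NI AM (%a. m a)"
proof -
 have "NI AM (%a. Wx k m a) = NI AM (%s. NI AM (%a. (ind {s<..} a * en (exp (- k * (a - s)))) * m s))"
  unfolding Wx_def by (rule AA.Fubini') measurable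
 also have "... = NI AM (%s. (NI AM (%a. ind {s<..} a * en (exp (- k * (a - s))))) * m s)" by (intro nn_integral_cong nn_integral_multc) measurable
 also have "... <= NI AM (%s. en C * m s)" by (intro nn_integral_mono mult_right_mono C) (auto simp: ages_def)
 finally show ?thesis by (simp add: nn_integral_cmult)
qed

lemma XCd_Rc_Vc:
 assumes ok: "okr (Re zt + D + mut)"
 shows "EX C>0. ALL e G E. continuous_on S e --> 0 <= E --> (ALL x:S. cmod (e x) <= E) --> XCd G -->
  XCd (%a x. Rc zt e a x + Vc zt G a x) & (NI AM (%a. ns (%a x. Rc zt e a x + Vc zt G a x) a)) <= en C * (en E + NS G)"
proof -
 define k where "k = Re zt + D + mut"
 obtain C where C: "C > 0" "!!s. s >= 0 ==> (NI AM (%a. ind {s<..} a * en (exp (- k * (a - s))))) <= en C"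
  using exp_integral_bdd[OF ok] unfolding k_def by blast
 have "XCd (%a x. Rc zt e a x + Vc zt G a x) & (NI AM (%a. ns (%a x. Rc zt e a x + Vc zt G a x) a)) <= en C * (en E + NS G)"
  if e: "continuous_on S e" "0 <= E" "!!x. x : S ==> cmod (e x) <= E" and G: "XCd G" for e E G
 proof -
  have nsm[measurable]: "ns G : BM AM" using XCdD(1) G by (auto intro: ns_AM)
  have [measurable]: "Wx k (ns G) : BM AM" unfolding Wx_def[abs_def] by measurable
  have qb: "exp (- Re zt * (a - s)) * (qq a x / qq s x) <= exp (- k * (a - s))" if "a : Ag" "0 <= s" "s <= a" "x : S" for a s x
  proof -
   have "exp (- Re zt * (a - s)) * (qq a x / qq s x) <= exp (- Re zt * (a - s)) * exp (- (D + mut) * (a - s))"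
    by (intro mult_left_mono qq_ratio_le that) simp
   then show ?thesis by (simp add: k_def exp_add[symmetric] algebra_simps)
  qed
  show ?thesis
  proof (rule XCd_le)
   show "(%a. Rc zt e a x + Vc zt G a x) : BM AM" if "x : S" for x using Rc_AM[OF that] Vc_AM[OF that, of G] XCdD(1)[OF G that] by measurable
   have "continuous_on S (%x. Rc zt e a x + Vc zt G a x)" if a: "a : Ag" for a
   proof (intro continuous_on_add)
    show "continuous_on S (%x. Rc zt e a x)" unfolding Rc_def by (intro continuous_intros e(1) qq_cont a)
    show "continuous_on S (%x. Vc zt G a x)" unfolding Vc_def
    proof (rule continuous_on_lebesgue_integral_AE[OF _ XCd_majorant(1)[OF G, of "exp (\<bar>k\<bar> * a)"]])
     show "(%s. complex_of_real (ind {..<a} s * (qq a x / qq s x)) * exp (- zt * of_real (a - s)) * G s x) : BM AM" if "x : S" for x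
     proof -
     note [measurable] = qq_AM[OF that] XCdD(1)[OF G that]
     show ?thesis by measurable
     qed
     show "AE s in AM. ALL x:S. cmod (complex_of_real (ind {..<a} s * (qq a x / qq s x)) * exp (- zt * of_real (a - s)) * G s x) <= exp (\<bar>k\<bar> * a) * enn2real (ns G s)"
     using XCd_majorant(2)[OF G] AE_space
     proof eventually_elim
     case (elim s)
     then have s: "0 < s" by (simp add: ages_def)
     show ?case
     proof
     fix x assume x: "x : S"
     show "cmod (complex_of_real (ind {..<a} s * (qq a x / qq s x)) * exp (- zt * of_real (a - s)) * G s x) <= exp (\<bar>k\<bar> * a) * enn2real (ns G s)"
     proof (cases "s < a")
     case True
     have "- k * (a - s) <= \<bar>k\<bar> * a" using True s by (intro order_trans[OF mult_right_mono[OF abs_ge_minus_self]] mult_left_mono) auto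
     then have "exp (- Re zt * (a - s)) * (qq a x / qq s x) <= exp (\<bar>k\<bar> * a)" using qb[OF a _ _ x, of s] True s by (simp add: order_trans)
     then have "exp (- Re zt * (a - s)) * (qq a x / qq s x) * cmod (G s x) <= exp (\<bar>k\<bar> * a) * enn2real (ns G s)"
     using elim(1) x by (intro mult_mono) auto
     then show ?thesis using True by (simp add: norm_mult norm_divide mult_ac)
     qed simp
     qed
     qed
     show "AE s in AM. continuous_on S (%x. complex_of_real (ind {..<a} s * (qq a x / qq s x)) * exp (- zt * of_real (a - s)) * G s x)"
     using XCdD(2)[OF G] AE_space by eventually_elim (intro continuous_intros qq_cont a, auto simp: qq_cont)
    qed
   qed
   then show "AE a in AM. continuous_on S (%x. Rc zt e a x + Vc zt G a x)" by (intro AE_I2) auto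
   have "nm (%a x. Rc zt e a x + Vc zt G a x) a x <= ind {0<..} a * en (exp (- k * (a - 0))) * en E + Wx k (ns G) a" if a: "a : Ag" and x: "x : S" for a x
   proof (rule order_trans[OF nm_add add_mono])
    have a0: "0 < a" using a by (simp add: ages_def)
    have "en (exp (- Re zt * a) * qq a x) * en (cmod (e x)) <= en (exp (- k * a)) * en E"
     using qb[OF a order_refl less_imp_le[OF a0] x] e(3)[OF x] by (intro mult_mono ennreal_leI) auto
    then show "nm (Rc zt e) a x <= ind {0<..} a * en (exp (- k * (a - 0))) * en E" unfolding Rc_norm Rn_def nm1_def using a0 by simp
    have "Vn (Re zt) (nm G) a x <= Wx k (ns G) a" unfolding Vn_def Wx_def
    proof (rule nn_integral_mono_AE)
     show "AE s in AM. ind {..<a} s * en (exp (- Re zt * (a - s)) * (qq a x / qq s x)) * nm G s x <= ind {s<..} a * en (exp (- k * (a - s))) * ns G s"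
     using XCd_bound[OF G] AE_space
     proof eventually_elim
     case (elim s)
     then show ?case using qb[OF a _ _ x, of s] x by (cases "s < a") (auto simp: ages_def intro!: mult_mono ennreal_leI)
     qed
    qed
    then show "nm (Vc zt G) a x <= Wx k (ns G) a" using Vc_norm order_trans by blast
   qed
   then show "AE a in AM. ALL x:S. nm (%a x. Rc zt e a x + Vc zt G a x) a x <= ind {0<..} a * en (exp (- k * (a - 0))) * en E + Wx k (ns G) a"
    by (intro AE_I2) auto
   have "(NI AM (%a. ind {0<..} a * en (exp (- k * (a - 0))) * en E + Wx k (ns G) a))
    = NI AM (%a. ind {0<..} a * en (exp (- k * (a - 0)))) * en E + NI AM (%a. Wx k (ns G) a)"
    by (subst nn_integral_add) (auto simp: nn_integral_multc)
   also have "... <= en C * en E + en C * NS G" using C(2)[of 0] by (intro add_mono mult_right_mono Wx_int[OF nsm C(2)]) auto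
   finally show "NI AM (%a. ind {0<..} a * en (exp (- k * (a - 0))) * en E + Wx k (ns G) a) <= en C * (en E + NS G)" by (simp add: distrib_left)
   show "en C * (en E + NS G) < \<infinity>" using XCdD(3)[OF G] by (simp add: ennreal_mult_less_top)
  qed
 qed
 then show ?thesis using C(1) by (intro exI[of _ C]) blast
qed

lemma bounded_cont: "continuous_on S (e::real^'n => complex) ==> bdd_above ((%x. cmod (e x)) ` S) & (ALL x:S. cmod (e x) <= (SUP x\<in>S. cmod (e x)))"
proof -
 assume "continuous_on S e"
 then have "bdd_above ((%x. cmod (e x)) ` S)"
  by (intro bounded_imp_bdd_above compact_imp_bounded compact_continuous_image S_compact continuous_on_norm)
 then show ?thesis by (auto intro: cSUP_upper)
qed

lemma XCd_RV:
 assumes "okr (Re zt + D + mut)" and e: "continuous_on S e" and "XCd G"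
 shows "XCd (%a x. Rc zt e a x + Vc zt G a x)"
proof -
 have b: "ALL x:S. cmod (e x) <= \<bar>SUP x\<in>S. cmod (e x)\<bar>" using bounded_cont[OF e] by (meson abs_ge_self order_trans)
 show ?thesis using XCd_Rc_Vc[OF assms(1)] e abs_ge_zero b assms(3) by blast
qed

lemma bc_XCd:
 assumes h: "XCd h"
 shows "continuous_on S (bc h)" "x : S ==> nm1 (bc h) x <= en B * NS h"
proof -
 have [measurable]: "ns h : BM AM" using XCdD(1) h by (auto intro: ns_AM)
 show "continuous_on S (bc h)" unfolding bc_def[abs_def]
 proof (rule continuous_on_lebesgue_integral_AE[OF _ XCd_majorant(1)[OF h, of B]])
  show "(%a. complex_of_real (beta a x) * h a x) : BM AM" if "x : S" for x
   using bc_integrable[OF that, of h] XCd_int[OF h that] by (auto intro: borel_measurable_integrable)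
  show "AE a in AM. ALL x:S. cmod (complex_of_real (beta a x) * h a x) <= B * enn2real (ns h a)" using XCd_majorant(2)[OF h] AE_space
   by eventually_elim (auto simp: norm_mult abs_of_nonneg beta_nonneg intro!: mult_mono beta_le B_nonneg)
  show "AE a in AM. continuous_on S (%x. complex_of_real (beta a x) * h a x)"
   using XCdD(2)[OF h] AE_space by eventually_elim (intro continuous_intros beta_cont, auto)
 qed
 assume x: "x : S"
 have "bn (nm h) x <= NI AM (%a. en B * ns h a)" unfolding bn_def
 proof (rule nn_integral_mono_AE)
  show "AE a in AM. en (beta a x) * nm h a x <= en B * ns h a"
   using XCd_bound[OF h] AE_space by eventually_elim (use x beta_le in \<open>auto intro!: mult_mono ennreal_leI\<close>)
 qed
 then show "nm1 (bc h) x <= en B * NS h" using bc_norm[OF x, of h] by (simp add: nn_integral_cmult)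
qed

lemma XC_rep:
 assumes p: "inXX XC Om ahat p"
 obtains p2 where "XCd p2" "L1c p2" "!!a x. a : Ag ==> x : S ==> R0 mu D p a x = hR (fst p) p2 a x"
  "!!zt. eqXX XC Om ahat (LL zt p) (F1 (fst p) p2, F2 zt (fst p) p2)" "XCd (hR (fst p) p2)"
proof -
 have p1: "continuous_on S (fst p)" and pX: "XCd (snd p)" using p by (auto simp: inXX_XC)
 obtain p2 where p2: "XCd p2" "L1c p2" "AE a in AM. ALL x. p2 a x = snd p a x" using XCd_nice[OF pX] by blast
 define h where "h = hR (fst p) p2"
 have hX: "XCd h" unfolding h_def hR_def[abs_def] using okr0 by (intro XCd_RV p1 p2(1)) simp
 have hR0: "R0 mu D p a x = h a x" if a: "a : Ag" and x: "x : S" for a x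
 proof -
  have "AE s in AM. snd p s x = p2 s x" using p2(3) by eventually_elim simp
  then have "Vc 0 (snd p) a x = Vc 0 p2 a x" using Vc_AE[OF x, of "snd p" p2] XCdD(1)[OF pX x] XCdD(1)[OF p2(1) x] by blast
  then show ?thesis by (simp add: R0_eq[OF a x XCdD(1)[OF pX x]] h_def hR_def)
 qed
 have hRp: "hR (fst p) (snd p) a x = h a x" if a: "a : Ag" and x: "x : S" for a x
  using hR0[OF that] by (simp add: R0_eq[OF a x XCdD(1)[OF pX x]] hR_def)
 have eq: "eqXX XC Om ahat (LL zt p) (F1 (fst p) p2, F2 zt (fst p) p2)" for zt unfolding eqXX_XC fst_conv snd_conv
 proof (intro conjI ballI)
  fix x assume x: "x : S"
  have "bc (hR (fst p) (snd p)) x = bc h x" unfolding bc_def by (intro Bochner_Integration.integral_cong refl) (simp add: hRp x)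
  then show "fst (LL zt p) x = F1 (fst p) p2 x" using LL_eq(1)[OF XCdD(1)[OF pX Om_S] x XCdD(1)[OF pX x], of zt] by (simp add: F1_def h_def)
 next
  show "AE a in AM. ALL x:S. snd (LL zt p) a x = F2 zt (fst p) p2 a x" using p2(3) AE_space
  proof eventually_elim
   case (elim a)
   then have a: "a : Ag" by simp
   have "Kc (hR (fst p) (snd p)) a x = Kc h a x" for x unfolding Kc_def by (intro Bochner_Integration.integral_cong refl) (simp add: hRp a Om_S)
   then show ?case using elim by (auto simp: LL_eq(2)[OF XCdD(1)[OF pX Om_S] a _ XCdD(1)[OF pX]] F2_def hRp[OF a] h_def)
  qed
 qed
 show thesis by (rule that[OF p2(1,2) _ eq]) (use hR0 hX in \<open>auto simp: h_def\<close>)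
qed

definition Gc :: "complex => real^'n => complex" where "Gc zt = bc (Rc zt (%_. 1))"

lemma bc_Rc: "bc (Rc zt e) x = Gc zt x * e x"
 unfolding Gc_def bc_def Rc_def by (subst Bochner_Integration.integral_mult_left_zero[symmetric]) (simp add: mult_ac)

lemma cmod_Gc: "okr (Re zt + D + mut) ==> x : S ==> cmod (Gc zt x) <= vr (Re zt) 0 x"
proof -
 assume *: "okr (Re zt + D + mut)" "x : S"
 have "nm (Rc zt (%_. 1)) = Rn (Re zt) (nm1 (%_. 1))" by (intro ext Rc_norm)
 then have "nm1 (Gc zt) x <= en (vr (Re zt) 0 x)"
  using bc_norm[OF *(2), of "Rc zt (%_. 1)"] bn_Rn[OF *(2), of "Re zt" "nm1 (%_. 1)"] vn_eq_vr[OF *(1) order_refl *(2)] by (simp add: Gc_def nm1_def)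
 then show ?thesis by (simp add: nm1_def)
qed

lemma XCd_Rc1: "okr (Re zt + D + mut) ==> XCd (Rc zt (%_. 1))"
proof -
 assume ok: "okr (Re zt + D + mut)"
 have "ns (%_ _. 0) = (%_. 0)" using ns_le[of "%_ _. 0" _ 0] by (simp add: nm_def fun_eq_iff)
 then have "XCd (%_ _. 0)" unfolding XCd_def by simp
 from XCd_RV[OF ok _ this, of "%_. 1"] show ?thesis by (simp add: Vc_def)
qed

lemma Gc_cont: "okr (Re zt + D + mut) ==> continuous_on S (Gc zt)" unfolding Gc_def by (rule bc_XCd(1)[OF XCd_Rc1])

lemma Rc_int: "okr (Re zt + D + mut) ==> x : S ==> integrable AM (%a. Rc zt e a x)"
 using integrable_mult_left[of "e x" AM "%a. Rc zt (%_. 1) a x"] XCd_int[OF XCd_Rc1, of zt x] by (simp add: Rc_def)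

end

context age_eig
begin

lemma cont_integrable_OM: "continuous_on S (e::real^'n => complex) ==> integrable OM e"
proof (rule integrableI_bounded)
 assume e: "continuous_on S e"
 show "e : BM OM" by (rule cont_OM[OF e])
 show "NI OM (%x. en (norm (e x))) < \<infinity>" by (rule cont_int_finite) (intro continuous_intros e)
qed

lemma Gc_lt: "r <= Re zt ==> x : S ==> cmod (Gc zt x) < 1" using cmod_Gc[OF rho(2)] rho(3) by (meson order_le_less_trans)

lemma XC_apriori:
 assumes rrh: "r <= Re zt"
 shows "EX C>0. ALL e G h E. continuous_on S e --> 0 <= E --> (ALL x:S. cmod (e x) <= E) --> XCd G -->
  (ALL a:Ag. ALL x:S. h a x = Rc zt (%x. e x + bc h x) a x + Vc zt G a x) -->
  XCd h & NS h <= en C * (en E + NS G)"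
proof -
 note ok = rho(2)[OF rrh]
 obtain C where C: "C > 0" "!!e G E. continuous_on S e ==> 0 <= E ==> (!!x. x : S ==> cmod (e x) <= E) ==> XCd G ==>
  XCd (%a x. Rc zt e a x + Vc zt G a x) & (NI AM (%a. ns (%a x. Rc zt e a x + Vc zt G a x) a)) <= en C * (en E + NS G)"
  using XCd_Rc_Vc[OF ok] by blast
 have "continuous_on S (%x. 1 / (1 - Gc zt x))" using Gc_lt[OF rrh] by (intro continuous_intros Gc_cont ok) force
 from bounded_cont[OF this] obtain K where "!!x. x : S ==> cmod (1 / (1 - Gc zt x)) <= K" by blast
 then have "EX K>=0. ALL x:S. cmod (1 / (1 - Gc zt x)) <= K" by (meson abs_ge_self abs_ge_zero order_trans)
 then obtain K where K: "K >= 0" "!!x. x : S ==> cmod (1 / (1 - Gc zt x)) <= K" by blast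
 have "XCd h & NS h <= en (C * (1 + K * B * C)) * (en E + NS G)"
  if e: "continuous_on S e" "0 <= E" "!!x. x : S ==> cmod (e x) <= E" and G: "XCd G"
   and h: "!!a x. a : Ag ==> x : S ==> h a x = Rc zt (%x. e x + bc h x) a x + Vc zt G a x" for e E G h
 proof -
  define u where "u a x = Rc zt e a x + Vc zt G a x" for a x
  have u: "XCd u" "NS u <= en C * (en E + NS G)" using C(2)[OF e G] by (auto simp: u_def[abs_def])
  obtain g where g: "NS G = en g" "0 <= g" using XCdD(3)[OF G] by (cases "NS G") auto
  have bch: "bc h x = bc u x * (1 / (1 - Gc zt x))" if x: "x : S" for x
  proof -
   have "bc h x = bc (%a x. u a x + Rc zt (bc h) a x) x"
    unfolding bc_def[of _ x] by (intro Bochner_Integration.integral_cong refl) (use h x in \<open>simp add: u_def Rc_def algebra_simps\<close>)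
   also have "... = bc u x + bc (Rc zt (bc h)) x" using bc_add[OF x, of u "Rc zt (bc h)"] XCd_int[OF u(1) x] Rc_int[OF ok x] by simp
   finally have "bc h x * (1 - Gc zt x) = bc u x" by (simp add: bc_Rc algebra_simps)
   moreover have "1 - Gc zt x ~= 0" using Gc_lt[OF rrh x] by auto
   ultimately show ?thesis by (simp add: field_simps)
  qed
  have "continuous_on S (%x. bc u x * (1 / (1 - Gc zt x)))" using Gc_lt[OF rrh] by (intro continuous_intros bc_XCd u Gc_cont ok) force
  then have c: "continuous_on S (bc h)" by (rule continuous_on_cong[THEN iffD2, OF refl bch, rotated])
  have b: "cmod (bc h x) <= K * (B * (C * (E + g)))" if x: "x : S" for x
  proof -
   have "nm1 (bc u) x <= en B * (en C * (en E + en g))" using order_trans[OF bc_XCd(2)[OF u(1) x] mult_left_mono[OF u(2)]] g by auto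
   then have "cmod (bc u x) <= B * (C * (E + g))" unfolding nm1_def using B_nonneg C(1) g e(2)
    by (simp add: ennreal_plus[symmetric] ennreal_mult[symmetric] del: ennreal_plus)
   then have "cmod (bc u x) * cmod (1 / (1 - Gc zt x)) <= (B * (C * (E + g))) * K" using K x B_nonneg C(1) g e(2) by (intro mult_mono) auto
   then show ?thesis unfolding bch[OF x] norm_mult by (simp add: mult_ac)
  qed
  have E': "cmod (e x + bc h x) <= E + K * (B * (C * (E + g)))" if "x : S" for x
   using norm_triangle_ineq[of "e x" "bc h x"] e(3)[OF that] b[OF that] by simp
  have E'0: "0 <= E + K * (B * (C * (E + g)))" using e(2) K(1) B_nonneg C(1) g by simp
  let ?h = "%a x. Rc zt (%x. e x + bc h x) a x + Vc zt G a x"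
  have H: "XCd ?h & NS ?h <= en C * (en (E + K * (B * (C * (E + g)))) + NS G)" by (rule C(2)[OF continuous_on_add[OF e(1) c] E'0 E' G])
  have "C * (E + K * (B * (C * (E + g))) + g) = C * (1 + K * B * C) * (E + g)" by (simp add: algebra_simps)
  then have eq: "en C * (en (E + K * (B * (C * (E + g)))) + NS G) = en (C * (1 + K * B * C)) * (en E + NS G)"
   unfolding g(1) using E'0 e(2) g(2) C(1) K(1) B_nonneg by (simp add: ennreal_plus[symmetric] ennreal_mult[symmetric] del: ennreal_plus)
  have "XCd h & NS h <= en (C * (1 + K * B * C)) * (en E + NS G)"
  proof (rule XCd_le)
   show "(%a. h a x) : BM AM" if "x : S" for x by (subst measurable_cong[OF h[OF _ that]]) (use XCdD(1)[OF conjunct1[OF H] that] in auto)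
   show "AE a in AM. continuous_on S (h a)" using XCdD(2)[OF conjunct1[OF H]] AE_space
   proof eventually_elim
    case (elim a)
    then show ?case by (subst continuous_on_cong[OF refl h]) auto
   qed
   show "AE a in AM. ALL x:S. nm h a x <= ns ?h a" using XCd_bound[OF conjunct1[OF H]] AE_space
    by eventually_elim (use h in \<open>auto simp: nm_def\<close>)
   show "NS ?h <= en (C * (1 + K * B * C)) * (en E + NS G)" using H unfolding eq by simp
  qed (use XCdD(3)[OF G] in \<open>simp add: ennreal_mult_less_top\<close>)
  then show ?thesis .
 qed
 moreover have "0 < C * (1 + K * B * C)" using C(1) K(1) B_nonneg by (simp add: add_pos_nonneg)
 ultimately show ?thesis by (intro exI[of _ "C * (1 + K * B * C)"]) blast
qed

lemma XC_surj:
 assumes rrh: "r < Re zt" and f: "inXX XC Om ahat f"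
 shows "EX p. inXX XC Om ahat p & eqXX XC Om ahat (LL zt p) f"
proof -
 have rr: "r <= Re zt" using rrh by simp
 note ok = rho(2)[OF rr]
 define f1 where "f1 = fst f"
 have f1: "continuous_on S f1" and fX: "XCd (snd f)" using f by (auto simp: inXX_XC f1_def)
 obtain f2 where f2: "XCd f2" "L1c f2" "AE a in AM. ALL x. f2 a x = snd f a x" using XCd_nice[OF fX] by blast
 obtain h0 where h0: "L1c h0"
  "AE p in PM. h0 (fst p) (snd p) = Rc zt (%x. f1 x + bc h0 x) (fst p) (snd p) + Vc zt (%s x. f2 s x + of_real D * Kc h0 s x) (fst p) (snd p)"
  by (rule XL1_solve[OF rrh cont_integrable_OM[OF f1] f2(2)])
 define G where "G s x = f2 s x + of_real D * Kc h0 s x" for s x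
 have LG: "L1c G" unfolding G_def by (intro L1c_add f2 L1c_DKc h0(1))
 have G: "XCd G" unfolding G_def using XCd_add(1)[OF f2(1)] XCd_Kc[OF h0(1)] by blast
 define u where "u a x = Rc zt f1 a x + Vc zt G a x" for a x
 have XRV: "XCd (%a x. Rc zt e a x + Vc zt G a x)" if "continuous_on S e" for e by (rule XCd_RV[OF ok that G])
 have u: "XCd u" unfolding u_def by (rule XRV[OF f1])
 have ne: "1 - Gc zt x ~= 0" if "x : S" for x using Gc_lt[OF rr that] by auto
 define Et where "Et x = bc u x / (1 - Gc zt x)" for x
 have Et: "continuous_on S Et" unfolding Et_def using ne by (intro continuous_intros bc_XCd u Gc_cont ok) auto
 define p1 where "p1 x = f1 x + Et x" for x
 have p1: "continuous_on S p1" unfolding p1_def by (intro continuous_intros f1 Et)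
 define h where "h a x = Rc zt p1 a x + Vc zt G a x" for a x
 have h: "XCd h" unfolding h_def by (rule XRV[OF p1])
 have hL: "L1c h" unfolding h_def by (rule L1c_Rc_Vc[OF ok cont_integrable_OM[OF p1] LG])
 have bcu: "bc w x = bc u x + Gc zt x * e x" if x: "x : S" and w: "AE a in AM. w a x = u a x + Rc zt e a x" "(%a. w a x) : BM AM" for w e x
 proof -
  note [measurable] = w(2) beta_AM[OF x] XCdD(1)[OF u x] Rc_AM[OF x]
  have "bc w x = bc (%a x. u a x + Rc zt e a x) x" unfolding bc_def
   by (rule integral_cong_AE) (use w(1) in \<open>measurable, auto elim: eventually_mono\<close>)
  also have "... = bc u x + bc (Rc zt e) x" using bc_add[OF x, of u "Rc zt e"] XCd_int[OF u x] Rc_int[OF ok x] by simp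
  finally show ?thesis by (simp add: bc_Rc)
 qed
 have hu: "h a x = u a x + Rc zt Et a x" for a x by (simp add: h_def u_def p1_def Rc_def algebra_simps)
 have bch: "bc h x = Et x" if x: "x : S" for x using bcu[OF x, of h Et] XCdD(1)[OF h x] ne[OF x] by (simp add: hu[abs_def] Et_def field_simps)
 have h0x: "AE x in OM. AE a in AM. h0 a x = u a x + Rc zt (bc h0) a x"
 proof (rule AE_pair_swap)
  show "AE p in PM. h0 (fst p) (snd p) = u (fst p) (snd p) + Rc zt (bc h0) (fst p) (snd p)"
   using h0(2) by eventually_elim (simp add: u_def G_def[abs_def] Rc_def algebra_simps)
 qed
 have "AE x in OM. bc h0 x = Et x" using h0x AE_space
 proof eventually_elim
  case (elim x)
  then have x: "x : Om" "x : S" by (auto simp: Om_S)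
  show ?case using bcu[OF x(2), of h0 "bc h0"] elim(1) cm_section[OF L1cD(1)[OF h0(1)] x(1)] ne[OF x(2)] by (simp add: Et_def field_simps)
 qed
 from AE_P_of_OM[OF this] h0(2) have hh0: "AE p in PM. h (fst p) (snd p) = h0 (fst p) (snd p)"
  by eventually_elim (simp add: hu, simp add: u_def G_def[abs_def] Rc_def algebra_simps)
 define p2 where "p2 a x = G a x + (0 - zt) * h a x" for a x
 have p2: "XCd p2" unfolding p2_def by (intro XCd_add XCd_cmult G h)
 have hR: "hR p1 p2 a x = h a x" if a: "a : Ag" and x: "x : S" for a x
 proof -
  have "Rc 0 p1 a x + Vc 0 (%s x. G s x + (0 - zt) * h s x) a x = h a x"
   by (rule resolvent_identity[where G=G and h=h and nu=zt, OF x XCd_int[OF G x] a]) (simp add: h_def)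
  then show ?thesis by (simp add: hR_def p2_def[abs_def])
 qed
 have sec: "(%s. snd (p1, p2) s x) : BM AM" if "x : S" for x using XCdD(1)[OF p2 that] by simp
 obtain xx where xx: "xx : S" using Om_ne Om_S by blast
 have "fst (LL zt (p1, p2)) x = f1 x" if x: "x : S" for x
 proof -
  have "bc (hR p1 p2) x = bc h x" unfolding bc_def by (intro Bochner_Integration.integral_cong refl) (simp add: hR x)
  then show ?thesis using LL_eq(1)[OF sec[OF Om_S] x sec[OF x], of zt] bch[OF x] by (simp add: F1_def p1_def[of x])
 qed
 moreover have "AE a in AM. ALL x:S. snd (LL zt (p1, p2)) a x = snd f a x" using Sc_AE(2)[OF L1cD(1)[OF hL] L1cD(1)[OF h0(1)] xx hh0] f2(3) AE_space
 proof eventually_elim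
  case (elim a)
  then have a: "a : Ag" by simp
  have "Kc (hR p1 p2) a x = Kc h a x" for x unfolding Kc_def by (intro Bochner_Integration.integral_cong refl) (simp add: hR a Om_S)
  then show ?case using elim by (auto simp: LL_eq(2)[OF sec[OF Om_S] a _ sec] F2_def hR[OF a] p2_def[of a] G_def[of a])
 qed
 ultimately show ?thesis using p1 p2 by (intro exI[of _ "(p1, p2)"]) (simp add: inXX_XC eqXX_XC f1_def)
qed

lemma XC_bound:
 assumes rrh: "r < Re zt"
 shows "EX C. ALL p. inXX XC Om ahat p --> normXX XC Om ahat (domA_elt mu D p) <= C * normXX XC Om ahat (LL zt p)"
proof -
 have rr: "r <= Re zt" using rrh by simp
 obtain C1 where C1: "C1 > 0" "ALL e G h E. continuous_on S e --> 0 <= E --> (ALL x:S. cmod (e x) <= E) --> XCd G -->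
  (ALL a:Ag. ALL x:S. h a x = Rc zt (%x. e x + bc h x) a x + Vc zt G a x) -->
  XCd h & NS h <= en C1 * (en E + NS G)" using XC_apriori[OF rr] by blast
 obtain C2 where C2: "C2 > 0" "!!p1 p2. integrable OM p1 ==> L1c p2 ==>
  I2 (nm (hR p1 p2)) <= en C2 * (NI OM (%x. nm1 (F1 p1 p2) x) + I2 (nm (F2 zt p1 p2)))" using XL1_bound[OF rrh] by blast
 define W where "W = measure OM Om"
 define C where "C = C1 * (1 + D * JB * C2 * W)"
 have W0: "0 <= W" by (simp add: W_def)
 have "normXX XC Om ahat (domA_elt mu D p) <= C * normXX XC Om ahat (LL zt p)" if p: "inXX XC Om ahat p" for p
 proof -
  define p1 where "p1 = fst p"
  have p1: "continuous_on S p1" and pX: "XCd (snd p)" using p by (auto simp: inXX_XC p1_def)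
  obtain p2 where p2: "XCd p2" "L1c p2"
   and R0h: "!!a x. a : Ag ==> x : S ==> R0 mu D p a x = hR p1 p2 a x"
   and LLF: "!!zt. eqXX XC Om ahat (LL zt p) (F1 p1 p2, F2 zt p1 p2)"
   and hX: "XCd (hR p1 p2)" using XC_rep[OF p] unfolding p1_def by blast
  define h where "h = hR p1 p2"
  note hX = hX[folded h_def]
  have hL: "L1c h" unfolding h_def by (rule L1c_hR[OF cont_integrable_OM[OF p1] p2(2)])
  define g1 g2 where "g1 = F1 p1 p2" and "g2 = F2 zt p1 p2"
  have g1: "continuous_on S g1" unfolding g1_def F1_def[abs_def] h_def[symmetric] by (intro continuous_intros p1 bc_XCd hX)
  have g2e: "g2 = (%a x. (zt * h a x + p2 a x) + (-1) * (of_real D * Kc h a x))" by (simp add: g2_def F2_def[abs_def] h_def)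
  have g2: "XCd g2" unfolding g2e by (intro XCd_add XCd_cmult hX p2(1) conjunct1[OF XCd_Kc[OF hL]])
  have cg2: "cm g2" unfolding g2e by (intro L1cD(1) L1c_add L1c_cmult hL p2 L1c_DKc[OF hL, simplified])
  have n1: "normXX XC Om ahat (domA_elt mu D p) = normXX XC Om ahat (%_. 0, h)"
   by (rule normXX_XC_cong) (auto simp: eqXX_XC domA_elt_def R0h h_def intro!: AE_I2)
  have n2: "normXX XC Om ahat (LL zt p) = normXX XC Om ahat (g1, g2)" unfolding g1_def g2_def by (rule normXX_XC_cong[OF LLF])
  define E where "E = (SUP x\<in>S. cmod (g1 x))"
  have E: "!!x. x : S ==> cmod (g1 x) <= E" using bounded_cont[OF g1] by (auto simp: E_def)
  obtain xx where "xx : S" using Om_ne Om_S by blast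
  then have E0: "0 <= E" using E[of xx] norm_ge_zero order_trans by blast
  obtain g where g: "NS g2 = en g" "0 <= g" using XCdD(3)[OF g2] by (cases "NS g2") auto
  obtain hh where hh: "NS h = en hh" "0 <= hh" using XCdD(3)[OF hX] by (cases "NS h") auto
  have N2: "normXX XC Om ahat (LL zt p) = E + g" unfolding n2 normXX_XC[of "(g1, g2)", simplified, OF g2] by (simp add: E_def g enn2real_ennreal)
  have "(SUP x\<in>S. cmod 0) = 0" using \<open>xx : S\<close> by (subst cSUP_const) auto
  then have N1: "normXX XC Om ahat (domA_elt mu D p) = hh" unfolding n1 using normXX_XC[of "(%_. 0, h)", simplified, OF hX] by (simp add: hh)
  have "NI OM (%x. nm1 g1 x) <= NI OM (%x. en E)" by (intro nn_integral_mono) (auto simp: nm1_def Om_S E ennreal_leI)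
  then have i1: "NI OM (%x. nm1 g1 x) <= en (W * E)" using E0 by (simp add: W_def OM.emeasure_eq_measure ennreal_mult mult.commute)
  have i2: "I2 (nm g2) <= en (W * g)" using XCd_I2[OF g2 cg2] g by (simp add: W_def ennreal_mult)
  have "I2 (nm h) <= en C2 * (en (W * E) + en (W * g))"
   using C2(2)[OF cont_integrable_OM[OF p1] p2(2)] unfolding h_def[symmetric] g1_def[symmetric] g2_def[symmetric]
   by (rule order_trans) (intro mult_left_mono add_mono i1 i2, simp)
  then have I: "I2 (nm h) <= en (C2 * (W * E + W * g))" using C2(1) E0 g W0 by (simp add: ennreal_plus[symmetric] ennreal_mult[symmetric] del: ennreal_plus)
  define G where "G s x = g2 s x + of_real D * Kc h s x" for s x
  have G: "XCd G" "NS G <= en (g + D * JB * (C2 * (W * E + W * g)))"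
  proof -
   note K = XCd_Kc[OF hL]
   show "XCd G" unfolding G_def by (rule XCd_add(1)[OF g2 conjunct1[OF K]])
   have "NS G <= en g + en (D * JB) * en (C2 * (W * E + W * g))" unfolding G_def using XCd_add(2)[OF g2 conjunct1[OF K]] unfolding g(1)
    by (rule order_trans) (intro add_left_mono order_trans[OF conjunct2[OF K]] mult_left_mono I, simp)
   also have "... = en (g + D * JB * (C2 * (W * E + W * g)))" using D_pos JB_pos C2(1) E0 g W0
    by (simp add: ennreal_plus[symmetric] ennreal_mult[symmetric] del: ennreal_plus)
   finally show "NS G <= ..." .
  qed
  have hid: "h a x = Rc zt (%x. g1 x + bc h x) a x + Vc zt G a x" if "a : Ag" "x : S" for a x
   using hR_identity[OF that(2) _ that(1), of p2 p1 zt] XCd_int[OF p2(1) that(2)] by (simp add: h_def g1_def g2_def G_def[abs_def])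
  have "en hh <= en C1 * (en E + NS G)" using C1(2)[rule_format, of g1 E G h] g1 E0 E G(1) hid by (simp add: hh)
  also have "... <= en C1 * (en E + en (g + D * JB * (C2 * (W * E + W * g))))" by (intro mult_left_mono add_left_mono G(2)) simp
  also have "... = en (C1 * (E + (g + D * JB * (C2 * (W * E + W * g)))))" using D_pos JB_pos C1(1) C2(1) E0 g W0
    by (simp add: ennreal_plus[symmetric] ennreal_mult[symmetric] del: ennreal_plus)
  also have "C1 * (E + (g + D * JB * (C2 * (W * E + W * g)))) = C * (E + g)" by (simp add: C_def algebra_simps)
  finally have "hh <= C * (E + g)" using D_pos JB_pos C1(1) C2(1) E0 g W0 by (subst (asm) ennreal_le_iff) (auto simp: C_def)
  then show ?thesis unfolding N1 N2 .
 qed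
 then show ?thesis by blast
qed

lemma XC_resolvent: "r < Re zt ==> zt : resolvent_A XC Om ahat D J beta mu"
 unfolding resolvent_A_def Let_def mem_Collect_eq LL_def[symmetric] using XC_surj XC_bound by blast

end

section \<open>Eigenvalues on the critical line\<close>

lemma complex_triangle_eq:
 fixes u v :: complex
 assumes "u ~= 0" "cmod (u + v) = cmod u + cmod v"
 shows "u + v = of_real (cmod (u + v) / cmod u) * u"
proof -
 have "cmod u *\<^sub>R v = cmod v *\<^sub>R u" using assms(2) norm_triangle_eq by blast
 then have "v = of_real (cmod v / cmod u) * u" using assms(1) by (simp add: scaleR_conv_of_real field_simps)
 then have "u + v = of_real (1 + cmod v / cmod u) * u" by (simp add: algebra_simps)
 also have "1 + cmod v / cmod u = cmod (u + v) / cmod u" using assms by (simp add: field_simps)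
 finally show ?thesis .
qed

lemma countable_cos_eq_1:
 assumes "(et::real) ~= 0"
 shows "countable {a. cos (et * a) = 1}"
proof (rule countable_subset)
 show "{a. cos (et * a) = 1} <= range (%n::int. of_int n * 2 * pi / et)" using assms by (auto simp: cos_one_2pi_int field_simps)
qed simp

context age_model
begin

lemma AE_AM_False: "~ (AE a in AM. False)" using b0_nontriv unfolding AM_def by (metis (no_types, lifting) eventually_mono)

lemma cont_AE_zero:
 fixes w :: "real^'n => real"
 assumes w: "continuous_on S w" "!!x. x : S ==> 0 <= w x" and 0: "AE x in OM. w x = 0" and y: "y : S"
 shows "w y = 0"
proof (rule Kx_zero[OF w _ y])
 show "Kx (%z. en (w z)) y = 0" unfolding Kx_def using cont_OM[OF w(1)]
  by (subst nn_integral_0_iff_AE) (use 0 in \<open>auto elim!: eventually_mono\<close>)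
qed (use d0_pos in auto)

lemma AE_ball_False: "x0 : S ==> 0 < d ==> ~ (AE x in OM. ~ dist x0 x < d)"
proof
 assume x0: "x0 : S" "0 < d" and AE: "AE x in OM. ~ dist x0 x < d"
 have "max 0 (d - dist x0 x0) = 0"
  by (rule cont_AE_zero[of "%x. max 0 (d - dist x0 x)"]) (use x0 AE in \<open>auto intro!: continuous_intros elim!: eventually_mono\<close>)
 then show False using x0 by simp
qed

lemma AE_P_False: "~ (AE p in PM. False)"
proof
 assume "AE p in PM. False"
 from P.AE_pair[OF this] have *: "AE a in AM. AE x in OM. False" by simp
 obtain x0 where "x0 : S" using Om_ne Om_S by blast
 then have "~ (AE x in OM. False)" using AE_ball_False[of x0 1] by (metis (no_types, lifting) eventually_mono zero_less_one)
 with * show False using AE_AM_False by simp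
qed

lemma LL_zero:
 "eqXX ch Om ahat (opA_img Om ahat D J beta mu p) (scaleXX zt (domA_elt mu D p)) \<longleftrightarrow> eqXX ch Om ahat (LL zt p) zeroXX"
 by (cases ch) (auto simp: eqXX_XC eqXX_XL1 LL_def diffXX_def scaleXX_def domA_elt_def zeroXX_def eq_commute[of "_ * _"])

lemma XL1_rep:
 assumes p: "inXX XL1 Om ahat p"
 shows "!!a x. a : Ag ==> x : Om ==> R0 mu D p a x = hR (fst p) (snd p) a x"
  "eqXX XL1 Om ahat (LL zt p) (F1 (fst p) (snd p), F2 zt (fst p) (snd p))"
proof -
 have p2: "L1c (snd p)" using p by (simp add: inXX_XL1)
 have sec: "(%s. snd p s x) : BM AM" if "x : Om" for x by (rule cm_section[OF L1cD(1)[OF p2] that])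
 show "!!a x. a : Ag ==> x : Om ==> R0 mu D p a x = hR (fst p) (snd p) a x" by (simp add: R0_eq sec Om_S hR_def)
 show "eqXX XL1 Om ahat (LL zt p) (F1 (fst p) (snd p), F2 zt (fst p) (snd p))"
  unfolding eqXX_XL1 by (auto intro!: AE_I2 simp: LL_eq(1)[OF sec _ sec] LL_eq(2)[OF sec _ _ sec] Om_S space_pair_measure)
qed

lemma eigen_equation:
 assumes p1: "integrable OM p1" and p2: "L1c p2" and 1: "AE x in OM. F1 p1 p2 x = 0"
  and 2: "AE q in PM. F2 zt p1 p2 (fst q) (snd q) = 0"
 shows "AE q in PM. hR p1 p2 (fst q) (snd q) = Qc zt (hR p1 p2) (fst q) (snd q)"
proof -
 define h where "h = hR p1 p2"
 have Lh: "L1c h" unfolding h_def by (rule L1c_hR[OF p1 p2])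
 have LF: "L1c (F2 zt p1 p2)" unfolding F2_def[abs_def] h_def[symmetric] by (intro L1c_diff L1c_add L1c_cmult Lh p2 L1c_DKc)
 have "AE x in OM. F1 p1 p2 x = 0 & (AE a in AM. F2 zt p1 p2 a x = 0) & integrable AM (%a. p2 a x)"
  using 1 AE_pair_swap[OF 2] L1c_section_x[OF p2] by eventually_elim simp
 from AE_P_of_OM[OF this] AE_space show ?thesis unfolding h_def[symmetric]
 proof eventually_elim
  case (elim q)
  then have q: "fst q : Ag" "snd q : Om" "snd q : S" by (auto simp: space_pair_measure Om_S)
  have "Vc zt (%s x. F2 zt p1 p2 s x + of_real D * Kc h s x) (fst q) (snd q) = Vc zt (%s x. of_real D * Kc h s x) (fst q) (snd q)"
  proof (rule Vc_AE[OF q(3)])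
   note [measurable] = cm_section[OF L1cD(1)[OF LF] q(2)] Kc_AM[OF L1cD(1)[OF Lh]]
   show "(%s. F2 zt p1 p2 s (snd q) + of_real D * Kc h s (snd q)) : BM AM" "(%s. of_real D * Kc h s (snd q)) : BM AM" by measurable
  qed (use elim in auto)
  then show ?case using hR_identity[OF q(3) _ q(1), of p2 p1 zt] elim by (simp add: h_def Qc_def Sc_def Rc_def)
 qed
qed

lemma eigen_L1:
 assumes "is_eigenvalue_A ch Om ahat D J beta mu zt" and cOM: "!!e::real^'n => complex. continuous_on S e ==> integrable OM e"
 obtains h where "L1c h" "~ (AE q in PM. h (fst q) (snd q) = 0)" "AE q in PM. h (fst q) (snd q) = Qc zt h (fst q) (snd q)"
proof -
 obtain p where p: "inXX ch Om ahat p" "~ eqXX ch Om ahat (domA_elt mu D p) zeroXX" "eqXX ch Om ahat (LL zt p) zeroXX"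
  using assms(1) unfolding is_eigenvalue_A_def LL_zero by blast
 show thesis
 proof (cases ch)
  case XL1
  note p = p[unfolded XL1]
  have p12: "integrable OM (fst p)" "L1c (snd p)" using p(1) by (auto simp: inXX_XL1)
  note R = XL1_rep[OF p(1)]
  show thesis
  proof (rule that[OF L1c_hR[OF p12] _ eigen_equation[OF p12]])
   show "~ (AE q in PM. hR (fst p) (snd p) (fst q) (snd q) = 0)"
   proof
    assume "AE q in PM. hR (fst p) (snd p) (fst q) (snd q) = 0"
    with AE_space have "AE q in PM. R0 mu D p (fst q) (snd q) = 0" by eventually_elim (auto simp: space_pair_measure R(1))
    then show False using p(2) by (simp add: eqXX_XL1 domA_elt_def zeroXX_def)
   qed
   show "AE x in OM. F1 (fst p) (snd p) x = 0" "AE q in PM. F2 zt (fst p) (snd p) (fst q) (snd q) = 0"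
    using p(3) R(2)[of zt] unfolding eqXX_XL1 by (auto simp: zeroXX_def elim: eventually_elim2)
  qed
 next
  case XC
  note p = p[unfolded XC]
  have p1: "continuous_on S (fst p)" using p(1) by (auto simp: inXX_XC)
  obtain p2 where p2: "XCd p2" "L1c p2" "!!a x. a : Ag ==> x : S ==> R0 mu D p a x = hR (fst p) p2 a x"
   "!!zt. eqXX XC Om ahat (LL zt p) (F1 (fst p) p2, F2 zt (fst p) p2)" "XCd (hR (fst p) p2)" using XC_rep[OF p(1)] by blast
  show thesis
  proof (rule that[OF L1c_hR[OF cOM[OF p1] p2(2)] _ eigen_equation[OF cOM[OF p1] p2(2)]])
   show "~ (AE q in PM. hR (fst p) p2 (fst q) (snd q) = 0)"
   proof
    assume "AE q in PM. hR (fst p) p2 (fst q) (snd q) = 0"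
    from P.AE_pair[OF this] have "AE a in AM. AE x in OM. hR (fst p) p2 a x = 0" by simp
    with XCdD(2)[OF p2(5)] AE_space have "AE a in AM. ALL x:S. R0 mu D p a x = 0"
    proof eventually_elim
     case (elim a)
     have "cmod (hR (fst p) p2 a x) = 0" if "x : S" for x
     by (rule cont_AE_zero[OF _ _ _ that]) (use elim in \<open>auto intro!: continuous_intros\<close>)
     then show ?case using elim p2(3) by auto
    qed
    then show False using p(2) by (simp add: eqXX_XC domA_elt_def zeroXX_def)
   qed
   have "AE a in AM. ALL x:S. F2 zt (fst p) p2 a x = 0" using p(3) p2(4)[of zt] unfolding eqXX_XC by (auto simp: zeroXX_def elim: eventually_elim2)
   from AE_P_of_AM[OF this] AE_space show "AE q in PM. F2 zt (fst p) p2 (fst q) (snd q) = 0" by eventually_elim (auto simp: space_pair_measure Om_S)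
   show "AE x in OM. F1 (fst p) p2 x = 0" using p(3) p2(4)[of zt] unfolding eqXX_XC by (auto simp: zeroXX_def Om_S intro!: AE_I2)
  qed
 qed
qed

lemma norm_zero:
 assumes "inXX ch Om ahat p" "normXX ch Om ahat p <= 0" "!!x. fst p x = 0"
 shows "eqXX ch Om ahat p zeroXX"
proof (cases ch)
 case XL1
 have p: "integrable OM (fst p)" "L1c (snd p)" using assms(1) XL1 by (auto simp: inXX_XL1)
 have "en (normXX XL1 Om ahat p) = 0" using assms(2) XL1 by (simp add: ennreal_neg)
 then have "I2 (nm (snd p)) = 0" using normXX_XL1[OF p] by simp
 from I2_zero_AE[OF L1cD(3)[OF p(2)] this] show ?thesis unfolding XL1 eqXX_XL1 using assms(3) by (simp add: nm_def zeroXX_def)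
next
 case XC
 have p: "XCd (snd p)" using assms(1) XC by (auto simp: inXX_XC)
 have [measurable]: "ns (snd p) : BM AM" using XCdD(1)[OF p] by (rule ns_AM)
 have "(SUP x\<in>S. cmod (fst p x)) = 0" using assms(3) Om_ne by simp
 then have "enn2real (NI AM (%a. ns (snd p) a)) = 0" using assms(2) normXX_XC[OF p] XC by (simp add: antisym)
 then have "NI AM (%a. ns (snd p) a) = 0" using XCdD(3)[OF p] by (auto simp: enn2real_eq_0_iff)
 then have "AE a in AM. ns (snd p) a = 0" by (subst (asm) nn_integral_0_iff_AE) auto
 with XCd_bound[OF p] have "AE a in AM. ALL x:S. snd p a x = 0" by eventually_elim (auto simp: nm_def)
 then show ?thesis unfolding XC eqXX_XC using assms(3) by (simp add: zeroXX_def)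
qed

lemma XCd_cong: "(!!a x. a : Ag ==> x : S ==> h a x = h' a x) ==> XCd h' ==> XCd h"
proof -
 assume eq: "!!a x. a : Ag ==> x : S ==> h a x = h' a x" and h': "XCd h'"
 have "XCd h & NS h <= NI AM (%a. ns h' a)"
 proof (rule XCd_le)
  show "(%a. h a x) : BM AM" if "x : S" for x by (subst measurable_cong[OF eq[OF _ that]]) (use XCdD(1)[OF h' that] in auto)
  show "AE a in AM. continuous_on S (h a)" using XCdD(2)[OF h'] AE_space
  proof eventually_elim
   case (elim a)
   then show ?case by (subst continuous_on_cong[OF refl eq]) auto
  qed
  show "AE a in AM. ALL x:S. nm h a x <= ns h' a" using XCd_bound[OF h'] AE_space by eventually_elim (use eq in \<open>auto simp: nm_def\<close>)
 qed (use XCdD(3)[OF h'] in auto)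
 then show ?thesis ..
qed

end

context age_eig
begin

lemma no_peripheral:
 assumes re: "Re zt = r" and im: "zt ~= of_real r" and h: "L1c h"
  and eq: "AE q in PM. h (fst q) (snd q) = Qc zt h (fst q) (snd q)"
 shows "AE q in PM. h (fst q) (snd q) = 0"
proof (rule ccontr)
 assume nz: "~ ?thesis"
 define H where "H = nm h"
 have im0: "Im zt ~= 0" using re im by (auto simp: complex_eq_iff)
 have H: "mb H" "I2 H < \<infinity>" using L1cD[OF h] by (auto simp: H_def)
 obtain a1 where a1: "~ (AE a in AM. a < a1 --> b0 a = 0)" "~ (AE a in AM. a1 < a --> b0 a = 0)" using age_split by blast
 have "AE p in PM. H (fst p) (snd p) <= Rn r (bn H) (fst p) (snd p) + Sn r H (fst p) (snd p)" using eq AE_space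
 proof eventually_elim
  case (elim p)
  have "nm (Qc zt h) (fst p) (snd p) <= Qn (Re zt) (nm h) (fst p) (snd p)" by (rule Qc_norm) (use elim in \<open>auto simp: space_pair_measure Om_S\<close>)
  then show ?case using elim(1) by (simp add: H_def nm_def Qn_def re)
 qed
 from critical_subsolution[OF H a1(2) this] obtain e x0 where e: "0 <= e" "x0 : S"
  "AE p in PM. H (fst p) (snd p) <= en e * kz r (fst p) (snd p)"
  "AE p in PM. fst p < a1 --> dist x0 (snd p) < d0 --> H (fst p) (snd p) = en e * kz r (fst p) (snd p)" by blast
 have e0: "0 < e"
 proof (rule ccontr)
  assume "~ 0 < e"
  then have "e = 0" using e(1) by simp
  then have "AE q in PM. h (fst q) (snd q) = 0" using e(3) by (auto simp: H_def nm_def elim: eventually_mono)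
  with nz show False ..
 qed
 have "AE x in OM. ~ dist x0 x < d0"
  using AE_pair_swap[OF e(3)] AE_pair_swap[of "%a x. a < a1 --> dist x0 x < d0 --> H a x = en e * kz r a x", OF e(4)]
   AE_pair_swap[OF eq] L1c_section_x[OF h] AE_space
 proof eventually_elim
  case (elim x)
  then have x: "x : Om" "x : S" by (auto simp: Om_S)
  show ?case
  proof
   assume dx: "dist x0 x < d0"
   define c where "c = bc h x"
   have bcn: "en (cmod c) <= bn H x" using bc_norm[OF x(2), of h] by (simp add: nm1_def c_def H_def)
   have bnH: "bn H x <= en e * zn x"
   proof -
    have "bn H x <= bn (%a x. en e * kz r a x) x" by (rule bn_mono_AE) (use elim(1) in simp)
    then show ?thesis using bn_cmult[OF x(2), of "kz r" "%_. en e"] kz_AM[OF x(2), of r] by (simp add: bn_kz[OF x(2)])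
   qed
   have SH: "Sn r H a x <= en e * Sn r (kz r) a x" for a
    using Sn_mono_AE[of H "%a x. en e * kz r a x" r a x] e(3) Sn_cmult[OF mb_kz x(2), of r "en e" r a] by simp
   have fin: "en e * kz r a x < \<infinity>" if "a : Ag" for a using kz_fin[OF order_refl that x(2)] by (simp add: ennreal_mult_less_top)
   have key: "AE a in AM. a < a1 --> cmod c = e * z x & (c ~= 0 --> (EX t>0. h a x = of_real t * (exp (- zt * of_real a) * c)))"
    using elim(2,3) AE_space
   proof eventually_elim
    case (elim a)
    then have a: "a : Ag" by simp
    show ?case
    proof
     assume "a < a1"
     then have Ha: "H a x = en e * kz r a x" using elim dx by blast
     define A where "A = Rc zt (bc h) a x"
     define Bv where "Bv = Sc zt h a x"
     have hAB: "h a x = A + Bv" using elim(2) by (simp add: A_def Bv_def Qc_def)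
     define q where "q = exp (- r * a) * qq a x"
     have q0: "q > 0" by (simp add: q_def)
     have nA: "cmod A = q * cmod c" unfolding A_def Rc_def q_def c_def by (simp add: norm_mult re)
     have "en (cmod Bv) <= en e * Sn r (kz r) a x" using Sc_norm[of zt h a x] SH[of a] by (simp add: nm_def Bv_def re H_def)
     moreover obtain s where s: "en e * Sn r (kz r) a x = en s" "0 <= s"
     proof -
     have "en e * Sn r (kz r) a x <= en e * kz r a x" unfolding kz_eq[OF x(2), of r a] by (intro mult_left_mono) auto
     then have "en e * Sn r (kz r) a x < \<infinity>" using fin[OF a] by (rule order_le_less_trans)
     then show thesis using that by (cases "en e * Sn r (kz r) a x") auto
     qed
     ultimately have nB: "cmod Bv <= s" by simp
     have zp: "0 < z x" by (rule z_pos[OF x(2)])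
     have "en (cmod c) <= en (e * z x)" using order_trans[OF bcn bnH] e(1) zp by (simp add: zn_def ennreal_mult)
     then have nc: "cmod c <= e * z x" using e(1) zp by simp
     have "en (cmod (h a x)) = en e * (en q * zn x + Sn r (kz r) a x)" using Ha unfolding kz_eq[OF x(2), of r a] Rn_def by (simp add: H_def nm_def q_def)
     also have "... = en (q * (e * z x) + s)" using s e(1) q0 zp by (simp add: distrib_left zn_def ennreal_mult mult_ac)
     finally have nh: "cmod (A + Bv) = q * (e * z x) + s" using s(2) e(1) q0 zp by (subst (asm) ennreal_inj) (auto simp: hAB)
     have "q * (e * z x) + s <= q * cmod c + cmod Bv" using norm_triangle_ineq[of A Bv] nA nh by simp
     moreover have "q * cmod c <= q * (e * z x)" using nc q0 by simp
     ultimately have "q * cmod c = q * (e * z x)" and Bs: "cmod Bv = s" using nB by linarith+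
     then have cz: "cmod c = e * z x" using q0 by simp
     have "EX t>0. h a x = of_real t * (exp (- zt * of_real a) * c)" if "c ~= 0"
     proof -
     have A0: "A ~= 0" using that q0 nA by auto
     have "A + Bv = of_real (cmod (A + Bv) / cmod A) * A" by (rule complex_triangle_eq[OF A0]) (simp add: nA nh cz Bs)
     then have "h a x = of_real (cmod (A + Bv) / cmod A) * A" by (simp add: hAB)
     also have "of_real k * A = of_real (k * qq a x) * (exp (- zt * of_real a) * c)" for k by (simp add: A_def Rc_def c_def mult_ac)
     finally have "h a x = of_real (cmod (A + Bv) / cmod A * qq a x) * (exp (- zt * of_real a) * c)" .
     moreover have "cmod (A + Bv) > 0" unfolding nh using q0 e0 zp s(2) by (simp add: add_pos_nonneg)
     ultimately show ?thesis using A0 by (intro exI[of _ "cmod (A + Bv) / cmod A * qq a x"]) simp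
     qed
     with cz show "cmod c = e * z x & (c ~= 0 --> (EX t>0. h a x = of_real t * (exp (- zt * of_real a) * c)))" by blast
    qed
   qed
   have cz: "cmod c = e * z x"
   proof (rule ccontr)
    assume "cmod c ~= e * z x"
    then have "AE a in AM. a < a1 --> b0 a = 0" using key by (auto elim: eventually_mono)
    with a1(1) show False ..
   qed
   then have c0: "c ~= 0" using e0 z_pos[OF x(2)] by auto
   define th where "th = cnj c / of_real (cmod c)"
   have th1: "cmod th = 1" using c0 by (simp add: th_def norm_divide)
   have thc: "th * c = of_real (cmod c)" using c0 by (simp add: th_def complex_norm_square[symmetric] mult.commute power2_eq_square)
   have hi: "integrable AM (%a. h a x)" by (rule elim(4))
   note [measurable] = borel_measurable_integrable[OF hi] beta_AM[OF x(2)]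
   define f where "f a = beta a x * (cmod (h a x) - Re (th * h a x))" for a
   have f0: "0 <= f a" if "a : Ag" for a
    unfolding f_def using beta_nonneg[OF that x(2)] complex_Re_le_cmod[of "th * h a x"] th1 by (simp add: norm_mult)
   have i1: "integrable AM (%a. of_real (beta a x) * h a x)" using bc_integrable[OF x(2), of h] hi by simp
   have i2: "integrable AM (%a. beta a x * cmod (h a x))"
   proof -
    have "integrable AM (%a. norm (of_real (beta a x) * h a x))" using i1 by (rule integrable_norm)
    then show ?thesis by (rule Bochner_Integration.integrable_cong[THEN iffD1, rotated 2]) (auto simp: norm_mult beta_nonneg x)
   qed
   have i3: "integrable AM (%a. Re (th * (of_real (beta a x) * h a x)))" using integrable_Re[OF integrable_mult_right[of th, OF i1]] .
   have fe: "f = (%a. beta a x * cmod (h a x) - Re (th * (of_real (beta a x) * h a x)))" by (auto simp: f_def fun_eq_iff algebra_simps)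
   have "(LINT a|AM. f a) = (LINT a|AM. beta a x * cmod (h a x)) - Re (th * c)"
   proof -
    have "(LINT a|AM. f a) = (LINT a|AM. beta a x * cmod (h a x)) - (LINT a|AM. Re (th * (of_real (beta a x) * h a x)))"
     unfolding fe by (rule Bochner_Integration.integral_diff[OF i2 i3])
    also have "(LINT a|AM. Re (th * (of_real (beta a x) * h a x))) = Re (LINT a|AM. th * (of_real (beta a x) * h a x))"
     by (rule integral_Re) (use i1 in simp)
    finally show ?thesis by (simp add: c_def bc_def)
   qed
   also have "(LINT a|AM. beta a x * cmod (h a x)) <= e * z x"
   proof -
    have "en (LINT a|AM. beta a x * cmod (h a x)) = NI AM (%a. en (beta a x * cmod (h a x)))"
     by (rule nn_integral_eq_integral[symmetric, OF i2]) (auto simp: beta_nonneg x)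
    also have "... = bn H x" unfolding bn_def H_def nm_def by (intro nn_integral_cong) (simp add: ennreal_mult beta_nonneg x)
    also have "... <= en (e * z x)" using bnH e(1) z_pos[OF x(2)] by (simp add: zn_def ennreal_mult)
    finally show ?thesis using e(1) z_pos[OF x(2)] by simp
   qed
   finally have "(LINT a|AM. f a) <= 0" by (simp add: thc cz)
   moreover have "0 <= (LINT a|AM. f a)" using f0 by (intro integral_nonneg_AE AE_I2) simp
   ultimately have "(LINT a|AM. f a) = 0" by simp
   moreover have "integrable AM f" unfolding fe using i2 i3 by simp
   ultimately have fz: "AE a in AM. f a = 0" using f0 by (subst (asm) integral_nonneg_eq_0_iff_AE) auto
   have "AE a in lebesgue. a \<notin> {a. cos (Im zt * a) = 1}"
    by (intro AE_completion AE_not_in countable_imp_null_set_lborel countable_cos_eq_1 im0)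
   then have ncos: "AE a in AM. cos (Im zt * a) ~= 1" unfolding AM_def using ages_sets by (subst AE_restrict_space_iff) (auto elim: eventually_mono)
   have "AE a in AM. a < a1 --> b0 a = 0" using key fz ncos AE_space
   proof eventually_elim
    case (elim a)
    show ?case
    proof
     assume "a < a1"
     then obtain t where t: "t > 0" "h a x = of_real t * (exp (- zt * of_real a) * c)" using elim(1) c0 by blast
     have "th * h a x = of_real t * exp (- zt * of_real a) * (th * c)" by (simp add: t(2))
     then have "Re (th * h a x) = t * exp (- r * a) * cmod c * cos (Im zt * a)" by (simp add: thc Re_exp re)
     moreover have "cmod (h a x) = t * exp (- r * a) * cmod c" using t by (simp add: norm_mult re)
     ultimately have "f a = beta a x * (t * exp (- r * a) * cmod c * (1 - cos (Im zt * a)))" by (simp add: f_def algebra_simps)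
     then have "beta a x = 0" using elim(2,3) t(1) c0 by simp
     moreover have "b0 a <= beta a x" "0 <= b0 a" using beta_ge[of a x] b0_nonneg[of a] elim(4) x(2) by auto
     ultimately show "b0 a = 0" by simp
    qed
   qed
   with a1(1) show False ..
  qed
 qed
 with AE_ball_False[OF e(2) d0_pos] show False ..
qed

lemma eigenvalue_bound:
 assumes ev: "is_eigenvalue_A ch Om ahat D J beta mu zt" and ne: "zt ~= of_real r"
 shows "Re zt < r"
proof (rule ccontr)
 assume "~ Re zt < r"
 obtain h where h: "L1c h" "~ (AE q in PM. h (fst q) (snd q) = 0)" "AE q in PM. h (fst q) (snd q) = Qc zt h (fst q) (snd q)"
  by (rule eigen_L1[OF ev cont_integrable_OM])
 show False
 proof (cases "Re zt = r")
  case True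
  then show False using no_peripheral[OF _ ne h(1,3)] h(2) by blast
 next
  case False
  then have lt: "r < Re zt" using \<open>~ Re zt < r\<close> by simp
  have mb0: "mb (%_ _. 0)" by (simp add: mb_def)
  have "AE p in PM. nm h (fst p) (snd p) <= 0 + Rn (Re zt) (bn (nm h)) (fst p) (snd p) + Sn (Re zt) (nm h) (fst p) (snd p)" using h(3) AE_space
  proof eventually_elim
   case (elim p)
   have "nm (Qc zt h) (fst p) (snd p) <= Qn (Re zt) (nm h) (fst p) (snd p)" by (rule Qc_norm) (use elim in \<open>auto simp: space_pair_measure Om_S\<close>)
   then show ?case using elim(1) by (simp add: nm_def Qn_def)
  qed
  then obtain C where "I2 (nm h) <= en C * I2 (%_ _. 0)" using apriori[OF lt] L1cD[OF h(1)] mb0 by meson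
  then have "I2 (nm h) = 0" by (simp add: I2_def)
  from I2_zero_AE[OF L1cD(3)[OF h(1)] this] show False using h(2) by (simp add: nm_def)
 qed
qed

definition hz :: "real => real^'n => complex" where "hz a x = of_real (enn2real (kz r a x))"
definition Gz :: "real => real^'n => complex" where "Gz a x = of_real D * Kc hz a x"
definition pz :: "real => real^'n => complex" where "pz a x = Gz a x + (0 - of_real r) * hz a x"

lemma hz_L1c: "L1c hz"
proof -
 have "cm hz" unfolding cm_def hz_def using mb_kz[of r] unfolding mb_def by measurable
 moreover have "I2 (nm hz) <= I2 (kz r)"
  by (rule I2_mono) (use kz_fin[OF order_refl] in \<open>simp add: nm_def hz_def ennreal_enn2real_if Om_S\<close>)
 ultimately show ?thesis using kz_I2[OF order_refl] by (auto simp: L1c_def)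
qed

lemma Gz_eq: "AE s in AM. ALL x. Gz s x = of_real (D * enn2real (Kn (kz r) s x)) & Kn (kz r) s x < \<infinity>"
proof -
 have [measurable]: "(%s. NI OM (%y. kz r s y)) : BM AM"
 proof -
  note [measurable] = mbD[OF mb_kz]
  show ?thesis by measurable
 qed
 have "AE s in AM. (NI OM (%y. kz r s y)) ~= \<infinity>" using kz_I2[OF order_refl] unfolding I2_def by (intro nn_integral_PInf_AE) auto
 then show ?thesis using AE_space
 proof eventually_elim
  case (elim s)
  then have s: "s : Ag" by simp
  note [measurable] = section_meas[OF mb_kz s, of r]
  show ?case
  proof
   fix x
   have "Kn (kz r) s x < \<infinity>" using Kn_le[OF mb_kz s, of r x] elim(1) by (auto intro: order_le_less_trans simp: ennreal_mult_less_top less_top)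
   moreover have "Kc hz s x = of_real (LINT y|OM. J (x - y) * enn2real (kz r s y))" unfolding Kc_def hz_def by (subst integral_complex_of_real[symmetric]) simp
   moreover have "(LINT y|OM. J (x - y) * enn2real (kz r s y)) = enn2real (NI OM (%y. en (J (x - y) * enn2real (kz r s y))))"
    using J_nonneg by (intro integral_eq_nn_integral) auto
   moreover have "NI OM (%y. en (J (x - y) * enn2real (kz r s y))) = Kn (kz r) s x" unfolding Kn_def
    using J_nonneg kz_fin[OF order_refl s] by (intro nn_integral_cong) (auto simp: ennreal_mult ennreal_enn2real Om_S)
   ultimately show "Gz s x = of_real (D * enn2real (Kn (kz r) s x)) & Kn (kz r) s x < \<infinity>" by (simp add: Gz_def)
  qed
 qed
qed

lemma Vc_Gz:
 assumes a: "a : Ag" and x: "x : S"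
 shows "Vc (of_real r) Gz a x = of_real (enn2real (Sn r (kz r) a x))"
proof -
 note [measurable] = qq_AM[OF x] Kn_AM[OF mb_kz[of r]]
 have [measurable]: "(%s. Gz s x) : BM AM" unfolding Gz_def using Kc_AM[OF L1cD(1)[OF hz_L1c], of x] by measurable
 define f where "f s = ind {..<a} s * (exp (- r * (a - s)) * (qq a x / qq s x)) * (D * enn2real (Kn (kz r) s x))" for s
 have "Vc (of_real r) Gz a x = (LINT s|AM. of_real (f s))" unfolding Vc_def
 proof (rule integral_cong_AE)
  show "AE s in AM. of_real (ind {..<a} s * (qq a x / qq s x)) * exp (- of_real r * of_real (a - s)) * Gz s x = complex_of_real (f s)"
   using Gz_eq by eventually_elim (simp add: f_def exp_of_real[symmetric] mult_ac)
 qed (unfold f_def, measurable)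
 also have "... = of_real (LINT s|AM. f s)" by (rule integral_complex_of_real)
 also have "(LINT s|AM. f s) = enn2real (NI AM (%s. en (f s)))"
  by (rule integral_eq_nn_integral) (use D_pos in \<open>auto simp: f_def intro!: AE_I2\<close>)
 also have "NI AM (%s. en (f s)) = Sn r (kz r) a x" unfolding Sn_def Vn_def
 proof (rule nn_integral_cong_AE)
  show "AE s in AM. en (f s) = ind {..<a} s * en (exp (- r * (a - s)) * (qq a x / qq s x)) * (en D * Kn (kz r) s x)" using Gz_eq
  proof eventually_elim
   case (elim s)
   then have "Kn (kz r) s x < \<infinity>" by blast
   moreover have "en (E * (D * k)) = en E * (en D * en k)" if "0 <= E" "0 <= k" for E k using that D_pos by (simp add: ennreal_mult)
   from this[of "exp (- r * (a - s)) * (qq a x / qq s x)" "enn2real (Kn (kz r) s x)"]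
   have "en (exp (- r * (a - s)) * (qq a x / qq s x) * (D * enn2real (Kn (kz r) s x))) = en (exp (- r * (a - s)) * (qq a x / qq s x)) * (en D * en (enn2real (Kn (kz r) s x)))" by simp
   ultimately show ?case by (cases "s < a") (simp_all add: f_def ennreal_enn2real)
  qed
 qed
 finally show ?thesis .
qed

lemma hz_eq: "a : Ag ==> x : S ==> hz a x = Rc (of_real r) (%x. of_real (z x)) a x + Vc (of_real r) Gz a x"
proof -
 assume a: "a : Ag" and x: "x : S"
 have "Sn r (kz r) a x <= kz r a x" unfolding kz_eq[OF x, of r a] by simp
 then have "Sn r (kz r) a x < \<infinity>" using kz_fin[OF order_refl a x] by (rule order_le_less_trans)
 moreover have "Rn r zn a x = en (exp (- r * a) * qq a x * z x)" unfolding Rn_def zn_def using z_pos[OF x] by (simp add: ennreal_mult)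
 ultimately have "enn2real (kz r a x) = exp (- r * a) * qq a x * z x + enn2real (Sn r (kz r) a x)"
  unfolding kz_eq[OF x, of r a] using z_pos[OF x] by (subst enn2real_plus) auto
 then show ?thesis unfolding hz_def Vc_Gz[OF a x] Rc_def by (simp add: exp_of_real[symmetric])
qed

lemma bc_hz: "x : S ==> bc hz x = of_real (z x)"
proof -
 assume x: "x : S"
 note [measurable] = kz_AM[OF x, of r] beta_AM[OF x]
 have "bc hz x = of_real (LINT a|AM. beta a x * enn2real (kz r a x))" unfolding bc_def hz_def by (subst integral_complex_of_real[symmetric]) simp
 also have "(LINT a|AM. beta a x * enn2real (kz r a x)) = enn2real (NI AM (%a. en (beta a x * enn2real (kz r a x))))"
  using beta_nonneg x by (intro integral_eq_nn_integral) auto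
 also have "NI AM (%a. en (beta a x * enn2real (kz r a x))) = bn (kz r) x" unfolding bn_def
  using kz_fin[OF order_refl _ x] beta_nonneg x by (intro nn_integral_cong) (auto simp: ennreal_mult ennreal_enn2real)
 finally show ?thesis using bn_kz[OF x] z_pos[OF x] by (simp add: zn_def)
qed

theorem principal_eigenvalue:
 "sbound_A ch Om ahat D J beta mu = ereal r & principal_eigenvalue_A ch Om ahat D J beta mu r"
proof -
 define zc where "zc x = complex_of_real (z x)" for x
 have zc: "continuous_on S zc" unfolding zc_def by (intro continuous_intros z_cont)
 have ok: "okr (Re (of_real r) + D + mut)" using good_okr[OF r_good] by simp
 have GzX: "XCd Gz" and GzL: "L1c Gz" unfolding Gz_def using XCd_Kc[OF hz_L1c] L1c_DKc[OF hz_L1c] by auto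
 have hzX: "XCd hz" by (rule XCd_cong[OF hz_eq XCd_RV[OF ok zc[unfolded zc_def] GzX]])
 have pX: "XCd pz" and pL: "L1c pz" unfolding pz_def by (intro XCd_add XCd_cmult L1c_add L1c_cmult GzX GzL hzX hz_L1c)+
 have hR: "hR zc pz a x = hz a x" if a: "a : Ag" and x: "x : S" for a x
 proof -
  have "Rc 0 zc a x + Vc 0 (%s x. Gz s x + (0 - of_real r) * hz s x) a x = hz a x"
   by (rule resolvent_identity[where G=Gz and h=hz and nu="of_real r", OF x XCd_int[OF GzX x] a]) (simp add: hz_eq[OF _ x] zc_def[abs_def])
  then show ?thesis by (simp add: hR_def pz_def[abs_def])
 qed
 let ?p = "(zc, pz)"
 have sec: "(%s. snd ?p s x) : BM AM" if "x : S" for x using XCdD(1)[OF pX that] by simp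
 have R0: "R0 mu D ?p a x = hz a x" if "a : Ag" "x : S" for a x using R0_eq[OF that sec[OF that(2)]] hR[OF that] by (simp add: hR_def)
 have L1: "fst (LL (of_real r) ?p) x = 0" if x: "x : S" for x
 proof -
  have "bc (hR zc pz) x = bc hz x" unfolding bc_def by (intro Bochner_Integration.integral_cong refl) (simp add: hR x)
  then show ?thesis using LL_eq(1)[OF sec[OF Om_S] x sec[OF x], of "of_real r"] bc_hz[OF x] by (simp add: F1_def zc_def[of x])
 qed
 have L2: "snd (LL (of_real r) ?p) a x = 0" if a: "a : Ag" and x: "x : S" for a x
 proof -
  have "Kc (hR zc pz) a x = Kc hz a x" unfolding Kc_def by (intro Bochner_Integration.integral_cong refl) (simp add: hR a Om_S)
  then show ?thesis using LL_eq(2)[OF sec[OF Om_S] a x sec[OF x], of "of_real r"] by (simp add: F2_def hR[OF a x] pz_def[of a x] Gz_def)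
 qed
 have in_p: "inXX ch Om ahat ?p" using zc pX pL cont_integrable_OM[OF zc] by (cases ch) (auto simp: inXX_XC inXX_XL1)
 have eqI: "eqXX ch Om ahat q q'" if "!!x. x : S ==> fst q x = fst q' x" "!!a x. a : Ag ==> x : S ==> snd q a x = snd q' a x" for q q'
  using that by (cases ch) (auto simp: eqXX_XC eqXX_XL1 Om_S space_pair_measure intro!: AE_I2)
 have zero: "eqXX ch Om ahat (LL (of_real r) ?p) zeroXX" using L1 L2 by (intro eqI) (auto simp: zeroXX_def)
 have dom: "eqXX ch Om ahat (domA_elt mu D ?p) (%_. 0, hz)" using R0 by (intro eqI) (auto simp: domA_elt_def)
 have hz0: "hz a x ~= 0" if "a : Ag" "x : S" for a x
  using kz_pos[OF that(2), of r a] kz_fin[OF order_refl that] by (auto simp: hz_def enn2real_eq_0_iff)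
 have nz: "~ eqXX ch Om ahat (domA_elt mu D ?p) zeroXX"
 proof
  assume e: "eqXX ch Om ahat (domA_elt mu D ?p) zeroXX"
  show False
  proof (cases ch)
   case XC
   obtain x0 where x0: "x0 : S" using Om_ne Om_S by blast
   have "AE a in AM. ALL x:S. R0 mu D ?p a x = 0" using e XC by (simp add: eqXX_XC domA_elt_def zeroXX_def)
   with AE_space have "AE a in AM. False" by eventually_elim (use R0 hz0 x0 in force)
   then show False using AE_AM_False by simp
  next
   case XL1
   have "AE q in PM. R0 mu D ?p (fst q) (snd q) = 0" using e XL1 by (simp add: eqXX_XL1 domA_elt_def zeroXX_def)
   with AE_space have "AE q in PM. False" by eventually_elim (use R0 hz0 Om_S in \<open>force simp: space_pair_measure\<close>)
   then show False using AE_P_False by simp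
  qed
 qed
 have pos: "posXX ch Om ahat (domA_elt mu D ?p)" unfolding posXX_def prodM_eq AM_def[symmetric] OM_def[symmetric] domA_elt_def
  by (cases ch) (auto simp: cnonneg_def R0 hz_def Om_S space_pair_measure intro!: AE_I2)
 have pe: "principal_eigenvalue_A ch Om ahat D J beta mu r"
  unfolding principal_eigenvalue_A_def LL_zero using in_p nz zero pos eigenvalue_bound by blast
 have norm_cong: "normXX ch Om ahat q = normXX ch Om ahat q'"
  if "!!x. x : S ==> fst q x = fst q' x" "!!a x. a : Ag ==> x : S ==> snd q a x = snd q' a x" for q q'
 proof (cases ch)
  case XC
  then show ?thesis using normXX_XC_cong[of q q'] eqI[OF that] by simp
 next
  case XL1
  then show ?thesis using normXX_XL1_cong[of "fst q" "fst q'" "snd q" "snd q'"] that by (simp add: Om_S)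
 qed
 have sp: "of_real r : spectrum_A ch Om ahat D J beta mu"
 proof (rule ccontr)
  assume "~ ?thesis"
  then have "of_real r : resolvent_A ch Om ahat D J beta mu" by (simp add: spectrum_A_def)
  then obtain C where "normXX ch Om ahat (domA_elt mu D ?p) <= C * normXX ch Om ahat (LL (of_real r) ?p)"
   unfolding resolvent_A_def Let_def mem_Collect_eq LL_def[symmetric] using in_p by blast
  moreover have "normXX ch Om ahat (LL (of_real r) ?p) = normXX ch Om ahat zeroXX" using L1 L2 by (intro norm_cong) (auto simp: zeroXX_def)
  moreover have "normXX ch Om ahat zeroXX = 0" using Om_ne by (cases ch) (simp_all add: normXX_def zeroXX_def cSUP_const SUP_constant)
  moreover have "normXX ch Om ahat (domA_elt mu D ?p) = normXX ch Om ahat (%_. 0, hz)" using R0 by (intro norm_cong) (auto simp: domA_elt_def)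
  ultimately have "normXX ch Om ahat (%_. 0, hz) <= 0" by simp
  moreover have "inXX ch Om ahat (%_. 0, hz)" using hzX hz_L1c by (cases ch) (auto simp: inXX_XC inXX_XL1)
  ultimately have "eqXX ch Om ahat (%_. 0, hz) zeroXX" by (intro norm_zero) auto
  then have "eqXX ch Om ahat (domA_elt mu D ?p) zeroXX" using dom
   by (cases ch) (auto simp: eqXX_XC eqXX_XL1 zeroXX_def domA_elt_def elim: eventually_elim2)
  with nz show False ..
 qed
 have "zt : spectrum_A ch Om ahat D J beta mu ==> Re zt <= r" for zt
  using XC_resolvent[of zt] XL1_resolvent[of zt] by (cases ch) (auto simp: spectrum_A_def not_le[symmetric])
 then have "sbound_A ch Om ahat D J beta mu = ereal r" unfolding sbound_A_def by (intro antisym SUP_least) (auto intro: SUP_upper2[OF sp])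
 with pe show ?thesis by simp
qed

end

section \<open>Reduction to rates that are continuous in space\<close>

lemma countable_ratpts: "countable (ratpts Om)"
 by (rule countable_subset[OF _ countable_vector[of "%_. \<rat>"]]) (auto simp: ratpts_def countable_rat)

lemma closure_ratpts:
 fixes Om :: "(real^'n) set"
 assumes "open Om"
 shows "closure (ratpts Om) = closure Om"
proof -
 define Q where "Q = {x::real^'n. ALL i. x $ i : \<rat>}"
 have "x : closure Q" for x unfolding closure_approachable
 proof (intro allI impI)
  fix e :: real assume e: "0 < e"
  define c where "c = e / real (CARD('n))"
  have c: "0 < c" using e by (simp add: c_def)
  have "EX q:\<rat>. x $ i < q & q < x $ i + c" for i using Rats_dense_in_real[of "x $ i" "x $ i + c"] c by auto
  then obtain q where q: "!!i. q i : \<rat>" "!!i. x $ i < q i" "!!i. q i < x $ i + c" by metis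
  have ab: "\<bar>q i - x $ i\<bar> < c" for i using q(2)[of i] q(3)[of i] by linarith
  have "dist (\<chi> i. q i) x <= (\<Sum>i\<in>UNIV. \<bar>((\<chi> i. q i) - x) $ i\<bar>)" unfolding dist_norm by (rule norm_le_l1_cart)
  also have "... < (\<Sum>i\<in>(UNIV::'n set). c)" using ab by (intro sum_strict_mono) auto
  finally show "EX y:Q. dist y x < e" using q(1) by (intro bexI[of _ "\<chi> i. q i"]) (auto simp: c_def Q_def)
 qed
 then have "closure (Om \<inter> Q) = closure Om" using assms by (intro closure_open_Int_superset) auto
 moreover have "Om \<inter> Q = ratpts Om" by (auto simp: ratpts_def Q_def)
 ultimately show ?thesis by simp
qed

lemma lowenv_measurable: "(!!x. x : Om ==> (%a. f a x) : BM N) ==> lowenv f Om : BM N"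
 unfolding lowenv_def[abs_def] by (intro borel_measurable_cINF_real countable_ratpts) (auto simp: ratpts_def)

lemma upenv_measurable: "(!!x. x : Om ==> (%a. f a x) : BM N) ==> upenv f Om : BM N"
proof -
 assume f: "!!x. x : Om ==> (%a. f a x) : BM N"
 have "upenv f Om = (%a. - lowenv (%a x. - f a x) Om a)" by (simp add: upenv_def lowenv_def Inf_real_def image_image fun_eq_iff)
 moreover have "lowenv (%a x. - f a x) Om : BM N" using f by (intro lowenv_measurable) simp
 ultimately show ?thesis by simp
qed

lemma locally_bounded_compact:
 fixes S :: "'a::metric_space set" and P :: "real => 'a => bool"
 assumes S: "compact S" and loc: "!!x. x : S ==> EX d>0. EX M. ALL y:S. dist y x < d --> P M y"
  and mono: "!!M M' y. P M y ==> M <= M' ==> P M' y"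
 shows "EX M>=0. ALL y:S. P M y"
proof -
 obtain d M where d: "!!x. x : S ==> d x > 0" "!!x y. x : S ==> y : S ==> dist y x < d x ==> P (M x) y" using loc by metis
 obtain T where T: "T <= S" "finite T" "S <= (\<Union>x\<in>T. ball x (d x))"
  by (rule compactE_image[OF S, of S "%x. ball x (d x)"]) (use d(1) in force)+
 have "P (\<Sum>x\<in>T. \<bar>M x\<bar>) y" if y: "y : S" for y
 proof -
  obtain x where x: "x : T" "dist y x < d x" using T(3) y by (auto simp: dist_commute)
  have "\<bar>M x\<bar> <= (\<Sum>x\<in>T. \<bar>M x\<bar>)" by (rule member_le_sum) (use x(1) T(2) in auto)
  then have "M x <= (\<Sum>x\<in>T. \<bar>M x\<bar>)" using abs_ge_self[of "M x"] by linarith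
  then show ?thesis using mono d(2)[of x y] x y T(1) by blast
 qed
 then show ?thesis by (intro exI[of _ "\<Sum>x\<in>T. \<bar>M x\<bar>"]) (auto simp: sum_nonneg)
qed

lemma birth_rate_version:
 fixes Om :: "(real^'n) set"
 assumes Om: "open Om" "bounded Om" "Om ~= {}"
  and meas: "!!x. (%a. beta a x) : BM A"
  and nonneg: "!!x. AE a in A. 0 <= beta a x" and bdd: "!!x. EX M. AE a in A. \<bar>beta a x\<bar> <= M"
  and cont: "!!x e. 0 < e ==> EX d>0. ALL y. dist y x < d --> (AE a in A. \<bar>beta a y - beta a x\<bar> <= e)"
  and env: "!!x. AE a in A. lowenv beta Om a <= beta a x"
 obtains b0 B g where "b0 : BM A" "!!a. 0 <= b0 a" "!!a x. b0 a <= g a x" "!!a x. g a x <= B"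
  "!!a. a : space A ==> continuous_on (closure Om) (g a)"
  "!!x. x : closure Om ==> (%a. g a x) : BM A"
  "!!x. x : closure Om ==> AE a in A. g a x = beta a x" "AE a in A. b0 a = lowenv beta Om a"
proof -
 have S: "compact (closure Om)" using Om(2) by simp
 have ne: "ratpts Om ~= {}" using closure_ratpts[OF Om(1)] Om(3) by (metis closure_eq_empty)
 have rS: "ratpts Om <= closure Om" using closure_subset[of Om] by (auto simp: ratpts_def)
 have Ec: "EX d>0. ALL y:closure Om. dist y x < d --> (AE a in A. a : UNIV --> \<bar>beta a y - beta a x\<bar> <= e)" if "0 < e" for x e
  using cont[OF that, of x] by auto
 obtain v where v: "!!a. a : space A ==> continuous_on (closure Om) (v a)"
  "!!x. x : closure Om ==> AE a in A. v a x = beta a x" "!!x. x : closure Om ==> (%a. v a x) : BM A"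
  by (rule continuous_version[OF S closure_ratpts[OF Om(1), symmetric] countable_ratpts, of beta A "%_. UNIV"])
   (use meas Ec in auto)
 have "EX d>0. EX M. ALL y:closure Om. dist y x < d --> (AE a in A. \<bar>beta a y\<bar> <= M)" for x
 proof -
  obtain M where M: "AE a in A. \<bar>beta a x\<bar> <= M" using bdd by blast
  obtain d where d: "d > 0" "!!y. dist y x < d ==> AE a in A. \<bar>beta a y - beta a x\<bar> <= 1" using cont[of 1 x] by auto
  have "AE a in A. \<bar>beta a y\<bar> <= M + 1" if "dist y x < d" for y using M d(2)[OF that] by eventually_elim arith
  then show ?thesis using d(1) by blast
 qed
 then have "EX M>=0. ALL y:closure Om. AE a in A. \<bar>beta a y\<bar> <= M" by (intro locally_bounded_compact[OF S]) (auto elim!: eventually_mono)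
 then obtain B where B: "B >= 0" "!!y. y : closure Om ==> AE a in A. \<bar>beta a y\<bar> <= B" by blast
 define b0 where "b0 a = max 0 (min B (lowenv beta Om a))" for a
 define g where "g a x = max (b0 a) (min B (v a x))" for a x
 have lm[measurable]: "lowenv beta Om : BM A" by (rule lowenv_measurable[OF meas])
 have b0m[measurable]: "b0 : BM A" unfolding b0_def[abs_def] by measurable
 have "AE a in A. ALL x:ratpts Om. 0 <= beta a x" using nonneg by (subst AE_ball_countable[OF countable_ratpts]) auto
 then have low0: "AE a in A. 0 <= lowenv beta Om a" by eventually_elim (auto simp: lowenv_def intro!: cINF_greatest ne)
 have b0e: "AE a in A. b0 a = lowenv beta Om a"
 proof -
  obtain x where x: "x : ratpts Om" using ne by auto
  have "x : closure Om" using rS x by blast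
  from low0 env[of x] B(2)[OF this] show ?thesis by eventually_elim (auto simp: b0_def)
 qed
 show thesis
 proof (rule that[OF b0m, where g=g and B=B])
  show "0 <= b0 a" "b0 a <= g a x" "g a x <= B" for a x using B(1) by (auto simp: b0_def g_def)
  show "continuous_on (closure Om) (g a)" if "a : space A" for a
   unfolding g_def using v(1)[OF that] by (intro continuous_on_max continuous_on_min continuous_on_const)
  show "(%a. g a x) : BM A" if "x : closure Om" for x using v(3)[OF that] unfolding g_def by measurable
  show "AE a in A. g a x = beta a x" if x: "x : closure Om" for x
   using v(2)[OF x] b0e env[of x] B(2)[OF x] by eventually_elim (auto simp: g_def max_def min_def)
 qed (rule b0e)
qed

lemma death_rate_version:
 fixes Om :: "(real^'n) set" and ahat :: ereal
 defines "A \<equiv> lebesgue_on (ages ahat)"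
 assumes Om: "open Om" "bounded Om" "Om ~= {}"
  and ages: "ages ahat : sets lebesgue"
  and meas: "!!x. (%a. mu a x) : BM A"
  and nonneg: "!!x. AE a in A. 0 <= mu a x"
  and cont: "!!x e b. 0 < e ==> 0 < b ==> ereal b < ahat ==> EX d>0. ALL y. dist y x < d -->
     (AE a in lebesgue_on {0<..<b}. \<bar>mu a y - mu a x\<bar> <= e)"
  and low: "AE a in A. mut <= lowenv mu Om a"
  and env: "!!x. AE a in A. mu a x <= upenv mu Om a" and max: "EX M. AE a in A. upenv mu Om a <= M"
 obtains up M g where "up : BM A" "!!a. mut <= up a" "!!a. up a <= M" "!!a x. mut <= g a x" "!!a x. g a x <= up a"
  "!!a. a : ages ahat ==> continuous_on (closure Om) (g a)"
  "!!x. x : closure Om ==> (%a. g a x) : BM A"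
  "!!x. x : closure Om ==> AE a in A. g a x = mu a x" "AE a in A. up a = upenv mu Om a"
proof -
 have S: "compact (closure Om)" using Om(2) by simp
 have ne: "ratpts Om ~= {}" using closure_ratpts[OF Om(1)] Om(3) by (metis closure_eq_empty)
 have rS: "ratpts Om <= closure Om" using closure_subset[of Om] by (auto simp: ratpts_def)
 have spA: "space A = ages ahat" by (simp add: A_def)
 define E where "E n = (let q = real_of_rat (from_nat n) in if 0 < q & ereal q < ahat then {0<..<q} else {})" for n
 have Eex: "EX n. a : E n" if a: "a : space A" for a
 proof -
  have a': "0 < a" "ereal a < ahat" using a by (auto simp: spA ages_def)
  obtain c where c: "ereal a < ereal c" "ereal c < ahat" using ereal_dense2[OF a'(2)] by blast
  then obtain q where q: "a < real_of_rat q" "real_of_rat q < c" using of_rat_dense[of a c] by auto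
  have "ereal (real_of_rat q) < ahat" using q(2) c(2) by (meson ereal_less_le less_ereal.simps(1) order_less_trans)
  moreover have "0 < real_of_rat q" using a' q by linarith
  then have "0 < q" by simp
  ultimately show ?thesis using a' q by (intro exI[of _ "to_nat q"]) (simp add: E_def)
 qed
 have Econt: "EX d>0. ALL y:closure Om. dist y x < d --> (AE a in A. a : E n --> \<bar>mu a y - mu a x\<bar> <= e)" if e: "0 < e" for n x e
 proof (cases "E n = {}")
  case True
  then show ?thesis by (intro exI[of _ 1]) auto
 next
  case False
  define q where "q = real_of_rat (from_nat n)"
  have q: "0 < q" "ereal q < ahat" "E n = {0<..<q}" using False unfolding E_def Let_def q_def[symmetric] by (auto split: if_splits)
  obtain d where d: "d > 0" "!!y. dist y x < d ==> AE a in lebesgue_on {0<..<q}. \<bar>mu a y - mu a x\<bar> <= e" using cont[OF e q(1,2), of x] by blast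
  have "AE a in A. a : E n --> \<bar>mu a y - mu a x\<bar> <= e" if "dist y x < d" for y
   using d(2)[OF that] ages unfolding A_def q(3) by (simp add: AE_restrict_space_iff) (auto elim: eventually_mono)
  then show ?thesis using d(1) by blast
 qed
 obtain v where v: "!!a. a : space A ==> continuous_on (closure Om) (v a)"
  "!!x. x : closure Om ==> AE a in A. v a x = mu a x" "!!x. x : closure Om ==> (%a. v a x) : BM A"
  by (rule continuous_version[OF S closure_ratpts[OF Om(1), symmetric] countable_ratpts, of mu A E])
   (use meas Eex Econt in auto)
 obtain M0 where M0: "AE a in A. upenv mu Om a <= M0" using max by blast
 define M where "M = Orderings.max mut M0"
 define up where "up a = Orderings.max mut (min M (upenv mu Om a))" for a
 define g where "g a x = Orderings.max mut (min (up a) (v a x))" for a x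
 have [measurable]: "upenv mu Om : BM A" by (rule upenv_measurable[OF meas])
 have upm[measurable]: "up : BM A" unfolding up_def[abs_def] by measurable
 have "AE a in A. ALL x:ratpts Om. v a x = mu a x & 0 <= mu a x"
  using nonneg v(2) rS by (subst AE_ball_countable[OF countable_ratpts]) (auto simp: subset_eq)
 with low AE_space have vge: "AE a in A. ALL x:closure Om. mut <= v a x"
 proof eventually_elim
  case (elim a)
  have "mut <= v a y" if y: "y : ratpts Om" for y
  proof -
   have "bdd_below (mu a ` ratpts Om)" using elim by (intro bdd_belowI2[of _ 0]) auto
   then have "lowenv mu Om a <= mu a y" unfolding lowenv_def using cINF_lower[of "mu a" "ratpts Om" y] y by simp
   then show ?thesis using elim y by simp
  qed
  then show ?case using continuous_ge_on_closure[of "ratpts Om" "v a" _ mut] v(1) elim by (auto simp: closure_ratpts[OF Om(1)])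
 qed
 have upe: "AE a in A. up a = upenv mu Om a"
 proof -
  obtain x where x: "x : ratpts Om" using ne by auto
  then have xS: "x : closure Om" using rS by auto
  from vge v(2)[OF xS] env[of x] M0 show ?thesis
  proof eventually_elim
   case (elim a)
   then have "mut <= v a x" using xS by blast
   then show ?case using elim by (auto simp: up_def M_def)
  qed
 qed
 show thesis
 proof (rule that[OF upm, where g=g and M=M])
  show "mut <= up a" "up a <= M" "mut <= g a x" "g a x <= up a" for a x by (auto simp: up_def g_def M_def)
  show "continuous_on (closure Om) (g a)" if "a : ages ahat" for a
   unfolding g_def using v(1)[of a] that spA by (intro continuous_on_max continuous_on_min continuous_on_const) auto
  show "(%a. g a x) : BM A" if "x : closure Om" for x using v(3)[OF that] unfolding g_def by measurable
  show "AE a in A. g a x = mu a x" if x: "x : closure Om" for x using v(2)[OF x] upe env[of x] vge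
  proof eventually_elim
   case (elim a)
   then have "mut <= v a x" using x by blast
   then show ?case using elim by (auto simp: g_def)
  qed
 qed (rule upe)
qed

context age_model
begin

definition agree :: "Xchoice => 'n elt => 'n elt => bool" where
 "agree ch p p' \<longleftrightarrow> (ALL x:(if ch = XC then S else Om). fst p x = fst p' x & (ALL a:Ag. snd p a x = snd p' a x))"

lemma agree_eqXX:
 assumes "agree ch p p'" "agree ch q q'"
 shows "eqXX ch Om ahat p q \<longleftrightarrow> eqXX ch Om ahat p' q'"
proof (cases ch)
 case XC
 have "(AE a in AM. ALL x:S. snd p a x = snd q a x) \<longleftrightarrow> (AE a in AM. ALL x:S. snd p' a x = snd q' a x)"
  by (rule AE_cong) (use assms XC in \<open>simp add: agree_def\<close>)
 then show ?thesis using assms XC by (auto simp: eqXX_XC agree_def)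
next
 case XL1
 have "(AE x in OM. fst p x = fst q x) \<longleftrightarrow> (AE x in OM. fst p' x = fst q' x)"
  by (rule AE_cong) (use assms XL1 in \<open>simp add: agree_def\<close>)
 moreover have "(AE w in PM. snd p (fst w) (snd w) = snd q (fst w) (snd w)) \<longleftrightarrow> (AE w in PM. snd p' (fst w) (snd w) = snd q' (fst w) (snd w))"
  by (rule AE_cong) (use assms XL1 in \<open>auto simp: agree_def space_pair_measure\<close>)
 ultimately show ?thesis by (simp add: XL1 eqXX_XL1)
qed

lemma agree_posXX: "agree ch p p' ==> posXX ch Om ahat p \<longleftrightarrow> posXX ch Om ahat p'"
proof (cases ch)
 case XC
 assume a: "agree ch p p'"
 have "(AE a in AM. ALL x:S. cnonneg (snd p a x)) \<longleftrightarrow> (AE a in AM. ALL x:S. cnonneg (snd p' a x))"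
  by (rule AE_cong) (use a XC in \<open>simp add: agree_def\<close>)
 then show ?thesis using a XC unfolding posXX_def AM_def[symmetric] by (cases p; cases p') (auto simp: agree_def)
next
 case XL1
 assume a: "agree ch p p'"
 have "(AE x in OM. cnonneg (fst p x)) \<longleftrightarrow> (AE x in OM. cnonneg (fst p' x))"
  by (rule AE_cong) (use a XL1 in \<open>simp add: agree_def\<close>)
 moreover have "(AE w in PM. cnonneg (snd p (fst w) (snd w))) \<longleftrightarrow> (AE w in PM. cnonneg (snd p' (fst w) (snd w)))"
  by (rule AE_cong) (use a XL1 in \<open>auto simp: agree_def space_pair_measure\<close>)
 ultimately show ?thesis using XL1 unfolding posXX_def prodM_eq OM_def[symmetric] by (cases p; cases p') simp
qed

lemma agree_normXX: "agree ch p p' ==> normXX ch Om ahat p = normXX ch Om ahat p'"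
proof (cases ch)
 case XC
 assume "agree ch p p'"
 then show ?thesis unfolding XC by (intro normXX_XC_cong) (auto simp: eqXX_XC agree_def XC intro!: AE_I2)
next
 case XL1
 assume "agree ch p p'"
 then show ?thesis using normXX_XL1_cong[of "fst p" "fst p'" "snd p" "snd p'"] by (simp add: agree_def XL1)
qed

lemma transfer:
 assumes b: "!!x. x : S ==> (%a. beta2 a x) : BM AM" "!!x. x : S ==> AE a in AM. beta a x = beta2 a x"
  and m: "!!x. x : S ==> (%a. mu2 a x) : BM AM" "!!x. x : S ==> AE a in AM. mu a x = mu2 a x"
 shows "!!a s x. a : Ag ==> 0 <= s ==> x : S ==> pi_surv mu2 s a x = pi_surv mu s a x"
  and "sbound_A ch Om ahat D J beta2 mu2 = sbound_A ch Om ahat D J beta mu"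
  and "principal_eigenvalue_A ch Om ahat D J beta2 mu2 r = principal_eigenvalue_A ch Om ahat D J beta mu r"
proof -
 show pi: "pi_surv mu2 s a x = pi_surv mu s a x" if a: "a : Ag" and s: "0 <= s" and x: "x : S" for a s x
 proof -
  note [measurable] = m(1)[OF x] mu_AM[OF x]
  have "integral\<^sup>L (lebesgue_on {s..a}) (%t. mu2 t x) = (LINT t|AM. ind {s<..a} t *\<^sub>R mu2 t x)"
   using s by (intro integral_Icc_eq_AM[OF _ a]) auto
  also have "... = (LINT t|AM. ind {s<..a} t *\<^sub>R mu t x)"
   by (rule integral_cong_AE) (use m(2)[OF x] in \<open>measurable, auto elim: eventually_mono\<close>)
  also have "... = integral\<^sup>L (lebesgue_on {s..a}) (%t. mu t x)" using s by (intro integral_Icc_eq_AM[symmetric, OF _ a]) auto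
  finally show ?thesis by (simp add: pi_surv_def)
 qed
 have R: "R0 mu2 D p a x = R0 mu D p a x" if a: "a : Ag" and x: "x : S" for a x p
 proof -
  have "integral\<^sup>L (lebesgue_on {0..a}) (%s. complex_of_real (exp (- D * (a - s)) * pi_surv mu2 s a x) * snd p s x)
    = integral\<^sup>L (lebesgue_on {0..a}) (%s. complex_of_real (exp (- D * (a - s)) * pi_surv mu s a x) * snd p s x)"
   by (intro Bochner_Integration.integral_cong refl) (simp add: pi a x)
  then show ?thesis by (simp add: R0_def pi a x)
 qed
 have dom: "agree ch (domA_elt mu2 D p) (domA_elt mu D p)" for p by (simp add: agree_def domA_elt_def R Om_S)
 have op: "agree ch (opA_img Om ahat D J beta2 mu2 p) (opA_img Om ahat D J beta mu p)" if p: "inXX ch Om ahat p" for p unfolding agree_def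
 proof (intro ballI conjI)
  fix x assume "x : (if ch = XC then S else Om)"
  then have x: "x : S" and sec: "(%s. snd p s x) : BM AM"
   using p XCdD(1)[of "snd p"] cm_section[OF L1cD(1), of "snd p"] by (cases ch; auto simp: inXX_XC inXX_XL1 Om_S)+
  have "(%a. Rc 0 (fst p) a x + Vc 0 (snd p) a x) : BM AM" using Rc_AM[OF x] Vc_AM[OF x, of "snd p"] sec by measurable
  then have [measurable]: "(%a. R0 mu D p a x) : BM AM" by (subst measurable_cong[OF R0_eq[OF _ x sec]]) auto
  note [measurable] = b(1)[OF x] beta_AM[OF x]
  have "(LINT a|AM. of_real (beta2 a x) * R0 mu2 D p a x) = (LINT a|AM. of_real (beta2 a x) * R0 mu D p a x)"
   by (intro Bochner_Integration.integral_cong refl) (simp add: R x)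
  also have "... = (LINT a|AM. of_real (beta a x) * R0 mu D p a x)"
   by (rule integral_cong_AE) (use b(2)[OF x] in \<open>measurable, auto elim: eventually_mono\<close>)
  finally show "fst (opA_img Om ahat D J beta2 mu2 p) x = fst (opA_img Om ahat D J beta mu p) x" by (simp add: opA_img_def Let_def AM_def)
  fix a assume a: "a : Ag"
  have "(LINT y|OM. of_real (J (x - y)) * R0 mu2 D p a y) = (LINT y|OM. of_real (J (x - y)) * R0 mu D p a y)"
   by (intro Bochner_Integration.integral_cong refl) (simp add: R a Om_S)
  then show "snd (opA_img Om ahat D J beta2 mu2 p) a x = snd (opA_img Om ahat D J beta mu p) a x" by (simp add: opA_img_def Let_def OM_def)
 qed
 have sc: "agree ch (scaleXX zt (domA_elt mu2 D p)) (scaleXX zt (domA_elt mu D p))" for zt p using dom[of p] by (auto simp: agree_def scaleXX_def)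
 have rf: "agree ch q q" for q by (simp add: agree_def)
 have df: "agree ch (diffXX (scaleXX zt (domA_elt mu2 D p)) (opA_img Om ahat D J beta2 mu2 p)) (diffXX (scaleXX zt (domA_elt mu D p)) (opA_img Om ahat D J beta mu p))"
  if "inXX ch Om ahat p" for zt p using sc[of zt p] op[OF that] by (auto simp: agree_def diffXX_def)
 have "zt : resolvent_A ch Om ahat D J beta2 mu2 \<longleftrightarrow> zt : resolvent_A ch Om ahat D J beta mu" for zt
  unfolding resolvent_A_def Let_def mem_Collect_eq
  by (simp add: agree_normXX[OF dom] agree_normXX[OF df] agree_eqXX[OF df rf] cong: conj_cong imp_cong)
 then have "resolvent_A ch Om ahat D J beta2 mu2 = resolvent_A ch Om ahat D J beta mu" by blast
 then show "sbound_A ch Om ahat D J beta2 mu2 = sbound_A ch Om ahat D J beta mu" by (simp add: sbound_A_def spectrum_A_def)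
 have ev: "is_eigenvalue_A ch Om ahat D J beta2 mu2 = is_eigenvalue_A ch Om ahat D J beta mu" unfolding is_eigenvalue_A_def fun_eq_iff
  by (simp add: agree_eqXX[OF dom rf] agree_eqXX[OF op sc] cong: conj_cong)
 show "principal_eigenvalue_A ch Om ahat D J beta2 mu2 r = principal_eigenvalue_A ch Om ahat D J beta mu r" unfolding principal_eigenvalue_A_def ev
  by (simp add: agree_eqXX[OF dom rf] agree_eqXX[OF op sc] agree_posXX[OF dom] cong: conj_cong)
qed

lemma mm_envelope:
 assumes up[measurable]: "up : BM AM" and bd: "!!a. 0 <= up a" "!!a. up a <= M" "!!a x. mu a x <= up a"
  and a: "a : Ag" and s: "0 <= s" "s <= a" and x: "x : S"
 shows "mm a x - mm s x <= (LINT t|AM. ind {0<..a} t * up t) - (LINT t|AM. ind {0<..s} t * up t)"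
proof -
 have i: "integrable AM (%t. ind {b<..a} t * up t)" if "0 <= b" for b
  by (rule Bochner_Integration.integrable_bound[OF integrable_interval[OF a that, of M]])
   (use bd order_trans[OF bd(1) bd(2)] in \<open>measurable, auto simp: indicator_def abs_of_nonneg\<close>)
 have "integrable AM (%t. ind {0<..s} t * up t)"
  by (rule Bochner_Integration.integrable_bound[OF i[of 0]]) (use s in \<open>measurable, auto simp: indicator_def\<close>)
 moreover have "(%t. ind {0<..a} t * up t) = (%t. ind {0<..s} t * up t + ind {s<..a} t * up t)" using s by (auto simp: fun_eq_iff indicator_def)
 ultimately have "(LINT t|AM. ind {0<..a} t * up t) = (LINT t|AM. ind {0<..s} t * up t) + (LINT t|AM. ind {s<..a} t * up t)" using i[OF s(1)] by simp
 moreover have "(LINT t|AM. ind {s<..a} t * mu t x) <= (LINT t|AM. ind {s<..a} t * up t)"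
  by (intro integral_mono integrable_mu a s x i) (use bd(3) in \<open>auto simp: indicator_def\<close>)
 ultimately show ?thesis using mm_diff[OF a s x] by simp
qed

end

context age_model_w
begin

lemma principal_eigenvalue_of_start:
 assumes g: "good l0" and lt: "!!x. x : S ==> vr l0 0 x < 1"
  and start: "w0 : cone_on S" "x1 : S" "w0 x1 ~= 0" "!!x. x : S ==> w0 x <= TT l0 w0 x"
 shows "EX r. sbound_A ch Om ahat D J beta mu = ereal r & principal_eigenvalue_A ch Om ahat D J beta mu r"
proof -
 obtain r z where r: "l0 <= r" and z: "continuous_on S z" "!!x. x : S ==> 0 < z x" "!!x. x : S ==> bn (hn r (%x. en (z x))) x = en (z x)"
  using principal_solution[OF g lt start] by blast
 interpret E: age_eig Om ahat D mut B M JB j0 d0 J beta mu b0 phis kk r z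
 proof
  show "good r" by (rule good_mono[OF g r])
  show "vr r 0 x < 1" if "x : S" for x using vr_anti[OF good_okr[OF g] that r] lt[OF that] by simp
 qed (use z in auto)
 show ?thesis using E.principal_eigenvalue by blast
qed

lemma kernel_eigenvalue_unique:
 assumes phi: "continuous_on S phi" "!!x. x : S ==> 0 < phi x" and k: "0 <= k"
  and eig: "!!x. x : S ==> Kx (%x. en (phi x)) x = en (k * phi x)"
 shows "k = kk"
proof -
 note [measurable] = cont_OM[OF phi(1)] cont_OM[OF phis_cont]
 define I where "I = NI OM (%x. en (phis x * phi x))"
 have nn: "0 <= phi x" "0 <= phis x" if "x : Om" for x using phi(2)[of x] phis_pos[of x] Om_S[OF that] by auto
 have "en k * I = NI OM (%x. en (phis x) * Kx (%x. en (phi x)) x)"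
  unfolding I_def by (subst nn_integral_cmult[symmetric]) (use nn k in \<open>auto intro!: nn_integral_cong simp: eig Om_S ennreal_mult mult_ac\<close>)
 also have "... = NI OM (%x. NI OM (%y. en (phis x) * (en (J (x - y)) * en (phi y))))"
  unfolding Kx_def by (intro nn_integral_cong nn_integral_cmult[symmetric]) measurable
 also have "... = NI OM (%y. NI OM (%x. en (phis x) * (en (J (x - y)) * en (phi y))))"
 proof -
  interpret OO: pair_sigma_finite OM OM ..
  show ?thesis by (rule OO.Fubini') measurable
 qed
 also have "... = NI OM (%y. en kk * en (phis y * phi y))"
 proof (rule nn_integral_cong)
  fix y assume "y : space OM"
  then have y: "y : Om" by simp
  have "NI OM (%x. en (phis x) * (en (J (x - y)) * en (phi y))) = NI OM (%x. en (phis x * J (x - y)) * en (phi y))"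
   by (intro nn_integral_cong) (use nn J_nonneg in \<open>simp add: ennreal_mult mult_ac\<close>)
  also have "... = en (kk * phis y) * en (phi y)" using phis_eq[OF y] by (subst nn_integral_multc) (simp_all add: OM_def[symmetric])
  finally show "NI OM (%x. en (phis x) * (en (J (x - y)) * en (phi y))) = en kk * en (phis y * phi y)"
   using nn[OF y] kk_pos by (simp add: ennreal_mult mult_ac)
 qed
 also have "... = en kk * I" unfolding I_def by (rule nn_integral_cmult) measurable
 finally have eq: "en k * I = en kk * I" .
 have "I < \<infinity>" unfolding I_def by (rule cont_int_finite) (intro continuous_intros phi(1) phis_cont)
 moreover have "I ~= 0"
 proof
  assume "I = 0"
  then have AE: "AE x in OM. en (phis x * phi x) = 0" unfolding I_def by (subst (asm) nn_integral_0_iff_AE) auto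
  from AE AE_space have AE: "AE x in OM. phis x * phi x = 0"
  proof eventually_elim
   case (elim x)
   then have "0 <= phis x * phi x" using nn[of x] by simp
   then show ?case using elim(1) by (simp add: ennreal_eq_0_iff)
  qed
  obtain x0 where x0: "x0 : S" using Om_ne Om_S by blast
  have "phis x0 * phi x0 = 0" by (rule cont_AE_zero[where w="%x. phis x * phi x", OF _ _ _ x0])
    (use AE phi phis_cont phis_pos in \<open>auto intro!: continuous_intros mult_nonneg_nonneg less_imp_le\<close>)
  then show False using phi(2)[OF x0] phis_pos[OF x0] by simp
 qed
 ultimately obtain i where "I = en i" "0 < i" by (cases I) (auto simp: less_le)
 then show ?thesis using eq k kk_pos by (simp add: ennreal_mult[symmetric])
qed

end

theorem mainTheorem10:
  fixes ch :: Xchoice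
    and Om :: "(real^'n) set"
    and ahat :: ereal
    and D mut alpha :: real
    and J :: "real^'n \<Rightarrow> real"
    and beta mu :: "real \<Rightarrow> real^'n \<Rightarrow> real"
  assumes Om_domain: "open Om" "connected Om" "bounded Om" "Om \<noteq> {}"
    and ahat_pos: "0 < ahat"
    and D_pos: "0 < D"
    and J_cont: "continuous_on UNIV J"
    and J_nonneg: "\<And>x. 0 \<le> J x"
    and J_supp: "\<exists>r>0. \<forall>x. J x \<noteq> 0 \<longrightarrow> x \<in> ball 0 r"
    and J_zero: "0 < J 0"
    and J_int: "(J has_integral 1) UNIV"
    and beta_meas: "\<And>x. (\<lambda>a. beta a x) \<in> borel_measurable (lebesgue_on (ages ahat))"
    and beta_nonneg: "\<And>x. AE a in lebesgue_on (ages ahat). 0 \<le> beta a x"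
    and beta_bdd: "\<And>x. \<exists>M. AE a in lebesgue_on (ages ahat). \<bar>beta a x\<bar> \<le> M"
    and beta_cont: "\<And>x e. 0 < e \<Longrightarrow> \<exists>d>0. \<forall>y. dist y x < d \<longrightarrow>
                      (AE a in lebesgue_on (ages ahat). \<bar>beta a y - beta a x\<bar> \<le> e)"
    and mu_meas: "\<And>x. (\<lambda>a. mu a x) \<in> borel_measurable (lebesgue_on (ages ahat))"
    and mu_nonneg: "\<And>x. AE a in lebesgue_on (ages ahat). 0 \<le> mu a x"
    and mu_locbdd: "\<And>x b. 0 < b \<Longrightarrow> ereal b < ahat \<Longrightarrow>
                      \<exists>M. AE a in lebesgue_on {0<..<b}. \<bar>mu a x\<bar> \<le> M"
    and mu_cont: "\<And>x e b. 0 < e \<Longrightarrow> 0 < b \<Longrightarrow> ereal b < ahat \<Longrightarrow> \<exists>d>0. \<forall>y. dist y x < d \<longrightarrow>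
                      (AE a in lebesgue_on {0<..<b}. \<bar>mu a y - mu a x\<bar> \<le> e)"
    and mut_pos: "0 < mut"
    and mu_lower: "AE a in lebesgue_on (ages ahat). mut \<le> lowenv mu Om a"
    and beta_env: "\<And>x. AE a in lebesgue_on (ages ahat). lowenv beta Om a \<le> beta a x"
    and mu_env: "\<And>x. AE a in lebesgue_on (ages ahat). mu a x \<le> upenv mu Om a"
    and beta_low_nontriv: "\<not> (AE a in lebesgue_on (ages ahat). lowenv beta Om a = 0)"
    and H: "ahat = \<infinity> \<Longrightarrow> \<exists>lh\<in>Vset ahat D mut.
              (\<integral>\<^sup>+ a. ennreal (lowenv beta Om a * exp (- (lh + D) * a)
                  * exp (- integral\<^sup>L (lebesgue_on {0..a}) (upenv mu Om))) \<partial>lebesgue_on {0<..}) > 1"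
    and mu_max: "\<exists>M. AE a in lebesgue_on (ages ahat). upenv mu Om a \<le> M"
    and alpha_V: "alpha \<in> Vset ahat D mut"
    and alpha_max: "\<forall>x\<in>closure Om. Gfun ahat D beta mu alpha x \<le> 1"
                   "\<exists>x\<in>closure Om. Gfun ahat D beta mu alpha x = 1"
    and not_L1loc: "\<exists>xs\<in>closure Om. \<forall>d>0.
              (\<integral>\<^sup>+ x. indicator (Om \<inter> ball xs d) x / (1 - Gfun ahat D beta mu alpha x) \<partial>lebesgue) = \<infinity>"
  shows "\<exists>r. sbound_A ch Om ahat D J beta mu = ereal r
             \<and> principal_eigenvalue_A ch Om ahat D J beta mu r"
proof -
 have ages: "ages ahat : sets lebesgue"
 proof -
  have "ages ahat = {0<..} \<inter> {a. ereal a < ahat}" by (auto simp: ages_def)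
  moreover have "{a::real. ereal a < ahat} : sets borel" by measurable
  ultimately have "ages ahat : sets borel" by auto
  then show ?thesis by (simp add: sets_completionI_sets)
 qed
 obtain b0 B beta' where b: "b0 : BM (lebesgue_on (ages ahat))" "!!a. 0 <= b0 a" "!!a x. b0 a <= beta' a x" "!!a x. beta' a x <= B"
  "!!a. a : space (lebesgue_on (ages ahat)) ==> continuous_on (closure Om) (beta' a)"
  "!!x. x : closure Om ==> (%a. beta' a x) : BM (lebesgue_on (ages ahat))"
  "!!x. x : closure Om ==> AE a in lebesgue_on (ages ahat). beta' a x = beta a x" "AE a in lebesgue_on (ages ahat). b0 a = lowenv beta Om a"
  by (rule birth_rate_version[OF Om_domain(1,3,4) beta_meas beta_nonneg beta_bdd beta_cont beta_env]) blast+
 obtain up M mu' where m: "up : BM (lebesgue_on (ages ahat))" "!!a. mut <= up a" "!!a. up a <= M" "!!a x. mut <= mu' a x" "!!a x. mu' a x <= up a"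
  "!!a. a : ages ahat ==> continuous_on (closure Om) (mu' a)"
  "!!x. x : closure Om ==> (%a. mu' a x) : BM (lebesgue_on (ages ahat))"
  "!!x. x : closure Om ==> AE a in lebesgue_on (ages ahat). mu' a x = mu a x" "AE a in lebesgue_on (ages ahat). up a = upenv mu Om a"
  by (rule death_rate_version[OF Om_domain(1,3,4) ages mu_meas mu_nonneg mu_cont mu_lower mu_env mu_max]) blast+
 obtain JB where JB: "JB > 0" "!!x. J x <= JB"
 proof -
  obtain R where R: "!!x. J x ~= 0 ==> x : ball 0 R" using J_supp by blast
  have "bounded (J ` cball 0 R)" by (intro compact_imp_bounded compact_continuous_image continuous_on_subset[OF J_cont]) auto
  then obtain c where "ALL y:J ` cball 0 R. norm y <= c" unfolding bounded_iff by blast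
  then have c: "\<bar>J x\<bar> <= c" if "x : cball 0 R" for x using that by auto
  have "J x <= \<bar>c\<bar> + 1" for x
  proof (cases "J x = 0")
   case False
   then show ?thesis using c[of x] R[of x] by (auto simp: abs_le_iff)
  qed simp
  then show thesis by (intro that[of "\<bar>c\<bar> + 1"]) auto
 qed
 obtain d0 where d0: "d0 > 0" "!!x. norm x < d0 ==> J 0 / 2 <= J x"
 proof -
  obtain d where d: "d > 0" "!!x. dist x 0 < d ==> dist (J x) (J 0) < J 0 / 2"
   using J_cont J_zero unfolding continuous_on_iff by (metis UNIV_I half_gt_zero)
  have "J 0 / 2 <= J x" if "norm x < d" for x
  proof -
   have "\<bar>J x - J 0\<bar> < J 0 / 2" using d(2)[of x] that by (simp add: dist_real_def)
   then show ?thesis by linarith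
  qed
  then show thesis using that d(1) by blast
 qed
 have cJ: "continuous_on UNIV (%x. J (- x))" by (intro continuous_on_compose2[OF J_cont] continuous_intros) auto
 have dm: "J 0 / 2 <= J (- x)" if "norm x < d0" for x using d0(2)[of "- x"] that by simp
 have J2: "0 < J 0 / 2" using J_zero by simp
 obtain kk phis where ph: "0 < kk" "continuous_on (closure Om) phis" "!!x. x : closure Om ==> 0 < phis x"
  "!!x. x : closure Om ==> integrable (lebesgue_on Om) (%y. J (- (x - y)) * phis y) & (LINT y|lebesgue_on Om. J (- (x - y)) * phis y) = kk * phis x"
  using kernel_operator_eigenfunction[OF Om_domain cJ J_nonneg JB(2) dm J2 d0(1)] by blast
 interpret A: age_model Om ahat D mut B M JB "J 0 / 2" d0 J beta' mu' b0
 proof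
  show "~ (AE a in lebesgue_on (ages ahat). b0 a = 0)"
  proof
   assume "AE a in lebesgue_on (ages ahat). b0 a = 0"
   with b(8) have "AE a in lebesgue_on (ages ahat). lowenv beta Om a = 0" by eventually_elim simp
   with beta_low_nontriv show False ..
  qed
  show "mu' a x <= M" for a x using m(3,5) order_trans by blast
 qed (use Om_domain ahat_pos D_pos mut_pos JB d0 J_zero J_cont J_nonneg b m in auto)
 interpret W: age_model_w Om ahat D mut B M JB "J 0 / 2" d0 J beta' mu' b0 phis kk
 proof
  show "NI (lebesgue_on Om) (%x. en (phis x * J (x - z))) = en (kk * phis z)" if "z : Om" for z
  proof -
   note e = ph(4)[OF A.Om_S[OF that]]
   have "NI (lebesgue_on Om) (%x. en (J (- (z - x)) * phis x)) = en (kk * phis z)" unfolding conjunct2[OF e, symmetric]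
    by (intro nn_integral_eq_integral conjunct1[OF e] AE_I2 mult_nonneg_nonneg J_nonneg less_imp_le ph(3) A.Om_S) simp
   then show ?thesis by (simp add: mult.commute)
  qed
 qed (use ph in auto)
 have bm: "(%a. beta a x) : BM A.AM" "(%a. mu a x) : BM A.AM" for x using beta_meas mu_meas by (simp_all add: A.AM_def)
 have be: "AE a in A.AM. beta' a x = beta a x" "AE a in A.AM. mu' a x = mu a x" if "x : closure Om" for x unfolding A.AM_def by (rule b(7)[OF that], rule m(8)[OF that])
 have tr: "pi_surv mu s a x = pi_surv mu' s a x" if "a : ages ahat" "0 <= s" "x : closure Om" for a s x
  by (rule A.transfer(1)[of beta mu]) (use bm be that in auto)
 have G: "Gfun ahat D beta mu alpha x = A.vn alpha 0 x" if x: "x : closure Om" for x unfolding Gfun_def A.vn_def A.AM_def[symmetric]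
 proof (rule nn_integral_cong_AE)
  show "AE a in A.AM. en (beta a x * exp (- (alpha + D) * a) * pi_surv mu 0 a x)
   = ind {0<..} a * en (beta' a x * exp (- alpha * (a - 0)) * (A.qq a x / A.qq 0 x))" using be(1)[OF x] AE_space
  proof eventually_elim
   case (elim a)
   then have a: "a : ages ahat" "0 < a" by (auto simp: ages_def)
   have "exp (- (alpha + D) * a) * pi_surv mu 0 a x = exp (- alpha * a) * (exp (- D * (a - 0)) * pi_surv mu' 0 a x)"
    using tr[OF a(1) order_refl x] by (simp add: exp_add[symmetric] algebra_simps)
   also have "... = exp (- alpha * a) * (A.qq a x / A.qq 0 x)" using A.pi_surv_qq[OF a(1) order_refl less_imp_le[OF a(2)] x] by simp
   finally show ?case using elim(1) a(2) by (simp add: mult.assoc)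
  qed
 qed
 have ok: "A.okr (alpha + D + mut)" using alpha_V unfolding A.okr_def Vset_def by (auto split: if_splits)
 have le1: "A.vr alpha 0 x <= 1" if "x : closure Om" for x
 proof -
  have "A.vn alpha 0 x <= 1" using alpha_max(1) that unfolding G[OF that, symmetric] by blast
  then show ?thesis unfolding A.vn_eq_vr[OF ok order_refl that] by simp
 qed
 have lt1: "A.vr l 0 x < 1" if "alpha < l" "x : closure Om" for l x using A.vr_strict[OF ok that(2,1)] le1[OF that(2)] by simp
 have "EX r. sbound_A ch Om ahat D J beta' mu' = ereal r & principal_eigenvalue_A ch Om ahat D J beta' mu' r"
 proof (cases "ahat ~= \<infinity> | - D - mut + D * kk <= alpha")
  case True
  then have gg: "W.good r" if "alpha < r" for r using that unfolding W.good_def by auto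
  obtain xs where xs: "xs : closure Om" "!!d. d > 0 ==> (NI lebesgue (%x. indicator (Om \<inter> ball xs d) x / (1 - Gfun ahat D beta mu alpha x))) = \<infinity>"
   using not_L1loc by blast
  have "NI A.OM (%x. indicator (ball xs d) x / (1 - A.vn alpha 0 x)) = \<infinity>" if "d > 0" for d
  proof -
   have "NI A.OM (%x. indicator (ball xs d) x / (1 - A.vn alpha 0 x)) = NI lebesgue (%x. indicator (ball xs d) x / (1 - A.vn alpha 0 x) * indicator Om x)"
    unfolding A.OM_def by (rule nn_integral_restrict_space) (use A.Om_sets in simp)
   also have "... = NI lebesgue (%x. indicator (Om \<inter> ball xs d) x / (1 - Gfun ahat D beta mu alpha x))"
    by (intro nn_integral_cong) (auto simp: indicator_def G A.Om_S)
   finally show ?thesis using xs(2)[OF that] by simp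
  qed
  then obtain l0 w0 x1 where l0: "l0 > alpha" "w0 : cone_on (closure Om)" "x1 : closure Om" "w0 x1 ~= 0" "!!x. x : closure Om ==> w0 x <= W.TT l0 w0 x"
   using W.start_blowup[OF ok le1 gg xs(1)] by blast
  show ?thesis by (rule W.principal_eigenvalue_of_start[OF gg[OF l0(1)] lt1[OF l0(1)] l0(2-5)])
 next
  case False
  then have inf: "ahat = \<infinity>" and al: "alpha < - D - mut + D * kk" by auto
  have ages0: "ages ahat = {0<..}" using inf by (auto simp: ages_def)
  obtain lh where lh: "- D - mut < lh" "NI (lebesgue_on {0<..}) (%a. en (lowenv beta Om a * exp (- (lh + D) * a)
     * exp (- integral\<^sup>L (lebesgue_on {0..a}) (upenv mu Om)))) > 1" using H[OF inf] inf by (auto simp: Vset_def)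
  obtain k phi where k: "0 < k" "continuous_on (closure Om) phi" "!!x. x : closure Om ==> 0 < phi x"
   "!!x. x : closure Om ==> integrable (lebesgue_on Om) (%y. J (x - y) * phi y) & (LINT y|lebesgue_on Om. J (x - y) * phi y) = k * phi x"
   using kernel_operator_eigenfunction[OF Om_domain J_cont J_nonneg JB(2) d0(2) J2 d0(1)] by blast
  have Kphi: "A.Kx (%x. en (phi x)) x = en (k * phi x)" if "x : closure Om" for x
  proof -
   note e = k(4)[OF that]
   have "NI (lebesgue_on Om) (%y. en (J (x - y) * phi y)) = en (k * phi x)" unfolding conjunct2[OF e, symmetric]
    by (intro nn_integral_eq_integral conjunct1[OF e] AE_I2 mult_nonneg_nonneg J_nonneg less_imp_le k(3) A.Om_S) simp
   then show ?thesis unfolding A.Kx_def A.OM_def using J_nonneg by (simp add: ennreal_mult')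
  qed
  have kkk: "k = kk" by (rule W.kernel_eigenvalue_unique[OF k(2,3) less_imp_le[OF k(1)] Kphi])
  define mp where "mp a = (LINT s|A.AM. ind {0<..a} s * up s)" for a
  have upm[measurable]: "up : BM A.AM" using m(1) by (simp add: A.AM_def)
  have up0: "0 <= up a" for a using m(2)[of a] mut_pos by simp
  have mpm: "mp : BM A.AM" unfolding mp_def[abs_def] by measurable
  have mp0: "mp 0 = 0" by (simp add: mp_def)
  have mp_ge: "A.mm a x - A.mm s x <= mp a - mp s" if "a : ages ahat" "0 <= s" "s <= a" "x : closure Om" for a s x
   unfolding mp_def by (rule A.mm_envelope[OF upm up0 m(3,5) that])
  have mpe: "integral\<^sup>L (lebesgue_on {0..a}) (upenv mu Om) = mp a" if a: "a : ages ahat" for a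
  proof -
   have um[measurable]: "upenv mu Om : BM A.AM" by (rule upenv_measurable[OF bm(2)])
   have "integral\<^sup>L (lebesgue_on {0..a}) (upenv mu Om) = (LINT t|A.AM. ind {0<..a} t *\<^sub>R upenv mu Om t)"
    by (rule A.integral_Icc_eq_AM[OF um a order_refl]) auto
   also have "... = mp a" unfolding mp_def
    by (rule integral_cong_AE) (use m(9)[folded A.AM_def] in \<open>measurable, auto elim: eventually_mono\<close>)
   finally show ?thesis .
  qed
  have "(NI (lebesgue_on {0<..}) (%a. en (lowenv beta Om a * exp (- (lh + D) * a) * exp (- integral\<^sup>L (lebesgue_on {0..a}) (upenv mu Om)))))
   = NI A.AM (%a. en (b0 a * exp (- (lh + D) * a - mp a)))" unfolding ages0[symmetric] A.AM_def[symmetric]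
  proof (rule nn_integral_cong_AE)
   show "AE a in A.AM. en (lowenv beta Om a * exp (- (lh + D) * a) * exp (- integral\<^sup>L (lebesgue_on {0..a}) (upenv mu Om))) = en (b0 a * exp (- (lh + D) * a - mp a))"
    using b(8)[folded A.AM_def] AE_space
   proof eventually_elim
    case (elim a)
    have "exp (u - v) = exp u * exp (- v)" for u v :: real by (simp add: exp_diff exp_minus field_simps)
    then show ?case using elim mpe[of a] by (simp add: mult.assoc)
   qed
  qed
  with lh(2) have lh1: "1 <= NI A.AM (%a. en (b0 a * exp (- (lh + D) * a - mp a)))" by simp
  define l0 where "l0 = lh + D * kk"
  have l0: "W.good l0" "alpha < l0" unfolding W.good_def l0_def using lh(1) al by auto
  have st: "ALL x:closure Om. phi x <= W.TT l0 phi x"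
   unfolding l0_def by (rule W.start_unbounded_age[OF inf k(2,3) Kphi[unfolded kkk] mpm mp0 mp_ge lh(1) lh1 lt1[OF l0(2), unfolded l0_def]])
  obtain x1 where x1: "x1 : closure Om" using Om_domain(4) A.Om_S by blast
  have cone: "phi : cone_on (closure Om)" using k(2,3) by (auto simp: cone_on_def less_imp_le)
  show ?thesis by (rule W.principal_eigenvalue_of_start[OF l0(1) lt1[OF l0(2)] cone x1]) (use st k(3)[OF x1] in auto)
 qed
 moreover have "sbound_A ch Om ahat D J beta mu = sbound_A ch Om ahat D J beta' mu'" by (rule A.transfer(2)) (use bm be in auto)
 moreover have "principal_eigenvalue_A ch Om ahat D J beta mu r = principal_eigenvalue_A ch Om ahat D J beta' mu' r" for r
  by (rule A.transfer(3)) (use bm be in auto)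
 ultimately show ?thesis by simp
qed

end
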